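(* Let $d\ge 1$ be an integer and let $0<p,q<\infty$, $0<s<1/p$. Let $H^d$ be the Haar wavelet system on $I^d$, enumerated in any way that respects the natural ordering by level. a) If $1\le p<\infty$, then $H^d$ is an unconditional Schauder basis for $B_{p,q,1}^s(I^d)$ for all $0<s<1/p$, $0<q<\infty$. b) Let $0<p<1$. Then $H^d$ is an unconditional Schauder basis for $B_{p,q,1}^s(I^d)$ if and only if $d(1/p-1)<s<1/p$ (and $0<q<\infty$). If $s=d(1/p-1)$ and $0<q\le p$, then $H^d$ is a Schauder basis for $B_{p,q,1}^s(I^d)$, but not an unconditional one. In all other cases (within $0<p<1$, $0<q<\infty$, $0<s<1/p$), $H^d$ is not a Schauder basis for $B_{p,q,1}^s(I^d)$.
   Context: Notation: $I=[0,1]$, $I^d\subset\mathbb{R}^d$ is the unit cube with Lebesgue measure, functions are real-valued and identified when equal a.e., $L_p=L_p(I^d)$ with the usual (quasi-)norm. Besov spaces: for $y\in\mathbb{R}^d$ let $I^d_y=\{z\in I^d: z+y\in I^d\}$ and $\Delta_y f(x)=f(x+y)-f(x)$ for $x\in I^d_y$. The first-order $L_p$ modulus of smoothness is $\omega(t,f)_p=\sup_{0<|y|\le t}\|\Delta_y f\|_{L_p(I^d_y)}$, $t>0$. For $0<p,q<\infty$, the space $B_{p,q,1}^s(I^d)$ is the set of all $f\in L_p(I^d)$ with finite quasi-norm $$\|f\|_{B_{p,q,1}^s}=\Big(\|f\|_{L_p}^q+\int_0^1 \big(t^{-s}\omega(t,f)_p\big)^q\,\frac{dt}{t}\Big)^{1/q}.$$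 It is a quasi-Banach space. Haar wavelet system: for $k\ge 0$ and $i=1,\dots,2^k$ let $\Delta_{k,i}=[(i-1)2^{-k},i2^{-k})$. For $k\ge1$, $i=1,\dots,2^{k-1}$, put $h_{\Delta_{k-1,i}}=\chi_{\Delta_{k,2i-1}}-\chi_{\Delta_{k,2i}}$ (a function with support $\Delta_{k-1,i}$). Set $H_0^d=\{\chi_{I^d}\}$, and for $k\ge 1$ let $H_k^d$ be the set of all tensor products $\psi_1\otimes\cdots\otimes\psi_d$ such that, for some $(i_1,\dots,i_d)\in\{1,\dots,2^{k-1}\}^d$, each $\psi_l$ is either $h_{\Delta_{k-1,i_l}}$ or $\chi_{\Delta_{k-1,i_l}}$, with at least one $\psi_l$ equal to $h_{\Delta_{k-1,i_l}}$. Then $H^d=\bigcup_{k\ge0}H_k^d$. An enumeration of $H^d$ respects the natural ordering by level if all elements of $H_k^d$ precede all elements of $H_{k+1}^d$, for every $k\ge 0$; the order within each block $H_k^d$ is arbitrary. Schauder bases: a sequence $(f_m)_{m\in\mathbb{N}}$ in a quasi-Banach space $X$ is a Schauder basis in $X$ if every $f\in X$ has a unique representation $f=\sum_{m=1}^\infty c_mf_m$ converging in $X$. It is an unconditional Schauder basis if every rearrangement of it is a Schauder basis in $X$. *)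

theory Defs
  imports "HOL-Analysis.Analysis"
begin

section \<open>Besov spaces on the unit cube\<close>

text \<open>
  An equivalence class of functions on the cube is represented by any of its members, a
  total function of type \<^typ>\<open>real^'d \<Rightarrow> real\<close>; values outside the cube are never used.
\<close>

definition unit_cube :: "(real^'d) set" where
  "unit_cube = cbox 0 1"

definition Lp_space :: "real \<Rightarrow> (real^'d) set \<Rightarrow> (real^'d \<Rightarrow> real) set" where
  "Lp_space p S = {f. f \<in> borel_measurable (lebesgue_on S) \<and>
                      integrable (lebesgue_on S) (\<lambda>x. \<bar>f x\<bar> powr p)}"

definition Lp_norm :: "real \<Rightarrow> (real^'d) set \<Rightarrow> (real^'d \<Rightarrow> real) \<Rightarrow> real" where
  "Lp_norm p S f = (LINT x|lebesgue_on S. \<bar>f x\<bar> powr p) powr (1 / p)"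

definition shifted_cube :: "real^'d \<Rightarrow> (real^'d) set" where
  "shifted_cube y = {z \<in> unit_cube. z + y \<in> unit_cube}"

text \<open>
  For \<open>f\<close> in \<open>L\<^sub>p\<close> of the cube the set of which the supremum is taken is bounded above.
\<close>

definition modulus_of_smoothness :: "real \<Rightarrow> (real^'d \<Rightarrow> real) \<Rightarrow> real \<Rightarrow> real" where
  "modulus_of_smoothness p f t =
     (SUP y\<in>{y. 0 < norm y \<and> norm y \<le> t}. Lp_norm p (shifted_cube y) (\<lambda>x. f (x + y) - f x))"

definition besov_integrand :: "real \<Rightarrow> real \<Rightarrow> real \<Rightarrow> (real^'d \<Rightarrow> real) \<Rightarrow> real \<Rightarrow> real" where
  "besov_integrand p q s f t = (t powr (- s) * modulus_of_smoothness p f t) powr q / t"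

text \<open>
  The modulus of smoothness of an \<open>L\<^sub>p\<close> function is nondecreasing in \<open>t\<close>, so the integrand is
  nonnegative and measurable, and integrability just says that the integral is finite.
\<close>

definition besov_space :: "real \<Rightarrow> real \<Rightarrow> real \<Rightarrow> (real^'d \<Rightarrow> real) set" where
  "besov_space p q s = {f \<in> Lp_space p unit_cube.
                          integrable (lebesgue_on {0<..1}) (besov_integrand p q s f)}"

definition besov_norm :: "real \<Rightarrow> real \<Rightarrow> real \<Rightarrow> (real^'d \<Rightarrow> real) \<Rightarrow> real" where
  "besov_norm p q s f =
     (Lp_norm p unit_cube f powr q
       + (LINT t|lebesgue_on {0<..1}. besov_integrand p q s f t)) powr (1 / q)"


section \<open>The Haar wavelet system\<close>

definition dyadic_interval :: "nat \<Rightarrow> nat \<Rightarrow> real set" where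
  "dyadic_interval k i = {(real i - 1) / 2 ^ k ..< real i / 2 ^ k}"

definition haar_function :: "nat \<Rightarrow> nat \<Rightarrow> real \<Rightarrow> real" where
  "haar_function k i x = indicator (dyadic_interval (Suc k) (2 * i - 1)) x
                       - indicator (dyadic_interval (Suc k) (2 * i)) x"

definition tensor_product :: "('d \<Rightarrow> real \<Rightarrow> real) \<Rightarrow> real^'d \<Rightarrow> real" where
  "tensor_product \<psi> x = (\<Prod>l\<in>UNIV. \<psi> l (x $ l))"

fun haar_level :: "nat \<Rightarrow> (real^'d \<Rightarrow> real) set" where
  "haar_level 0 = {indicator unit_cube}"
| "haar_level (Suc k) =
     {tensor_product \<psi> |\<psi>. \<exists>i.
        (\<forall>l. i l \<in> {1..2 ^ k} \<and>
             (\<psi> l = haar_function k (i l) \<or> \<psi> l = indicator (dyadic_interval k (i l)))) \<and>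
        (\<exists>l. \<psi> l = haar_function k (i l))}"

definition haar_system :: "(real^'d \<Rightarrow> real) set" where
  "haar_system = (\<Union>k. haar_level k)"

definition level_ordered_enumeration :: "(nat \<Rightarrow> real^'d \<Rightarrow> real) \<Rightarrow> bool" where
  "level_ordered_enumeration h \<longleftrightarrow>
     bij_betw h UNIV haar_system \<and>
     (\<forall>k m n. h m \<in> haar_level k \<and> h n \<in> haar_level (Suc k) \<longrightarrow> m < n)"


section \<open>Schauder bases\<close>

text \<open>
  The space is given by a set \<open>X\<close> of functions and a quasi-norm \<open>N\<close> on it. Two functions
  represent the same element iff \<open>N\<close> of their difference is \<open>0\<close>; hence convergence of a
  series to \<open>f\<close> in \<open>X\<close> does not depend on the representatives.
\<close>

definition series_converges_to ::
  "(('a \<Rightarrow> real) \<Rightarrow> real) \<Rightarrow> (nat \<Rightarrow> 'a \<Rightarrow> real) \<Rightarrow> (nat \<Rightarrow> real) \<Rightarrow> ('a \<Rightarrow> real) \<Rightarrow> bool" where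
  "series_converges_to N b c f \<longleftrightarrow>
     (\<lambda>n. N (\<lambda>x. f x - (\<Sum>m<n. c m * b m x))) \<longlonglongrightarrow> 0"

definition schauder_basis ::
  "('a \<Rightarrow> real) set \<Rightarrow> (('a \<Rightarrow> real) \<Rightarrow> real) \<Rightarrow> (nat \<Rightarrow> 'a \<Rightarrow> real) \<Rightarrow> bool" where
  "schauder_basis X N b \<longleftrightarrow>
     (\<forall>m. b m \<in> X) \<and> (\<forall>f\<in>X. \<exists>!c. series_converges_to N b c f)"

definition unconditional_schauder_basis ::
  "('a \<Rightarrow> real) set \<Rightarrow> (('a \<Rightarrow> real) \<Rightarrow> real) \<Rightarrow> (nat \<Rightarrow> 'a \<Rightarrow> real) \<Rightarrow> bool" where
  "unconditional_schauder_basis X N b \<longleftrightarrow>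
     (\<forall>\<pi>. bij \<pi> \<longrightarrow> schauder_basis X N (b \<circ> \<pi>))"

end

theory Submission
  imports Defs
begin

text \<open>
  Write \<open>\<rho> = 2\<^sup>s\<^sup>p\<close>, and let \<open>\<sigma>\<close> be the norm growth of averaging: passing from a step function on
  dyadic cells of level \<open>k + 1\<close> to its averages over the cells of level \<open>k\<close> multiplies the \<open>p\<close>-th power
  of the \<open>L\<^sub>p\<close> quasi-norm by at most \<open>\<sigma>\<close>, where \<open>\<sigma> = 1\<close> for \<open>p \<ge> 1\<close> and
  \<open>\<sigma>\<close> is 2 to the power \<open>d (1 - p)\<close> for \<open>p < 1\<close>. Since \<open>s < 1/p\<close>, the quasi-norm is equivalent to an
  \<open>\<ell>\<^sub>q\<close> sum of the weighted errors of approximation by dyadic step functions, so that Haar partial sums,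
  being dyadic averages up to one incomplete level, are controlled by a discrete Hardy inequality when
  \<open>\<sigma> < \<rho>\<close>, which is the condition \<open>s > d (1/p - 1)\<close>; in this range the bound holds for arbitrary
  subsums, whence unconditionality. If \<open>\<sigma> = \<rho>\<close> and \<open>q \<le> p\<close>, it survives only for initial segments.

  The counterexamples are built from approximate point masses, the normalised indicators of the cells at a
  point, whose \<open>L\<^sub>p\<close> quasi-norms decay at the critical rate. For \<open>\<rho> < \<sigma>\<close> the expansion of the point mass at
  \<open>0\<close> converges to \<open>0\<close>, contradicting uniqueness. For \<open>\<rho> = \<sigma>\<close> and \<open>p < q\<close>, many point masses in
  distinct places produce a function whose partial sums are too large. For \<open>\<rho> = \<sigma>\<close> and \<open>q \<le> p\<close>, slowly
  decreasing multiples of the increments at \<open>0\<close> telescope in level order, whereas the sum over the even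
  levels alone diverges.
\<close>

section \<open>Discrete inequalities\<close>

text \<open>For p < 1 a function in L_p need not be integrable, so Haar coefficients cannot be
  introduced as integrals. Averages are therefore taken only of step functions, where they are
  finite sums over child cells; bounds are proved for finite Haar combinations and reach the whole
  space by density. Estimates are made for p-th powers with outer exponent r = q/p. This turns the
  quasi-triangle inequality into a linear inequality between integrals and the smoothness s into the
  ratio \<rho>. The condition s < 1/p reads \<rho> < 2: a step function of level k changes under a
  shift y only in boundary layers of relative size 2^k |y|, so the p-th power of its modulus halves
  per level, which has to beat \<rho>. The loss \<sigma> is attained when all mass of a cell sits in
  one child, so that point masses are extremal; the regimes compare this loss per averaging with the
  weight \<rho> gained per level. When \<sigma> = \<rho> no geometric decay is left, and q \<le> p,
  that is r \<le> 1, replaces it through the subadditivity of t^r.\<close>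

definition ndist :: "nat \<Rightarrow> nat \<Rightarrow> nat" where
  "ndist j k = (if j \<le> k then k - j else j - k)"

lemma ndist_commute: "ndist j k = ndist k j"
  by (auto simp: ndist_def)

lemma sum_ndist_le:
  fixes \<theta> :: real
  assumes \<theta>: "0 \<le> \<theta>" "\<theta> < 1" and "finite J"
  shows "(\<Sum>j\<in>J. \<theta> ^ ndist j k) \<le> 2 / (1 - \<theta>)"
proof -
  have geo: "(\<Sum>i\<in>K. \<theta> ^ i) \<le> 1 / (1 - \<theta>)" if "finite K" for K :: "nat set"
  proof -
    have "(\<Sum>i\<in>K. \<theta> ^ i) \<le> (\<Sum>i. \<theta> ^ i)"
      using \<theta> that by (intro sum_le_suminf) (auto intro: summable_geometric)
    then show ?thesis using \<theta> by (simp add: suminf_geometric)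
  qed
  have 1: "(\<Sum>j\<in>J \<inter> {..k}. \<theta> ^ ndist j k) = (\<Sum>i\<in>(\<lambda>j. k - j) ` (J \<inter> {..k}). \<theta> ^ i)"
    by (subst sum.reindex) (auto simp: inj_on_def ndist_def)
  have 2: "(\<Sum>j\<in>J - {..k}. \<theta> ^ ndist j k) = (\<Sum>i\<in>(\<lambda>j. j - k) ` (J - {..k}). \<theta> ^ i)"
    by (subst sum.reindex) (auto simp: inj_on_def ndist_def)
  have "(\<Sum>j\<in>J. \<theta> ^ ndist j k) = (\<Sum>j\<in>J \<inter> {..k}. \<theta> ^ ndist j k) + (\<Sum>j\<in>J - {..k}. \<theta> ^ ndist j k)"
    using \<open>finite J\<close> by (rule sum.Int_Diff)
  also have "\<dots> \<le> 1 / (1 - \<theta>) + 1 / (1 - \<theta>)"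
    unfolding 1 2 using \<open>finite J\<close> by (intro add_mono geo) auto
  finally show ?thesis by simp
qed

text \<open>Bounding each \<open>\<bar>a j\<bar>\<close> by a geometric factor times the largest weighted term costs only a
  constant, for every \<open>p > 0\<close>; it replaces the triangle inequality of \<open>L\<^sub>p\<close> throughout.\<close>

lemma weighted_power_sum:
  fixes p \<tau> :: real
  assumes p: "0 < p" and \<tau>: "1 < \<tau>"
  shows "\<exists>C>0. \<forall>J k (a :: nat \<Rightarrow> real). finite J \<longrightarrow>
    \<bar>\<Sum>j\<in>J. a j\<bar> powr p \<le> C * (\<Sum>j\<in>J. \<tau> ^ ndist j k * \<bar>a j\<bar> powr p)"
proof -
  define \<theta> where "\<theta> = \<tau> powr (- 1 / p)"
  have \<theta>: "0 < \<theta>" "\<theta> < 1"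
    using p \<tau> by (auto simp: \<theta>_def powr_less_one)
  have \<theta>p: "\<theta> powr p = 1 / \<tau>"
    using p \<tau> by (simp add: \<theta>_def powr_powr powr_minus_divide[of \<tau> 1, simplified])
  define K where "K = 2 / (1 - \<theta>)"
  have "K > 0" using \<theta> by (simp add: K_def)
  have "\<bar>\<Sum>j\<in>J. a j\<bar> powr p \<le> K powr p * (\<Sum>j\<in>J. \<tau> ^ ndist j k * \<bar>a j\<bar> powr p)"
    if "finite J" for J k and a :: "nat \<Rightarrow> real"
  proof (cases "J = {}")
    case False
    define S where "S = (\<Sum>j\<in>J. \<tau> ^ ndist j k * \<bar>a j\<bar> powr p)"
    have S0: "S \<ge> 0" unfolding S_def using \<tau> by (intro sum_nonneg) auto
    have "\<bar>a j\<bar> \<le> \<theta> ^ ndist j k * S powr (1 / p)" if "j \<in> J" for j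
    proof -
      have "\<tau> ^ ndist j k * \<bar>a j\<bar> powr p \<le> S"
        unfolding S_def using \<open>finite J\<close> that \<tau> by (intro member_le_sum) auto
      then have "\<bar>a j\<bar> powr p \<le> (1 / \<tau>) ^ ndist j k * S"
        using \<tau> by (simp add: field_simps power_divide)
      then have "(\<bar>a j\<bar> powr p) powr (1 / p) \<le> ((1 / \<tau>) ^ ndist j k * S) powr (1 / p)"
        using p by (intro powr_mono2) auto
      also have "(1 / \<tau>) ^ ndist j k = (\<theta> ^ ndist j k) powr p"
        using \<theta> unfolding \<theta>p[symmetric] by (simp add: powr_realpow[symmetric] powr_powr mult.commute)
      also have "((\<theta> ^ ndist j k) powr p * S) powr (1 / p) = \<theta> ^ ndist j k * S powr (1 / p)"
        using p S0 \<theta> by (simp add: powr_mult powr_powr)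
      finally show ?thesis using p by (simp add: powr_powr)
    qed
    then have "\<bar>\<Sum>j\<in>J. a j\<bar> \<le> (\<Sum>j\<in>J. \<theta> ^ ndist j k * S powr (1 / p))"
      by (intro order_trans[OF sum_abs] sum_mono)
    also have "\<dots> = (\<Sum>j\<in>J. \<theta> ^ ndist j k) * S powr (1 / p)"
      by (simp add: sum_distrib_right)
    also have "\<dots> \<le> K * S powr (1 / p)"
      unfolding K_def using sum_ndist_le[of \<theta> J k] \<theta> \<open>finite J\<close> by (intro mult_right_mono) auto
    finally have "\<bar>\<Sum>j\<in>J. a j\<bar> powr p \<le> (K * S powr (1 / p)) powr p"
      using p by (intro powr_mono2) auto
    also have "\<dots> = K powr p * S"
      using p S0 \<open>K > 0\<close> by (simp add: powr_mult powr_powr)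
    finally show ?thesis by (simp add: S_def)
  qed (use \<open>K > 0\<close> in simp)
  then show ?thesis using \<open>K > 0\<close> by (intro exI[of _ "K powr p"]) auto
qed

lemma powr_sum_le:
  fixes p :: real
  assumes "0 < p" "p \<le> 1" "finite J"
  shows "\<bar>\<Sum>j\<in>J. a j\<bar> powr p \<le> (\<Sum>j\<in>J. \<bar>a j :: real\<bar> powr p)"
  using \<open>finite J\<close>
proof (induction J)
  case (insert j J)
  have "\<bar>a j + sum a J\<bar> powr p \<le> (\<bar>a j\<bar> + \<bar>sum a J\<bar>) powr p"
    using assms by (intro powr_mono2) auto
  also have "\<dots> \<le> \<bar>a j\<bar> powr p + \<bar>sum a J\<bar> powr p"
  proof (cases "a j = 0 \<or> sum a J = 0")
    case False
    define A B where "A = \<bar>a j\<bar>" and "B = \<bar>sum a J\<bar>"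
    have AB: "A > 0" "B > 0" using False by (auto simp: A_def B_def)
    \<comment> \<open>Fractions of the total lie in (0, 1], where t \<le> t^p; the two fractions add
      up to 1.\<close>
    have "x / (A + B) \<le> (x / (A + B)) powr p" if "0 < x" "x \<le> A + B" for x
      using powr_mono'[of p 1 "x / (A + B)"] assms that AB by auto
    from this[of A] this[of B] AB have "A / (A + B) + B / (A + B) \<le> (A / (A + B)) powr p + (B / (A + B)) powr p"
      by auto
    then have "1 \<le> (A powr p + B powr p) / (A + B) powr p"
      using AB by (simp add: powr_divide add_divide_distrib[symmetric])
    then show ?thesis using AB unfolding A_def[symmetric] B_def[symmetric]
      by (simp add: field_simps)
  qed (use assms in auto)
  finally show ?case using insert by simp
qed simp

lemma powr_add_le:
  fixes p a b :: real
  assumes "0 < p"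
  shows "\<bar>a + b\<bar> powr p \<le> 2 powr p * (\<bar>a\<bar> powr p + \<bar>b\<bar> powr p)"
proof -
  have "\<bar>a + b\<bar> powr p \<le> (2 * max \<bar>a\<bar> \<bar>b\<bar>) powr p"
    using assms by (intro powr_mono2) auto
  also have "\<dots> = 2 powr p * max \<bar>a\<bar> \<bar>b\<bar> powr p" by (simp add: powr_mult)
  also have "\<dots> \<le> 2 powr p * (\<bar>a\<bar> powr p + \<bar>b\<bar> powr p)"
    by (intro mult_left_mono) (auto simp: max_def)
  finally show ?thesis .
qed

lemma summable_ndist:
  fixes \<theta> :: real
  assumes "0 \<le> \<theta>" "\<theta> \<le> 1" "summable b" "\<And>j. 0 \<le> b j"
  shows "summable (\<lambda>j. \<theta> ^ ndist j k * b j)"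
  using assms by (intro summable_comparison_test'[OF assms(3), of 0])
    (auto simp: abs_mult intro!: mult_left_le_one_le power_le_one)

lemma sum_suminf_ndist_le:
  fixes \<theta> :: real
  assumes \<theta>: "0 \<le> \<theta>" "\<theta> < 1" and b: "summable b" "\<And>j. 0 \<le> b j"
  shows "(\<Sum>k<n. \<Sum>j. \<theta> ^ ndist j k * b j) \<le> 2 / (1 - \<theta>) * suminf b"
proof -
  have "(\<Sum>k<n. \<Sum>j. \<theta> ^ ndist j k * b j) = (\<Sum>j. \<Sum>k<n. \<theta> ^ ndist j k * b j)"
    using assms by (intro suminf_sum[symmetric] summable_ndist) auto
  also have "\<dots> \<le> (\<Sum>j. 2 / (1 - \<theta>) * b j)"
  proof (intro suminf_le summable_sum summable_ndist summable_mult b)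
    fix j
    have "(\<Sum>k<n. \<theta> ^ ndist j k * b j) = (\<Sum>k<n. \<theta> ^ ndist k j) * b j"
      by (simp add: sum_distrib_right ndist_commute)
    also have "\<dots> \<le> 2 / (1 - \<theta>) * b j"
      using assms by (intro mult_right_mono sum_ndist_le) auto
    finally show "(\<Sum>k<n. \<theta> ^ ndist j k * b j) \<le> 2 / (1 - \<theta>) * b j" .
  qed (use \<theta> in auto)
  also have "\<dots> = 2 / (1 - \<theta>) * suminf b" by (rule suminf_mult[OF b(1)])
  finally show ?thesis .
qed

lemma le_of_le_add_powr:
  fixes x y r C :: real
  assumes "0 < r" "0 < C" "\<And>e. e > 0 \<Longrightarrow> x \<le> C * (y + e powr r)"
  shows "x \<le> C * y"
proof (rule field_le_epsilon)
  fix e :: real assume "e > 0"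
  have "x \<le> C * (y + ((e / C) powr (1 / r)) powr r)"
    using \<open>e > 0\<close> assms by (intro assms(3)) auto
  also have "\<dots> = C * y + e" using \<open>e > 0\<close> assms by (simp add: powr_powr algebra_simps)
  finally show "x \<le> C * y + e" .
qed

text \<open>\<open>weighted_power_sum\<close> with \<tau> = \<theta>^(-r/2) uses up only half of the
  decay \<theta>^r; the remaining kernel \<theta>^(r/2) is summable in k as well as in j. The error
  e allows finite sums whose index set depends on e, as is wanted when a remainder is only known to
  tend to 0.\<close>

lemma discrete_hardy:
  fixes r \<theta> :: real
  assumes r: "0 < r" and \<theta>: "0 \<le> \<theta>" "\<theta> < 1"
  shows "\<exists>C>0. \<forall>b x :: nat \<Rightarrow> real. (\<forall>j. 0 \<le> b j) \<longrightarrow> summable (\<lambda>j. b j powr r) \<longrightarrow> (\<forall>k. 0 \<le> x k) \<longrightarrow>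
     (\<forall>k. \<forall>e>0. \<exists>J. finite J \<and> x k \<le> (\<Sum>j\<in>J. \<theta> ^ ndist j k * b j) + e) \<longrightarrow>
     summable (\<lambda>k. x k powr r) \<and> (\<Sum>k. x k powr r) \<le> C * (\<Sum>j. b j powr r)"
proof -
  \<comment> \<open>At \<theta> = 0 the power \<theta>^(-r/2) would evaluate to 0, which is no
    admissible \<tau>; a positive bound below 1 serves instead.\<close>
  define \<theta>1 where "\<theta>1 = (if \<theta> = 0 then 1/2 else \<theta>)"
  have \<theta>1: "0 < \<theta>1" "\<theta>1 < 1" "\<theta> \<le> \<theta>1" using \<theta> by (auto simp: \<theta>1_def)
  define \<tau> where "\<tau> = \<theta>1 powr (- r / 2)"
  have \<tau>: "1 < \<tau>"
    using r \<theta>1 by (auto simp: \<tau>_def powr_def intro: mult_pos_neg)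
  define \<kappa> where "\<kappa> = \<theta>1 powr (r / 2)"
  have \<kappa>: "0 \<le> \<kappa>" "\<kappa> < 1" using r \<theta>1 using powr_less_mono2[of "r / 2" \<theta>1 1] by (auto simp: \<kappa>_def)
  have \<tau>\<kappa>: "\<tau> ^ n * (\<theta>1 ^ n) powr r = \<kappa> ^ n" for n
  proof -
    have "\<tau> * \<theta>1 powr r = \<kappa>" unfolding \<tau>_def \<kappa>_def by (simp add: powr_add[symmetric])
    moreover have "(\<theta>1 ^ n) powr r = (\<theta>1 powr r) ^ n"
      using \<theta>1 by (simp add: powr_realpow[symmetric] powr_powr powr_power mult.commute)
    ultimately show ?thesis by (simp add: power_mult_distrib[symmetric])
  qed
  obtain C where C: "C > 0" "\<And>J k (a :: nat \<Rightarrow> real). finite J \<Longrightarrow>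
    \<bar>\<Sum>j\<in>J. a j\<bar> powr r \<le> C * (\<Sum>j\<in>J. \<tau> ^ ndist j k * \<bar>a j\<bar> powr r)"
    using weighted_power_sum[OF r \<tau>] by blast
  define C' where "C' = 2 powr r * (C + 1)"
  define D where "D = C' * (2 / (1 - \<kappa>))"
  have C': "C' > 0" using C by (simp add: C'_def)
  have D: "D > 0" using C' \<kappa> by (simp add: D_def)
  have "summable (\<lambda>k. x k powr r) \<and> (\<Sum>k. x k powr r) \<le> D * (\<Sum>j. b j powr r)"
    if b: "\<And>j. 0 \<le> b j" "summable (\<lambda>j. b j powr r)" and x: "\<And>k. 0 \<le> x k"
      "\<And>k e. e > 0 \<Longrightarrow> \<exists>J. finite J \<and> x k \<le> (\<Sum>j\<in>J. \<theta> ^ ndist j k * b j) + e"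
    for b x :: "nat \<Rightarrow> real"
  proof -
    have main: "x k powr r \<le> C' * (\<Sum>j. \<kappa> ^ ndist j k * b j powr r)" for k
    proof (rule le_of_le_add_powr[OF r C'])
      fix e :: real assume "e > 0"
      then obtain J where J: "finite J" "x k \<le> (\<Sum>j\<in>J. \<theta> ^ ndist j k * b j) + e" using x(2) by blast
      have "x k powr r \<le> \<bar>(\<Sum>j\<in>J. \<theta>1 ^ ndist j k * b j) + e\<bar> powr r"
      proof (intro powr_mono2)
        have "(\<Sum>j\<in>J. \<theta> ^ ndist j k * b j) \<le> (\<Sum>j\<in>J. \<theta>1 ^ ndist j k * b j)"
          using \<theta>1 \<theta> b by (intro sum_mono mult_right_mono power_mono) auto
        then show "x k \<le> \<bar>(\<Sum>j\<in>J. \<theta>1 ^ ndist j k * b j) + e\<bar>" using J by linarith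
      qed (use r x in auto)
      also have "\<dots> \<le> 2 powr r * (\<bar>\<Sum>j\<in>J. \<theta>1 ^ ndist j k * b j\<bar> powr r + \<bar>e\<bar> powr r)"
        by (rule powr_add_le[OF r])
      also have "\<bar>\<Sum>j\<in>J. \<theta>1 ^ ndist j k * b j\<bar> powr r \<le>
           C * (\<Sum>j\<in>J. \<tau> ^ ndist j k * \<bar>\<theta>1 ^ ndist j k * b j\<bar> powr r)"
        by (rule C(2)[OF J(1)])
      also have "\<dots> = C * (\<Sum>j\<in>J. \<kappa> ^ ndist j k * b j powr r)"
        using \<theta>1 b by (simp add: abs_mult powr_mult \<tau>\<kappa>[symmetric] mult.assoc)
      also have "\<dots> \<le> C * (\<Sum>j. \<kappa> ^ ndist j k * b j powr r)"
        using C J \<kappa> b by (intro mult_left_mono sum_le_suminf summable_ndist) auto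
      also have "\<dots> \<le> (C + 1) * (\<Sum>j. \<kappa> ^ ndist j k * b j powr r)"
        using \<kappa> b by (intro mult_right_mono suminf_nonneg summable_ndist) auto
      also have "\<bar>e\<bar> powr r \<le> (C + 1) * e powr r" using C \<open>e > 0\<close> by (simp add: field_simps)
      finally show "x k powr r \<le> C' * ((\<Sum>j. \<kappa> ^ ndist j k * b j powr r) + e powr r)"
        by (simp add: C'_def algebra_simps)
    qed
    have bd: "(\<Sum>k<n. x k powr r) \<le> D * (\<Sum>j. b j powr r)" for n
    proof -
      have "(\<Sum>k<n. x k powr r) \<le> C' * (\<Sum>k<n. \<Sum>j. \<kappa> ^ ndist j k * b j powr r)"
        unfolding sum_distrib_left by (intro sum_mono main)
      also have "\<dots> \<le> C' * (2 / (1 - \<kappa>) * (\<Sum>j. b j powr r))"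
        using C' b \<kappa> by (intro mult_left_mono sum_suminf_ndist_le) auto
      finally show ?thesis by (simp add: D_def)
    qed
    have "summable (\<lambda>k. x k powr r)" by (rule summableI_nonneg_bounded[OF _ bd]) auto
    moreover from this have "(\<Sum>k. x k powr r) \<le> D * (\<Sum>j. b j powr r)"
      by (intro suminf_le_const bd)
    ultimately show ?thesis ..
  qed
  then show ?thesis using D by (intro exI[of _ D]) blast
qed

section \<open>The discretised Besov quasi-norm\<close>

lemma distr_lebesgue_plus:
  "distr lebesgue lebesgue (\<lambda>x. x + y) = (lebesgue :: 'a::euclidean_space measure)"
proof -
  have "(\<lambda>x. y + (\<Sum>j\<in>Basis. (1 * (x \<bullet> j)) *\<^sub>R j)) = (\<lambda>x::'a. x + y)"
    by (simp add: euclidean_representation add.commute)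
  then show ?thesis
    using lebesgue_affine_euclidean[of "\<lambda>_. 1" y] by (simp add: density_1 one_ennreal_def[symmetric])
qed

lemma measurable_plus_lebesgue:
  "(\<lambda>x. x + y) \<in> measurable lebesgue (lebesgue :: 'a::euclidean_space measure)"
  using lebesgue_affine_measurable[of "\<lambda>_. 1" y] by (simp add: euclidean_representation add.commute)

lemma integral_shift_lebesgue:
  fixes G :: "'a::euclidean_space \<Rightarrow> real"
  assumes "integrable lebesgue G"
  shows "integrable lebesgue (\<lambda>x. G (x + y))" "(LINT x|lebesgue. G (x + y)) = (LINT x|lebesgue. G x)"
proof -
  have G: "G \<in> borel_measurable lebesgue" using assms by auto
  show "integrable lebesgue (\<lambda>x. G (x + y))"
    using integrable_distr_eq[OF measurable_plus_lebesgue[of y] G] assms by (simp add: distr_lebesgue_plus)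
  show "(LINT x|lebesgue. G (x + y)) = (LINT x|lebesgue. G x)"
    using integral_distr[OF measurable_plus_lebesgue[of y] G] by (simp add: distr_lebesgue_plus)
qed

lemma integrable_lebesgue_on_le:
  fixes G :: "'a::euclidean_space \<Rightarrow> real"
  assumes "integrable lebesgue G" "\<And>x. 0 \<le> G x" "S \<in> sets lebesgue"
  shows "integrable (lebesgue_on S) G" "(LINT x|lebesgue_on S. G x) \<le> (LINT x|lebesgue. G x)"
proof -
  have *: "integrable lebesgue (\<lambda>x. indicator S x *\<^sub>R G x)"
    using assms by (intro integrable_mult_indicator) auto
  then show "integrable (lebesgue_on S) G"
    using assms by (subst integrable_restrict_space) auto
  have "(LINT x|lebesgue_on S. G x) = (LINT x|lebesgue. indicator S x *\<^sub>R G x)"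
    using assms by (subst integral_restrict_space) auto
  also have "\<dots> \<le> (LINT x|lebesgue. G x)"
    using assms by (intro integral_mono *) (auto simp: indicator_def)
  finally show "(LINT x|lebesgue_on S. G x) \<le> (LINT x|lebesgue. G x)" .
qed

lemma integrable_lebesgue_of_on:
  fixes g :: "'a::euclidean_space \<Rightarrow> real"
  assumes "integrable (lebesgue_on S) g" "S \<in> sets lebesgue"
  shows "integrable lebesgue (\<lambda>x. indicator S x * g x)"
    "(LINT x|lebesgue. indicator S x * g x) = (LINT x|lebesgue_on S. g x)"
  using assms integrable_restrict_space[of S lebesgue g] integral_restrict_space[of S lebesgue g] by auto

text \<open>Carries a pointwise weighted quasi-triangle inequality to integrals. The weights c are
  free because they vary: constants from \<open>powr_add_le\<close>, powers of \<tau> from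
  \<open>weighted_power_sum\<close>, and values of a step function.\<close>

lemma integral_dominated_sum:
  fixes F :: "'a \<Rightarrow> real" and g :: "'i \<Rightarrow> 'a \<Rightarrow> real"
  assumes F: "F \<in> borel_measurable M" and g: "\<And>j. j \<in> J \<Longrightarrow> integrable M (g j)"
    and le: "AE x in M. \<bar>F x\<bar> \<le> (\<Sum>j\<in>J. c j * g j x)"
  shows "integrable M F" "(LINT x|M. F x) \<le> (\<Sum>j\<in>J. c j * (LINT x|M. g j x))"
proof -
  have I: "integrable M (\<lambda>x. \<Sum>j\<in>J. c j * g j x)"
    using g by (intro Bochner_Integration.integrable_sum integrable_mult_right) auto
  show int: "integrable M F"
    using I F by (rule Bochner_Integration.integrable_bound) (use le in eventually_elim, auto)
  have "(LINT x|M. F x) \<le> (LINT x|M. (\<Sum>j\<in>J. c j * g j x))"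
    using int I by (rule integral_mono_AE) (use le in eventually_elim, auto)
  also have "\<dots> = (\<Sum>j\<in>J. c j * (LINT x|M. g j x))"
    using g by (simp add: Bochner_Integration.integral_sum)
  finally show "(LINT x|M. F x) \<le> (\<Sum>j\<in>J. c j * (LINT x|M. g j x))" .
qed

text \<open>The p-th power of the quasi-norm: it behaves additively over disjoint sets and, unlike
  the quasi-norm, obeys sum inequalities inherited pointwise from |a|^p.\<close>

definition Lp_pow :: "real \<Rightarrow> (real^'d \<Rightarrow> real) \<Rightarrow> real" where
  "Lp_pow p f = (LINT x|lebesgue_on unit_cube. \<bar>f x\<bar> powr p)"

definition shift_pow :: "real \<Rightarrow> real^'d \<Rightarrow> (real^'d \<Rightarrow> real) \<Rightarrow> real" where
  "shift_pow p y f = (LINT x|lebesgue_on (shifted_cube y). \<bar>f (x + y) - f x\<bar> powr p)"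

definition smod :: "real \<Rightarrow> nat \<Rightarrow> (real^'d \<Rightarrow> real) \<Rightarrow> real" where
  "smod p k f = modulus_of_smoothness p f (1 / 2 ^ k) powr p"

lemma unit_cube_iff: "x \<in> unit_cube \<longleftrightarrow> (\<forall>i. 0 \<le> x $ i \<and> x $ i \<le> 1)"
  by (simp add: unit_cube_def mem_box_cart)

lemma unit_cube_sets [simp]: "unit_cube \<in> sets lebesgue"
  by (simp add: unit_cube_def)

lemma shifted_cube_eq: "shifted_cube y = unit_cube \<inter> (\<lambda>z. z + y) -` unit_cube"
  by (auto simp: shifted_cube_def)

lemma shifted_cube_sets [simp]: "shifted_cube y \<in> sets lebesgue"
proof -
  have "(\<lambda>z. z + y) -` unit_cube \<inter> space lebesgue \<in> sets lebesgue"
    by (rule measurable_sets[OF measurable_plus_lebesgue]) simp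
  then show ?thesis unfolding shifted_cube_eq by (intro sets.Int) auto
qed

lemma Lp_pow_nonneg [simp]: "0 \<le> Lp_pow p f"
  by (simp add: Lp_pow_def)

lemma shift_pow_nonneg [simp]: "0 \<le> shift_pow p y f"
  by (simp add: shift_pow_def)

lemma smod_nonneg [simp]: "0 \<le> smod p k f"
  by (simp add: smod_def)

lemma integrable_shifted_cube:
  fixes g :: "real^'d \<Rightarrow> real"
  assumes g: "integrable (lebesgue_on unit_cube) g" "\<And>x. 0 \<le> g x"
  shows "integrable (lebesgue_on (shifted_cube y)) g"
    "(LINT x|lebesgue_on (shifted_cube y). g x) \<le> (LINT x|lebesgue_on unit_cube. g x)"
    "integrable (lebesgue_on (shifted_cube y)) (\<lambda>x. g (x + y))"
    "(LINT x|lebesgue_on (shifted_cube y). g (x + y)) \<le> (LINT x|lebesgue_on unit_cube. g x)"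
proof -
  \<comment> \<open>Extension by zero to the whole space, where translation invariance applies; on
    the shifted cube both \<open>G x\<close> and \<open>G (x + y)\<close> agree with g.\<close>
  define G where "G x = indicator unit_cube x * g x" for x
  have G: "integrable lebesgue G" "(LINT x|lebesgue. G x) = (LINT x|lebesgue_on unit_cube. g x)"
    unfolding G_def using integrable_lebesgue_of_on[OF g(1)] by auto
  have G0: "0 \<le> G x" for x using g by (simp add: G_def)
  note G' = integral_shift_lebesgue[OF G(1), of y]
  have 1: "G x = g x" "G (x + y) = g (x + y)" if "x \<in> shifted_cube y" for x
    using that by (auto simp: G_def shifted_cube_def)
  have "integrable (lebesgue_on (shifted_cube y)) G \<longleftrightarrow> integrable (lebesgue_on (shifted_cube y)) g"
    by (intro Bochner_Integration.integrable_cong) (auto simp: 1)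
  then show "integrable (lebesgue_on (shifted_cube y)) g"
    using integrable_lebesgue_on_le(1)[OF G(1) G0, of "shifted_cube y"] by simp
  have "integrable (lebesgue_on (shifted_cube y)) (\<lambda>x. G (x + y)) \<longleftrightarrow>
      integrable (lebesgue_on (shifted_cube y)) (\<lambda>x. g (x + y))"
    by (intro Bochner_Integration.integrable_cong) (auto simp: 1)
  then show "integrable (lebesgue_on (shifted_cube y)) (\<lambda>x. g (x + y))"
    using integrable_lebesgue_on_le(1)[OF G'(1) G0, of "shifted_cube y"] by simp
  have "(LINT x|lebesgue_on (shifted_cube y). g x) = (LINT x|lebesgue_on (shifted_cube y). G x)"
    by (intro Bochner_Integration.integral_cong) (auto simp: 1)
  then show "(LINT x|lebesgue_on (shifted_cube y). g x) \<le> (LINT x|lebesgue_on unit_cube. g x)"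
    using integrable_lebesgue_on_le(2)[OF G(1) G0, of "shifted_cube y"] G(2) by simp
  have "(LINT x|lebesgue_on (shifted_cube y). g (x + y)) = (LINT x|lebesgue_on (shifted_cube y). G (x + y))"
    by (intro Bochner_Integration.integral_cong) (auto simp: 1)
  then show "(LINT x|lebesgue_on (shifted_cube y). g (x + y)) \<le> (LINT x|lebesgue_on unit_cube. g x)"
    using integrable_lebesgue_on_le(2)[OF G'(1) G0, of "shifted_cube y"] G'(2) G(2) by simp
qed

lemma measurable_shifted_cube:
  fixes f :: "real^'d \<Rightarrow> real"
  assumes "f \<in> borel_measurable (lebesgue_on unit_cube)"
  shows "f \<in> borel_measurable (lebesgue_on (shifted_cube y))"
    "(\<lambda>x. f (x + y)) \<in> borel_measurable (lebesgue_on (shifted_cube y))"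
proof -
  define G where "G x = (if x \<in> unit_cube then f x else 0)" for x
  have G: "G \<in> borel_measurable lebesgue"
    unfolding G_def using assms by (subst borel_measurable_if) auto
  have G': "(\<lambda>x. G (x + y)) \<in> borel_measurable lebesgue"
    using measurable_compose[OF measurable_plus_lebesgue G] by simp
  have 1: "G x = f x" "G (x + y) = f (x + y)" if "x \<in> shifted_cube y" for x
    using that by (auto simp: G_def shifted_cube_def)
  show "f \<in> borel_measurable (lebesgue_on (shifted_cube y))"
    using measurable_restrict_space1[OF G, of "shifted_cube y"] 1(1)
    by (subst measurable_cong[where g = G]) auto
  show "(\<lambda>x. f (x + y)) \<in> borel_measurable (lebesgue_on (shifted_cube y))"
    using measurable_restrict_space1[OF G', of "shifted_cube y"] 1(2)
    by (subst measurable_cong[where g = "\<lambda>x. G (x + y)"]) auto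
qed

lemma Lp_spaceD:
  assumes "f \<in> Lp_space p unit_cube"
  shows "f \<in> borel_measurable (lebesgue_on unit_cube)" "integrable (lebesgue_on unit_cube) (\<lambda>x. \<bar>f x\<bar> powr p)"
  using assms by (auto simp: Lp_space_def)

lemma integrable_shift_pow:
  fixes f :: "real^'d \<Rightarrow> real"
  assumes p: "0 < p" and f: "f \<in> Lp_space p unit_cube"
  shows "integrable (lebesgue_on (shifted_cube y)) (\<lambda>x. \<bar>f (x + y) - f x\<bar> powr p)"
    "shift_pow p y f \<le> 2 * 2 powr p * Lp_pow p f"
proof -
  note I = integrable_shifted_cube[OF Lp_spaceD(2)[OF f]]
  have meas: "(\<lambda>x. \<bar>f (x + y) - f x\<bar> powr p) \<in> borel_measurable (lebesgue_on (shifted_cube y))"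
    using measurable_shifted_cube[OF Lp_spaceD(1)[OF f]] by measurable
  have le: "\<bar>\<bar>f (x + y) - f x\<bar> powr p\<bar> \<le>
     (\<Sum>b\<in>UNIV. 2 powr p * (if b then \<bar>f (x + y)\<bar> powr p else \<bar>f x\<bar> powr p))" for x
    using powr_add_le[OF p, of "f (x + y)" "- f x"] by (simp add: UNIV_bool algebra_simps)
  have J: "integrable (lebesgue_on (shifted_cube y))
     (\<lambda>x. if b then \<bar>f (x + y)\<bar> powr p else \<bar>f x\<bar> powr p)" for b
    using I(1,3) by (cases b) auto
  note D = integral_dominated_sum[where c = "\<lambda>_. 2 powr p" and J = UNIV
    and g = "\<lambda>b x. if b then \<bar>f (x + y)\<bar> powr p else \<bar>f x\<bar> powr p", OF meas J AE_I2]
  show "integrable (lebesgue_on (shifted_cube y)) (\<lambda>x. \<bar>f (x + y) - f x\<bar> powr p)"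
    by (rule D(1)) (use le in auto)
  have "shift_pow p y f \<le> (\<Sum>b\<in>UNIV. 2 powr p *
      (LINT x|lebesgue_on (shifted_cube y). (if b then \<bar>f (x + y)\<bar> powr p else \<bar>f x\<bar> powr p)))"
    unfolding shift_pow_def by (rule D(2)) (use le in auto)
  also have "\<dots> = 2 powr p * (LINT x|lebesgue_on (shifted_cube y). \<bar>f (x + y)\<bar> powr p) +
       2 powr p * (LINT x|lebesgue_on (shifted_cube y). \<bar>f x\<bar> powr p)"
    by (simp add: UNIV_bool)
  also have "\<dots> \<le> 2 powr p * Lp_pow p f + 2 powr p * Lp_pow p f"
    unfolding Lp_pow_def by (intro add_mono mult_left_mono I) auto
  finally show "shift_pow p y f \<le> 2 * 2 powr p * Lp_pow p f" by (simp add: mult_ac)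
qed

lemma Lp_norm_shift: "Lp_norm p (shifted_cube y) (\<lambda>x. f (x + y) - f x) = shift_pow p y f powr (1 / p)"
  by (simp add: Lp_norm_def shift_pow_def)

lemma exists_small_vector: "t > 0 \<Longrightarrow> \<exists>y :: real^'d. 0 < norm y \<and> norm y \<le> t"
  using vector_choose_size[of t] by (metis less_eq_real_def)

text \<open>The modulus is a supremum in the reals and has the expected order properties only for
  bounded sets; each later use of \<open>cSUP_upper\<close> rests on this.\<close>

lemma bdd_above_modulus:
  fixes f :: "real^'d \<Rightarrow> real"
  assumes p: "0 < p" and f: "f \<in> Lp_space p unit_cube"
  shows "bdd_above ((\<lambda>y. Lp_norm p (shifted_cube y) (\<lambda>x. f (x + y) - f x)) ` A)"
proof (rule bdd_aboveI2)
  fix y show "Lp_norm p (shifted_cube y) (\<lambda>x. f (x + y) - f x) \<le> (2 * 2 powr p * Lp_pow p f) powr (1 / p)"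
    unfolding Lp_norm_shift using p integrable_shift_pow(2)[OF p f] by (intro powr_mono2) auto
qed

lemma modulus_nonneg:
  fixes f :: "real^'d \<Rightarrow> real"
  assumes p: "0 < p" and f: "f \<in> Lp_space p unit_cube" and t: "0 < t"
  shows "0 \<le> modulus_of_smoothness p f t"
proof -
  obtain y :: "real^'d" where y: "0 < norm y" "norm y \<le> t" using exists_small_vector[OF t] by blast
  have "0 \<le> shift_pow p y f powr (1 / p)" by simp
  also have "\<dots> \<le> modulus_of_smoothness p f t"
    unfolding modulus_of_smoothness_def Lp_norm_shift[symmetric]
    by (rule cSUP_upper) (use y bdd_above_modulus[OF p f] in auto)
  finally show ?thesis .
qed

lemma modulus_mono:
  fixes f :: "real^'d \<Rightarrow> real"
  assumes p: "0 < p" and f: "f \<in> Lp_space p unit_cube" and t: "0 < t" "t \<le> t'"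
  shows "modulus_of_smoothness p f t \<le> modulus_of_smoothness p f t'"
  unfolding modulus_of_smoothness_def
  using exists_small_vector[OF t(1)] t bdd_above_modulus[OF p f] by (intro cSUP_subset_mono) auto

lemma shift_pow_le_smod:
  fixes f :: "real^'d \<Rightarrow> real"
  assumes p: "0 < p" and f: "f \<in> Lp_space p unit_cube" and y: "0 < norm y" "norm y \<le> 1 / 2 ^ k"
  shows "shift_pow p y f \<le> smod p k f"
proof -
  have "shift_pow p y f powr (1 / p) \<le> modulus_of_smoothness p f (1 / 2 ^ k)"
    unfolding modulus_of_smoothness_def Lp_norm_shift[symmetric]
    by (rule cSUP_upper) (use y bdd_above_modulus[OF p f] in auto)
  then have "(shift_pow p y f powr (1 / p)) powr p \<le> smod p k f"
    unfolding smod_def using p by (intro powr_mono2) auto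
  then show ?thesis using p by (simp add: powr_powr)
qed

lemma smod_le:
  fixes f :: "real^'d \<Rightarrow> real"
  assumes p: "0 < p" and f: "f \<in> Lp_space p unit_cube"
    and le: "\<And>y. 0 < norm y \<Longrightarrow> norm y \<le> 1 / 2 ^ k \<Longrightarrow> shift_pow p y f \<le> B"
  shows "smod p k f \<le> B"
proof -
  \<comment> \<open>An admissible shift shows that the supremum is over a nonempty set and that B is
    nonnegative.\<close>
  obtain y :: "real^'d" where y: "0 < norm y" "norm y \<le> 1 / 2 ^ k" using exists_small_vector[of "1 / 2 ^ k"] by auto
  have B: "B \<ge> 0" using le[OF y] by (meson order_trans shift_pow_nonneg)
  have "modulus_of_smoothness p f (1 / 2 ^ k) \<le> B powr (1 / p)"
    unfolding modulus_of_smoothness_def Lp_norm_shift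
    using y p by (intro cSUP_least powr_mono2 le) auto
  then have "smod p k f \<le> (B powr (1 / p)) powr p"
    unfolding smod_def using p f by (intro powr_mono2 modulus_nonneg) auto
  then show ?thesis using p B by (simp add: powr_powr)
qed

lemma smod_le_Lp_pow:
  fixes f :: "real^'d \<Rightarrow> real"
  assumes p: "0 < p" and f: "f \<in> Lp_space p unit_cube"
  shows "smod p k f \<le> 2 * 2 powr p * Lp_pow p f"
  by (rule smod_le[OF p f]) (rule integrable_shift_pow(2)[OF p f])

text \<open>One lemma for all quasi-triangle inequalities: any pointwise bound of |sum|^p by
  weighted p-th powers is inherited by \<open>Lp_pow\<close> and by each shift difference. It is
  used with constant weights 2^p, with weights 1 for p \<le> 1, and with geometric weights.\<close>

lemma sum_in_Lp_space:
  fixes f :: "nat \<Rightarrow> real^'d \<Rightarrow> real"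
  assumes p: "0 < p" and f: "\<And>j. j \<in> J \<Longrightarrow> f j \<in> Lp_space p unit_cube" and J: "finite J"
    and c: "\<And>a :: nat \<Rightarrow> real. \<bar>\<Sum>j\<in>J. a j\<bar> powr p \<le> (\<Sum>j\<in>J. c j * \<bar>a j\<bar> powr p)"
  shows "(\<lambda>x. \<Sum>j\<in>J. f j x) \<in> Lp_space p unit_cube"
    and "Lp_pow p (\<lambda>x. \<Sum>j\<in>J. f j x) \<le> (\<Sum>j\<in>J. c j * Lp_pow p (f j))"
    and "shift_pow p y (\<lambda>x. \<Sum>j\<in>J. f j x) \<le> (\<Sum>j\<in>J. c j * shift_pow p y (f j))"
proof -
  have m: "(\<lambda>x. \<Sum>j\<in>J. f j x) \<in> borel_measurable (lebesgue_on unit_cube)"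
    using Lp_spaceD(1)[OF f] by (intro borel_measurable_sum) auto
  have m': "(\<lambda>x. \<bar>\<Sum>j\<in>J. f j x\<bar> powr p) \<in> borel_measurable (lebesgue_on unit_cube)"
    using m by measurable
  note D = integral_dominated_sum[OF m' Lp_spaceD(2)[OF f] AE_I2, where c = c]
  have "integrable (lebesgue_on unit_cube) (\<lambda>x. \<bar>\<Sum>j\<in>J. f j x\<bar> powr p)"
    by (rule D(1)) (use c in auto)
  then show L: "(\<lambda>x. \<Sum>j\<in>J. f j x) \<in> Lp_space p unit_cube" using m by (auto simp: Lp_space_def)
  show "Lp_pow p (\<lambda>x. \<Sum>j\<in>J. f j x) \<le> (\<Sum>j\<in>J. c j * Lp_pow p (f j))"
    unfolding Lp_pow_def by (rule D(2)) (use c in auto)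
  have m2: "(\<lambda>x. \<bar>(\<Sum>j\<in>J. f j (x + y)) - (\<Sum>j\<in>J. f j x)\<bar> powr p) \<in> borel_measurable (lebesgue_on (shifted_cube y))"
    using integrable_shift_pow(1)[OF p L] by auto
  note D2 = integral_dominated_sum[OF m2 integrable_shift_pow(1)[OF p f] AE_I2, where c = c]
  show "shift_pow p y (\<lambda>x. \<Sum>j\<in>J. f j x) \<le> (\<Sum>j\<in>J. c j * shift_pow p y (f j))"
    unfolding shift_pow_def by (rule D2(2)) (use c in \<open>auto simp: sum_subtractf[symmetric]\<close>)
qed

lemma smod_sum_le:
  fixes f :: "nat \<Rightarrow> real^'d \<Rightarrow> real"
  assumes p: "0 < p" and f: "\<And>j. j \<in> J \<Longrightarrow> f j \<in> Lp_space p unit_cube" and J: "finite J"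
    and c: "\<And>a :: nat \<Rightarrow> real. \<bar>\<Sum>j\<in>J. a j\<bar> powr p \<le> (\<Sum>j\<in>J. c j * \<bar>a j\<bar> powr p)" "\<And>j. j \<in> J \<Longrightarrow> 0 \<le> c j"
  shows "smod p k (\<lambda>x. \<Sum>j\<in>J. f j x) \<le> (\<Sum>j\<in>J. c j * smod p k (f j))"
proof (rule smod_le[OF p sum_in_Lp_space(1)[OF p f J c(1)]])
  fix y :: "real^'d" assume y: "0 < norm y" "norm y \<le> 1 / 2 ^ k"
  have "shift_pow p y (\<lambda>x. \<Sum>j\<in>J. f j x) \<le> (\<Sum>j\<in>J. c j * shift_pow p y (f j))"
    by (rule sum_in_Lp_space(3)[OF p f J c(1)])
  also have "\<dots> \<le> (\<Sum>j\<in>J. c j * smod p k (f j))"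
    by (intro sum_mono mult_left_mono shift_pow_le_smod p f y c)
  finally show "shift_pow p y (\<lambda>x. \<Sum>j\<in>J. f j x) \<le> (\<Sum>j\<in>J. c j * smod p k (f j))" .
qed

lemma add_in_Lp_space:
  fixes f g :: "real^'d \<Rightarrow> real"
  assumes p: "0 < p" and f: "f \<in> Lp_space p unit_cube" and g: "g \<in> Lp_space p unit_cube"
  shows "(\<lambda>x. f x + g x) \<in> Lp_space p unit_cube"
    and "Lp_pow p (\<lambda>x. f x + g x) \<le> 2 powr p * (Lp_pow p f + Lp_pow p g)"
    and "smod p k (\<lambda>x. f x + g x) \<le> 2 powr p * (smod p k f + smod p k g)"
proof -
  define F where "F j = (if j = 0 then f else g)" for j :: nat
  have e: "(\<lambda>x. \<Sum>j\<in>{0,1}. F j x) = (\<lambda>x. f x + g x)" by (auto simp: F_def)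
  have c: "\<bar>\<Sum>j\<in>{0,1}. a j\<bar> powr p \<le> (\<Sum>j\<in>{0,1}. 2 powr p * \<bar>a j\<bar> powr p)" for a :: "nat \<Rightarrow> real"
    using powr_add_le[OF p, of "a 0" "a 1"] by (simp add: algebra_simps)
  have F: "F j \<in> Lp_space p unit_cube" for j using f g by (simp add: F_def)
  show "(\<lambda>x. f x + g x) \<in> Lp_space p unit_cube"
    using sum_in_Lp_space(1)[of p "{0,1}" F, OF p F _ c] unfolding e by simp
  show "Lp_pow p (\<lambda>x. f x + g x) \<le> 2 powr p * (Lp_pow p f + Lp_pow p g)"
    using sum_in_Lp_space(2)[of p "{0,1}" F, OF p F _ c] unfolding e by (simp add: F_def algebra_simps)
  show "smod p k (\<lambda>x. f x + g x) \<le> 2 powr p * (smod p k f + smod p k g)"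
    using smod_sum_le[of p "{0,1}" F, OF p F _ c] unfolding e by (simp add: F_def algebra_simps)
qed

lemma scale_in_Lp_space:
  fixes f :: "real^'d \<Rightarrow> real"
  assumes p: "0 < p" and f: "f \<in> Lp_space p unit_cube"
  shows "(\<lambda>x. a * f x) \<in> Lp_space p unit_cube"
    and "Lp_pow p (\<lambda>x. a * f x) = \<bar>a\<bar> powr p * Lp_pow p f"
    and "smod p k (\<lambda>x. a * f x) \<le> \<bar>a\<bar> powr p * smod p k f"
proof -
  show L: "(\<lambda>x. a * f x) \<in> Lp_space p unit_cube"
    using f by (auto simp: Lp_space_def abs_mult powr_mult)
  show "Lp_pow p (\<lambda>x. a * f x) = \<bar>a\<bar> powr p * Lp_pow p f"
    by (simp add: Lp_pow_def abs_mult powr_mult)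
  show "smod p k (\<lambda>x. a * f x) \<le> \<bar>a\<bar> powr p * smod p k f"
  proof (rule smod_le[OF p L])
    fix y :: "real^'d" assume y: "0 < norm y" "norm y \<le> 1 / 2 ^ k"
    have "shift_pow p y (\<lambda>x. a * f x) = \<bar>a\<bar> powr p * shift_pow p y f"
      by (simp add: shift_pow_def abs_mult powr_mult right_diff_distrib[symmetric])
    also have "\<dots> \<le> \<bar>a\<bar> powr p * smod p k f"
      by (intro mult_left_mono shift_pow_le_smod p f y) auto
    finally show "shift_pow p y (\<lambda>x. a * f x) \<le> \<bar>a\<bar> powr p * smod p k f" .
  qed
qed

lemma diff_in_Lp_space:
  fixes f g :: "real^'d \<Rightarrow> real"
  assumes p: "0 < p" and f: "f \<in> Lp_space p unit_cube" and g: "g \<in> Lp_space p unit_cube"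
  shows "(\<lambda>x. f x - g x) \<in> Lp_space p unit_cube"
    and "Lp_pow p (\<lambda>x. f x - g x) \<le> 2 powr p * (Lp_pow p f + Lp_pow p g)"
    and "smod p k (\<lambda>x. f x - g x) \<le> 2 powr p * (smod p k f + smod p k g)"
proof -
  note m = scale_in_Lp_space[OF p g, where a = "-1", simplified]
  note a = add_in_Lp_space[OF p f m(1)]
  show "(\<lambda>x. f x - g x) \<in> Lp_space p unit_cube"
    and "Lp_pow p (\<lambda>x. f x - g x) \<le> 2 powr p * (Lp_pow p f + Lp_pow p g)"
    using a(1,2) m(2) by simp_all
  show "smod p k (\<lambda>x. f x - g x) \<le> 2 powr p * (smod p k f + smod p k g)"
  proof -
    have "smod p k (\<lambda>x. f x - g x) \<le> 2 powr p * (smod p k f + smod p k (\<lambda>x. - g x))"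
      using a(3)[of k] by simp
    also have "\<dots> \<le> 2 powr p * (smod p k f + smod p k g)"
      using m(3)[of k] by (intro mult_left_mono add_left_mono) auto
    finally show ?thesis .
  qed
qed

section \<open>Discretisation of the integral over t\<close>

lemma UN_dyadic_shells: "(\<Union>k. {1 / 2 ^ Suc k<..1 / 2 ^ k}) = {0<..1::real}"
proof -
  have "\<exists>k. 1 / 2 ^ Suc k < t \<and> t \<le> 1 / 2 ^ k" if t: "0 < t" "t \<le> 1" for t :: real
  proof -
    obtain n where n: "1 / 2 ^ n < t" using t reals_power_lt_ex[of t 2] by (auto simp: field_simps)
    define k where "k = (LEAST n. 1 / 2 ^ n < t)"
    have k: "1 / 2 ^ k < t" unfolding k_def by (rule LeastI[of _ n]) (rule n)
    then have "k \<noteq> 0" using t by (auto intro: gr0I)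
    then obtain m where m: "k = Suc m" by (cases k) auto
    have "\<not> 1 / 2 ^ m < t" using not_less_Least[of m "\<lambda>n. 1 / 2 ^ n < t"] m k_def by auto
    then show ?thesis using k m by auto
  qed
  moreover have "0 < t" if "1 / 2 ^ Suc k < t" for t :: real and k
    using that by (smt (verit) zero_less_divide_1_iff zero_less_power)
  moreover have "t \<le> 1" if "t \<le> 1 / 2 ^ k" for t :: real and k
    using that by (rule order_trans) simp
  ultimately show ?thesis by (auto simp del: power_Suc)
qed

lemma disjoint_dyadic_shells: "disjoint_family (\<lambda>k. {1 / 2 ^ Suc k<..1 / 2 ^ k :: real})"
proof -
  have "{1 / 2 ^ Suc k<..1 / 2 ^ k :: real} \<inter> {1 / 2 ^ Suc l<..1 / 2 ^ l} = {}" if "k < l" for k l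
  proof -
    have "1 / 2 ^ l \<le> (1 / 2 ^ Suc k :: real)"
      using that by (intro divide_left_mono power_increasing) auto
    then show ?thesis by auto
  qed
  then show ?thesis
    unfolding disjoint_family_on_def by (metis inf_commute linorder_neqE_nat)
qed

text \<open>The p-th power is kept inside, so that estimates of \<open>smod\<close> can be inserted
  directly; the exponent q/p turns it into the usual term of the l_q sum over dyadic scales.\<close>

definition besov_term :: "real \<Rightarrow> real \<Rightarrow> real \<Rightarrow> (real^'d \<Rightarrow> real) \<Rightarrow> nat \<Rightarrow> real" where
  "besov_term p q s f k = ((2 powr (s * p)) ^ k * smod p k f) powr (q / p)"

definition besov_pow :: "real \<Rightarrow> real \<Rightarrow> real \<Rightarrow> (real^'d \<Rightarrow> real) \<Rightarrow> real" where
  "besov_pow p q s f = Lp_pow p f powr (q / p) + (\<Sum>k. besov_term p q s f k)"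

lemma besov_term_nonneg [simp]: "0 \<le> besov_term p q s f k"
  by (simp add: besov_term_def)

context
  fixes p q s :: real
  assumes p: "0 < p" and q: "0 < q" and s: "0 < s"
begin

lemma besov_term_eq:
  assumes f: "f \<in> Lp_space p unit_cube"
  shows "besov_term p q s f k = (2 powr (s * k) * modulus_of_smoothness p f (1 / 2 ^ k)) powr q"
proof -
  have "besov_term p q s f k = ((2 powr (s * k) * modulus_of_smoothness p f (1 / 2 ^ k)) powr p) powr (q / p)"
    unfolding besov_term_def smod_def using modulus_nonneg[OF p f, of "1 / 2 ^ k"]
    by (simp add: powr_mult powr_powr powr_power mult_ac)
  then show ?thesis using p by (simp add: powr_powr)
qed

text \<open>A supremum over uncountably many shifts gives no measurability by itself; monotonicity
  of the modulus in t does.\<close>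

lemma measurable_besov_integrand:
  fixes f :: "real^'d \<Rightarrow> real"
  assumes f: "f \<in> Lp_space p unit_cube"
  shows "besov_integrand p q s f \<in> borel_measurable (lebesgue_on {0<..1})"
proof -
  have "mono_on {0<..1} (modulus_of_smoothness p f)"
    by (intro mono_onI modulus_mono[OF p f]) auto
  then have "modulus_of_smoothness p f \<in> borel_measurable (restrict_space borel {0<..1})"
    by (rule borel_measurable_mono_on_fnc)
  then have "(\<lambda>t. modulus_of_smoothness p f t * indicator {0<..1} t) \<in> borel_measurable borel"
    by (subst (asm) borel_measurable_restrict_space_iff) (auto simp: mult.commute)
  then have "(\<lambda>t. modulus_of_smoothness p f t * indicator {0<..1} t) \<in> borel_measurable lebesgue"
    by (intro measurable_completion) simp
  then have "(\<lambda>t. modulus_of_smoothness p f t * indicator {0<..1} t) \<in> borel_measurable (lebesgue_on {0<..1})"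
    by (rule measurable_restrict_space1)
  then have m: "modulus_of_smoothness p f \<in> borel_measurable (lebesgue_on {0<..1})"
    by (subst measurable_cong[where g = "\<lambda>t. modulus_of_smoothness p f t * indicator {0<..1} t"]) auto
  have i: "(\<lambda>t::real. t) \<in> borel_measurable (lebesgue_on {0<..1})"
    using id_borel_measurable_lebesgue_on[of "{0<..1::real}"] by (simp add: id_def)
  show ?thesis unfolding besov_integrand_def using m i by measurable
qed

text \<open>On a dyadic shell the factors t^(-s) and 1/t vary by bounded ratios and the modulus is
  monotone. The lower bound sees the modulus only at the left end of the shell, so shell k controls
  the term of index k + 1.\<close>

lemma besov_integrand_bounds:
  fixes f :: "real^'d \<Rightarrow> real"
  assumes f: "f \<in> Lp_space p unit_cube" and t: "1 / 2 ^ Suc k < t" "t \<le> 1 / 2 ^ k"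
  shows "besov_integrand p q s f t \<le> 2 powr (s * q) * 2 * 2 ^ k * besov_term p q s f k"
    "2 powr (- (s * q)) * 2 ^ k * besov_term p q s f (Suc k) \<le> besov_integrand p q s f t"
proof -
  let ?w = "modulus_of_smoothness p f"
  have t0: "0 < t" using t by (smt (verit) zero_less_divide_1_iff zero_less_power)
  have pw: "(1 / 2 ^ n) powr (- s) = 2 powr (s * n)" for n :: nat
  proof -
    have "1 / 2 ^ n = (2::real) powr (- real n)" by (simp add: powr_minus powr_realpow divide_inverse)
    then show ?thesis by (simp add: powr_powr mult.commute)
  qed
  have up: "t powr (- s) \<le> 2 powr (s * Suc k)"
    using t s powr_mono2'[of "-s" "1 / 2 ^ Suc k" t] pw[of "Suc k"] by auto
  have lo: "2 powr (s * k) \<le> t powr (- s)"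
    using t t0 s powr_mono2'[of "-s" t "1 / 2 ^ k"] pw[of k] by auto
  have w: "0 \<le> ?w (1 / 2 ^ Suc k)" "?w (1 / 2 ^ Suc k) \<le> ?w t" "0 \<le> ?w t" "?w t \<le> ?w (1 / 2 ^ k)"
    using t t0 by (auto intro!: modulus_mono[OF p f] modulus_nonneg[OF p f] simp del: power_Suc)
  have inv: "1 / t \<le> 2 * 2 ^ k" "2 ^ k \<le> 1 / t"
    using t t0 by (auto simp: field_simps)
  have "besov_integrand p q s f t = (t powr (- s) * ?w t) powr q * (1 / t)"
    by (simp add: besov_integrand_def)
  also have "\<dots> \<le> (2 powr (s * Suc k) * ?w (1 / 2 ^ k)) powr q * (2 * 2 ^ k)"
    using q w inv up t0 by (intro mult_mono powr_mono2) auto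
  also have "2 powr (s * Suc k) * ?w (1 / 2 ^ k) = 2 powr s * (2 powr (s * k) * ?w (1 / 2 ^ k))"
    by (simp add: algebra_simps powr_add)
  also have "\<dots> powr q = 2 powr (s * q) * besov_term p q s f k"
    using w by (simp add: besov_term_eq[OF f] powr_mult powr_powr)
  finally show "besov_integrand p q s f t \<le> 2 powr (s * q) * 2 * 2 ^ k * besov_term p q s f k"
    by (simp add: mult_ac)
  have "besov_term p q s f (Suc k) = (2 powr s * (2 powr (s * k) * ?w (1 / 2 ^ Suc k))) powr q"
    unfolding besov_term_eq[OF f] by (simp add: algebra_simps powr_add)
  also have "\<dots> = 2 powr (s * q) * (2 powr (s * k) * ?w (1 / 2 ^ Suc k)) powr q"
    using w by (simp add: powr_mult powr_powr)
  finally have "2 powr (- (s * q)) * 2 ^ k * besov_term p q s f (Suc k) = (2 powr (s * k) * ?w (1 / 2 ^ Suc k)) powr q * 2 ^ k"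
    by (simp add: powr_minus)
  also have "\<dots> \<le> (t powr (- s) * ?w t) powr q * (1 / t)"
    using q w inv lo t0 by (intro mult_mono powr_mono2) auto
  finally show "2 powr (- (s * q)) * 2 ^ k * besov_term p q s f (Suc k) \<le> besov_integrand p q s f t"
    by (simp add: besov_integrand_def)
qed

lemma besov_integrand_nonneg: "0 < t \<Longrightarrow> 0 \<le> besov_integrand p q s f t"
  by (simp add: besov_integrand_def)

text \<open>In the extended nonnegative reals both comparisons hold whether or not the quantities
  are finite; hence one yields integrability from summability and the other the converse.\<close>

lemma nn_integral_besov_integrand:
  fixes f :: "real^'d \<Rightarrow> real"
  assumes f: "f \<in> Lp_space p unit_cube"
  defines "J \<equiv> (\<integral>\<^sup>+t. ennreal (besov_integrand p q s f t) \<partial>lebesgue_on {0<..1})"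
  shows "J \<le> (\<Sum>k. ennreal (2 powr (s * q) * besov_term p q s f k))"
    "(\<Sum>k. ennreal (2 powr (- (s * q)) / 2 * besov_term p q s f (Suc k))) \<le> J"
proof -
  let ?S = "\<lambda>k. {1 / 2 ^ Suc k<..1 / 2 ^ k :: real}"
  let ?F = "\<lambda>t. ennreal (besov_integrand p q s f t)"
  have mF: "?F \<in> borel_measurable (lebesgue_on {0<..1})"
    using measurable_besov_integrand[OF f] by measurable
  have sub: "?S k \<subseteq> {0<..1}" for k unfolding UN_dyadic_shells[symmetric] by blast
  have sets: "?S k \<in> sets (lebesgue_on {0<..1})" for k
    using sub[of k] by (subst sets_restrict_space_iff) auto
  have em: "emeasure (lebesgue_on {0<..1}) (?S k) = ennreal (1 / 2 ^ Suc k)" for k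
  proof -
    have "emeasure (lebesgue_on {0<..1}) (?S k) = emeasure lborel (?S k)"
      using sub[of k] by (subst emeasure_restrict_space) (auto simp del: power_Suc)
    also have "\<dots> = ennreal (1 / 2 ^ k - 1 / 2 ^ Suc k)"
      by (intro emeasure_lborel_Ioc divide_left_mono) auto
    finally show ?thesis by (simp add: field_simps)
  qed
  have "J = (\<integral>\<^sup>+t\<in>(\<Union>k. ?S k). ?F t \<partial>lebesgue_on {0<..1})"
    unfolding J_def UN_dyadic_shells by (intro nn_integral_cong) auto
  also have "\<dots> = (\<Sum>k. \<integral>\<^sup>+t\<in>?S k. ?F t \<partial>lebesgue_on {0<..1})"
    by (intro nn_integral_disjoint_family mF sets disjoint_dyadic_shells)
  finally have J: "J = (\<Sum>k. \<integral>\<^sup>+t\<in>?S k. ?F t \<partial>lebesgue_on {0<..1})" .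
  show "J \<le> (\<Sum>k. ennreal (2 powr (s * q) * besov_term p q s f k))"
    unfolding J
  proof (intro suminf_le)
    fix k
    let ?c = "2 powr (s * q) * 2 * 2 ^ k * besov_term p q s f k"
    have "(\<integral>\<^sup>+t\<in>?S k. ?F t \<partial>lebesgue_on {0<..1}) \<le> (\<integral>\<^sup>+t. ennreal ?c * indicator (?S k) t \<partial>lebesgue_on {0<..1})"
      by (intro nn_integral_mono) (auto simp: indicator_def intro!: ennreal_leI besov_integrand_bounds(1)[OF f] simp del: power_Suc)
    also have "\<dots> = ennreal ?c * ennreal (1 / 2 ^ Suc k)"
      using sets[of k] em[of k] by (subst nn_integral_cmult_indicator) auto
    also have "\<dots> = ennreal (2 powr (s * q) * besov_term p q s f k)"
      by (subst ennreal_mult[symmetric]) auto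
    finally show "(\<integral>\<^sup>+t\<in>?S k. ?F t \<partial>lebesgue_on {0<..1}) \<le> ennreal (2 powr (s * q) * besov_term p q s f k)" .
  qed auto
  show "(\<Sum>k. ennreal (2 powr (- (s * q)) / 2 * besov_term p q s f (Suc k))) \<le> J"
    unfolding J
  proof (intro suminf_le)
    fix k
    let ?c = "2 powr (- (s * q)) * 2 ^ k * besov_term p q s f (Suc k)"
    have "ennreal (2 powr (- (s * q)) / 2 * besov_term p q s f (Suc k)) = ennreal ?c * ennreal (1 / 2 ^ Suc k)"
      by (subst ennreal_mult[symmetric]) auto
    also have "\<dots> = (\<integral>\<^sup>+t. ennreal ?c * indicator (?S k) t \<partial>lebesgue_on {0<..1})"
      using sets[of k] em[of k] by (subst nn_integral_cmult_indicator) auto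
    also have "\<dots> \<le> (\<integral>\<^sup>+t\<in>?S k. ?F t \<partial>lebesgue_on {0<..1})"
      by (intro nn_integral_mono) (auto simp: indicator_def intro!: ennreal_leI besov_integrand_bounds(2)[OF f] simp del: power_Suc)
    finally show "ennreal (2 powr (- (s * q)) / 2 * besov_term p q s f (Suc k)) \<le> (\<integral>\<^sup>+t\<in>?S k. ?F t \<partial>lebesgue_on {0<..1})" .
  qed auto
qed

lemma summable_imp_integrable_besov:
  fixes f :: "real^'d \<Rightarrow> real"
  assumes f: "f \<in> Lp_space p unit_cube" and sm: "summable (besov_term p q s f)"
  shows "integrable (lebesgue_on {0<..1}) (besov_integrand p q s f)"
    "(LINT t|lebesgue_on {0<..1}. besov_integrand p q s f t) \<le> 2 powr (s * q) * (\<Sum>k. besov_term p q s f k)"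
proof -
  have le: "(\<integral>\<^sup>+t. ennreal (besov_integrand p q s f t) \<partial>lebesgue_on {0<..1}) \<le>
      ennreal (2 powr (s * q) * (\<Sum>k. besov_term p q s f k))"
    using nn_integral_besov_integrand(1)[OF f] sm
    by (simp add: suminf_ennreal2 suminf_mult summable_mult)
  have nn: "AE t in lebesgue_on {0<..1}. 0 \<le> besov_integrand p q s f t"
    by (intro AE_I2) (auto intro: besov_integrand_nonneg)
  show int: "integrable (lebesgue_on {0<..1}) (besov_integrand p q s f)"
    using le measurable_besov_integrand[OF f] nn
    by (intro integrableI_nonneg) (auto intro: le_less_trans)
  have "ennreal (LINT t|lebesgue_on {0<..1}. besov_integrand p q s f t) \<le>
      ennreal (2 powr (s * q) * (\<Sum>k. besov_term p q s f k))"
    using le nn_integral_eq_integral[OF int nn] by simp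
  then show "(LINT t|lebesgue_on {0<..1}. besov_integrand p q s f t) \<le> 2 powr (s * q) * (\<Sum>k. besov_term p q s f k)"
    using sm by (subst (asm) ennreal_le_iff) (auto intro!: mult_nonneg_nonneg suminf_nonneg)
qed

lemma integrable_imp_summable_besov:
  fixes f :: "real^'d \<Rightarrow> real"
  assumes f: "f \<in> Lp_space p unit_cube"
    and int: "integrable (lebesgue_on {0<..1}) (besov_integrand p q s f)"
  shows "summable (besov_term p q s f)"
    "(\<Sum>k. besov_term p q s f (Suc k)) \<le> 2 * 2 powr (s * q) * (LINT t|lebesgue_on {0<..1}. besov_integrand p q s f t)"
proof -
  define I where "I = (LINT t|lebesgue_on {0<..1}. besov_integrand p q s f t)"
  define c where "c = 2 powr (- (s * q)) / 2"
  have c: "c > 0" by (simp add: c_def)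
  have nn: "AE t in lebesgue_on {0<..1}. 0 \<le> besov_integrand p q s f t"
    by (intro AE_I2) (auto intro: besov_integrand_nonneg)
  have le: "(\<Sum>k. ennreal (c * besov_term p q s f (Suc k))) \<le> ennreal I"
    using nn_integral_besov_integrand(2)[OF f] nn_integral_eq_integral[OF int nn] by (simp add: I_def c_def)
  have sm: "summable (\<lambda>k. c * besov_term p q s f (Suc k))"
    using le c by (intro summable_suminf_not_top) (auto simp: top_unique)
  then have sm': "summable (\<lambda>k. besov_term p q s f (Suc k))" using c by (simp add: summable_cmult_iff)
  then show "summable (besov_term p q s f)" by (simp add: summable_Suc_iff)
  have I0: "0 \<le> I" unfolding I_def by (rule integral_nonneg_AE[OF nn])
  have "ennreal (\<Sum>k. c * besov_term p q s f (Suc k)) \<le> ennreal I"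
    using le sm c by (subst (asm) suminf_ennreal2) auto
  then have "c * (\<Sum>k. besov_term p q s f (Suc k)) \<le> I"
    using I0 by (simp add: suminf_mult[OF sm'] ennreal_le_iff)
  then show "(\<Sum>k. besov_term p q s f (Suc k)) \<le> 2 * 2 powr (s * q) * I"
    by (simp add: c_def powr_minus field_simps)
qed

lemma besov_space_iff:
  "f \<in> besov_space p q s \<longleftrightarrow> f \<in> Lp_space p unit_cube \<and> summable (besov_term p q s f)"
  unfolding besov_space_def
  using summable_imp_integrable_besov(1) integrable_imp_summable_besov(1) by blast

lemma besov_pow_nonneg: "f \<in> besov_space p q s \<Longrightarrow> 0 \<le> besov_pow p q s f"
  by (auto simp: besov_pow_def besov_space_iff intro!: add_nonneg_nonneg suminf_nonneg)

lemma besov_norm_powr: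
  fixes f :: "real^'d \<Rightarrow> real"
  assumes f: "f \<in> besov_space p q s"
  shows "besov_norm p q s f powr q =
     Lp_pow p f powr (q / p) + (LINT t|lebesgue_on {0<..1}. besov_integrand p q s f t)"
proof -
  have "0 \<le> (LINT t|lebesgue_on {0<..1}. besov_integrand p q s f t)"
    by (intro integral_nonneg_AE AE_I2) (auto intro: besov_integrand_nonneg)
  then show ?thesis
    using q by (simp add: besov_norm_def Lp_norm_def Lp_pow_def powr_powr)
qed

text \<open>Justifies arguing with \<open>besov_pow\<close> alone: convergence in the quasi-norm and
  convergence of \<open>besov_pow\<close> to 0 are the same.\<close>

lemma besov_norm_equiv:
  "\<exists>C>0. \<forall>f \<in> besov_space p q s :: (real^'d \<Rightarrow> real) set.
     besov_norm p q s f powr q \<le> C * besov_pow p q s f \<and>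
     besov_pow p q s f \<le> C * besov_norm p q s f powr q"
proof -
  define C1 where "C1 = (2 * 2 powr p) powr (q / p)"
  define C where "C = 2 * 2 powr (s * q) + C1"
  have C: "C \<ge> 1 + C1" "C \<ge> 2 powr (s * q)" "C \<ge> 2 * 2 powr (s * q)" "C1 \<ge> 0" "C \<ge> 1"
  proof -
    have "C1 \<ge> 0" by (simp add: C1_def)
    moreover have "2 powr (s * q) \<ge> 1" using powr_mono[of 0 "s * q" 2] s q by auto
    ultimately show "C \<ge> 1 + C1" "C \<ge> 2 powr (s * q)" "C \<ge> 2 * 2 powr (s * q)" "C1 \<ge> 0" "C \<ge> 1"
      by (auto simp: C_def)
  qed
  have "besov_norm p q s f powr q \<le> C * besov_pow p q s f \<and>
     besov_pow p q s f \<le> C * besov_norm p q s f powr q"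
    if f: "f \<in> besov_space p q s" for f :: "real^'d \<Rightarrow> real"
  proof
    define I where "I = (LINT t|lebesgue_on {0<..1}. besov_integrand p q s f t)"
    define A where "A = Lp_pow p f powr (q / p)"
    have fL: "f \<in> Lp_space p unit_cube" and sm: "summable (besov_term p q s f)"
      using f besov_space_iff by blast+
    have int: "integrable (lebesgue_on {0<..1}) (besov_integrand p q s f)"
      using f by (simp add: besov_space_def)
    have I0: "0 \<le> I"
      unfolding I_def by (intro integral_nonneg_AE AE_I2) (auto intro: besov_integrand_nonneg)
    have S0: "0 \<le> (\<Sum>k. besov_term p q s f k)" by (intro suminf_nonneg sm) auto
    have A0: "0 \<le> A" by (simp add: A_def)
    have "I \<le> 2 powr (s * q) * (\<Sum>k. besov_term p q s f k)"
      unfolding I_def by (rule summable_imp_integrable_besov(2)[OF fL sm])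
    also have "\<dots> \<le> C * (\<Sum>k. besov_term p q s f k)"
      using C S0 by (intro mult_right_mono) auto
    finally show "besov_norm p q s f powr q \<le> C * besov_pow p q s f"
      unfolding besov_norm_powr[OF f] besov_pow_def A_def[symmetric] I_def[symmetric]
      using mult_right_mono[OF C(5) A0] by (simp add: algebra_simps)
    \<comment> \<open>The integral over (0, 1] controls only the terms from index 1 on; the term 0
      is paid for by the L_p part.\<close>
    have "besov_term p q s f 0 \<le> (2 * 2 powr p * Lp_pow p f) powr (q / p)"
      unfolding besov_term_def using p q smod_le_Lp_pow[OF p fL, of 0] by (intro powr_mono2) auto
    then have 0: "besov_term p q s f 0 \<le> C1 * A" by (simp add: powr_mult C1_def A_def)
    have "(\<Sum>k. besov_term p q s f k) = (\<Sum>k. besov_term p q s f (Suc k)) + besov_term p q s f 0"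
      using suminf_split_head[OF sm] by simp
    also have "\<dots> \<le> 2 * 2 powr (s * q) * I + C1 * A"
      using integrable_imp_summable_besov(2)[OF fL int] 0 by (simp add: I_def)
    also have "\<dots> \<le> C * I + C1 * A"
      using C I0 A0 by (intro add_mono mult_right_mono) auto
    finally show "besov_pow p q s f \<le> C * besov_norm p q s f powr q"
      unfolding besov_norm_powr[OF f] besov_pow_def A_def[symmetric] I_def[symmetric]
      using mult_right_mono[OF C(1) A0] by (simp only: distrib_left distrib_right)
  qed
  then show ?thesis using C by (intro exI[of _ C]) auto
qed

lemma besov_pow_add:
  "\<exists>K\<ge>1. \<forall>f \<in> besov_space p q s. \<forall>g \<in> besov_space p q s :: (real^'d \<Rightarrow> real) set.
     (\<lambda>x. f x + g x) \<in> besov_space p q s \<and>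
     besov_pow p q s (\<lambda>x. f x + g x) \<le> K * (besov_pow p q s f + besov_pow p q s g)"
proof -
  define r where "r = q / p"
  have r: "r > 0" using p q by (simp add: r_def)
  define K where "K = (2 powr p) powr r * 2 powr r"
  have K0: "K \<ge> 1" using p r by (simp add: K_def powr_powr powr_add[symmetric] ge_one_powr_ge_zero)
  have le: "z powr r \<le> K * (x powr r + y powr r)" if "0 \<le> z" "z \<le> 2 powr p * (x + y)" "0 \<le> x" "0 \<le> y" for x y z
  proof -
    have "z powr r \<le> (2 powr p * (x + y)) powr r" using that r by (intro powr_mono2) auto
    also have "\<dots> = (2 powr p) powr r * \<bar>x + y\<bar> powr r" using that by (simp add: powr_mult)
    also have "\<dots> \<le> (2 powr p) powr r * (2 powr r * (\<bar>x\<bar> powr r + \<bar>y\<bar> powr r))"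
      by (intro mult_left_mono powr_add_le r) auto
    finally show ?thesis using that by (simp add: K_def mult_ac)
  qed
  have "(\<lambda>x. f x + g x) \<in> besov_space p q s \<and>
     besov_pow p q s (\<lambda>x. f x + g x) \<le> K * (besov_pow p q s f + besov_pow p q s g)"
    if "f \<in> besov_space p q s" "g \<in> besov_space p q s" for f g :: "real^'d \<Rightarrow> real"
  proof -
    have f: "f \<in> Lp_space p unit_cube" "summable (besov_term p q s f)"
      and g: "g \<in> Lp_space p unit_cube" "summable (besov_term p q s g)"
      using that besov_space_iff by blast+
    note a = add_in_Lp_space[OF p f(1) g(1)]
    have t: "besov_term p q s (\<lambda>x. f x + g x) k \<le> K * (besov_term p q s f k + besov_term p q s g k)" for k
      unfolding besov_term_def r_def[symmetric]
    proof (rule le)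
      have "(2 powr (s * p)) ^ k * smod p k (\<lambda>x. f x + g x) \<le> (2 powr (s * p)) ^ k * (2 powr p * (smod p k f + smod p k g))"
        by (intro mult_left_mono a) auto
      then show "(2 powr (s * p)) ^ k * smod p k (\<lambda>x. f x + g x) \<le>
         2 powr p * ((2 powr (s * p)) ^ k * smod p k f + (2 powr (s * p)) ^ k * smod p k g)"
        by (simp add: algebra_simps)
    qed auto
    have sm: "summable (\<lambda>k. K * (besov_term p q s f k + besov_term p q s g k))"
      using f g by (intro summable_mult summable_add)
    have sm': "summable (besov_term p q s (\<lambda>x. f x + g x))"
      by (rule summable_comparison_test'[OF sm, of 0]) (use t in auto)
    have "(\<Sum>k. besov_term p q s (\<lambda>x. f x + g x) k) \<le> (\<Sum>k. K * (besov_term p q s f k + besov_term p q s g k))"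
      by (intro suminf_le t sm sm')
    also have "\<dots> = K * ((\<Sum>k. besov_term p q s f k) + (\<Sum>k. besov_term p q s g k))"
      using f g by (simp add: suminf_mult suminf_add summable_add)
    finally have "besov_pow p q s (\<lambda>x. f x + g x) \<le> K * (besov_pow p q s f + besov_pow p q s g)"
      using le[OF _ a(2)] unfolding besov_pow_def r_def[symmetric] by (simp add: algebra_simps)
    then show ?thesis using a(1) sm' besov_space_iff by blast
  qed
  then show ?thesis using K0 by (intro exI[of _ K]) auto
qed

lemma besov_pow_scale:
  fixes f :: "real^'d \<Rightarrow> real"
  assumes "f \<in> besov_space p q s"
  shows "(\<lambda>x. a * f x) \<in> besov_space p q s"
    "besov_pow p q s (\<lambda>x. a * f x) \<le> \<bar>a\<bar> powr q * besov_pow p q s f"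
proof -
  have f: "f \<in> Lp_space p unit_cube" "summable (besov_term p q s f)"
    using assms besov_space_iff by blast+
  note m = scale_in_Lp_space[OF p f(1)]
  have le: "z powr (q / p) \<le> \<bar>a\<bar> powr q * x powr (q / p)" if "0 \<le> z" "z \<le> \<bar>a\<bar> powr p * x" "0 \<le> x" for x z
  proof -
    have "z powr (q / p) \<le> (\<bar>a\<bar> powr p * x) powr (q / p)"
      using that p q by (intro powr_mono2) auto
    then show ?thesis using that p by (simp add: powr_mult powr_powr)
  qed
  have t: "besov_term p q s (\<lambda>x. a * f x) k \<le> \<bar>a\<bar> powr q * besov_term p q s f k" for k
    unfolding besov_term_def
  proof (rule le)
    have "(2 powr (s * p)) ^ k * smod p k (\<lambda>x. a * f x) \<le> (2 powr (s * p)) ^ k * (\<bar>a\<bar> powr p * smod p k f)"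
      by (intro mult_left_mono m) auto
    then show "(2 powr (s * p)) ^ k * smod p k (\<lambda>x. a * f x) \<le> \<bar>a\<bar> powr p * ((2 powr (s * p)) ^ k * smod p k f)"
      by (simp add: mult_ac)
  qed auto
  have sm: "summable (\<lambda>k. \<bar>a\<bar> powr q * besov_term p q s f k)" using f by (intro summable_mult)
  have sm': "summable (besov_term p q s (\<lambda>x. a * f x))"
    by (rule summable_comparison_test'[OF sm, of 0]) (use t in auto)
  then show "(\<lambda>x. a * f x) \<in> besov_space p q s" using m(1) besov_space_iff by blast
  have "(\<Sum>k. besov_term p q s (\<lambda>x. a * f x) k) \<le> \<bar>a\<bar> powr q * (\<Sum>k. besov_term p q s f k)"
    unfolding suminf_mult[OF f(2), symmetric] by (intro suminf_le t sm sm')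
  then show "besov_pow p q s (\<lambda>x. a * f x) \<le> \<bar>a\<bar> powr q * besov_pow p q s f"
    using le[of "Lp_pow p (\<lambda>x. a * f x)" "Lp_pow p f"] m(2) by (simp add: besov_pow_def algebra_simps)
qed

end

section \<open>Dyadic step functions\<close>

text \<open>Without the upper faces each point lies in exactly one cell of every level; the faces
  removed form a null set.\<close>

definition half_cube :: "(real^'d) set" where
  "half_cube = {x. \<forall>i. 0 \<le> x $ i \<and> x $ i < 1}"

definition cell :: "nat \<Rightarrow> real^'d \<Rightarrow> 'd \<Rightarrow> int" where
  "cell k x i = \<lfloor>2 ^ k * x $ i\<rfloor>"

definition grid :: "nat \<Rightarrow> ('d \<Rightarrow> int) set" where
  "grid k = {a. \<forall>i. 0 \<le> a i \<and> a i < 2 ^ k}"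

text \<open>The lower corner of a cell, used as its representative: a step function is recovered
  from its values at these points.\<close>

definition grid_point :: "nat \<Rightarrow> ('d \<Rightarrow> int) \<Rightarrow> real^'d" where
  "grid_point k a = (\<chi> i. real_of_int (a i) / 2 ^ k)"

text \<open>Nothing is said off \<open>half_cube\<close>, so the notion suits functions known only
  up to null sets, such as the Haar function of level 0, which also lives on the upper
  faces.\<close>

definition dyadic_step :: "nat \<Rightarrow> (real^'d \<Rightarrow> real) \<Rightarrow> bool" where
  "dyadic_step k u \<longleftrightarrow> (\<forall>x\<in>half_cube. \<forall>y\<in>half_cube. cell k x = cell k y \<longrightarrow> u x = u y)"

lemma dyadic_stepD:
  "dyadic_step k u \<Longrightarrow> x \<in> half_cube \<Longrightarrow> y \<in> half_cube \<Longrightarrow> cell k x = cell k y \<Longrightarrow> u x = u y"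
  unfolding dyadic_step_def by blast

lemma half_cube_sub: "half_cube \<subseteq> unit_cube"
proof
  fix x :: "real^'d" assume "x \<in> half_cube"
  then have "0 \<le> x $ i \<and> x $ i < 1" for i unfolding half_cube_def by blast
  then have "0 \<le> x $ i \<and> x $ i \<le> 1" for i using less_imp_le by blast
  then show "x \<in> unit_cube" unfolding unit_cube_iff by blast
qed

lemma half_cube_iff_cell: "x \<in> half_cube \<longleftrightarrow> cell k x \<in> grid k"
proof -
  have "0 \<le> z \<and> z < 1 \<longleftrightarrow> 0 \<le> \<lfloor>2 ^ k * z\<rfloor> \<and> \<lfloor>2 ^ k * z\<rfloor> < 2 ^ k" for z :: real
  proof -
    have "\<lfloor>2 ^ k * z\<rfloor> < 2 ^ k \<longleftrightarrow> z < 1"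
      using floor_less_iff[of "2 ^ k * z" "2 ^ k"] by simp
    moreover have "\<not> (2::real) ^ k \<le> 0" by (simp add: not_le)
    ultimately show ?thesis by (auto simp: zero_le_mult_iff)
  qed
  then show ?thesis by (auto simp: half_cube_def grid_def cell_def)
qed

lemma cell_grid_point [simp]: "cell k (grid_point k a) = a"
  by (auto simp: cell_def grid_point_def)

lemma grid_point_in: "a \<in> grid k \<Longrightarrow> grid_point k a \<in> half_cube"
  by (simp add: half_cube_iff_cell[of _ k])

lemma cell_in: "x \<in> half_cube \<Longrightarrow> cell k x \<in> grid k"
  by (simp add: half_cube_iff_cell[symmetric])

lemma grid_eq_PiE: "grid k = PiE UNIV (\<lambda>_. {0..<2 ^ k})"
  by (auto simp: grid_def PiE_def extensional_def Pi_def)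

lemma finite_grid [simp]: "finite (grid k :: ('d::finite \<Rightarrow> int) set)"
  unfolding grid_eq_PiE by (intro finite_PiE) auto

lemma card_grid: "card (grid k :: ('d::finite \<Rightarrow> int) set) = (2 ^ k) ^ CARD('d)"
  unfolding grid_eq_PiE by (subst card_PiE) (auto simp: nat_power_eq)

lemma cell_div:
  assumes "k \<le> j" shows "cell k x i = cell j x i div 2 ^ (j - k)"
proof -
  have "(2::real) ^ j = 2 ^ k * 2 ^ (j - k)" using assms by (simp flip: power_add)
  then have "2 ^ k * x $ i = (2 ^ j * x $ i) / real_of_int (2 ^ (j - k))" by simp
  then show ?thesis unfolding cell_def by (metis floor_divide_real_eq_div zero_le_numeral zero_le_power)
qed

lemma cell_mono: "k \<le> j \<Longrightarrow> cell j x = cell j y \<Longrightarrow> cell k x = cell k y"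
  by (auto simp: cell_div fun_eq_iff)

lemma dyadic_step_mono: "dyadic_step k u \<Longrightarrow> k \<le> j \<Longrightarrow> dyadic_step j u"
  unfolding dyadic_step_def using cell_mono by blast

lemma dyadic_step_const: "dyadic_step k (\<lambda>x. c)"
  by (simp add: dyadic_step_def)

lemma dyadic_step_diff: "dyadic_step k u \<Longrightarrow> dyadic_step k v \<Longrightarrow> dyadic_step k (\<lambda>x. u x - v x)"
  unfolding dyadic_step_def by (intro ballI impI arg_cong2[where f = "(-)"]) blast+

lemma dyadic_step_mult: "dyadic_step k u \<Longrightarrow> dyadic_step k v \<Longrightarrow> dyadic_step k (\<lambda>x. u x * v x)"
  unfolding dyadic_step_def by (intro ballI impI arg_cong2[where f = "(*)"]) blast+

lemma dyadic_step_cmult: "dyadic_step k u \<Longrightarrow> dyadic_step k (\<lambda>x. c * u x)"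
  by (intro dyadic_step_mult dyadic_step_const)

lemma dyadic_step_sum: "(\<And>j. j \<in> J \<Longrightarrow> dyadic_step k (u j)) \<Longrightarrow> dyadic_step k (\<lambda>x. \<Sum>j\<in>J. u j x)"
  unfolding dyadic_step_def by (intro ballI impI sum.cong refl) blast

lemma dyadic_step_cell: "dyadic_step k (\<lambda>x. F (cell k x))"
  by (auto simp: dyadic_step_def)

lemma dyadic_step_grid_point:
  "dyadic_step k u \<Longrightarrow> x \<in> half_cube \<Longrightarrow> u (grid_point k (cell k x)) = u x"
  by (erule dyadic_stepD) (auto intro: grid_point_in cell_in)

section \<open>Measures of cells and integrals of step functions\<close>

lemma measure_box_between:
  fixes a b :: "real^'d"
  assumes "box a b \<subseteq> S" "S \<subseteq> cbox a b" "\<And>i. a $ i \<le> b $ i"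
  shows "S \<in> lmeasurable" "measure lebesgue S = (\<Prod>i\<in>UNIV. b $ i - a $ i)"
proof -
  have n: "negligible (sym_diff (cbox a b) S)"
    by (rule negligible_subset[OF negligible_frontier_interval[of a b]]) (use assms in auto)
  show "S \<in> lmeasurable" by (rule lmeasurable_negligible_symdiff[OF _ n]) auto
  have "measure lebesgue S = measure lebesgue (cbox a b)"
    by (rule measure_negligible_symdiff[OF _ n]) auto
  also have "\<dots> = (\<Prod>i\<in>UNIV. b $ i - a $ i)"
    using assms by (subst measure_completion) (auto simp: content_cbox_cart interval_ne_empty_cart)
  finally show "measure lebesgue S = (\<Prod>i\<in>UNIV. b $ i - a $ i)" .
qed

lemma negligible_cube_boundary: "negligible (unit_cube - half_cube :: (real^'d) set)"
  unfolding unit_cube_def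
  by (rule negligible_subset[OF negligible_frontier_interval[of 0 1]])
    (auto simp: half_cube_def mem_box_cart intro: less_imp_le)

lemma cell_eq_iff: "cell k x = a \<longleftrightarrow> (\<forall>i. a i / 2 ^ k \<le> x $ i \<and> x $ i < (a i + 1) / 2 ^ k)"
proof -
  have "\<lfloor>2 ^ k * x $ i\<rfloor> = a i \<longleftrightarrow> a i / 2 ^ k \<le> x $ i \<and> x $ i < (a i + 1) / 2 ^ k" for i
    by (simp add: floor_eq_iff field_simps)
  then show ?thesis by (simp add: cell_def fun_eq_iff)
qed

lemma measure_cell:
  fixes y :: "real^'d"
  shows "{x. cell k (x + y) = a} \<in> lmeasurable" "measure lebesgue {x. cell k (x + y) = a} = 1 / (2 ^ k) ^ CARD('d)"
proof -
  define lo hi where "lo = grid_point k a - y" and "hi = lo + (\<chi> i. 1 / 2 ^ k)"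
  have 1: "box lo hi \<subseteq> {x. cell k (x + y) = a}" "{x. cell k (x + y) = a} \<subseteq> cbox lo hi"
    by (auto simp: cell_eq_iff lo_def hi_def mem_box_cart grid_point_def add_divide_distrib algebra_simps)
      (simp_all add: less_imp_le)
  have 2: "lo $ i \<le> hi $ i" for i by (simp add: hi_def)
  show "{x. cell k (x + y) = a} \<in> lmeasurable" "measure lebesgue {x. cell k (x + y) = a} = 1 / (2 ^ k) ^ CARD('d)"
    using measure_box_between[OF 1 2] by (auto simp: hi_def power_divide)
qed

lemma measure_cell0:
  "{x :: real^'d. cell k x = a} \<in> lmeasurable" "measure lebesgue {x :: real^'d. cell k x = a} = 1 / (2 ^ k) ^ CARD('d)"
  using measure_cell[of k 0 a] by auto

lemma cell_sub_cube: "a \<in> grid k \<Longrightarrow> {x. cell k x = a} \<subseteq> unit_cube"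
  using half_cube_sub by (auto simp: half_cube_iff_cell[of _ k])

lemma integral_indicator_on:
  fixes A S :: "(real^'d) set"
  assumes "A \<in> lmeasurable" "S \<in> sets lebesgue"
  shows "integrable (lebesgue_on S) (indicator A :: _ \<Rightarrow> real)"
    "(LINT x|lebesgue_on S. indicator A x) = measure lebesgue (S \<inter> A)"
proof -
  have i: "integrable lebesgue (indicator A :: _ \<Rightarrow> real)"
    using assms by (intro integrable_real_indicator) (auto simp: fmeasurable_def)
  show "integrable (lebesgue_on S) (indicator A :: _ \<Rightarrow> real)"
    using integrable_lebesgue_on_le(1)[OF i _ assms(2)] by simp
  have "(LINT x|lebesgue_on S. indicator A x) = (LINT x|lebesgue. indicator (S \<inter> A) x :: real)"
    using assms by (subst integral_restrict_space) (auto simp: indicator_inter_arith[symmetric])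
  then show "(LINT x|lebesgue_on S. indicator A x) = measure lebesgue (S \<inter> A)" by simp
qed

lemma AE_cube_half: "AE x in lebesgue_on unit_cube. x \<in> half_cube"
proof -
  have "AE x in lebesgue. x \<notin> unit_cube - half_cube"
    using negligible_cube_boundary by (intro AE_not_in) (simp add: negligible_iff_null_sets)
  then show ?thesis by (subst AE_restrict_space_iff) auto
qed

lemma AE_shifted_half: "AE x in lebesgue_on (shifted_cube y). x \<in> half_cube \<and> x + y \<in> half_cube"
proof -
  have "negligible ((+) (- y) ` (unit_cube - half_cube))"
    by (rule negligible_translation[OF negligible_cube_boundary])
  then have 1: "AE x in lebesgue. x \<notin> (+) (- y) ` (unit_cube - half_cube)"
    by (intro AE_not_in) (simp add: negligible_iff_null_sets)
  have 2: "AE x in lebesgue. x \<notin> unit_cube - half_cube"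
    using negligible_cube_boundary by (intro AE_not_in) (simp add: negligible_iff_null_sets)
  have "AE x in lebesgue. x \<in> shifted_cube y \<longrightarrow> x \<in> half_cube \<and> x + y \<in> half_cube"
    using 1 2
  proof eventually_elim
    case (elim x)
    have "x + y \<notin> unit_cube - half_cube"
      using elim(1) imageI[of "x + y" "unit_cube - half_cube" "(+) (- y)"] by auto
    then show ?case using elim(2) by (auto simp: shifted_cube_def)
  qed
  then show ?thesis by (subst AE_restrict_space_iff) auto
qed

lemma sum_grid_indicator:
  assumes "x \<in> half_cube"
  shows "(\<Sum>a\<in>grid k. F a * indicator {x. cell k x = a} x) = (F (cell k x) :: real)"
proof -
  have "(\<Sum>a\<in>grid k. F a * indicator {x. cell k x = a} x) = (\<Sum>a\<in>grid k. if a = cell k x then F a else 0)"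
    by (intro sum.cong) (auto simp: indicator_def)
  then show ?thesis using cell_in[OF assms] by (simp add: sum.delta')
qed

text \<open>On the boundary of the cube the function is arbitrary, so measurability comes from
  almost everywhere equality with a combination of cell indicators and the completeness of Lebesgue
  measure. The integral is the sum over the corners divided by the number of cells.\<close>

lemma dyadic_step_Lp:
  fixes u :: "real^'d \<Rightarrow> real"
  assumes u: "dyadic_step k u"
  shows "u \<in> Lp_space p unit_cube"
    "Lp_pow p u = (\<Sum>a\<in>grid k. \<bar>u (grid_point k a)\<bar> powr p) / (2 ^ k) ^ CARD('d)"
proof -
  define v where "v F x = (\<Sum>a\<in>grid k. F a * indicator {x. cell k x = a} x :: real)" for F and x :: "real^'d"
  have v: "integrable (lebesgue_on unit_cube) (v F)" for F
    unfolding v_def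
    by (intro Bochner_Integration.integrable_sum integrable_mult_right integral_indicator_on measure_cell0) auto
  have F: "AE x in lebesgue_on unit_cube. F (u x) = v (\<lambda>a. F (u (grid_point k a))) x" for F :: "real \<Rightarrow> real"
    using AE_cube_half
  proof eventually_elim
    case (elim x)
    show ?case
      unfolding v_def sum_grid_indicator[OF elim] by (simp add: dyadic_step_grid_point[OF u elim])
  qed
  have meas: "(\<lambda>x. F (u x)) \<in> borel_measurable (lebesgue_on unit_cube)" for F :: "real \<Rightarrow> real"
  proof -
    let ?v = "v (\<lambda>a. F (u (grid_point k a)))"
    have "(\<lambda>x. if x \<in> unit_cube then ?v x else 0) \<in> borel_measurable lebesgue"
      using v[of "\<lambda>a. F (u (grid_point k a))"] by (subst borel_measurable_if) auto
    moreover have "AE x in lebesgue. (if x \<in> unit_cube then ?v x else 0) = (if x \<in> unit_cube then F (u x) else 0)"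
      using F[of F] by (subst (asm) AE_restrict_space_iff) auto
    ultimately have "(\<lambda>x. if x \<in> unit_cube then F (u x) else 0) \<in> borel_measurable lebesgue"
      by (rule borel_measurable_AE)
    then show ?thesis by (subst (asm) borel_measurable_if) auto
  qed
  have F': "AE x in lebesgue_on unit_cube. v (\<lambda>a. \<bar>u (grid_point k a)\<bar> powr p) x = \<bar>u x\<bar> powr p"
    using F[of "\<lambda>z. \<bar>z\<bar> powr p"] by eventually_elim auto
  have "integrable (lebesgue_on unit_cube) (\<lambda>x. \<bar>u x\<bar> powr p)"
    by (rule integrable_cong_AE_imp[OF v meas F'])
  then show "u \<in> Lp_space p unit_cube"
    using meas[of "\<lambda>z. z"] by (simp add: Lp_space_def)
  have "Lp_pow p u = (LINT x|lebesgue_on unit_cube. v (\<lambda>a. \<bar>u (grid_point k a)\<bar> powr p) x)"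
    unfolding Lp_pow_def using F' v by (intro integral_cong_AE meas) auto
  also have "\<dots> = (\<Sum>a\<in>grid k. LINT x|lebesgue_on unit_cube.
      \<bar>u (grid_point k a)\<bar> powr p * indicator {x. cell k x = a} x)"
    unfolding v_def
    by (intro Bochner_Integration.integral_sum integrable_mult_right integral_indicator_on measure_cell0) auto
  also have "\<dots> = (\<Sum>a\<in>grid k. \<bar>u (grid_point k a)\<bar> powr p * measure lebesgue (unit_cube \<inter> {x :: real^'d. cell k x = a}))"
    unfolding integral_mult_right_zero integral_indicator_on(2)[OF measure_cell0(1) unit_cube_sets] ..
  also have "\<dots> = (\<Sum>a\<in>grid k. \<bar>u (grid_point k a)\<bar> powr p * (1 / (2 ^ k) ^ CARD('d)))"
    by (intro sum.cong refl) (simp add: Int_absorb1[OF cell_sub_cube] measure_cell0)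
  finally show "Lp_pow p u = (\<Sum>a\<in>grid k. \<bar>u (grid_point k a)\<bar> powr p) / (2 ^ k) ^ CARD('d)"
    by (simp add: sum_divide_distrib)
qed

text \<open>A point leaving its cell under the shift violates the cell condition in some coordinate
  i, so it lies in a slab of thickness |y_i| along one face; there are d such slabs.\<close>

lemma measure_leave_cell:
  fixes y :: "real^'d" and a :: "'d \<Rightarrow> int" and k :: nat
  defines "E \<equiv> {x. cell k x = a \<and> cell k (x + y) \<noteq> a}"
  shows "E \<in> lmeasurable" "measure lebesgue E \<le> real CARD('d) * (2 ^ k * norm y) / (2 ^ k) ^ CARD('d)"
proof -
  have "E = {x. cell k x = a} - {x. cell k (x + y) = a}" by (auto simp: E_def)
  then show Em: "E \<in> lmeasurable" using measure_cell0 measure_cell by (metis fmeasurable.Diff)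
  \<comment> \<open>The slab lies at the upper face in direction i when y_i is nonnegative and at
    the lower face otherwise.\<close>
  define lo hi where "lo i = (\<chi> j. if j = i then (if 0 \<le> y $ i then (a i + 1) / 2 ^ k - y $ i else a i / 2 ^ k) else a j / 2 ^ k)"
    and "hi i = lo i + (\<chi> j. if j = i then \<bar>y $ i\<bar> else 1 / 2 ^ k)" for i
  have "E \<subseteq> (\<Union>i. cbox (lo i) (hi i))"
  proof
    fix x assume "x \<in> E"
    then have x: "\<And>j. a j / 2 ^ k \<le> x $ j \<and> x $ j < (a j + 1) / 2 ^ k"
      and "\<exists>i. \<not> (a i / 2 ^ k \<le> x $ i + y $ i \<and> x $ i + y $ i < (a i + 1) / 2 ^ k)"
      by (auto simp: E_def cell_eq_iff)
    then obtain i where i: "\<not> (a i / 2 ^ k \<le> x $ i + y $ i \<and> x $ i + y $ i < (a i + 1) / 2 ^ k)" by blast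
    have "x \<in> cbox (lo i) (hi i)"
      unfolding mem_box_cart
    proof
      fix j show "lo i $ j \<le> x $ j \<and> x $ j \<le> hi i $ j"
        using x[of j] i by (cases "j = i") (auto simp: lo_def hi_def add_divide_distrib)
    qed
    then show "x \<in> (\<Union>i. cbox (lo i) (hi i))" by blast
  qed
  then have "measure lebesgue E \<le> measure lebesgue (\<Union>i. cbox (lo i) (hi i))"
    using Em by (intro measure_mono_fmeasurable) (auto intro!: fmeasurable.finite_UN)
  also have "\<dots> \<le> (\<Sum>i\<in>UNIV. measure lebesgue (cbox (lo i) (hi i)))"
    by (intro measure_UNION_le) auto
  also have "\<dots> \<le> (\<Sum>i\<in>(UNIV::'d set). (2 ^ k * norm y) / (2 ^ k) ^ CARD('d))"
  proof (rule sum_mono)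
    fix i :: 'd
    have "measure lebesgue (cbox (lo i) (hi i)) = (\<Prod>j\<in>UNIV. hi i $ j - lo i $ j)"
      by (rule measure_box_between(2)) (auto simp: hi_def box_subset_cbox)
    also have "\<dots> = (\<Prod>j\<in>UNIV. (1 / 2 ^ k) * (if j = i then 2 ^ k * \<bar>y $ i\<bar> else 1))"
      by (intro prod.cong) (auto simp: hi_def)
    also have "\<dots> = (1 / 2 ^ k) ^ CARD('d) * (2 ^ k * \<bar>y $ i\<bar>)"
      unfolding prod.distrib by simp
    also have "\<dots> \<le> (1 / 2 ^ k) ^ CARD('d) * (2 ^ k * norm y)"
      by (intro mult_left_mono component_le_norm_cart) auto
    finally show "measure lebesgue (cbox (lo i) (hi i)) \<le> (2 ^ k * norm y) / (2 ^ k) ^ CARD('d)"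
      by (simp add: power_divide)
  qed
  finally show "measure lebesgue E \<le> real CARD('d) * (2 ^ k * norm y) / (2 ^ k) ^ CARD('d)" by simp
qed

text \<open>The difference vanishes unless x and x + y lie in different cells; otherwise it is
  charged to the values on these two cells, each with the measure of the points that leave
  it.\<close>

lemma shift_pow_dyadic_step_le:
  fixes u :: "real^'d \<Rightarrow> real"
  assumes p: "0 < p" and u: "dyadic_step k u"
  shows "shift_pow p y u \<le> 2 * 2 powr p * real CARD('d) * (2 ^ k * norm y) * Lp_pow p u"
proof -
  define w where "w a = \<bar>u (grid_point k a)\<bar> powr p" for a
  define E where "E y a = {x. cell k x = a \<and> cell k (x + y) \<noteq> a}" for y :: "real^'d" and a
  let ?m = "real CARD('d) * (2 ^ k * norm y) / (2 ^ k) ^ CARD('d)"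
  have E: "E y' a \<in> lmeasurable" "measure lebesgue (E y' a) \<le> real CARD('d) * (2 ^ k * norm y') / (2 ^ k) ^ CARD('d)" for y' a
    using measure_leave_cell[of k a y'] by (auto simp: E_def)
  \<comment> \<open>The flag distinguishes the cell left at x from the cell reached at x + y; the
    latter is regarded as being left under the shift - y.\<close>
  define J where "J = (UNIV :: bool set) \<times> (grid k :: ('d \<Rightarrow> int) set)"
  define g where "g j x = (if fst j then indicator (E y (snd j)) x else indicator (E (- y) (snd j)) (x + y) :: real)"
    for j and x :: "real^'d"
  have ind: "integrable lebesgue (indicator (E y' a) :: _ \<Rightarrow> real)" for y' a
    using E(1)[of y' a] by (intro integrable_real_indicator) (auto simp: fmeasurable_def)
  note sh = integral_shift_lebesgue[OF ind[where y' = "- y"], where y = y]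
  have g: "integrable (lebesgue_on (shifted_cube y)) (g j)"
    "(LINT x|lebesgue_on (shifted_cube y). g j x) \<le> ?m" for j
  proof -
    have "integrable lebesgue (g j)" "(LINT x|lebesgue. g j x) \<le> ?m"
      using sh ind E(2)[of y "snd j"] E(2)[of "- y" "snd j"]
      by (cases "fst j"; auto simp: g_def[abs_def])+
    moreover have "0 \<le> g j x" for x by (simp add: g_def)
    ultimately show "integrable (lebesgue_on (shifted_cube y)) (g j)"
      "(LINT x|lebesgue_on (shifted_cube y). g j x) \<le> ?m"
      using integrable_lebesgue_on_le[of "g j" "shifted_cube y"] by (blast intro: shifted_cube_sets order_trans)+
  qed
  have nonneg: "0 \<le> g j x" "0 \<le> w a" for j x a by (auto simp: g_def w_def)
  have AE: "AE x in lebesgue_on (shifted_cube y). \<bar>\<bar>u (x + y) - u x\<bar> powr p\<bar> \<le> (\<Sum>j\<in>J. (2 powr p * w (snd j)) * g j x)"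
    using AE_shifted_half
  proof eventually_elim
    case (elim x)
    have ux: "\<bar>u x\<bar> powr p = w (cell k x)" "\<bar>u (x + y)\<bar> powr p = w (cell k (x + y))"
      using elim by (simp_all add: w_def dyadic_step_grid_point[OF u])
    show ?case
    proof (cases "cell k x = cell k (x + y)")
      case True
      then have "u (x + y) = u x" using elim by (intro dyadic_stepD[OF u]) auto
      then show ?thesis by (simp add: sum_nonneg nonneg)
    next
      case False
      have "\<bar>u (x + y) - u x\<bar> powr p \<le> 2 powr p * (w (cell k (x + y)) + w (cell k x))"
        using powr_add_le[OF p, of "u (x + y)" "- u x"] ux by simp
      also have "\<dots> = (\<Sum>j\<in>{(True, cell k x), (False, cell k (x + y))}. (2 powr p * w (snd j)) * g j x)"
        using False by (simp add: g_def E_def algebra_simps)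
      also have "\<dots> \<le> (\<Sum>j\<in>J. (2 powr p * w (snd j)) * g j x)"
        using elim by (intro sum_mono2 mult_nonneg_nonneg) (auto simp: J_def cell_in nonneg)
      finally show ?thesis by simp
    qed
  qed
  have "shift_pow p y u \<le> (\<Sum>j\<in>J. (2 powr p * w (snd j)) * (LINT x|lebesgue_on (shifted_cube y). g j x))"
    unfolding shift_pow_def using integrable_shift_pow(1)[OF p dyadic_step_Lp(1)[OF u]]
    by (intro integral_dominated_sum(2) g AE) auto
  also have "\<dots> \<le> (\<Sum>j\<in>J. (2 powr p * w (snd j)) * ?m)"
    by (intro sum_mono mult_left_mono g) (auto simp: nonneg)
  also have "\<dots> = 2 powr p * ?m * (\<Sum>j\<in>J. w (snd j))"
    by (simp add: sum_distrib_left sum_divide_distrib mult_ac)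
  also have "(\<Sum>j\<in>J. w (snd j)) = 2 * (\<Sum>a\<in>grid k. w a)"
  proof -
    have "(\<Sum>j\<in>J. w (snd j)) = (\<Sum>b\<in>(UNIV :: bool set). \<Sum>a\<in>grid k. w a)"
      unfolding J_def by (subst sum.cartesian_product) (simp add: case_prod_beta')
    then show ?thesis by (simp add: UNIV_bool)
  qed
  also have "(\<Sum>a\<in>grid k. w a) = Lp_pow p u * (2 ^ k) ^ CARD('d)"
    unfolding dyadic_step_Lp(2)[OF u] w_def by simp
  finally show ?thesis by (simp add: mult_ac)
qed

text \<open>The linear decay 2^(k - n) at scales finer than the level is what confines s to s < 1/p;
  at coarser scales only the trivial bound by the L_p part is available.\<close>

lemma smod_dyadic_step_le:
  fixes u :: "real^'d \<Rightarrow> real"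
  assumes p: "0 < p" and u: "dyadic_step k u"
  shows "smod p n u \<le> 2 * 2 powr p * real CARD('d) * min 1 (2 ^ k / 2 ^ n) * Lp_pow p u"
proof -
  note L = dyadic_step_Lp(1)[OF u, of p]
  have "smod p n u \<le> 2 * 2 powr p * real CARD('d) * (2 ^ k / 2 ^ n) * Lp_pow p u"
  proof (rule smod_le[OF p L])
    fix y :: "real^'d" assume y: "norm y \<le> 1 / 2 ^ n"
    have "shift_pow p y u \<le> 2 * 2 powr p * real CARD('d) * (2 ^ k * norm y) * Lp_pow p u"
      by (rule shift_pow_dyadic_step_le[OF p u])
    also have "\<dots> \<le> 2 * 2 powr p * real CARD('d) * (2 ^ k * (1 / 2 ^ n)) * Lp_pow p u"
      by (intro mult_right_mono mult_left_mono y) auto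
    finally show "shift_pow p y u \<le> 2 * 2 powr p * real CARD('d) * (2 ^ k / 2 ^ n) * Lp_pow p u" by simp
  qed
  moreover have "smod p n u \<le> 2 * 2 powr p * real CARD('d) * 1 * Lp_pow p u"
  proof -
    have "smod p n u \<le> 2 * 2 powr p * 1 * Lp_pow p u" using smod_le_Lp_pow[OF p L] by simp
    also have "\<dots> \<le> 2 * 2 powr p * real CARD('d) * Lp_pow p u"
      by (intro mult_right_mono mult_left_mono) (auto simp: Suc_leI)
    finally show ?thesis by simp
  qed
  ultimately show ?thesis by (simp add: min_def)
qed

section \<open>Approximation by dyadic step functions\<close>

text \<open>A shift by a grid vector maps cells of level n onto cells, so on the cells that stay
  inside the cube the integrand is constant and the integral becomes a finite sum of
  differences.\<close>

lemma shift_pow_grid_le: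
  fixes g :: "real^'d \<Rightarrow> real" and b :: "'d \<Rightarrow> int"
  assumes p: "0 < p" and g: "dyadic_step n g"
  defines "G \<equiv> {a \<in> grid n. (\<lambda>i. a i + b i) \<in> grid n}"
  shows "(\<Sum>a\<in>G. \<bar>g (grid_point n (\<lambda>i. a i + b i)) - g (grid_point n a)\<bar> powr p) / (2 ^ n) ^ CARD('d)
    \<le> shift_pow p (grid_point n b) g"
proof -
  define y :: "real^'d" where "y = grid_point n b"
  define w where "w a = \<bar>g (grid_point n (\<lambda>i. a i + b i)) - g (grid_point n a)\<bar> powr p" for a
  define F where "F x = (\<Sum>a\<in>G. w a * indicator {x. cell n x = a} x)" for x :: "real^'d"
  have cy: "cell n (x + y) = (\<lambda>i. cell n x i + b i)" for x
    by (simp add: cell_def y_def grid_point_def fun_eq_iff distrib_left)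
  have finG: "finite G" by (simp add: G_def)
  have sub: "{x. cell n x = a} \<subseteq> shifted_cube y" if "a \<in> G" for a
    using that half_cube_sub by (auto simp: G_def shifted_cube_def half_cube_iff_cell[of _ n] cy)
  have i: "integrable (lebesgue_on (shifted_cube y)) (\<lambda>x. w a * indicator {x. cell n x = a} x)" for a
    by (intro integrable_mult_right integral_indicator_on measure_cell0) auto
  have "(LINT x|lebesgue_on (shifted_cube y). F x) =
      (\<Sum>a\<in>G. LINT x|lebesgue_on (shifted_cube y). w a * indicator {x. cell n x = a} x)"
    unfolding F_def by (intro Bochner_Integration.integral_sum i)
  also have "\<dots> = (\<Sum>a\<in>G. w a * measure lebesgue (shifted_cube y \<inter> {x. cell n x = a}))"
    unfolding integral_mult_right_zero integral_indicator_on(2)[OF measure_cell0(1) shifted_cube_sets] ..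
  also have "\<dots> = (\<Sum>a\<in>G. w a * (1 / (2 ^ n) ^ CARD('d)))"
    by (intro sum.cong refl) (simp add: Int_absorb1[OF sub] measure_cell0)
  finally have "(\<Sum>a\<in>G. w a) / (2 ^ n) ^ CARD('d) = (LINT x|lebesgue_on (shifted_cube y). F x)"
    by (simp add: sum_divide_distrib)
  also have "\<dots> \<le> shift_pow p y g"
    unfolding shift_pow_def
  proof (intro integral_mono)
    show "integrable (lebesgue_on (shifted_cube y)) F"
      unfolding F_def by (intro Bochner_Integration.integrable_sum i)
    show "integrable (lebesgue_on (shifted_cube y)) (\<lambda>x. \<bar>g (x + y) - g x\<bar> powr p)"
      by (rule integrable_shift_pow(1)[OF p dyadic_step_Lp(1)[OF g]])
    fix x
    have "F x = (\<Sum>a\<in>G. if a = cell n x then w a else 0)"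
      unfolding F_def by (intro sum.cong) (auto simp: indicator_def)
    then have F: "F x = (if cell n x \<in> G then w (cell n x) else 0)"
      using finG by (simp add: sum.delta')
    show "F x \<le> \<bar>g (x + y) - g x\<bar> powr p"
    proof (cases "cell n x \<in> G")
      case True
      then have x: "x \<in> half_cube" "x + y \<in> half_cube"
        by (auto simp: G_def half_cube_iff_cell[of _ n] cy)
      have "w (cell n x) = \<bar>g (x + y) - g x\<bar> powr p"
        unfolding w_def using dyadic_step_grid_point[OF g x(1)] dyadic_step_grid_point[OF g x(2)] by (simp add: cy)
      then show ?thesis using F by simp
    qed (simp add: F)
  qed
  finally show ?thesis by (simp add: w_def y_def)
qed

text \<open>Of the functions that are constant on each coarse cell with the value of \<open>g\<close> at a fixed offset in
  that cell, at least one does as well as the average over all offsets.\<close>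

lemma dyadic_step_approx:
  fixes g :: "real^'d \<Rightarrow> real"
  assumes p: "0 < p" and g: "dyadic_step n g" and "k \<le> n" and "0 \<le> B"
    and B: "\<And>b. (\<And>i. \<bar>b i\<bar> < 2 ^ (n - k)) \<Longrightarrow> b \<noteq> (\<lambda>_. 0) \<Longrightarrow> shift_pow p (grid_point n b) g \<le> B"
  shows "\<exists>u. dyadic_step k u \<and> Lp_pow p (\<lambda>x. g x - u x) \<le> 2 ^ CARD('d) * B"
proof -
  define N :: int where "N = 2 ^ (n - k)"
  have N: "N > 0" by (simp add: N_def)
  define E where "E = (grid (n - k) :: ('d \<Rightarrow> int) set)"
  define V where "V = (2 ^ n :: real) ^ CARD('d)"
  have V: "V > 0" by (simp add: V_def)
  define u where "u e x = g (grid_point n (\<lambda>i. N * cell k x i + e i))" for e and x :: "real^'d"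
  define H where "H a a' = \<bar>g (grid_point n a') - g (grid_point n a)\<bar> powr p" for a a'
  define par where "par a i = N * (a i div N)" for a and i :: 'd
  \<comment> \<open>Differences of two offsets inside a coarse cell have entries of absolute value
    below N. There are at most 2^d times as many such differences as offsets, which is the origin of
    the factor 2^d.\<close>
  define Bs where "Bs = {b :: 'd \<Rightarrow> int. \<forall>i. - N < b i \<and> b i < N}"
  have Bs: "Bs = PiE UNIV (\<lambda>_. {-N<..<N})" by (auto simp: Bs_def PiE_def extensional_def Pi_def)
  have finBs: "finite Bs" unfolding Bs by (intro finite_PiE) auto
  have cardBs: "real (card Bs) \<le> 2 ^ CARD('d) * real (card E)"
  proof -
    have "card Bs = nat (2 * N - 1) ^ CARD('d)" unfolding Bs by (subst card_PiE) auto
    also have "\<dots> \<le> (2 * 2 ^ (n - k)) ^ CARD('d)"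
      by (intro power_mono) (auto simp: N_def nat_le_iff)
    finally have "real (card Bs) \<le> real ((2 * 2 ^ (n - k)) ^ CARD('d))" by (simp only: of_nat_le_iff)
    then show ?thesis by (simp add: E_def card_grid power_mult_distrib)
  qed
  have step: "dyadic_step k (u e)" for e
    unfolding u_def by (rule dyadic_step_cell)
  have A: "Lp_pow p (\<lambda>x. g x - u e x) = (\<Sum>a\<in>grid n. H a (\<lambda>i. par a i + e i)) / V" for e
  proof -
    have 1: "dyadic_step n (\<lambda>x. g x - u e x)"
      by (intro dyadic_step_diff g dyadic_step_mono[OF step \<open>k \<le> n\<close>])
    have "cell k (grid_point n a) i = a i div N" for a :: "'d \<Rightarrow> int" and i
      using cell_div[OF \<open>k \<le> n\<close>, of "grid_point n a" i] by (simp add: N_def)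
    then show ?thesis
      unfolding dyadic_step_Lp(2)[OF 1] by (simp add: V_def H_def u_def par_def abs_minus_commute)
  qed
  have inner: "(\<Sum>e\<in>E. H a (\<lambda>i. par a i + e i)) \<le> (\<Sum>b\<in>{b \<in> Bs. (\<lambda>i. a i + b i) \<in> grid n}. H a (\<lambda>i. a i + b i))"
    if a: "a \<in> grid n" for a
  proof -
    \<comment> \<open>For a fixed fine cell a, offsets e are exchanged for displacements from a.
      This is injective, so the sum over e is part of the sum over all displacements.\<close>
    define T where "T e = (\<lambda>i. par a i + e i - a i)" for e :: "'d \<Rightarrow> int"
    have inj: "inj_on T E" by (auto simp: T_def inj_on_def fun_eq_iff)
    have "(\<Sum>e\<in>E. H a (\<lambda>i. par a i + e i)) = (\<Sum>b\<in>T ` E. H a (\<lambda>i. a i + b i))"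
      by (subst sum.reindex[OF inj]) (simp add: T_def o_def)
    also have "\<dots> \<le> (\<Sum>b\<in>{b \<in> Bs. (\<lambda>i. a i + b i) \<in> grid n}. H a (\<lambda>i. a i + b i))"
    proof (intro sum_mono2)
      show "T ` E \<subseteq> {b \<in> Bs. (\<lambda>i. a i + b i) \<in> grid n}"
      proof safe
        fix e assume e: "e \<in> E"
        have e': "0 \<le> e i" "e i < N" for i using e by (auto simp: E_def grid_def N_def)
        have par: "par a i = a i - a i mod N" for i by (simp add: par_def minus_mod_eq_mult_div)
        have m: "0 \<le> a i mod N" "a i mod N < N" for i using N by auto
        have "- N < e i - a i mod N \<and> e i - a i mod N < N" for i using e'[of i] m[of i] by linarith
        then show "T e \<in> Bs" by (auto simp: Bs_def T_def par)
        have "0 \<le> par a i + e i \<and> par a i + e i < 2 ^ n" for i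
        proof
          have ai: "0 \<le> a i" "a i < 2 ^ n" using a by (auto simp: grid_def)
          show "0 \<le> par a i + e i" using ai N e' by (simp add: par_def pos_imp_zdiv_nonneg_iff)
          have nk: "(2 :: int) ^ n = N * 2 ^ k" using \<open>k \<le> n\<close> by (simp add: N_def flip: power_add)
          have "a i div N < 2 ^ k"
          proof (rule ccontr)
            assume "\<not> ?thesis"
            then have "N * 2 ^ k \<le> N * (a i div N)" using N by (intro mult_left_mono) auto
            also have "\<dots> \<le> a i" using m(1)[of i] by (simp add: minus_mod_eq_mult_div[symmetric])
            finally show False using ai unfolding nk by simp
          qed
          then have "par a i \<le> N * (2 ^ k - 1)" unfolding par_def using N by (intro mult_left_mono) auto
          then show "par a i + e i < 2 ^ n" unfolding nk using e'[of i] by (simp add: algebra_simps)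
        qed
        then show "(\<lambda>i. a i + T e i) \<in> grid n" by (simp add: T_def grid_def)
      qed
    qed (use finBs in \<open>auto simp: H_def\<close>)
    finally show ?thesis .
  qed
  have "(\<Sum>e\<in>E. Lp_pow p (\<lambda>x. g x - u e x)) = (\<Sum>a\<in>grid n. \<Sum>e\<in>E. H a (\<lambda>i. par a i + e i)) / V"
    unfolding A by (subst sum.swap) (simp add: sum_divide_distrib)
  also have "\<dots> \<le> (\<Sum>a\<in>grid n. \<Sum>b\<in>{b \<in> Bs. (\<lambda>i. a i + b i) \<in> grid n}. H a (\<lambda>i. a i + b i)) / V"
    using V by (intro divide_right_mono sum_mono inner) auto
  \<comment> \<open>With the sums exchanged, each displacement b contributes one difference of g
    along a single grid shift, bounded by B.\<close>
  also have "\<dots> = (\<Sum>b\<in>Bs. \<Sum>a\<in>{a \<in> grid n. (\<lambda>i. a i + b i) \<in> grid n}. H a (\<lambda>i. a i + b i)) / V"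
    using finBs by (subst sum.swap_restrict) auto
  also have "\<dots> \<le> (\<Sum>b\<in>Bs. B)"
    unfolding sum_divide_distrib[of _ Bs]
  proof (rule sum_mono)
    fix b assume b: "b \<in> Bs"
    show "(\<Sum>a\<in>{a \<in> grid n. (\<lambda>i. a i + b i) \<in> grid n}. H a (\<lambda>i. a i + b i)) / V \<le> B"
    proof (cases "b = (\<lambda>_. 0)")
      case True
      then show ?thesis using \<open>0 \<le> B\<close> by (simp add: H_def)
    next
      case False
      have "(\<Sum>a\<in>{a \<in> grid n. (\<lambda>i. a i + b i) \<in> grid n}. H a (\<lambda>i. a i + b i)) / V \<le> shift_pow p (grid_point n b) g"
        unfolding H_def V_def by (rule shift_pow_grid_le[OF p g])
      also have "\<dots> \<le> B"
      proof (rule B[OF _ False])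
        fix i
        have "- N < b i \<and> b i < N" using b by (simp add: Bs_def)
        then show "\<bar>b i\<bar> < 2 ^ (n - k)" unfolding N_def by linarith
      qed
      finally show ?thesis .
    qed
  qed
  also have "\<dots> = real (card Bs) * B" by simp
  also have "\<dots> \<le> 2 ^ CARD('d) * real (card E) * B"
    by (intro mult_right_mono cardBs \<open>0 \<le> B\<close>)
  finally have le: "(\<Sum>e\<in>E. Lp_pow p (\<lambda>x. g x - u e x)) \<le> (\<Sum>e\<in>E. 2 ^ CARD('d) * B)" by (simp add: mult_ac)
  \<comment> \<open>If every offset exceeded the bound, so would the sum over all offsets.\<close>
  have "\<exists>e\<in>E. Lp_pow p (\<lambda>x. g x - u e x) \<le> 2 ^ CARD('d) * B"
  proof (rule ccontr)
    assume "\<not> ?thesis"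
    moreover have "(\<lambda>_. 0) \<in> E" by (simp add: E_def grid_def)
    ultimately have "(\<Sum>e\<in>E. 2 ^ CARD('d) * B) < (\<Sum>e\<in>E. Lp_pow p (\<lambda>x. g x - u e x))"
      by (intro sum_strict_mono) (auto simp: E_def not_le)
    with le show False by simp
  qed
  then show ?thesis using step by blast
qed

section \<open>Density of step functions in L_p\<close>

lemma Lp_pow_dominated_tendsto_0:
  fixes f :: "nat \<Rightarrow> real^'d \<Rightarrow> real"
  assumes p: "0 < p" and m: "\<And>n. f n \<in> borel_measurable (lebesgue_on unit_cube)"
    and w: "integrable (lebesgue_on unit_cube) w"
    and lim: "AE x in lebesgue_on unit_cube. (\<lambda>n. f n x) \<longlonglongrightarrow> 0"
    and le: "\<And>n x. \<bar>f n x\<bar> powr p \<le> w x"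
  shows "(\<lambda>n. Lp_pow p (f n)) \<longlonglongrightarrow> 0"
proof -
  have "(\<lambda>n. LINT x|lebesgue_on unit_cube. \<bar>f n x\<bar> powr p) \<longlonglongrightarrow> (LINT x|lebesgue_on (unit_cube :: (real^'d) set). 0)"
  proof (rule integral_dominated_convergence[where w = w])
    show "AE x in lebesgue_on unit_cube. (\<lambda>n. \<bar>f n x\<bar> powr p) \<longlonglongrightarrow> 0"
      using lim
    proof eventually_elim
      case (elim x)
      then have "(\<lambda>n. \<bar>f n x\<bar>) \<longlonglongrightarrow> 0" by (rule tendsto_rabs_zero)
      then show ?case using p by (intro tendsto_zero_powrI[where b = p]) auto
    qed
    show "(\<lambda>x. \<bar>f n x\<bar> powr p) \<in> borel_measurable (lebesgue_on unit_cube)" for n using m[of n] by measurable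
    show "AE x in lebesgue_on unit_cube. norm (\<bar>f n x\<bar> powr p) \<le> w x" for n
      using le by (intro AE_I2) auto
  qed (use w in auto)
  then show ?thesis by (simp add: Lp_pow_def)
qed

lemma integrable_const_cube: "integrable (lebesgue_on (unit_cube :: (real^'d) set)) (\<lambda>x. c :: real)"
proof -
  interpret finite_measure "lebesgue_on (unit_cube :: (real^'d) set)"
    by (rule finite_measure_lebesgue_on) (simp add: unit_cube_def)
  show ?thesis by simp
qed

lemma bounded_in_Lp_space:
  fixes f :: "real^'d \<Rightarrow> real"
  assumes p: "0 < p" and m: "f \<in> borel_measurable (lebesgue_on unit_cube)" and "\<And>x. \<bar>f x\<bar> \<le> M"
  shows "f \<in> Lp_space p unit_cube"
proof -
  have "integrable (lebesgue_on unit_cube) (\<lambda>x. \<bar>f x\<bar> powr p)"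
  proof (rule Bochner_Integration.integrable_bound[OF integrable_const_cube[of "M powr p"]])
    show "(\<lambda>x. \<bar>f x\<bar> powr p) \<in> borel_measurable (lebesgue_on unit_cube)" using m by measurable
    show "AE x in lebesgue_on unit_cube. norm (\<bar>f x\<bar> powr p) \<le> norm (M powr p)"
      using assms by (intro AE_I2) (auto intro!: powr_mono2)
  qed
  then show ?thesis using m by (simp add: Lp_space_def)
qed

lemma grid_point_cell_tendsto: "(\<lambda>m. grid_point m (cell m x)) \<longlonglongrightarrow> (x :: real^'d)"
proof (rule vec_tendstoI)
  fix i
  have "(\<lambda>m. grid_point m (cell m x) $ i - x $ i) \<longlonglongrightarrow> 0"
  proof (rule Lim_null_comparison)
    show "\<forall>\<^sub>F m in sequentially. norm (grid_point m (cell m x) $ i - x $ i) \<le> (1 / 2) ^ m"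
    proof (intro always_eventually allI)
      fix m
      have "\<bar>real_of_int \<lfloor>2 ^ m * x $ i\<rfloor> - 2 ^ m * x $ i\<bar> \<le> 1" by linarith
      then have "\<bar>real_of_int \<lfloor>2 ^ m * x $ i\<rfloor> - 2 ^ m * x $ i\<bar> / 2 ^ m \<le> 1 / 2 ^ m" by (intro divide_right_mono) auto
      also have "\<bar>real_of_int \<lfloor>2 ^ m * x $ i\<rfloor> - 2 ^ m * x $ i\<bar> / 2 ^ m = \<bar>real_of_int \<lfloor>2 ^ m * x $ i\<rfloor> / 2 ^ m - x $ i\<bar>"
      proof -
        have "real_of_int \<lfloor>2 ^ m * x $ i\<rfloor> / 2 ^ m - x $ i = (real_of_int \<lfloor>2 ^ m * x $ i\<rfloor> - 2 ^ m * x $ i) / 2 ^ m"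
          by (simp add: diff_divide_distrib)
        then show ?thesis by (simp add: abs_divide)
      qed
      finally show "norm (grid_point m (cell m x) $ i - x $ i) \<le> (1 / 2) ^ m"
        by (simp add: grid_point_def cell_def power_divide)
    qed
  qed (auto intro: LIMSEQ_power_zero)
  then show "(\<lambda>m. grid_point m (cell m x) $ i) \<longlonglongrightarrow> x $ i" by (simp add: LIM_zero_iff)
qed

text \<open>Three applications of dominated convergence: f is truncated at height T, the truncation
  is replaced by a truncated continuous function, and that function is sampled at the corners of
  fine cells. Truncating throughout supplies the constant majorant in the last two.\<close>

lemma dyadic_step_dense:
  fixes f :: "real^'d \<Rightarrow> real"
  assumes p: "0 < p" and f: "f \<in> Lp_space p unit_cube" and \<epsilon>: "0 < \<epsilon>"
  shows "\<exists>n u. dyadic_step n u \<and> Lp_pow p (\<lambda>x. f x - u x) < \<epsilon>"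
proof -
  define c where "c T z = max (- real T) (min (real T) z)" for T z
  have c: "\<bar>c T z\<bar> \<le> real T" "\<bar>z - c T z\<bar> \<le> \<bar>z\<bar>" for T z by (auto simp: c_def)
  have cc: "continuous_on UNIV (c T)" for T unfolding c_def by (intro continuous_intros)
  have c2: "\<bar>c T z - c T z'\<bar> powr p \<le> (2 * real T) powr p" for T z z'
    using p c(1)[of T z] c(1)[of T z'] by (intro powr_mono2) auto
  note mf = Lp_spaceD(1)[OF f]
  have mc: "(\<lambda>x. c T (f x)) \<in> borel_measurable (lebesgue_on unit_cube)" for T
    unfolding c_def using mf by measurable
  \<comment> \<open>Solves the two nested quasi-triangle inequalities at the end, where the total
    error is \<delta> (2^p (1 + 2 * 2^p)).\<close>
  define \<delta> where "\<delta> = \<epsilon> / (2 powr p * (1 + 2 powr p * 2))"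
  have \<delta>: "\<delta> > 0" using \<epsilon> by (simp add: \<delta>_def add_pos_pos)
  have "(\<lambda>T. Lp_pow p (\<lambda>x. f x - c T (f x))) \<longlonglongrightarrow> 0"
  proof (rule Lp_pow_dominated_tendsto_0[OF p _ Lp_spaceD(2)[OF f]])
    show "(\<lambda>x. f x - c T (f x)) \<in> borel_measurable (lebesgue_on unit_cube)" for T using mf mc by measurable
    show "\<bar>f x - c T (f x)\<bar> powr p \<le> \<bar>f x\<bar> powr p" for T x using c(2) p by (intro powr_mono2) auto
    show "AE x in lebesgue_on unit_cube. (\<lambda>T. f x - c T (f x)) \<longlonglongrightarrow> 0"
    proof (intro AE_I2 tendsto_eventually)
      fix x
      obtain T0 :: nat where "\<bar>f x\<bar> \<le> real T0" using real_arch_simple by blast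
      then have "f x - c T (f x) = 0" if "T \<ge> T0" for T using that by (auto simp: c_def)
      then show "\<forall>\<^sub>F T in sequentially. f x - c T (f x) = 0" by (auto simp: eventually_sequentially)
    qed
  qed
  then have "\<forall>\<^sub>F T in sequentially. Lp_pow p (\<lambda>x. f x - c T (f x)) < \<delta>" using \<delta> by (rule order_tendstoD(2))
  then obtain T where T: "Lp_pow p (\<lambda>x. f x - c T (f x)) < \<delta>" by (auto simp: eventually_sequentially)
  \<comment> \<open>This form of measurability provides continuous functions converging to f outside
    a negligible set.\<close>
  have "f measurable_on unit_cube" using mf by (subst measurable_on_iff_borel_measurable) auto
  then obtain N g where N: "negligible N" and g: "\<And>n. continuous_on UNIV (g n)"
    and lim: "\<And>x. x \<notin> N \<Longrightarrow> (\<lambda>n. g n x) \<longlonglongrightarrow> (if x \<in> unit_cube then f x else 0)"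
    unfolding measurable_on_def by blast
  have cg: "continuous_on UNIV (\<lambda>x. c T (g n x))" for n
    by (rule continuous_on_compose2[OF cc g]) auto
  have mg: "(\<lambda>x. c T (g n x)) \<in> borel_measurable (lebesgue_on unit_cube)" for n
    by (rule continuous_imp_measurable_on_sets_lebesgue[OF continuous_on_subset[OF cg]]) auto
  have "(\<lambda>n. Lp_pow p (\<lambda>x. c T (f x) - c T (g n x))) \<longlonglongrightarrow> 0"
  proof (rule Lp_pow_dominated_tendsto_0[OF p _ integrable_const_cube])
    show "\<bar>c T (f x) - c T (g n x)\<bar> powr p \<le> (2 * real T) powr p" for n x by (rule c2)
    show "(\<lambda>x. c T (f x) - c T (g n x)) \<in> borel_measurable (lebesgue_on unit_cube)" for n using mc mg by measurable
    have "AE x in lebesgue. x \<notin> N" using N by (intro AE_not_in) (simp add: negligible_iff_null_sets)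
    then have "AE x in lebesgue. x \<in> unit_cube \<longrightarrow> (\<lambda>n. c T (f x) - c T (g n x)) \<longlonglongrightarrow> 0"
    proof eventually_elim
      case (elim x)
      show ?case
      proof
        assume "x \<in> unit_cube"
        then have "(\<lambda>n. g n x) \<longlonglongrightarrow> f x" using lim[OF elim] by simp
        then have "(\<lambda>n. c T (g n x)) \<longlonglongrightarrow> c T (f x)"
          by (rule continuous_on_tendsto_compose[OF cc]) auto
        then have "(\<lambda>n. c T (f x) - c T (g n x)) \<longlonglongrightarrow> c T (f x) - c T (f x)" by (intro tendsto_diff tendsto_const)
        then show "(\<lambda>n. c T (f x) - c T (g n x)) \<longlonglongrightarrow> 0" by simp
      qed
    qed
    then show "AE x in lebesgue_on unit_cube. (\<lambda>n. c T (f x) - c T (g n x)) \<longlonglongrightarrow> 0"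
      by (subst AE_restrict_space_iff) auto
  qed
  then have "\<forall>\<^sub>F n in sequentially. Lp_pow p (\<lambda>x. c T (f x) - c T (g n x)) < \<delta>" using \<delta> by (rule order_tendstoD(2))
  then obtain n where n: "Lp_pow p (\<lambda>x. c T (f x) - c T (g n x)) < \<delta>" by (auto simp: eventually_sequentially)
  define G where "G x = c T (g n x)" for x
  define u where "u m x = G (grid_point m (cell m x))" for m and x
  have u: "dyadic_step m (u m)" for m unfolding u_def by (rule dyadic_step_cell)
  have "(\<lambda>m. Lp_pow p (\<lambda>x. G x - u m x)) \<longlonglongrightarrow> 0"
  proof (rule Lp_pow_dominated_tendsto_0[OF p _ integrable_const_cube])
    show "(\<lambda>x. G x - u m x) \<in> borel_measurable (lebesgue_on unit_cube)" for m
    proof -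
      have "G \<in> borel_measurable (lebesgue_on unit_cube)" unfolding G_def by (rule mg)
      moreover have "u m \<in> borel_measurable (lebesgue_on unit_cube)"
        by (rule Lp_spaceD(1)[OF dyadic_step_Lp(1)[OF u]])
      ultimately show ?thesis by measurable
    qed
    show "\<bar>G x - u m x\<bar> powr p \<le> (2 * real T) powr p" for m x unfolding G_def u_def by (rule c2)
    show "AE x in lebesgue_on unit_cube. (\<lambda>m. G x - u m x) \<longlonglongrightarrow> 0"
    proof (intro AE_I2)
      fix x
      have "(\<lambda>m. u m x) \<longlonglongrightarrow> G x" unfolding u_def G_def
        by (rule continuous_on_tendsto_compose[OF cg grid_point_cell_tendsto]) auto
      then have "(\<lambda>m. G x - u m x) \<longlonglongrightarrow> G x - G x" by (intro tendsto_diff tendsto_const)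
      then show "(\<lambda>m. G x - u m x) \<longlonglongrightarrow> 0" by simp
    qed
  qed
  then have "\<forall>\<^sub>F m in sequentially. Lp_pow p (\<lambda>x. G x - u m x) < \<delta>" using \<delta> by (rule order_tendstoD(2))
  then obtain m where m: "Lp_pow p (\<lambda>x. G x - u m x) < \<delta>" by (auto simp: eventually_sequentially)
  have cf: "(\<lambda>x. c T (f x)) \<in> Lp_space p unit_cube" by (rule bounded_in_Lp_space[OF p mc c(1)])
  have G: "G \<in> Lp_space p unit_cube"
    unfolding G_def by (rule bounded_in_Lp_space[OF p mg c(1)])
  note um = dyadic_step_Lp(1)[OF u[of m], of p]
  have "Lp_pow p (\<lambda>x. c T (f x) - u m x) = Lp_pow p (\<lambda>x. (c T (f x) - G x) + (G x - u m x))" by simp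
  also have "\<dots> \<le> 2 powr p * (Lp_pow p (\<lambda>x. c T (f x) - G x) + Lp_pow p (\<lambda>x. G x - u m x))"
    by (intro add_in_Lp_space(2) p diff_in_Lp_space(1) cf G um)
  also have "\<dots> \<le> 2 powr p * (\<delta> + \<delta>)"
    using n m by (intro mult_left_mono add_mono) (auto simp: G_def)
  finally have 1: "Lp_pow p (\<lambda>x. c T (f x) - u m x) \<le> 2 powr p * (\<delta> + \<delta>)" .
  have "Lp_pow p (\<lambda>x. f x - u m x) = Lp_pow p (\<lambda>x. (f x - c T (f x)) + (c T (f x) - u m x))" by simp
  also have "\<dots> \<le> 2 powr p * (Lp_pow p (\<lambda>x. f x - c T (f x)) + Lp_pow p (\<lambda>x. c T (f x) - u m x))"
    by (intro add_in_Lp_space(2) p diff_in_Lp_space(1) cf f um)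
  also have "\<dots> < 2 powr p * (\<delta> + 2 powr p * (\<delta> + \<delta>))"
    using T 1 by (intro mult_strict_left_mono add_less_le_mono) auto
  also have "\<dots> = \<delta> * (2 powr p * (1 + 2 powr p * 2))" by (simp add: algebra_simps)
  also have "\<dots> = \<epsilon>"
    unfolding \<delta>_def by (rule nonzero_eq_divide_eq[THEN iffD1, OF _ refl]) (simp add: add_nonneg_eq_0_iff)
  finally show ?thesis using u by blast
qed

text \<open>The offset averaging works on step functions, so f is replaced by a fine step function
  within \<epsilon>; this is why the approximant depends on \<epsilon>. The shift m0 in the level
  absorbs the diameter of a cell.\<close>

lemma jackson:
  assumes p: "0 < p"
  shows "\<exists>C>0. \<exists>m0. \<forall>f \<in> Lp_space p unit_cube :: (real^'d \<Rightarrow> real) set. \<forall>k\<ge>m0. \<forall>\<epsilon>>0. \<exists>u.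
    dyadic_step k u \<and> Lp_pow p (\<lambda>x. f x - u x) \<le> C * (smod p (k - m0) f + \<epsilon>)"
proof -
  \<comment> \<open>A displacement inside a cell of level k has norm at most d / 2^k, and d \<le>
    2^m0.\<close>
  define m0 where "m0 = CARD('d)"
  have m0: "real CARD('d) \<le> 2 ^ m0" unfolding m0_def using less_exp[of "CARD('d)"]
    by (metis less_imp_le of_nat_le_iff of_nat_numeral of_nat_power)
  define P where "P = 2 powr p"
  have P: "P > 0" by (simp add: P_def)
  define D where "D = (2 :: real) ^ CARD('d)"
  have D: "D > 0" by (simp add: D_def)
  define C where "C = P * (1 + D * P * (1 + 2 * P))"
  have C: "C > 0" using P D by (simp add: C_def add_pos_pos)
  have "\<exists>u. dyadic_step k u \<and> Lp_pow p (\<lambda>x. f x - u x) \<le> C * (smod p (k - m0) f + \<epsilon>)"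
    if f: "f \<in> Lp_space p unit_cube" and k: "k \<ge> m0" and \<epsilon>: "\<epsilon> > 0" for f :: "real^'d \<Rightarrow> real" and k \<epsilon>
  proof -
    obtain n0 g where g0: "dyadic_step n0 g" and fg: "Lp_pow p (\<lambda>x. f x - g x) < \<epsilon>"
      using dyadic_step_dense[OF p f \<epsilon>] by blast
    define n where "n = max n0 k"
    have g: "dyadic_step n g" "k \<le> n" using dyadic_step_mono[OF g0] by (auto simp: n_def)
    note gL = dyadic_step_Lp(1)[OF g(1), of p]
    note fgL = diff_in_Lp_space(1)[OF p f gL]
    have "\<exists>u. dyadic_step k u \<and> Lp_pow p (\<lambda>x. g x - u x) \<le> 2 ^ CARD('d) * smod p (k - m0) g"
    proof (rule dyadic_step_approx[OF p g])
      fix b :: "'d \<Rightarrow> int" assume b: "\<And>i. \<bar>b i\<bar> < 2 ^ (n - k)" "b \<noteq> (\<lambda>_. 0)"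
      have "norm (grid_point n b :: real^'d) \<le> (\<Sum>i\<in>UNIV. \<bar>grid_point n b $ i\<bar>)" by (rule norm_le_l1_cart)
      also have "\<dots> \<le> (\<Sum>i\<in>(UNIV :: 'd set). 1 / 2 ^ k)"
      proof (rule sum_mono)
        fix i
        have "real_of_int \<bar>b i\<bar> \<le> real_of_int (2 ^ (n - k))" using b(1)[of i] by (intro of_int_le_iff[THEN iffD2]) simp
        then have "\<bar>real_of_int (b i)\<bar> / 2 ^ n \<le> 2 ^ (n - k) / 2 ^ n" by (intro divide_right_mono) auto
        also have "(2::real) ^ (n - k) / 2 ^ n = 1 / 2 ^ k" using g(2) by (simp add: power_diff)
        finally show "\<bar>grid_point n b $ i\<bar> \<le> 1 / 2 ^ k" by (simp add: grid_point_def)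
      qed
      also have "\<dots> = real CARD('d) / 2 ^ k" by simp
      also have "\<dots> \<le> 2 ^ m0 / 2 ^ k" using m0 by (intro divide_right_mono) auto
      also have "\<dots> = 1 / 2 ^ (k - m0)" using k by (simp add: power_diff)
      finally have le: "norm (grid_point n b :: real^'d) \<le> 1 / 2 ^ (k - m0)" .
      obtain i where "b i \<noteq> 0" using b(2) by auto
      then have "grid_point n b $ i \<noteq> 0" by (simp add: grid_point_def)
      then have "(grid_point n b :: real^'d) \<noteq> 0" by (metis zero_index)
      then show "shift_pow p (grid_point n b) g \<le> smod p (k - m0) g"
        using le by (intro shift_pow_le_smod[OF p gL]) auto
    qed simp
    then obtain u where u: "dyadic_step k u" "Lp_pow p (\<lambda>x. g x - u x) \<le> D * smod p (k - m0) g"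
      unfolding D_def by blast
    have "smod p (k - m0) g = smod p (k - m0) (\<lambda>x. f x - (f x - g x))" by simp
    also have "\<dots> \<le> P * (smod p (k - m0) f + smod p (k - m0) (\<lambda>x. f x - g x))"
      unfolding P_def by (rule diff_in_Lp_space(3)[OF p f fgL])
    also have "\<dots> \<le> P * (smod p (k - m0) f + 2 * P * \<epsilon>)"
    proof (intro mult_left_mono add_left_mono)
      have "smod p (k - m0) (\<lambda>x. f x - g x) \<le> 2 * P * Lp_pow p (\<lambda>x. f x - g x)"
        unfolding P_def by (rule smod_le_Lp_pow[OF p fgL])
      also have "\<dots> \<le> 2 * P * \<epsilon>" using fg P by (intro mult_left_mono) auto
      finally show "smod p (k - m0) (\<lambda>x. f x - g x) \<le> 2 * P * \<epsilon>" .
    qed (use P in auto)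
    finally have g': "smod p (k - m0) g \<le> P * (smod p (k - m0) f + 2 * P * \<epsilon>)" .
    have "Lp_pow p (\<lambda>x. f x - u x) = Lp_pow p (\<lambda>x. (f x - g x) + (g x - u x))" by simp
    also have "\<dots> \<le> P * (Lp_pow p (\<lambda>x. f x - g x) + Lp_pow p (\<lambda>x. g x - u x))"
      unfolding P_def by (intro add_in_Lp_space(2)[OF p fgL] diff_in_Lp_space(1)[OF p gL] dyadic_step_Lp(1)[OF u(1)])
    also have "\<dots> \<le> P * (\<epsilon> + D * (P * (smod p (k - m0) f + 2 * P * \<epsilon>)))"
      using fg order_trans[OF u(2) mult_left_mono[OF g', of D]] P D by (intro mult_left_mono add_mono) auto
    also have "\<dots> \<le> C * (smod p (k - m0) f + \<epsilon>)"
    proof -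
      define W where "W = smod p (k - m0) f"
      have W: "0 \<le> W" by (simp add: W_def)
      have "C * (W + \<epsilon>) - P * (\<epsilon> + D * (P * (W + 2 * P * \<epsilon>))) = P * W + 2 * P * P * P * D * W + P * P * D * \<epsilon>"
        unfolding C_def by (simp add: algebra_simps)
      also have "\<dots> \<ge> 0" using P D W \<epsilon> by simp
      finally show ?thesis by (simp add: W_def)
    qed
    finally show ?thesis using u(1) by blast
  qed
  then show ?thesis using C by blast
qed

section \<open>Besov quasi-norms in terms of dyadic approximation\<close>

locale besov_params =
  fixes p q s :: real
  assumes p: "0 < p" and q: "0 < q" and s: "0 < s" and sp: "s < 1 / p"
begin

definition \<rho> :: real where "\<rho> = 2 powr (s * p)"

definition r :: real where "r = q / p"

lemma r: "0 < r"
  using p q by (simp add: r_def)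

lemma \<rho>: "1 < \<rho>" "\<rho> < 2"
proof -
  have "0 < s * p" "s * p < 1" using p s sp by (auto simp: field_simps)
  then show "1 < \<rho>" "\<rho> < 2"
    using powr_less_mono[of 0 "s * p" 2] powr_less_mono[of "s * p" 1 2] by (auto simp: \<rho>_def)
qed

lemma besov_term_alt: "besov_term p q s f k = (\<rho> ^ k * smod p k f) powr r"
  by (simp add: besov_term_def \<rho>_def r_def)

lemma besov_pow_alt: "besov_pow p q s f = Lp_pow p f powr r + (\<Sum>k. (\<rho> ^ k * smod p k f) powr r)"
  by (simp add: besov_pow_def besov_term_alt r_def)

lemma besov_space_alt:
  "f \<in> besov_space p q s \<longleftrightarrow> f \<in> Lp_space p unit_cube \<and> summable (\<lambda>k. (\<rho> ^ k * smod p k f) powr r)"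
  using besov_space_iff[OF p q s] by (simp add: besov_term_alt[abs_def])

lemma Lp_of_besov: "f \<in> besov_space p q s \<Longrightarrow> f \<in> Lp_space p unit_cube"
  by (simp add: besov_space_alt)

lemma Lp_pow_le_besov:
  fixes f :: "real^'d \<Rightarrow> real"
  assumes "f \<in> besov_space p q s"
  shows "Lp_pow p f powr r \<le> besov_pow p q s f"
  using assms unfolding besov_pow_alt besov_space_alt by (auto intro!: suminf_nonneg)

text \<open>At scale k the term \<open>v j\<close> contributes, after weighting, a factor
  (\<rho>/2)^(k - j) for j \<le> k and (1/\<rho>)^(j - k) for j > k. Both ratios are below 1, so the
  discrete Hardy inequality sums the contributions.\<close>

theorem besov_series_upper:
  "\<exists>C>0. \<forall>(f :: real^'d \<Rightarrow> real) v. f \<in> Lp_space p unit_cube \<longrightarrow> (\<forall>j. dyadic_step j (v j)) \<longrightarrow>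
     summable (\<lambda>j. (\<rho> ^ j * Lp_pow p (v j)) powr r) \<longrightarrow>
     (\<lambda>n. Lp_pow p (\<lambda>x. f x - (\<Sum>j<n. v j x))) \<longlonglongrightarrow> 0 \<longrightarrow>
     f \<in> besov_space p q s \<and> besov_pow p q s f \<le> C * (\<Sum>j. (\<rho> ^ j * Lp_pow p (v j)) powr r)"
proof -
  \<comment> \<open>The weights \<tau> > 1 of the quasi-triangle inequality must fit below both
    2/\<rho> and \<rho>; there is room because 1 < \<rho> < 2.\<close>
  define m where "m = min (2 / \<rho>) \<rho>"
  have m: "1 < m" "m \<le> 2 / \<rho>" "m \<le> \<rho>" using \<rho> by (auto simp: m_def)
  define \<tau> where "\<tau> = (1 + m) / 2"
  have \<tau>: "1 < \<tau>" "\<tau> < 2 / \<rho>" "\<tau> < \<rho>" using m by (auto simp: \<tau>_def)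
  define \<theta> where "\<theta> = max (\<rho> * \<tau> / 2) (\<tau> / \<rho>)"
  have \<theta>: "0 \<le> \<theta>" "\<theta> < 1" "\<rho> * \<tau> / 2 \<le> \<theta>" "\<tau> / \<rho> \<le> \<theta>"
    using \<tau> \<rho> by (auto simp: \<theta>_def field_simps max_def)
  obtain K where K: "K > 0" "\<And>J k (a :: nat \<Rightarrow> real). finite J \<Longrightarrow>
    \<bar>\<Sum>j\<in>J. a j\<bar> powr p \<le> K * (\<Sum>j\<in>J. \<tau> ^ ndist j k * \<bar>a j\<bar> powr p)"
    using weighted_power_sum[OF p \<tau>(1)] by blast
  obtain H where H: "H > 0" "\<And>b x :: nat \<Rightarrow> real. (\<forall>j. 0 \<le> b j) \<Longrightarrow> summable (\<lambda>j. b j powr r) \<Longrightarrow> (\<forall>k. 0 \<le> x k) \<Longrightarrow>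
     (\<forall>k. \<forall>e>0. \<exists>J. finite J \<and> x k \<le> (\<Sum>j\<in>J. \<theta> ^ ndist j k * b j) + e) \<Longrightarrow>
     summable (\<lambda>k. x k powr r) \<and> (\<Sum>k. x k powr r) \<le> H * (\<Sum>j. b j powr r)"
    using discrete_hardy[OF r \<theta>(1,2)] by blast
  define B where "B = 2 * 2 powr p * real CARD('d)"
  have B: "B \<ge> 1"
  proof -
    have "1 \<le> (2::real) powr p" using p by (simp add: ge_one_powr_ge_zero)
    moreover have "1 \<le> real CARD('d)" by (simp add: Suc_leI)
    ultimately have "1 * 1 \<le> 2 powr p * real CARD('d)" by (intro mult_mono) auto
    then show ?thesis by (simp add: B_def)
  qed
  define M where "M = 2 powr p * (B * (1 + K))"
  have M: "M > 0" using B K by (simp add: M_def)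
  define C where "C = 2 * (M powr r * H)"
  have "f \<in> besov_space p q s \<and> besov_pow p q s f \<le> C * (\<Sum>j. (\<rho> ^ j * Lp_pow p (v j)) powr r)"
    if f: "f \<in> Lp_space p unit_cube" and v: "\<And>j. dyadic_step j (v j)"
      and sm: "summable (\<lambda>j. (\<rho> ^ j * Lp_pow p (v j)) powr r)"
      and lim: "(\<lambda>n. Lp_pow p (\<lambda>x. f x - (\<Sum>j<n. v j x))) \<longlonglongrightarrow> 0" for f :: "real^'d \<Rightarrow> real" and v
  proof -
    define b where "b j = \<rho> ^ j * Lp_pow p (v j)" for j
    have b: "0 \<le> b j" for j using \<rho> by (simp add: b_def)
    define u where "u n x = (\<Sum>j<n. v j x)" for n x
    define R where "R n = Lp_pow p (\<lambda>x. f x - u n x)" for n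
    have R0: "0 \<le> R n" for n by (simp add: R_def)
    have Rlim: "R \<longlonglongrightarrow> 0" using lim by (simp add: R_def[abs_def] u_def)
    note vL = dyadic_step_Lp(1)[OF v, of _ p]
    have K': "\<bar>\<Sum>j\<in>J. a j\<bar> powr p \<le> (\<Sum>j\<in>J. K * \<tau> ^ ndist j k * \<bar>a j\<bar> powr p)"
      if "finite J" for J k and a :: "nat \<Rightarrow> real"
      using K(2)[OF that, of a k] by (simp add: sum_distrib_left mult.assoc)
    have uL: "u n \<in> Lp_space p unit_cube" for n
      unfolding u_def by (rule sum_in_Lp_space(1)[OF p vL finite_lessThan K'[of _ _ 0]]) auto
    have rL: "(\<lambda>x. f x - u n x) \<in> Lp_space p unit_cube" for n by (rule diff_in_Lp_space(1)[OF p f uL])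
    have split: "f = (\<lambda>x. (f x - u n x) + u n x)" for n by simp
    have key: "(if j \<le> k then (\<rho> * \<tau> / 2) ^ (k - j) else (\<tau> / \<rho>) ^ (j - k)) \<le> \<theta> ^ ndist j k" for j k
      using \<theta> \<tau> \<rho> by (auto simp: ndist_def intro!: power_mono)
    have A: "Lp_pow p f \<le> M * ((\<Sum>j<n. \<theta> ^ ndist j 0 * b j) + R n)" for n
    proof -
      have "Lp_pow p (u n) \<le> (\<Sum>j<n. K * \<tau> ^ ndist j 0 * Lp_pow p (v j))"
        unfolding u_def by (rule sum_in_Lp_space(2)[OF p vL finite_lessThan K']) auto
      also have "\<dots> \<le> (\<Sum>j<n. K * (\<theta> ^ ndist j 0 * b j))"
      proof (rule sum_mono)
        fix j
        have nd: "ndist j 0 = j" by (simp add: ndist_def)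
        have "\<tau> ^ ndist j 0 * Lp_pow p (v j) = (\<tau> / \<rho>) ^ j * b j"
          using \<rho> by (simp add: nd b_def power_divide)
        also have "\<dots> \<le> \<theta> ^ j * b j" using \<theta> \<tau> \<rho> b by (intro mult_right_mono power_mono) auto
        finally show "K * \<tau> ^ ndist j 0 * Lp_pow p (v j) \<le> K * (\<theta> ^ ndist j 0 * b j)"
          using K by (simp add: nd mult.assoc)
      qed
      finally have u: "Lp_pow p (u n) \<le> K * (\<Sum>j<n. \<theta> ^ ndist j 0 * b j)" by (simp add: sum_distrib_left)
      define S where "S = (\<Sum>j<n. \<theta> ^ ndist j 0 * b j)"
      have S: "0 \<le> S" unfolding S_def using \<theta> b by (intro sum_nonneg) auto
      have "Lp_pow p f \<le> 2 powr p * (R n + Lp_pow p (u n))"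
        using add_in_Lp_space(2)[OF p rL[of n] uL[of n]] unfolding R_def by simp
      also have "\<dots> \<le> 2 powr p * (B * (1 + K) * (S + R n))"
      proof (rule mult_left_mono)
        have "R n + Lp_pow p (u n) \<le> R n + K * S" using u by (simp add: S_def)
        also have "\<dots> \<le> 1 * (1 + K) * (S + R n)" using S R0[of n] K by (simp add: algebra_simps)
        also have "\<dots> \<le> B * (1 + K) * (S + R n)" using B K S R0[of n] by (intro mult_right_mono) auto
        finally show "R n + Lp_pow p (u n) \<le> B * (1 + K) * (S + R n)" .
      qed auto
      finally show ?thesis by (simp add: M_def S_def mult.assoc)
    qed
    have W: "\<rho> ^ k * smod p k f \<le> M * ((\<Sum>j<n. \<theta> ^ ndist j k * b j) + \<rho> ^ k * R n)" for n k
    proof -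
      define S where "S = (\<Sum>j<n. \<theta> ^ ndist j k * b j)"
      have S: "0 \<le> S" unfolding S_def using \<theta> b by (intro sum_nonneg) auto
      have "smod p k (u n) \<le> (\<Sum>j<n. K * \<tau> ^ ndist j k * smod p k (v j))"
        unfolding u_def using K \<tau> by (intro smod_sum_le[OF p vL finite_lessThan K']) auto
      also have "\<dots> \<le> (\<Sum>j<n. K * \<tau> ^ ndist j k * (B * min 1 (2 ^ j / 2 ^ k) * Lp_pow p (v j)))"
        unfolding B_def using K \<tau> by (intro sum_mono mult_left_mono smod_dyadic_step_le p v) auto
      finally have "\<rho> ^ k * smod p k (u n) \<le> \<rho> ^ k * \<dots>" using \<rho> by (intro mult_left_mono) auto
      also have "\<dots> = (\<Sum>j<n. B * K * (\<rho> ^ k * \<tau> ^ ndist j k * min 1 (2 ^ j / 2 ^ k) * Lp_pow p (v j)))"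
        by (simp add: sum_distrib_left mult_ac)
      also have "\<dots> \<le> (\<Sum>j<n. B * K * (\<theta> ^ ndist j k * b j))"
      proof (intro sum_mono mult_left_mono)
        fix j
        have "\<rho> ^ k * \<tau> ^ ndist j k * min 1 (2 ^ j / 2 ^ k) = (if j \<le> k then (\<rho> * \<tau> / 2) ^ (k - j) else (\<tau> / \<rho>) ^ (j - k)) * \<rho> ^ j"
        proof (cases "j \<le> k")
          case True
          then have e: "\<rho> ^ k = \<rho> ^ (k - j) * \<rho> ^ j" "(2::real) ^ k = 2 ^ (k - j) * 2 ^ j" by (simp_all flip: power_add)
          have "2 ^ j / 2 ^ k = (1 / 2 ^ (k - j) :: real)" unfolding e(2) by simp
          then have "min 1 (2 ^ j / 2 ^ k) = (1 / 2 ^ (k - j) :: real)" by (simp add: min_absorb2)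
          then show ?thesis using True e(1) by (simp add: ndist_def power_mult_distrib power_divide)
        next
          case False
          then have e: "\<rho> ^ j = \<rho> ^ (j - k) * \<rho> ^ k" by (simp flip: power_add)
          have "min 1 (2 ^ j / 2 ^ k) = (1::real)" using False by (simp add: min_def)
          then show ?thesis using False e \<rho> by (simp add: ndist_def power_divide)
        qed
        also have "\<dots> \<le> \<theta> ^ ndist j k * \<rho> ^ j" using key \<rho> by (intro mult_right_mono) auto
        finally show "\<rho> ^ k * \<tau> ^ ndist j k * min 1 (2 ^ j / 2 ^ k) * Lp_pow p (v j) \<le> \<theta> ^ ndist j k * b j"
          unfolding b_def mult.assoc[symmetric] by (intro mult_right_mono) auto
      qed (use B K in auto)
      finally have u: "\<rho> ^ k * smod p k (u n) \<le> B * K * S" by (simp add: S_def sum_distrib_left)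
      have "smod p k f \<le> 2 powr p * (smod p k (\<lambda>x. f x - u n x) + smod p k (u n))"
        using add_in_Lp_space(3)[OF p rL[of n] uL[of n], of k] by simp
      then have "\<rho> ^ k * smod p k f \<le> \<rho> ^ k * \<dots>" using \<rho> by (intro mult_left_mono) auto
      also have "\<dots> = 2 powr p * (\<rho> ^ k * smod p k (\<lambda>x. f x - u n x) + \<rho> ^ k * smod p k (u n))"
        by (simp add: algebra_simps)
      also have "\<dots> \<le> 2 powr p * (B * (1 + K) * (S + \<rho> ^ k * R n))"
      proof (rule mult_left_mono)
        have "smod p k (\<lambda>x. f x - u n x) \<le> 2 * 2 powr p * R n"
          unfolding R_def by (rule smod_le_Lp_pow[OF p rL])
        also have "\<dots> \<le> B * R n"
          unfolding B_def using R0[of n] by (intro mult_right_mono) (auto simp: Suc_leI)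
        finally have "\<rho> ^ k * smod p k (\<lambda>x. f x - u n x) \<le> \<rho> ^ k * (B * R n)" using \<rho> by (intro mult_left_mono) auto
        then have "\<rho> ^ k * smod p k (\<lambda>x. f x - u n x) + \<rho> ^ k * smod p k (u n) \<le> B * (\<rho> ^ k * R n) + B * K * S"
          using u by (simp add: mult_ac)
        also have "\<dots> \<le> B * (1 + K) * (S + \<rho> ^ k * R n)"
          using S R0[of n] K \<rho> B by (simp add: algebra_simps)
        finally show "\<rho> ^ k * smod p k (\<lambda>x. f x - u n x) + \<rho> ^ k * smod p k (u n) \<le> B * (1 + K) * (S + \<rho> ^ k * R n)" .
      qed auto
      finally show ?thesis by (simp add: M_def S_def mult.assoc)
    qed
    \<comment> \<open>For a fixed scale k the remainder R n is multiplied by the constant \<rho>^k,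
      so taking n large makes it the error term of the Hardy inequality.\<close>
    have small: "\<exists>n. c * R n < e" if "e > 0" "c > 0" for e c :: real
    proof -
      have "\<forall>\<^sub>F n in sequentially. R n < e / c" using Rlim that by (intro order_tendstoD(2)[of R 0]) auto
      then obtain n where "R n < e / c" by (auto simp: eventually_sequentially)
      then show ?thesis using that by (auto simp: field_simps)
    qed
    define X where "X k = \<rho> ^ k * smod p k f / M" for k
    \<comment> \<open>The L_p part is treated as a sequence supported at index 0, so that the same
      inequality bounds it.\<close>
    define Y where "Y k = (if k = 0 then Lp_pow p f / M else 0)" for k :: nat
    have X: "summable (\<lambda>k. X k powr r) \<and> (\<Sum>k. X k powr r) \<le> H * (\<Sum>j. b j powr r)"
    proof (rule H(2))
      show "\<forall>k. \<forall>e>0. \<exists>J. finite J \<and> X k \<le> (\<Sum>j\<in>J. \<theta> ^ ndist j k * b j) + e"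
      proof (intro allI impI)
      fix k and e :: real assume "e > 0"
      then obtain n where n: "\<rho> ^ k * R n < e" using small[of e "\<rho> ^ k"] \<rho> by auto
      have "X k \<le> (\<Sum>j<n. \<theta> ^ ndist j k * b j) + \<rho> ^ k * R n"
        unfolding X_def using W[of k n] M by (simp add: field_simps)
      then show "\<exists>J. finite J \<and> X k \<le> (\<Sum>j\<in>J. \<theta> ^ ndist j k * b j) + e"
        using n by (intro exI[of _ "{..<n}"]) auto
      qed
      show "\<forall>j. 0 \<le> b j" using b by blast
      show "summable (\<lambda>j. b j powr r)" using sm by (simp add: b_def)
      show "\<forall>k. 0 \<le> X k" using M \<rho> by (simp add: X_def)
    qed
    have Y: "summable (\<lambda>k. Y k powr r) \<and> (\<Sum>k. Y k powr r) \<le> H * (\<Sum>j. b j powr r)"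
    proof (rule H(2))
      show "\<forall>k. \<forall>e>0. \<exists>J. finite J \<and> Y k \<le> (\<Sum>j\<in>J. \<theta> ^ ndist j k * b j) + e"
      proof (intro allI impI)
      fix k and e :: real assume e: "e > 0"
      show "\<exists>J. finite J \<and> Y k \<le> (\<Sum>j\<in>J. \<theta> ^ ndist j k * b j) + e"
      proof (cases "k = 0")
        case True
        obtain n where n: "R n < e" using small[of e 1] e by auto
        have "Y 0 \<le> (\<Sum>j<n. \<theta> ^ ndist j 0 * b j) + R n"
          unfolding Y_def using A[of n] M by (simp add: field_simps)
        then show ?thesis using n True by (intro exI[of _ "{..<n}"]) auto
      next
        case False
        then show ?thesis using e by (intro exI[of _ "{}"]) (simp add: Y_def)
      qed
      qed
      show "\<forall>j. 0 \<le> b j" using b by blast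
      show "summable (\<lambda>j. b j powr r)" using sm by (simp add: b_def)
      show "\<forall>k. 0 \<le> Y k" using M by (simp add: Y_def)
    qed
    have X': "(\<rho> ^ k * smod p k f) powr r = M powr r * X k powr r" for k
      using M \<rho> by (simp add: X_def powr_divide)
    have sum: "summable (\<lambda>k. (\<rho> ^ k * smod p k f) powr r)"
      unfolding X' using X by (intro summable_mult) auto
    have "(\<Sum>k. (\<rho> ^ k * smod p k f) powr r) = M powr r * (\<Sum>k. X k powr r)"
      unfolding X' using X by (intro suminf_mult) auto
    also have "\<dots> \<le> M powr r * (H * (\<Sum>j. b j powr r))" using X by (intro mult_left_mono) auto
    finally have 1: "(\<Sum>k. (\<rho> ^ k * smod p k f) powr r) \<le> M powr r * (H * (\<Sum>j. b j powr r))" .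
    have "(\<Sum>k. Y k powr r) = Y 0 powr r"
      using suminf_finite[of "{0}" "\<lambda>k. Y k powr r"] r by (auto simp: Y_def)
    then have "Lp_pow p f powr r = M powr r * (\<Sum>k. Y k powr r)"
      using M by (simp add: Y_def powr_divide)
    also have "\<dots> \<le> M powr r * (H * (\<Sum>j. b j powr r))" using Y by (intro mult_left_mono) auto
    finally have 2: "Lp_pow p f powr r \<le> M powr r * (H * (\<Sum>j. b j powr r))" .
    show ?thesis
      using f sum 1 2 unfolding besov_space_alt besov_pow_alt C_def b_def by simp
  qed
  then show ?thesis using M H by (intro exI[of _ C]) (auto simp: C_def)
qed

text \<open>A Bernstein inequality: the upper estimate applied to a series with a single nonzero
  term.\<close>

lemma besov_dyadic_step:
  "\<exists>C>0. \<forall>k (u :: real^'d \<Rightarrow> real). dyadic_step k u \<longrightarrow>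
     u \<in> besov_space p q s \<and> besov_pow p q s u \<le> C * (\<rho> ^ k * Lp_pow p u) powr r"
proof -
  obtain C where C: "C > 0" "\<And>(f :: real^'d \<Rightarrow> real) v. f \<in> Lp_space p unit_cube \<Longrightarrow> (\<forall>j. dyadic_step j (v j)) \<Longrightarrow>
     summable (\<lambda>j. (\<rho> ^ j * Lp_pow p (v j)) powr r) \<Longrightarrow>
     (\<lambda>n. Lp_pow p (\<lambda>x. f x - (\<Sum>j<n. v j x))) \<longlonglongrightarrow> 0 \<Longrightarrow>
     f \<in> besov_space p q s \<and> besov_pow p q s f \<le> C * (\<Sum>j. (\<rho> ^ j * Lp_pow p (v j)) powr r)"
    using besov_series_upper by blast
  have "u \<in> besov_space p q s \<and> besov_pow p q s u \<le> C * (\<rho> ^ k * Lp_pow p u) powr r"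
    if u: "dyadic_step k u" for k and u :: "real^'d \<Rightarrow> real"
  proof -
    define v where "v j = (if j = k then u else (\<lambda>_. 0))" for j
    have z: "Lp_pow p (\<lambda>_ :: real^'d. 0) = 0" by (simp add: Lp_pow_def)
    have t: "(\<lambda>j. (\<rho> ^ j * Lp_pow p (v j)) powr r) sums ((\<rho> ^ k * Lp_pow p u) powr r)"
      using sums_finite[of "{k}" "\<lambda>j. (\<rho> ^ j * Lp_pow p (v j)) powr r"] r by (simp add: v_def z)
    have "Lp_pow p (\<lambda>x. u x - (\<Sum>j<n. v j x)) = 0" if "n > k" for n
    proof -
      have "(\<Sum>j<n. v j x) = (\<Sum>j<n. if j = k then u x else 0)" for x by (intro sum.cong) (auto simp: v_def)
      then have "(\<lambda>x. u x - (\<Sum>j<n. v j x)) = (\<lambda>_. 0)" using that by simp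
      then show ?thesis using z by simp
    qed
    then have "\<forall>\<^sub>F n in sequentially. Lp_pow p (\<lambda>x. u x - (\<Sum>j<n. v j x)) = 0"
      by (auto simp: eventually_sequentially intro!: exI[of _ "Suc k"])
    then have "(\<lambda>n. Lp_pow p (\<lambda>x. u x - (\<Sum>j<n. v j x))) \<longlonglongrightarrow> 0" by (rule tendsto_eventually)
    then show ?thesis
      using C(2)[of u v] dyadic_step_Lp(1)[OF u] u t by (auto simp: v_def dyadic_step_const sums_iff)
  qed
  then show ?thesis using C(1) by blast
qed

text \<open>Choosing the errors in \<open>jackson\<close> geometrically small relative to the norm
  of f makes one sequence of approximants work for all levels, with a summable total excess.\<close>

theorem besov_approx_lower:
  "\<exists>C>0. \<forall>f \<in> besov_space p q s :: (real^'d \<Rightarrow> real) set. \<exists>u. (\<forall>k. dyadic_step k (u k)) \<and>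
     summable (\<lambda>k. (\<rho> ^ k * Lp_pow p (\<lambda>x. f x - u k x)) powr r) \<and>
     (\<Sum>k. (\<rho> ^ k * Lp_pow p (\<lambda>x. f x - u k x)) powr r) \<le> C * besov_pow p q s f"
proof -
  obtain J m0 where J: "J > 0" "\<And>(f :: real^'d \<Rightarrow> real) k \<epsilon>. f \<in> Lp_space p unit_cube \<Longrightarrow> k \<ge> m0 \<Longrightarrow> \<epsilon> > 0 \<Longrightarrow>
     \<exists>u. dyadic_step k u \<and> Lp_pow p (\<lambda>x. f x - u x) \<le> J * (smod p (k - m0) f + \<epsilon>)"
    using jackson[OF p] by metis
  define \<kappa> where "\<kappa> = 2 powr (- r)"
  have \<kappa>: "0 \<le> \<kappa>" "\<kappa> < 1" using r powr_less_mono[of "- r" 0 2] by (auto simp: \<kappa>_def)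
  define K where "K = (J * \<rho> ^ m0) powr r * 2 powr r"
  have K: "0 \<le> K" by (simp add: K_def)
  define C where "C = 1 + real m0 * (\<rho> ^ m0) powr r + K * (1 + 1 / (1 - \<kappa>))"
  have C: "C \<ge> 1" using K \<kappa> by (simp add: C_def)
  have "\<exists>u. (\<forall>k. dyadic_step k (u k)) \<and>
     summable (\<lambda>k. (\<rho> ^ k * Lp_pow p (\<lambda>x. f x - u k x)) powr r) \<and>
     (\<Sum>k. (\<rho> ^ k * Lp_pow p (\<lambda>x. f x - u k x)) powr r) \<le> C * besov_pow p q s f"
    if fB: "f \<in> besov_space p q s" for f :: "real^'d \<Rightarrow> real"
  \<comment> \<open>The errors below are proportional to a power of this quantity and have to be
    positive; when it vanishes, f is 0 in L_p and zero approximants suffice.\<close>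
  proof (cases "besov_pow p q s f = 0")
    case True
    then have "Lp_pow p f powr r \<le> 0" using Lp_pow_le_besov[OF fB] by simp
    then have "Lp_pow p f = 0" by simp
    then show ?thesis using True r by (intro exI[of _ "\<lambda>_ _. 0"]) (auto simp: dyadic_step_const)
  next
    case False
    define N where "N = besov_pow p q s f"
    have N: "N > 0" using False besov_pow_nonneg[OF p q s fB] by (simp add: N_def)
    have f: "f \<in> Lp_space p unit_cube" and sm: "summable (\<lambda>k. (\<rho> ^ k * smod p k f) powr r)"
      using fB besov_space_alt by auto
    \<comment> \<open>The weight \<rho>^k leaves 2^(-k), whose r-th powers form a geometric series;
      the factor N^(1/r) makes the excess a multiple of N.\<close>
    define \<epsilon> where "\<epsilon> k = (1 / (2 * \<rho>)) ^ k * N powr (1 / r)" for k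
    have \<epsilon>: "\<epsilon> k > 0" for k using \<rho> N by (simp add: \<epsilon>_def)
    \<comment> \<open>Below m0 the Jackson estimate says nothing; the zero function is taken there,
      and finitely many levels cost a multiple of the L_p part.\<close>
    have "\<exists>u. dyadic_step k u \<and> (if m0 \<le> k then Lp_pow p (\<lambda>x. f x - u x) \<le> J * (smod p (k - m0) f + \<epsilon> k) else u = (\<lambda>_. 0))" for k
      using J(2)[OF f, of k "\<epsilon> k"] \<epsilon> by (auto intro: dyadic_step_const)
    then obtain u where u: "\<And>k. dyadic_step k (u k)"
      "\<And>k. m0 \<le> k \<Longrightarrow> Lp_pow p (\<lambda>x. f x - u k x) \<le> J * (smod p (k - m0) f + \<epsilon> k)"
      "\<And>k. \<not> m0 \<le> k \<Longrightarrow> u k = (\<lambda>_. 0)" by metis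
    define t where "t k = (\<rho> ^ k * Lp_pow p (\<lambda>x. f x - u k x)) powr r" for k
    have t0: "0 \<le> t k" for k by (simp add: t_def)
    have lo: "t k \<le> (\<rho> ^ m0) powr r * N" if "k < m0" for k
    proof -
      have "t k = (\<rho> ^ k) powr r * Lp_pow p f powr r" using that u(3)[of k] \<rho> by (simp add: t_def powr_mult)
      also have "\<dots> \<le> (\<rho> ^ m0) powr r * N"
        unfolding N_def using that \<rho> r Lp_pow_le_besov[OF fB]
        by (intro mult_mono powr_mono2 power_increasing) auto
      finally show ?thesis .
    qed
    have hi: "t (k + m0) \<le> K * ((\<rho> ^ k * smod p k f) powr r + \<kappa> ^ k * N)" for k
    proof -
      have "\<rho> ^ (k + m0) * Lp_pow p (\<lambda>x. f x - u (k + m0) x) \<le> \<rho> ^ (k + m0) * (J * (smod p k f + \<epsilon> (k + m0)))"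
        using u(2)[of "k + m0"] \<rho> by (intro mult_left_mono) auto
      also have "\<dots> = J * \<rho> ^ m0 * (\<rho> ^ k * smod p k f + \<rho> ^ k * \<epsilon> (k + m0))"
        by (simp add: power_add algebra_simps)
      also have "\<rho> ^ k * \<epsilon> (k + m0) \<le> (1 / 2) ^ k * N powr (1 / r)"
      proof -
        have "\<epsilon> (k + m0) = ((1 / (2 * \<rho>)) ^ k * N powr (1 / r)) * (1 / (2 * \<rho>)) ^ m0"
          by (simp add: \<epsilon>_def power_add)
        also have "\<dots> \<le> ((1 / (2 * \<rho>)) ^ k * N powr (1 / r)) * 1"
          using \<rho> by (intro mult_left_mono power_le_one) auto
        finally have "\<rho> ^ k * \<epsilon> (k + m0) \<le> \<rho> ^ k * ((1 / (2 * \<rho>)) ^ k * N powr (1 / r))"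
          using \<rho> by (intro mult_left_mono) auto
        then show ?thesis using \<rho> by (simp add: power_divide power_mult_distrib)
      qed
      finally have "\<rho> ^ (k + m0) * Lp_pow p (\<lambda>x. f x - u (k + m0) x) \<le>
          J * \<rho> ^ m0 * (\<rho> ^ k * smod p k f + (1 / 2) ^ k * N powr (1 / r))"
        using J \<rho> by (simp add: mult_left_mono)
      then have "t (k + m0) \<le> (J * \<rho> ^ m0 * (\<rho> ^ k * smod p k f + (1 / 2) ^ k * N powr (1 / r))) powr r"
        unfolding t_def using r \<rho> by (intro powr_mono2) auto
      also have "\<dots> = (J * \<rho> ^ m0) powr r * \<bar>\<rho> ^ k * smod p k f + (1 / 2) ^ k * N powr (1 / r)\<bar> powr r"
        using J \<rho> by (simp add: powr_mult)
      also have "\<dots> \<le> (J * \<rho> ^ m0) powr r * (2 powr r * (\<bar>\<rho> ^ k * smod p k f\<bar> powr r + \<bar>(1 / 2) ^ k * N powr (1 / r)\<bar> powr r))"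
        by (intro mult_left_mono powr_add_le r) auto
      also have "\<bar>(1 / 2) ^ k * N powr (1 / r)\<bar> powr r = \<kappa> ^ k * N"
      proof -
        have "((1 / 2) ^ k) powr r = \<kappa> ^ k"
          unfolding \<kappa>_def by (simp add: powr_minus_divide powr_divide power_divide powr_power powr_powr powr_realpow[symmetric] mult.commute)
        then show ?thesis using N r by (simp add: abs_mult powr_mult powr_powr)
      qed
      also have "\<bar>\<rho> ^ k * smod p k f\<bar> = \<rho> ^ k * smod p k f" using \<rho> by simp
      finally show ?thesis by (simp add: K_def mult.assoc)
    qed
    have sN: "(\<Sum>k. (\<rho> ^ k * smod p k f) powr r) \<le> N"
      unfolding N_def besov_pow_alt by simp
    have geo: "summable (\<lambda>k. \<kappa> ^ k * N)" "(\<Sum>k. \<kappa> ^ k * N) = N / (1 - \<kappa>)"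
      using \<kappa> by (auto intro!: summable_mult2 summable_geometric simp: suminf_mult2[symmetric] summable_geometric suminf_geometric)
    have sm': "summable (\<lambda>k. K * ((\<rho> ^ k * smod p k f) powr r + \<kappa> ^ k * N))"
      by (intro summable_mult summable_add sm geo)
    have st: "summable (\<lambda>k. t (k + m0))"
      by (rule summable_comparison_test'[OF sm', of 0]) (use hi t0 in auto)
    then have stt: "summable t" by (simp add: summable_iff_shift)
    have "(\<Sum>k. t k) = (\<Sum>k. t (k + m0)) + (\<Sum>k<m0. t k)"
      by (rule suminf_split_initial_segment[OF stt])
    also have "\<dots> \<le> K * (N + N / (1 - \<kappa>)) + real m0 * ((\<rho> ^ m0) powr r * N)"
    proof (rule add_mono)
      have "(\<Sum>k. t (k + m0)) \<le> (\<Sum>k. K * ((\<rho> ^ k * smod p k f) powr r + \<kappa> ^ k * N))"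
        by (intro suminf_le hi st sm')
      also have "\<dots> = K * ((\<Sum>k. (\<rho> ^ k * smod p k f) powr r) + N / (1 - \<kappa>))"
        using sm geo by (simp add: suminf_mult suminf_add[symmetric] summable_add)
      also have "\<dots> \<le> K * (N + N / (1 - \<kappa>))" using sN K by (intro mult_left_mono) auto
      finally show "(\<Sum>k. t (k + m0)) \<le> K * (N + N / (1 - \<kappa>))" .
      have "(\<Sum>k<m0. t k) \<le> (\<Sum>k<m0. (\<rho> ^ m0) powr r * N)" by (intro sum_mono lo) auto
      then show "(\<Sum>k<m0. t k) \<le> real m0 * ((\<rho> ^ m0) powr r * N)" by simp
    qed
    also have "\<dots> \<le> C * N" using N by (simp add: C_def algebra_simps)
    finally have "(\<Sum>k. t k) \<le> C * besov_pow p q s f" by (simp add: N_def)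
    then show ?thesis using u(1) stt by (intro exI[of _ u]) (simp add: t_def[abs_def])
  qed
  then show ?thesis using C by (intro exI[of _ C]) auto
qed

end

section \<open>Averages and Haar functions\<close>

text \<open>S is the set of coordinates in which the upper half of the cell is chosen, so the 2^d
  children correspond to the subsets of the index type.\<close>

definition child :: "nat \<Rightarrow> real^'d \<Rightarrow> 'd set \<Rightarrow> 'd \<Rightarrow> int" where
  "child k x S i = 2 * cell k x i + of_bool (i \<in> S)"

text \<open>One step of conditional expectation, read off from the corners of the children. For a
  step function of level k + 1 it is the true mean over each cell of level k; as a formula it makes
  sense for any function.\<close>

definition avg :: "nat \<Rightarrow> (real^'d \<Rightarrow> real) \<Rightarrow> real^'d \<Rightarrow> real" where
  "avg k u x = (\<Sum>S\<in>UNIV. u (grid_point (Suc k) (child k x S))) / 2 ^ CARD('d)"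

lemma card_UNIV_set: "real CARD('d::finite set) = 2 ^ CARD('d)"
  using card_Pow[of "UNIV :: 'd set"] by simp

lemma child_in_grid:
  assumes "x \<in> half_cube" shows "child k x S \<in> grid (Suc k)"
  unfolding grid_def
proof (intro CollectI allI)
  fix i
  have "0 \<le> cell k x i" "cell k x i < 2 ^ k" using cell_in[OF assms, of k] by (auto simp: grid_def)
  then show "0 \<le> child k x S i \<and> child k x S i < 2 ^ Suc k" by (auto simp: child_def)
qed

lemma cell_child: "cell k (grid_point (Suc k) (child k x S)) = cell k x"
  using cell_div[of k "Suc k" "grid_point (Suc k) (child k x S)"] by (auto simp: child_def fun_eq_iff)

lemma child_point_in: "x \<in> half_cube \<Longrightarrow> grid_point (Suc k) (child k x S) \<in> half_cube"
  by (intro grid_point_in child_in_grid)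

lemma cell_Suc_eq_child: "cell (Suc k) x = child k x {i. odd (cell (Suc k) x i)}"
proof
  fix i
  have "cell k x i = cell (Suc k) x i div 2" using cell_div[of k "Suc k" x i] by simp
  then show "cell (Suc k) x i = child k x {i. odd (cell (Suc k) x i)} i"
    by (simp add: child_def of_bool_odd_eq_mod_2)
qed

lemma dyadic_step_avg: "dyadic_step k (avg k u)"
  unfolding dyadic_step_def avg_def child_def by auto

lemma avg_sum: "avg k (\<lambda>x. \<Sum>j\<in>J. u j x) x = (\<Sum>j\<in>J. avg k (u j) x)"
  unfolding avg_def by (subst sum.swap) (simp add: sum_divide_distrib)

lemma avg_cmult: "avg k (\<lambda>x. c * u x) x = c * avg k u x"
  by (simp add: avg_def sum_distrib_left)

lemma avg_add: "avg k (\<lambda>x. u x + v x) x = avg k u x + avg k v x"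
  by (simp add: avg_def sum.distrib add_divide_distrib)

lemma avg_diff: "avg k (\<lambda>x. u x - v x) x = avg k u x - avg k v x"
  by (simp add: avg_def sum_subtractf diff_divide_distrib)

lemma avg_mult_step:
  assumes "dyadic_step k v" "x \<in> half_cube"
  shows "avg k (\<lambda>x. v x * u x) x = v x * avg k u x"
proof -
  have "v (grid_point (Suc k) (child k x S)) = v x" for S
    using assms by (intro dyadic_stepD[OF assms(1)] child_point_in cell_child)
  then show ?thesis by (simp add: avg_def sum_distrib_left)
qed

lemma avg_step:
  fixes u :: "real^'d \<Rightarrow> real"
  assumes "dyadic_step k u" "x \<in> half_cube"
  shows "avg k u x = u x"
proof -
  have "avg k (\<lambda>_. 1) x = 1" by (simp add: avg_def card_UNIV_set)
  then show ?thesis using avg_mult_step[OF assms, of "\<lambda>_. 1"] by simp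
qed

lemma avg_cong:
  assumes "\<And>x. x \<in> half_cube \<Longrightarrow> u x = v x" "x \<in> half_cube"
  shows "avg k u x = avg k v x"
  unfolding avg_def using assms child_point_in by (metis (no_types, lifting) sum.cong)

lemma sum_grid_Suc:
  fixes F :: "('d::finite \<Rightarrow> int) \<Rightarrow> real"
  shows "(\<Sum>a\<in>grid (Suc k). F a) = (\<Sum>b\<in>grid k. \<Sum>S\<in>UNIV. F (\<lambda>i. 2 * b i + of_bool (i \<in> S)))"
proof -
  let ?h = "\<lambda>(b :: 'd \<Rightarrow> int, S). (\<lambda>i. 2 * b i + of_bool (i \<in> S))"
  have "bij_betw ?h (grid k \<times> UNIV) (grid (Suc k))"
  proof (rule bij_betw_byWitness[where f' = "\<lambda>a. (\<lambda>i. a i div 2, {i. odd (a i)})"])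
    show "\<forall>a\<in>grid k \<times> UNIV. (\<lambda>i. ?h a i div 2, {i. odd (?h a i)}) = a" by auto
    show "\<forall>a'\<in>grid (Suc k). ?h (\<lambda>i. a' i div 2, {i. odd (a' i)}) = a'"
      by (auto simp: of_bool_odd_eq_mod_2)
    show "?h ` (grid k \<times> UNIV) \<subseteq> grid (Suc k)"
    proof safe
      fix b :: "'d \<Rightarrow> int" and S assume b: "b \<in> grid k"
      have "0 \<le> 2 * b i + of_bool (i \<in> S) \<and> 2 * b i + of_bool (i \<in> S) < 2 ^ Suc k" for i
        using b by (auto simp: grid_def dest!: spec[of _ i])
      then show "(\<lambda>i. 2 * b i + of_bool (i \<in> S)) \<in> grid (Suc k)" by (simp add: grid_def)
    qed
    have "a i div 2 < 2 ^ k" if "a i < 2 * 2 ^ k" for a :: "'d \<Rightarrow> int" and i using that by simp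
    then show "(\<lambda>a. (\<lambda>i. a i div 2, {i. odd (a i)})) ` grid (Suc k) \<subseteq> grid k \<times> UNIV"
      by (auto simp: grid_def)
  qed
  then have "(\<Sum>a\<in>grid (Suc k). F a) = (\<Sum>z\<in>grid k \<times> UNIV. F (?h z))"
    by (intro sum.reindex_bij_betw[symmetric])
  then show ?thesis by (simp add: sum.cartesian_product case_prod_unfold)
qed

lemma powr_mean_le:
  fixes a :: "'i \<Rightarrow> real"
  assumes p: "1 \<le> p" and S: "finite S" "S \<noteq> {}" and a: "\<And>i. i \<in> S \<Longrightarrow> 0 \<le> a i"
  shows "((\<Sum>i\<in>S. a i) / card S) powr p \<le> (\<Sum>i\<in>S. a i powr p) / card S"
proof -
  \<comment> \<open>Convexity of the power is applied on the open half-line, so zeros are split off;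
    they are put back through (m/n)^p \<le> m/n.\<close>
  define T where "T = {i \<in> S. a i \<noteq> 0}"
  have T: "finite T" "T \<subseteq> S" using S by (auto simp: T_def)
  have sT: "(\<Sum>i\<in>S. a i) = (\<Sum>i\<in>T. a i)" "(\<Sum>i\<in>S. a i powr p) = (\<Sum>i\<in>T. a i powr p)"
    using S by (auto intro!: sum.mono_neutral_right simp: T_def)
  show ?thesis
  proof (cases "T = {}")
    case True
    then show ?thesis using sT p by simp
  next
    case False
    define n m where "n = real (card S)" and "m = real (card T)"
    have n: "n > 0" and m: "m > 0" "m \<le> n"
      using S T False by (auto simp: n_def m_def card_gt_0_iff card_mono)
    have "(\<lambda>x. x powr p) (\<Sum>i\<in>T. (1 / m) *\<^sub>R a i) \<le> (\<Sum>i\<in>T. (1 / m) * (\<lambda>x. x powr p) (a i))"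
    proof (rule convex_on_sum[OF T(1) False powr_convex[OF p]])
      show "(\<Sum>i\<in>T. 1 / m) = 1" using m by (simp add: m_def)
      show "0 \<le> 1 / m" for i using m by simp
      show "a i \<in> {0<..}" if "i \<in> T" for i using a[of i] that by (auto simp: T_def)
    qed
    then have j: "((\<Sum>i\<in>T. a i) / m) powr p \<le> (\<Sum>i\<in>T. a i powr p) / m"
      by (simp add: sum_divide_distrib)
    have "(m / n) powr p \<le> (m / n) powr 1" using n m p by (intro powr_mono') auto
    then have mn: "(m / n) powr p \<le> m / n" using n m by simp
    have "((\<Sum>i\<in>T. a i) / n) powr p = ((m / n) * ((\<Sum>i\<in>T. a i) / m)) powr p" using m by simp
    also have "\<dots> = (m / n) powr p * ((\<Sum>i\<in>T. a i) / m) powr p"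
      using n m T a by (subst powr_mult) (auto intro!: divide_nonneg_nonneg sum_nonneg)
    also have "\<dots> \<le> (m / n) * ((\<Sum>i\<in>T. a i powr p) / m)"
      using n m by (intro mult_mono mn j) auto
    also have "\<dots> = (\<Sum>i\<in>T. a i powr p) / n" using m by simp
    finally show ?thesis by (simp add: sT n_def)
  qed
qed

text \<open>The dummy argument carries the dimension, which enters only through the type.\<close>

definition avg_growth :: "real \<Rightarrow> 'd::finite itself \<Rightarrow> real" where
  "avg_growth p _ = (if p < 1 then 2 powr (real CARD('d) * (1 - p)) else 1)"

lemma avg_growth_ge_1: "1 \<le> avg_growth p TYPE('d::finite)"
  by (auto simp: avg_growth_def intro!: ge_one_powr_ge_zero)

text \<open>For p \<ge> 1 this is Jensen's inequality. For p < 1 subadditivity gives n^(-p) times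
  the sum of p-th powers, which is n^(1-p) times their mean with n = 2^d; equality holds when a
  single child carries everything.\<close>

lemma powr_avg_le:
  fixes u :: "real^'d \<Rightarrow> real"
  assumes p: "0 < p"
  shows "\<bar>avg k u x\<bar> powr p \<le> avg_growth p TYPE('d) * avg k (\<lambda>x. \<bar>u x\<bar> powr p) x"
proof -
  define a where "a S = \<bar>u (grid_point (Suc k) (child k x S))\<bar>" for S
  define n where "n = (2::real) ^ CARD('d)"
  have n: "n = real (card (UNIV :: 'd set set))" "n > 0" by (simp_all add: n_def card_UNIV_set)
  have "\<bar>avg k u x\<bar> \<le> (\<Sum>S\<in>UNIV. a S) / n"
    unfolding avg_def a_def n_def by (simp add: abs_divide divide_right_mono)
  then have 1: "\<bar>avg k u x\<bar> powr p \<le> ((\<Sum>S\<in>UNIV. a S) / n) powr p" using p by (intro powr_mono2) auto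
  have m: "avg k (\<lambda>x. \<bar>u x\<bar> powr p) x = (\<Sum>S\<in>UNIV. a S powr p) / n" by (simp add: avg_def a_def n_def)
  show ?thesis
  proof (cases "p < 1")
    case True
    have a0: "\<bar>\<Sum>S\<in>UNIV. a S\<bar> = (\<Sum>S\<in>UNIV. a S)" by (simp add: a_def sum_nonneg)
    have "((\<Sum>S\<in>UNIV. a S) / n) powr p = \<bar>\<Sum>S\<in>UNIV. a S\<bar> powr p / n powr p"
      unfolding a0 using n by (subst powr_divide) (auto simp: a_def intro!: sum_nonneg)
    also have "\<dots> \<le> (\<Sum>S\<in>UNIV. a S powr p) / n powr p"
      using powr_sum_le[of p UNIV a] p True by (intro divide_right_mono) (auto simp: a_def)
    also have "\<dots> = n powr (1 - p) * ((\<Sum>S\<in>UNIV. a S powr p) / n)"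
      using n by (simp add: powr_diff field_simps)
    also have "n powr (1 - p) = avg_growth p TYPE('d)"
      using True by (simp add: avg_growth_def n_def powr_realpow[symmetric] powr_powr)
    finally show ?thesis using 1 m by simp
  next
    case False
    have "((\<Sum>S\<in>UNIV. a S) / n) powr p \<le> (\<Sum>S\<in>UNIV. a S powr p) / n"
      unfolding n(1) using False by (intro powr_mean_le) (auto simp: a_def)
    then show ?thesis using 1 m False by (simp add: avg_growth_def)
  qed
qed

text \<open>Averaging preserves the mean over the cube, stated for corner sums so that it applies to
  p-th powers.\<close>

lemma Lp_pow_avg_eq:
  fixes v :: "real^'d \<Rightarrow> real"
  shows "(\<Sum>b\<in>grid k. avg k v (grid_point k b)) / (2 ^ k) ^ CARD('d) =
    (\<Sum>a\<in>grid (Suc k). v (grid_point (Suc k) a)) / (2 ^ Suc k) ^ CARD('d)"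
proof -
  have "(\<Sum>b\<in>grid k. avg k v (grid_point k b)) = (\<Sum>a\<in>grid (Suc k). v (grid_point (Suc k) a)) / 2 ^ CARD('d)"
    unfolding sum_grid_Suc by (simp add: avg_def child_def[abs_def] sum_divide_distrib)
  then show ?thesis by (simp add: power_mult_distrib mult.commute)
qed

lemma Lp_pow_avg_le:
  fixes u :: "real^'d \<Rightarrow> real"
  assumes p: "0 < p" and u: "dyadic_step (Suc k) u"
  shows "Lp_pow p (avg k u) \<le> avg_growth p TYPE('d) * Lp_pow p u"
proof -
  have "Lp_pow p (avg k u) \<le> (\<Sum>b\<in>grid k. avg_growth p TYPE('d) * avg k (\<lambda>x. \<bar>u x\<bar> powr p) (grid_point k b)) / (2 ^ k) ^ CARD('d)"
    unfolding dyadic_step_Lp(2)[OF dyadic_step_avg] by (intro divide_right_mono sum_mono powr_avg_le p) auto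
  also have "\<dots> = avg_growth p TYPE('d) * ((\<Sum>b\<in>grid k. avg k (\<lambda>x. \<bar>u x\<bar> powr p) (grid_point k b)) / (2 ^ k) ^ CARD('d))"
    by (simp add: sum_distrib_left[symmetric])
  also have "\<dots> = avg_growth p TYPE('d) * Lp_pow p u"
    unfolding Lp_pow_avg_eq dyadic_step_Lp(2)[OF u] ..
  finally show ?thesis .
qed

lemma Lp_pow_mono_step:
  assumes "dyadic_step k u" "dyadic_step k v" "0 < p" "\<And>x. x \<in> half_cube \<Longrightarrow> \<bar>u x\<bar> \<le> \<bar>v x\<bar>"
  shows "Lp_pow p u \<le> Lp_pow p v"
  unfolding dyadic_step_Lp(2)[OF assms(1)] dyadic_step_Lp(2)[OF assms(2)]
  using assms(3,4) by (intro divide_right_mono sum_mono powr_mono2) (auto simp: grid_point_in)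

section \<open>Haar functions as functions of integer cell indices\<close>

lemma dyadic_interval_iff: "z \<in> dyadic_interval k i \<longleftrightarrow> \<lfloor>2 ^ k * z\<rfloor> = int i - 1"
proof -
  have "z \<in> dyadic_interval k i \<longleftrightarrow> real i - 1 \<le> 2 ^ k * z \<and> 2 ^ k * z < real i"
    by (simp add: dyadic_interval_def field_simps)
  also have "\<dots> \<longleftrightarrow> \<lfloor>2 ^ k * z\<rfloor> = int i - 1" by (simp add: floor_eq_iff)
  finally show ?thesis .
qed

lemma haar_function_eq:
  assumes "i \<ge> 1"
  shows "haar_function k i z = of_bool (\<lfloor>2 ^ Suc k * z\<rfloor> = 2 * (int i - 1)) - of_bool (\<lfloor>2 ^ Suc k * z\<rfloor> = 2 * (int i - 1) + 1)"
  unfolding haar_function_def using assms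
  by (simp add: indicator_def dyadic_interval_iff of_nat_diff algebra_simps del: power_Suc)

text \<open>Expanding a product of two-term sums over the subsets of the coordinates turns averages of
  tensor products over the \<open>2\<^sup>d\<close> children of a cell into products of one-dimensional averages.\<close>

lemma avg_tensor:
  fixes F :: "'d::finite \<Rightarrow> real \<Rightarrow> real" and x :: "real^'d"
  shows "avg k (\<lambda>x. \<Prod>l\<in>UNIV. F l (x $ l)) x =
    (\<Prod>l\<in>UNIV. (F l (real_of_int (2 * cell k x l + 1) / 2 ^ Suc k) + F l (real_of_int (2 * cell k x l) / 2 ^ Suc k)) / 2)"
proof -
  let ?f = "\<lambda>l. F l (real_of_int (2 * cell k x l + 1) / 2 ^ Suc k)"
  let ?g = "\<lambda>l. F l (real_of_int (2 * cell k x l) / 2 ^ Suc k)"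
  have "(\<Prod>l\<in>UNIV. F l (grid_point (Suc k) (child k x S) $ l)) = prod ?f S * prod ?g (UNIV - S)" for S
  proof -
    have "(\<Prod>l\<in>UNIV. F l (grid_point (Suc k) (child k x S) $ l)) = (\<Prod>l\<in>UNIV. if l \<in> S then ?f l else ?g l)"
      by (intro prod.cong refl) (simp add: grid_point_def child_def)
    also have "\<dots> = prod ?f S * prod ?g (UNIV - S)"
      by (subst prod.If_cases) (auto simp: Compl_eq_Diff_UNIV)
    finally show ?thesis .
  qed
  then have "(\<Sum>S\<in>UNIV. \<Prod>l\<in>UNIV. F l (grid_point (Suc k) (child k x S) $ l)) = (\<Prod>l\<in>UNIV. ?f l + ?g l)"
    by (subst prod_add) auto
  then show ?thesis unfolding avg_def by (simp add: prod_dividef)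
qed

text \<open>S collects the coordinates with an oscillating factor. The empty S, excluded from the
  Haar system, is allowed here and gives the indicator of a cell of level k.\<close>

definition haar_tensor :: "nat \<Rightarrow> ('d \<Rightarrow> nat) \<Rightarrow> 'd set \<Rightarrow> real^'d \<Rightarrow> real" where
  "haar_tensor k i S = tensor_product (\<lambda>l. if l \<in> S then haar_function k (i l) else indicator (dyadic_interval k (i l)))"

lemma haar_level_Suc:
  "haar_level (Suc k) = {haar_tensor k i S | i S. (\<forall>l. i l \<in> {1..2 ^ k}) \<and> S \<noteq> {}}"
proof (intro subset_antisym subsetI)
  fix f :: "real^'d \<Rightarrow> real" assume "f \<in> haar_level (Suc k)"
  then obtain \<psi> i where f: "f = tensor_product \<psi>" and i: "\<And>l. i l \<in> {1..2 ^ k}"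
    and \<psi>: "\<And>l. \<psi> l = haar_function k (i l) \<or> \<psi> l = indicator (dyadic_interval k (i l))"
    and ex: "\<exists>l. \<psi> l = haar_function k (i l)" by auto
  define S where "S = {l. \<psi> l = haar_function k (i l)}"
  have "\<psi> = (\<lambda>l. if l \<in> S then haar_function k (i l) else indicator (dyadic_interval k (i l)))"
  proof
    fix l
    show "\<psi> l = (if l \<in> S then haar_function k (i l) else indicator (dyadic_interval k (i l)))"
      using \<psi>[of l] unfolding S_def by (cases "\<psi> l = haar_function k (i l)") auto
  qed
  then have "f = haar_tensor k i S" by (simp add: f haar_tensor_def)
  then show "f \<in> {haar_tensor k i S | i S. (\<forall>l. i l \<in> {1..2 ^ k}) \<and> S \<noteq> {}}" using i ex by (auto simp: S_def)
next
  fix f :: "real^'d \<Rightarrow> real" assume "f \<in> {haar_tensor k i S | i S. (\<forall>l. i l \<in> {1..2 ^ k}) \<and> S \<noteq> {}}"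
  then obtain i S where "f = haar_tensor k i S" "\<forall>l. i l \<in> {1..2 ^ k}" "S \<noteq> {}" by auto
  then show "f \<in> haar_level (Suc k)"
    by (auto simp: haar_tensor_def intro!: exI[of _ "\<lambda>l. if l \<in> S then haar_function k (i l) else indicator (dyadic_interval k (i l))"] exI[of _ i])
qed

text \<open>The value of a one-dimensional factor on the interval of level k + 1 with index c; b
  selects the oscillating one. It reduces pointwise identities to parity of c. The shift by 1 occurs
  because Haar indices start at 1 and cell indices at 0.\<close>

definition haar_factor :: "nat \<Rightarrow> nat \<Rightarrow> bool \<Rightarrow> int \<Rightarrow> real" where
  "haar_factor k i b c = (if c div 2 = int i - 1 then (if b \<and> odd c then - 1 else 1) else 0)"

lemma haar_tensor_eq:
  assumes i: "\<forall>l. 1 \<le> i l"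
  shows "haar_tensor k i S x = (\<Prod>l\<in>UNIV. haar_factor k (i l) (l \<in> S) (cell (Suc k) x l))"
  unfolding haar_tensor_def tensor_product_def
proof (rule prod.cong[OF refl])
  fix l
  have d: "\<lfloor>2 ^ k * x $ l\<rfloor> = cell (Suc k) x l div 2"
    using cell_div[of k "Suc k" x l] by (simp add: cell_def)
  have c: "\<lfloor>2 ^ Suc k * x $ l\<rfloor> = cell (Suc k) x l" by (simp add: cell_def)
  show "(if l \<in> S then haar_function k (i l) else indicator (dyadic_interval k (i l))) (x $ l) =
      haar_factor k (i l) (l \<in> S) (cell (Suc k) x l)"
  proof (cases "l \<in> S")
    case True
    have "\<And>c. c = 2 * (int (i l) - 1) \<longleftrightarrow> c div 2 = int (i l) - 1 \<and> even c"
       "\<And>c. c = 2 * (int (i l) - 1) + 1 \<longleftrightarrow> c div 2 = int (i l) - 1 \<and> odd c" by presburger+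
    then show ?thesis using True
      by (simp only: if_True haar_function_eq[OF i[rule_format]] c haar_factor_def) auto
  next
    case False
    then show ?thesis by (simp add: indicator_def dyadic_interval_iff d haar_factor_def)
  qed
qed

lemma dyadic_step_haar_tensor: "(\<forall>l. 1 \<le> i l) \<Longrightarrow> dyadic_step (Suc k) (haar_tensor k i S)"
  unfolding dyadic_step_def by (auto simp: haar_tensor_eq)

lemma avg_prod_cell:
  fixes G :: "'d::finite \<Rightarrow> int \<Rightarrow> real" and x :: "real^'d"
  shows "avg k (\<lambda>x. \<Prod>l\<in>UNIV. G l (cell (Suc k) x l)) x =
    (\<Prod>l\<in>UNIV. (G l (2 * cell k x l + 1) + G l (2 * cell k x l)) / 2)"
proof -
  have "\<lfloor>2 * real_of_int m\<rfloor> = 2 * m" for m by (metis floor_of_int of_int_mult of_int_numeral)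
  then show ?thesis
    using avg_tensor[of k "\<lambda>l z. G l \<lfloor>z * 2 ^ Suc k\<rfloor>" x]
    by (simp add: cell_def[abs_def] mult.commute[of _ "2 ^ Suc k"] del: power_Suc)
qed

lemma avg_haar_tensor:
  assumes "\<forall>l. 1 \<le> i l" "S \<noteq> {}"
  shows "avg k (haar_tensor k i S) x = 0"
proof -
  obtain l0 where "l0 \<in> S" using assms by blast
  then have "haar_factor k (i l0) (l0 \<in> S) (2 * cell k x l0 + 1) + haar_factor k (i l0) (l0 \<in> S) (2 * cell k x l0) = 0"
    by (simp add: haar_factor_def)
  then show ?thesis
    unfolding haar_tensor_eq[OF assms(1), abs_def] avg_prod_cell[of k "\<lambda>l. haar_factor k (i l) (l \<in> S)" x]
    by (intro prod_zero) (auto intro!: bexI[of _ l0])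
qed

text \<open>Orthogonality inside each parent cell: the average of the product factorises, and a
  coordinate in which the positions or the types differ contributes 0.\<close>

lemma avg_haar_tensor_mult:
  assumes i: "\<forall>l. 1 \<le> i l" and i': "\<forall>l. 1 \<le> i' l" and ne: "i \<noteq> i' \<or> S \<noteq> S'"
  shows "avg k (\<lambda>x. haar_tensor k i S x * haar_tensor k i' S' x) x = 0"
proof -
  obtain l0 where l0: "i l0 \<noteq> i' l0 \<or> (i l0 = i' l0 \<and> (l0 \<in> S) \<noteq> (l0 \<in> S'))"
    using ne by (auto simp: fun_eq_iff set_eq_iff)
  let ?G = "\<lambda>l c. haar_factor k (i l) (l \<in> S) c * haar_factor k (i' l) (l \<in> S') c"
  have "?G l0 (2 * cell k x l0 + 1) + ?G l0 (2 * cell k x l0) = 0"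
    using l0 i i' by (auto simp: haar_factor_def)
  then show ?thesis
    unfolding haar_tensor_eq[OF i] haar_tensor_eq[OF i'] prod.distrib[symmetric] avg_prod_cell[of k ?G x]
    by (intro prod_zero) (auto intro!: bexI[of _ l0])
qed

lemma haar_tensor_nonzero_iff:
  assumes i: "\<forall>l. 1 \<le> i l"
  shows "haar_tensor k i S x \<noteq> 0 \<longleftrightarrow> (\<forall>l. cell k x l = int (i l) - 1)"
proof -
  have "cell k x l = cell (Suc k) x l div 2" for l using cell_div[of k "Suc k" x l] by simp
  then show ?thesis unfolding haar_tensor_eq[OF i] by (auto simp: haar_factor_def)
qed

lemma abs_haar_tensor_le:
  assumes i: "\<forall>l. 1 \<le> i l"
  shows "\<bar>haar_tensor k i S x\<bar> \<le> 1"
  unfolding haar_tensor_eq[OF i] abs_prod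
  by (intro prod_le_1) (auto simp: haar_factor_def)

lemma avg_haar_tensor_square:
  assumes i: "\<forall>l. 1 \<le> i l" and "haar_tensor k i S x \<noteq> 0"
  shows "avg k (\<lambda>x. haar_tensor k i S x * haar_tensor k i S x) x = 1"
proof -
  have "cell k x l = int (i l) - 1" for l using assms haar_tensor_nonzero_iff[OF i] by blast
  then show ?thesis
    unfolding haar_tensor_eq[OF i] prod.distrib[symmetric]
      avg_prod_cell[of k "\<lambda>l c. haar_factor k (i l) (l \<in> S) c * haar_factor k (i l) (l \<in> S) c" x]
    by (intro prod.neutral ballI) (simp add: haar_factor_def)
qed

lemma haar_levelD:
  "f \<in> haar_level (Suc k) \<Longrightarrow>
    \<exists>i S. f = haar_tensor k i S \<and> (\<forall>l. 1 \<le> i l) \<and> (\<forall>l. i l \<le> 2 ^ k) \<and> S \<noteq> {}"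
  unfolding haar_level_Suc by auto

lemma haar_level_dyadic_step:
  assumes "f \<in> haar_level k" shows "dyadic_step k f"
proof (cases k)
  case 0
  then have "f = indicator unit_cube" using assms by simp
  then show ?thesis using half_cube_sub by (auto simp: dyadic_step_def indicator_def)
next
  case (Suc k')
  with assms obtain i S where "f = haar_tensor k' i S" "\<forall>l. 1 \<le> i l" using haar_levelD by blast
  then show ?thesis using dyadic_step_haar_tensor Suc by blast
qed

lemma avg_haar_level: "f \<in> haar_level (Suc k) \<Longrightarrow> avg k f x = 0"
  by (metis avg_haar_tensor haar_levelD)

lemma haar_level_nonzero:
  assumes "f \<in> haar_level k" shows "\<exists>x\<in>half_cube. f x \<noteq> 0"
proof (cases k)
  case 0
  then have "f = indicator unit_cube" using assms by simp
  moreover have "(0 :: real^'a) \<in> half_cube" by (simp add: half_cube_def)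
  ultimately show ?thesis using half_cube_sub by (intro bexI[of _ 0]) (auto simp: indicator_def)
next
  case (Suc k')
  with assms obtain i S where f: "f = haar_tensor k' i S" "\<forall>l. 1 \<le> i l" and i: "\<forall>l. i l \<le> 2 ^ k'" using haar_levelD by blast
  have "0 \<le> int (i l) - 1 \<and> int (i l) - 1 < 2 ^ k'" for l
  proof -
    have "int (i l) \<le> 2 ^ k'" using i by (metis of_nat_le_iff of_nat_numeral of_nat_power)
    moreover have "1 \<le> i l" using f(2) by blast
    ultimately show ?thesis by linarith
  qed
  then have "(\<lambda>l. int (i l) - 1) \<in> grid k'" unfolding grid_def by blast
  then show ?thesis using f haar_tensor_nonzero_iff[OF f(2), of k' S]
    by (intro bexI[of _ "grid_point k' (\<lambda>l. int (i l) - 1)"] grid_point_in) auto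
qed

text \<open>A function of a lower level is fixed by averaging over the parent cells of the higher
  level, whereas a function of the higher level is averaged to 0; a function of both kinds would
  vanish.\<close>

lemma haar_level_disjoint:
  assumes "f \<in> haar_level j" "f \<in> haar_level k" shows "j = k"
proof -
  have False if jk: "j < k" and f: "f \<in> haar_level j" "f \<in> haar_level k" for j k
  proof -
    obtain k' where k: "k = Suc k'" using jk by (cases k) auto
    have "dyadic_step k' f" by (rule dyadic_step_mono[OF haar_level_dyadic_step[OF f(1)]]) (use jk k in simp)
    then have "f x = 0" if "x \<in> half_cube" for x
      using avg_step[of k' f x] avg_haar_level[of f k' x] f(2) that unfolding k by simp
    then show False using haar_level_nonzero[OF f(2)] by blast
  qed
  then show ?thesis using assms by (meson linorder_neqE_nat)
qed

lemma finite_haar_level: "finite (haar_level k)"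
proof (cases k)
  case (Suc k')
  have "haar_level (Suc k') \<subseteq> (\<lambda>(i, S). haar_tensor k' i S) ` (PiE UNIV (\<lambda>_. {1..2 ^ k'}) \<times> UNIV)"
    unfolding haar_level_Suc by (auto simp: PiE_def extensional_def Pi_def intro!: image_eqI)
  moreover have "finite ((PiE UNIV (\<lambda>_. {1..2 ^ k'}) :: ('a \<Rightarrow> nat) set) \<times> (UNIV :: 'a set set))"
    by (intro finite_cartesian_product finite_PiE) auto
  ultimately show ?thesis unfolding Suc by (blast intro: finite_subset finite_imageI)
qed simp

text \<open>At x only tensors located at the cell of x survive, and these are indexed by subsets
  S.\<close>

lemma card_haar_level_at:
  fixes x :: "real^'d"
  shows "card {f \<in> haar_level (Suc k). f x \<noteq> 0} \<le> 2 ^ CARD('d)"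
proof -
  have "{f \<in> haar_level (Suc k). f x \<noteq> 0} \<subseteq> (\<lambda>S. haar_tensor k (\<lambda>l. nat (cell k x l + 1)) S) ` UNIV"
  proof
    fix f assume "f \<in> {f \<in> haar_level (Suc k). f x \<noteq> 0}"
    then obtain i S where f: "f = haar_tensor k i S" "\<forall>l. 1 \<le> i l" "f x \<noteq> 0"
      using haar_levelD by blast
    then have "i = (\<lambda>l. nat (cell k x l + 1))" using haar_tensor_nonzero_iff[OF f(2), of k S x] by auto
    then show "f \<in> (\<lambda>S. haar_tensor k (\<lambda>l. nat (cell k x l + 1)) S) ` UNIV" using f by auto
  qed
  then have "card {f \<in> haar_level (Suc k). f x \<noteq> 0} \<le> card (UNIV :: 'd set set)"
    by (meson card_image_le card_mono finite finite_imageI order_trans)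
  then show ?thesis using card_Pow[of "UNIV :: 'd set"] by simp
qed

text \<open>Orthogonality recovers the coefficient as the local mean of the sum against its Haar
  function, which is bounded by 1. The bound uses only values in the cell where that function
  lives.\<close>

lemma haar_coefficient_le:
  fixes h :: "nat \<Rightarrow> real^'d \<Rightarrow> real"
  assumes M: "finite M" "inj_on h M" "\<And>m. m \<in> M \<Longrightarrow> h m \<in> haar_level (Suc k)" and m: "m \<in> M" and x: "h m x \<noteq> 0"
  shows "\<bar>c m\<bar> \<le> avg k (\<lambda>x. \<bar>\<Sum>m\<in>M. c m * h m x\<bar>) x"
proof -
  define g where "g x = (\<Sum>m\<in>M. c m * h m x)" for x
  have orth: "avg k (\<lambda>x. h n x * h m x) x = of_bool (n = m)" if n: "n \<in> M" for n
  proof -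
    obtain i S where i: "h m = haar_tensor k i S" "\<forall>l. 1 \<le> i l" using haar_levelD[OF M(3)[OF m]] by blast
    obtain i' S' where i': "h n = haar_tensor k i' S'" "\<forall>l. 1 \<le> i' l" using haar_levelD[OF M(3)[OF n]] by blast
    show ?thesis
    proof (cases "n = m")
      case True
      then show ?thesis using avg_haar_tensor_square[OF i(2), of k S x] x i(1) by simp
    next
      case False
      then have "h n \<noteq> h m" using M(2) n m by (auto dest: inj_onD)
      then have "i' \<noteq> i \<or> S' \<noteq> S" using i(1) i'(1) by auto
      then show ?thesis using avg_haar_tensor_mult[OF i'(2) i(2)] False i i' by simp
    qed
  qed
  have "avg k (\<lambda>x. g x * h m x) x = avg k (\<lambda>x. \<Sum>n\<in>M. c n * (h n x * h m x)) x"
    by (simp add: g_def sum_distrib_right mult.assoc)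
  also have "\<dots> = (\<Sum>n\<in>M. c n * of_bool (n = m))"
    unfolding avg_sum avg_cmult using orth by (intro sum.cong) auto
  also have "\<dots> = c m" using M(1) m by (simp add: of_bool_def if_distrib[of "\<lambda>z. _ * z"] sum.delta cong: if_cong)
  finally have "\<bar>c m\<bar> = \<bar>avg k (\<lambda>x. g x * h m x) x\<bar>" by simp
  also have "\<dots> \<le> avg k (\<lambda>x. \<bar>g x\<bar>) x"
  proof -
    obtain i S where i: "h m = haar_tensor k i S" "\<forall>l. 1 \<le> i l" using haar_levelD[OF M(3)[OF m]] by blast
    have "\<bar>g y * h m y\<bar> \<le> \<bar>g y\<bar>" for y
      using abs_haar_tensor_le[OF i(2), of k S y] i(1) by (simp add: abs_mult mult_left_le)
    then have "\<bar>\<Sum>S\<in>UNIV. g (grid_point (Suc k) (child k x S)) * h m (grid_point (Suc k) (child k x S))\<bar>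
        \<le> (\<Sum>S\<in>UNIV. \<bar>g (grid_point (Suc k) (child k x S))\<bar>)"
      by (intro order_trans[OF sum_abs] sum_mono)
    then show ?thesis unfolding avg_def by (simp add: abs_divide divide_right_mono)
  qed
  finally show ?thesis by (simp add: g_def)
qed

text \<open>Unconditionality within one level. Pointwise at most 2^d terms are present, each bounded
  by the local mean of the full sum; that mean costs one factor of averaging growth. Subsets
  therefore cost a constant independent of the level.\<close>

lemma haar_level_subsum:
  fixes h :: "nat \<Rightarrow> real^'d \<Rightarrow> real"
  assumes p: "0 < p" and M: "finite M" "inj_on h M" "\<And>m. m \<in> M \<Longrightarrow> h m \<in> haar_level (Suc k)" and sub: "M' \<subseteq> M"
  shows "Lp_pow p (\<lambda>x. \<Sum>m\<in>M'. c m * h m x) \<le>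
     (2 ^ CARD('d)) powr p * avg_growth p TYPE('d) * Lp_pow p (\<lambda>x. \<Sum>m\<in>M. c m * h m x)"
proof -
  define g where "g x = \<bar>\<Sum>m\<in>M. c m * h m x\<bar>" for x
  define g' where "g' x = (\<Sum>m\<in>M'. c m * h m x)" for x
  have st: "dyadic_step (Suc k) (\<lambda>x. \<Sum>m\<in>M''. c m * h m x)" if "M'' \<subseteq> M" for M''
    using that M(3) by (intro dyadic_step_sum dyadic_step_cmult haar_level_dyadic_step) auto
  have sg: "dyadic_step (Suc k) g" unfolding g_def dyadic_step_def
  proof (intro ballI impI arg_cong[where f = abs])
    fix x y :: "real^'d" assume "x \<in> half_cube" "y \<in> half_cube" "cell (Suc k) x = cell (Suc k) y"
    then show "(\<Sum>m\<in>M. c m * h m x) = (\<Sum>m\<in>M. c m * h m y)"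
      by (rule dyadic_stepD[OF st[OF subset_refl]])
  qed
  have bd: "\<bar>g' x\<bar> \<le> \<bar>2 ^ CARD('d) * avg k g x\<bar>" for x
  proof -
    define T where "T = {m \<in> M'. h m x \<noteq> 0}"
    have T: "finite T" "T \<subseteq> M'" using finite_subset[OF sub M(1)] by (auto simp: T_def)
    have a0: "0 \<le> avg k g x" unfolding avg_def g_def by (intro divide_nonneg_nonneg sum_nonneg) auto
    have "g' x = (\<Sum>m\<in>T. c m * h m x)"
      unfolding g'_def using finite_subset[OF sub M(1)] by (intro sum.mono_neutral_right) (auto simp: T_def)
    then have "\<bar>g' x\<bar> \<le> (\<Sum>m\<in>T. \<bar>c m * h m x\<bar>)" by simp
    also have "\<dots> \<le> (\<Sum>m\<in>T. avg k g x)"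
    proof (rule sum_mono)
      fix m assume m: "m \<in> T"
      then have mM: "m \<in> M" "h m x \<noteq> 0" using sub by (auto simp: T_def)
      obtain i S where i: "h m = haar_tensor k i S" "\<forall>l. 1 \<le> i l" using haar_levelD[OF M(3)[OF mM(1)]] by blast
      have "\<bar>c m * h m x\<bar> \<le> \<bar>c m\<bar>"
        using abs_haar_tensor_le[OF i(2), of k S x] i(1) by (simp add: abs_mult mult_left_le)
      also have "\<dots> \<le> avg k g x" unfolding g_def by (rule haar_coefficient_le[OF M mM])
      finally show "\<bar>c m * h m x\<bar> \<le> avg k g x" .
    qed
    also have "\<dots> = real (card T) * avg k g x" by simp
    also have "\<dots> \<le> 2 ^ CARD('d) * avg k g x"
    proof (intro mult_right_mono a0)
      have "card T = card (h ` T)" using M(2) T sub by (metis card_image inj_on_subset)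
      also have "\<dots> \<le> card {f \<in> haar_level (Suc k). f x \<noteq> 0}"
        using M(3) T sub by (intro card_mono) (auto simp: T_def finite_haar_level simp del: haar_level.simps)
      also have "\<dots> \<le> 2 ^ CARD('d)" by (rule card_haar_level_at)
      finally have "real (card T) \<le> real (2 ^ CARD('d))" by (simp only: of_nat_le_iff)
      then show "real (card T) \<le> 2 ^ CARD('d)" by simp
    qed
    finally show ?thesis by simp
  qed
  have "Lp_pow p g' \<le> Lp_pow p (\<lambda>x. 2 ^ CARD('d) * avg k g x)"
    using st[OF sub] unfolding g'_def[symmetric]
    by (intro Lp_pow_mono_step[of "Suc k"] bd p dyadic_step_cmult dyadic_step_mono[OF dyadic_step_avg]) auto
  also have "\<dots> = (2 ^ CARD('d)) powr p * Lp_pow p (avg k g)"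
    using scale_in_Lp_space(2)[OF p dyadic_step_Lp(1)[OF dyadic_step_avg[of k g]], of "2 ^ CARD('d)"] by simp
  also have "\<dots> \<le> (2 ^ CARD('d)) powr p * (avg_growth p TYPE('d) * Lp_pow p g)"
    by (intro mult_left_mono Lp_pow_avg_le p sg) auto
  also have "Lp_pow p g = Lp_pow p (\<lambda>x. \<Sum>m\<in>M. c m * h m x)" by (simp add: Lp_pow_def g_def)
  finally show ?thesis by (simp add: g'_def mult.assoc)
qed

text \<open>Coefficients are indexed by the Haar functions themselves, which keeps the notion
  independent of any enumeration.\<close>

definition haar_span :: "nat \<Rightarrow> (real^'d \<Rightarrow> real) \<Rightarrow> bool" where
  "haar_span k u \<longleftrightarrow> (\<exists>c. \<forall>x\<in>half_cube. u x = (\<Sum>f\<in>(\<Union>j\<le>k. haar_level j). c f * f x))"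

lemma haar_span_sum:
  assumes "finite A" "\<And>a. a \<in> A \<Longrightarrow> haar_span k (u a)"
  shows "haar_span k (\<lambda>x. \<Sum>a\<in>A. w a * u a x)"
proof -
  have "\<forall>a\<in>A. \<exists>c. \<forall>x\<in>half_cube. u a x = (\<Sum>f\<in>(\<Union>j\<le>k. haar_level j). c f * f x)"
    using assms(2) unfolding haar_span_def by blast
  from bchoice[OF this] obtain c
    where c: "\<And>a x. a \<in> A \<Longrightarrow> x \<in> half_cube \<Longrightarrow> u a x = (\<Sum>f\<in>(\<Union>j\<le>k. haar_level j). c a f * f x)"
    by blast
  have "(\<Sum>a\<in>A. w a * u a x) = (\<Sum>f\<in>(\<Union>j\<le>k. haar_level j). (\<Sum>a\<in>A. w a * c a f) * f x)" if "x \<in> half_cube" for x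
    using c that by (simp add: sum_distrib_left sum_distrib_right mult.assoc) (rule sum.swap)
  then show ?thesis unfolding haar_span_def by (intro exI[of _ "\<lambda>f. \<Sum>a\<in>A. w a * c a f"]) blast
qed

lemma haar_span_level:
  assumes "f \<in> haar_level j" "j \<le> k" shows "haar_span k f"
proof -
  have f: "f \<in> (\<Union>j\<le>k. haar_level j)" using assms by auto
  have "f x = (\<Sum>g\<in>(\<Union>j\<le>k. haar_level j). of_bool (g = f) * g x)" for x
  proof -
    have "(\<Sum>g\<in>(\<Union>j\<le>k. haar_level j). of_bool (g = f) * g x) = (\<Sum>g\<in>(\<Union>j\<le>k. haar_level j). if g = f then g x else 0)"
      by (intro sum.cong) auto
    then show ?thesis using f by (simp add: sum.delta finite_haar_level)
  qed
  then show ?thesis unfolding haar_span_def by (intro exI[of _ "\<lambda>g. of_bool (g = f)"]) blast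
qed

lemma haar_span_mono:
  assumes "haar_span k u" "k \<le> j" shows "haar_span j u"
proof -
  let ?L = "\<Union>j\<le>k. haar_level j"
  obtain c where c: "\<And>x. x \<in> half_cube \<Longrightarrow> u x = (\<Sum>f\<in>?L. c f * f x)" using assms(1) unfolding haar_span_def by blast
  have "haar_span j (\<lambda>x. \<Sum>f\<in>?L. c f * f x)"
    using assms(2) by (intro haar_span_sum) (auto simp: finite_haar_level intro: haar_span_level)
  then show ?thesis using c unfolding haar_span_def by auto
qed

text \<open>The indicator of a child cell is a product of factors \<open>(\<chi> \<plusminus> h) / 2\<close>.\<close>

lemma haar_span_cell: "a \<in> grid k \<Longrightarrow> haar_span k (\<lambda>x. of_bool (cell k x = a))"
proof (induction k arbitrary: a)
  case 0
  have "cell 0 x = a" if "x \<in> half_cube" for x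
    using cell_in[OF that, of 0] 0 by (auto simp: grid_def fun_eq_iff) (metis int_one_le_iff_zero_less linorder_not_less order_antisym)
  then have "of_bool (cell 0 x = a) = (indicator unit_cube x :: real)" if "x \<in> half_cube" for x
    using that half_cube_sub by (auto simp: indicator_def)
  moreover have "haar_span 0 (indicator (unit_cube :: (real^'a) set))" by (rule haar_span_level[of _ 0]) auto
  ultimately show ?case unfolding haar_span_def by auto
next
  case (Suc k)
  define i where "i l = nat (a l div 2 + 1)" for l
  have a: "0 \<le> a l" "a l < 2 * 2 ^ k" for l using Suc.prems by (auto simp: grid_def)
  have i: "\<forall>l. 1 \<le> i l" "\<And>l. int (i l) - 1 = a l div 2"
  proof -
    have "0 \<le> a l div 2" for l using a(1)[of l] by (simp add: pos_imp_zdiv_nonneg_iff)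
    moreover from this have "1 \<le> a l div 2 + 1" for l by (simp add: algebra_simps)
    ultimately show "\<forall>l. 1 \<le> i l" "\<And>l. int (i l) - 1 = a l div 2" by (simp_all add: i_def le_nat_iff)
  qed
  have i2: "i l \<le> 2 ^ k" for l
  proof -
    have "a l div 2 < 2 ^ k" using a[of l] by simp
    then have "int (i l) \<le> 2 ^ k" using i(2)[of l] by linarith
    then show ?thesis by (metis of_nat_le_iff of_nat_numeral of_nat_power)
  qed
  \<comment> \<open>The oscillating factor is -1 on the odd half, so this sign makes half the sum of
    the two factors the indicator of the wanted half.\<close>
  define \<epsilon> :: "'a \<Rightarrow> real" where "\<epsilon> l = (if odd (a l) then - 1 else 1)" for l
  have fac: "of_bool (c = a l) = \<epsilon> l * haar_factor k (i l) True c / 2 + haar_factor k (i l) False c / 2" for c l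
  proof -
    have "c = a l \<longleftrightarrow> c div 2 = a l div 2 \<and> odd c = odd (a l)" by (metis bit_eq_rec)
    then show ?thesis by (auto simp: haar_factor_def i(2) \<epsilon>_def)
  qed
  have "of_bool (cell (Suc k) x = a) = (\<Sum>S\<in>UNIV. (\<Prod>l\<in>S. \<epsilon> l) / 2 ^ CARD('a) * haar_tensor k i S x)" for x
  proof -
    let ?f = "\<lambda>l. \<epsilon> l * haar_factor k (i l) True (cell (Suc k) x l) / 2"
    let ?g = "\<lambda>l. haar_factor k (i l) False (cell (Suc k) x l) / 2"
    have "of_bool (cell (Suc k) x = a) = (\<Prod>l\<in>UNIV. of_bool (cell (Suc k) x l = a l) :: real)"
      by (auto simp: fun_eq_iff of_bool_def)
    also have "\<dots> = (\<Prod>l\<in>UNIV. ?f l + ?g l)" unfolding fac ..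
    also have "\<dots> = (\<Sum>S\<in>UNIV. prod ?f S * prod ?g (UNIV - S))" by (subst prod_add) auto
    also have "\<dots> = (\<Sum>S\<in>UNIV. (\<Prod>l\<in>S. \<epsilon> l) / 2 ^ CARD('a) * haar_tensor k i S x)"
    proof (rule sum.cong[OF refl])
      fix S :: "'a set"
      have "haar_tensor k i S x = (\<Prod>l\<in>UNIV. if l \<in> S then haar_factor k (i l) True (cell (Suc k) x l) else haar_factor k (i l) False (cell (Suc k) x l))"
        unfolding haar_tensor_eq[OF i(1)] by (intro prod.cong) auto
      also have "\<dots> = (\<Prod>l\<in>S. haar_factor k (i l) True (cell (Suc k) x l)) * (\<Prod>l\<in>UNIV - S. haar_factor k (i l) False (cell (Suc k) x l))"
        by (subst prod.If_cases) (auto simp: Compl_eq_Diff_UNIV)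
      finally have ht: "haar_tensor k i S x = \<dots>" .
      have "CARD('a) = card S + card (UNIV - S)" by (metis card_Diff_subset card_mono finite le_add_diff_inverse subset_UNIV)
      then have "(2::real) ^ CARD('a) = 2 ^ card S * 2 ^ card (UNIV - S)" by (simp add: power_add)
      then show "prod ?f S * prod ?g (UNIV - S) = (\<Prod>l\<in>S. \<epsilon> l) / 2 ^ CARD('a) * haar_tensor k i S x"
        unfolding ht by (simp add: prod_dividef prod.distrib)
    qed
    finally show ?thesis .
  qed
  \<comment> \<open>The empty S gives the indicator of the parent cell, covered by the induction
    hypothesis; all other S give members of the system.\<close>
  moreover have "haar_span (Suc k) (haar_tensor k i S)" for S
  proof (cases "S = {}")
    case True
    have "a l div 2 < 2 ^ k" for l using a[of l] by simp
    then have "(\<lambda>l. a l div 2) \<in> grid k" using a by (auto simp: grid_def pos_imp_zdiv_nonneg_iff)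
    then have *: "haar_span k (\<lambda>x. of_bool (cell k x = (\<lambda>l. a l div 2)))" by (rule Suc.IH)
    have "haar_tensor k i S x = of_bool (cell k x = (\<lambda>l. a l div 2))" for x
    proof -
      have "cell k x l = cell (Suc k) x l div 2" for l using cell_div[of k "Suc k" x l] by simp
      then show ?thesis unfolding haar_tensor_eq[OF i(1)] True
        by (auto simp: haar_factor_def i(2) fun_eq_iff of_bool_def)
    qed
    then have "haar_tensor k i S = (\<lambda>x. of_bool (cell k x = (\<lambda>l. a l div 2)))" by blast
    then show ?thesis using haar_span_mono[OF *, of "Suc k"] by simp
  next
    case False
    then have "haar_tensor k i S \<in> haar_level (Suc k)"
      using i(1) i2 unfolding haar_level_Suc mem_Collect_eq by (intro exI[of _ i] exI[of _ S] conjI) auto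
    then show ?thesis by (rule haar_span_level) simp
  qed
  ultimately show ?case by (simp only:) (intro haar_span_sum; simp)
qed

lemma haar_span_dyadic_step:
  fixes u :: "real^'d \<Rightarrow> real"
  assumes u: "dyadic_step k u" shows "haar_span k u"
proof -
  have "haar_span k (\<lambda>x. \<Sum>a\<in>grid k. u (grid_point k a) * of_bool (cell k x = a))"
    by (intro haar_span_sum haar_span_cell) auto
  moreover have "u x = (\<Sum>a\<in>grid k. u (grid_point k a) * of_bool (cell k x = a))" if "x \<in> half_cube" for x
  proof -
    have "(\<Sum>a\<in>grid k. u (grid_point k a) * of_bool (cell k x = a)) = (\<Sum>a\<in>grid k. if a = cell k x then u (grid_point k a) else 0)"
      by (intro sum.cong) auto
    then show ?thesis using cell_in[OF that, of k] dyadic_step_grid_point[OF u that] by (simp add: sum.delta')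
  qed
  ultimately show ?thesis unfolding haar_span_def by auto
qed

section \<open>Bases in quasi-normed spaces\<close>

definition lincomb :: "nat set \<Rightarrow> (nat \<Rightarrow> real) \<Rightarrow> (nat \<Rightarrow> 'a \<Rightarrow> real) \<Rightarrow> 'a \<Rightarrow> real" where
  "lincomb M c b x = (\<Sum>m\<in>M. c m * b m x)"

text \<open>\<phi> stands for the q-th power of an equivalent quasi-norm, hence the homogeneity in
  \<bar>a\<bar>^q; N is tied to it only through null sequences. The two decisive assumptions are
  density of finite combinations and the uniform bound on initial segments. Limits are taken of
  scalar coefficients only.\<close>

locale quasi_norm_basis =
  fixes X :: "('a \<Rightarrow> real) set" and \<phi> N :: "('a \<Rightarrow> real) \<Rightarrow> real" and b :: "nat \<Rightarrow> 'a \<Rightarrow> real" and q K C :: real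
  assumes q: "0 < q" and K: "1 \<le> K" and C: "1 \<le> C"
    and nonneg: "\<And>f. f \<in> X \<Longrightarrow> 0 \<le> \<phi> f"
    and add_in: "\<And>f g. f \<in> X \<Longrightarrow> g \<in> X \<Longrightarrow> (\<lambda>x. f x + g x) \<in> X"
    and quasi: "\<And>f g. f \<in> X \<Longrightarrow> g \<in> X \<Longrightarrow> \<phi> (\<lambda>x. f x + g x) \<le> K * (\<phi> f + \<phi> g)"
    and scale_in: "\<And>a f. f \<in> X \<Longrightarrow> (\<lambda>x. a * f x) \<in> X"
    and scale: "\<And>a f. f \<in> X \<Longrightarrow> \<phi> (\<lambda>x. a * f x) \<le> \<bar>a\<bar> powr q * \<phi> f"
    and equiv: "\<And>F :: nat \<Rightarrow> _. (\<And>n. F n \<in> X) \<Longrightarrow> (\<lambda>n. N (F n)) \<longlonglongrightarrow> 0 \<longleftrightarrow> (\<lambda>n. \<phi> (F n)) \<longlonglongrightarrow> 0"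
    and b_in: "\<And>m. b m \<in> X" and b_pos: "\<And>m. 0 < \<phi> (b m)"
    and dense: "\<And>f e. f \<in> X \<Longrightarrow> 0 < e \<Longrightarrow> \<exists>M c. finite M \<and> \<phi> (\<lambda>x. f x - lincomb M c b x) < e"
    and bounded: "\<And>M c n. finite M \<Longrightarrow> \<phi> (lincomb {m \<in> M. m < n} c b) \<le> C * \<phi> (lincomb M c b)"
begin

lemma diff_in: "f \<in> X \<Longrightarrow> g \<in> X \<Longrightarrow> (\<lambda>x. f x - g x) \<in> X"
  using add_in[of f "\<lambda>x. - 1 * g x"] scale_in[of g "- 1"] by simp

lemma quasi_diff: "f \<in> X \<Longrightarrow> g \<in> X \<Longrightarrow> \<phi> (\<lambda>x. f x - g x) \<le> K * (\<phi> f + \<phi> g)"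
proof -
  assume fg: "f \<in> X" "g \<in> X"
  have "\<phi> (\<lambda>x. f x + - 1 * g x) \<le> K * (\<phi> f + \<phi> (\<lambda>x. - 1 * g x))"
    using fg by (intro quasi scale_in)
  also have "\<dots> \<le> K * (\<phi> f + \<phi> g)"
    using scale[OF fg(2), of "- 1"] K by (intro mult_left_mono add_left_mono) auto
  finally show ?thesis by simp
qed

lemma zero_in: "(\<lambda>_. 0) \<in> X"
  using scale_in[OF b_in, of 0] by simp

lemma \<phi>_zero: "\<phi> (\<lambda>_. 0) = 0"
  using scale[OF b_in, of 0] nonneg[OF zero_in] by simp

lemma lincomb_in: "finite M \<Longrightarrow> lincomb M c b \<in> X"
proof (induction M rule: finite_induct)
  case empty
  then show ?case using zero_in by (simp add: lincomb_def[abs_def])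
next
  case (insert m M)
  have "lincomb (insert m M) c b = (\<lambda>x. c m * b m x + lincomb M c b x)"
    using insert by (auto simp: lincomb_def)
  then show ?case using insert by (simp add: add_in scale_in b_in)
qed

lemma lincomb_tendsto_0:
  assumes "finite M" "\<And>m. m \<in> M \<Longrightarrow> (\<lambda>j. d j m) \<longlonglongrightarrow> 0"
  shows "(\<lambda>j. \<phi> (lincomb M (d j) b)) \<longlonglongrightarrow> 0"
  using assms
proof (induction M rule: finite_induct)
  case empty
  then show ?case using \<phi>_zero by (simp add: lincomb_def[abs_def])
next
  case (insert m M)
  have e: "lincomb (insert m M) (d j) b = (\<lambda>x. d j m * b m x + lincomb M (d j) b x)" for j
    using insert by (auto simp: lincomb_def)
  have lim: "(\<lambda>j. K * (\<bar>d j m\<bar> powr q * \<phi> (b m) + \<phi> (lincomb M (d j) b))) \<longlonglongrightarrow> K * (0 * \<phi> (b m) + 0)"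
  proof (intro tendsto_intros)
    show "(\<lambda>j. \<bar>d j m\<bar> powr q) \<longlonglongrightarrow> 0"
      using insert.prems[of m] q by (intro tendsto_zero_powrI[where b = q] tendsto_rabs_zero) auto
    show "(\<lambda>j. \<phi> (lincomb M (d j) b)) \<longlonglongrightarrow> 0" using insert by auto
  qed
  show ?case
  proof (rule tendsto_sandwich[OF _ _ tendsto_const])
    show "\<forall>\<^sub>F j in sequentially. 0 \<le> \<phi> (lincomb (insert m M) (d j) b)"
      using insert by (intro always_eventually allI nonneg lincomb_in) auto
    show "\<forall>\<^sub>F j in sequentially. \<phi> (lincomb (insert m M) (d j) b) \<le> K * (\<bar>d j m\<bar> powr q * \<phi> (b m) + \<phi> (lincomb M (d j) b))"
    proof (intro always_eventually allI)
      fix j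
      have "\<phi> (lincomb (insert m M) (d j) b) \<le> K * (\<phi> (\<lambda>x. d j m * b m x) + \<phi> (lincomb M (d j) b))"
        unfolding e using insert by (intro quasi scale_in b_in lincomb_in) auto
      also have "\<dots> \<le> K * (\<bar>d j m\<bar> powr q * \<phi> (b m) + \<phi> (lincomb M (d j) b))"
        using K by (intro mult_left_mono add_right_mono scale b_in) auto
      finally show "\<phi> (lincomb (insert m M) (d j) b) \<le> K * (\<bar>d j m\<bar> powr q * \<phi> (b m) + \<phi> (lincomb M (d j) b))" .
    qed
    show "(\<lambda>j. K * (\<bar>d j m\<bar> powr q * \<phi> (b m) + \<phi> (lincomb M (d j) b))) \<longlonglongrightarrow> 0" using lim by simp
  qed
qed

text \<open>A single term is the difference of two consecutive initial segments, both bounded by the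
  whole combination.\<close>

lemma coordinate_bound:
  assumes "finite M" "m \<in> M"
  shows "\<bar>c m\<bar> powr q \<le> 2 * K * C / \<phi> (b m) * \<phi> (lincomb M c b)"
proof (cases "c m = 0")
  case True
  then show ?thesis using nonneg[OF lincomb_in[OF assms(1)]] K C b_pos[of m] by simp
next
  case False
  have e: "(\<lambda>x. c m * b m x) = (\<lambda>x. lincomb {i \<in> M. i < Suc m} c b x - lincomb {i \<in> M. i < m} c b x)"
  proof
    fix x
    have "{i \<in> M. i < Suc m} = insert m {i \<in> M. i < m}" using assms by auto
    then show "c m * b m x = lincomb {i \<in> M. i < Suc m} c b x - lincomb {i \<in> M. i < m} c b x"
      using assms by (simp add: lincomb_def)
  qed
  have "\<phi> (\<lambda>x. c m * b m x) \<le> K * (\<phi> (lincomb {i \<in> M. i < Suc m} c b) + \<phi> (lincomb {i \<in> M. i < m} c b))"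
    unfolding e using assms by (intro quasi_diff lincomb_in) auto
  also have "\<dots> \<le> K * (C * \<phi> (lincomb M c b) + C * \<phi> (lincomb M c b))"
    using K by (intro mult_left_mono add_mono bounded assms) auto
  finally have 1: "\<phi> (\<lambda>x. c m * b m x) \<le> 2 * K * C * \<phi> (lincomb M c b)" by simp
  have "\<phi> (b m) = \<phi> (\<lambda>x. (1 / c m) * (c m * b m x))" using False by simp
  also have "\<dots> \<le> \<bar>1 / c m\<bar> powr q * \<phi> (\<lambda>x. c m * b m x)" by (intro scale scale_in b_in)
  also have "\<dots> = \<phi> (\<lambda>x. c m * b m x) / \<bar>c m\<bar> powr q" using False by (simp add: powr_divide)
  finally have "\<bar>c m\<bar> powr q * \<phi> (b m) \<le> 2 * K * C * \<phi> (lincomb M c b)"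
    using 1 False by (simp add: field_simps)
  then show ?thesis using b_pos[of m] by (simp add: field_simps)
qed

lemma lincomb_diff: "(\<lambda>x. lincomb M c b x - lincomb M c' b x) = lincomb M (\<lambda>m. c m - c' m) b"
  by (auto simp: lincomb_def sum_subtractf left_diff_distrib)

lemma series_iff:
  assumes "f \<in> X"
  shows "series_converges_to N b c f \<longleftrightarrow> (\<lambda>n. \<phi> (\<lambda>x. f x - lincomb {..<n} c b x)) \<longlonglongrightarrow> 0"
  unfolding series_converges_to_def lincomb_def[symmetric]
  using assms by (intro equiv diff_in lincomb_in) auto

lemma dense_initial:
  assumes "f \<in> X" "0 < e"
  shows "\<exists>n c. \<phi> (\<lambda>x. f x - lincomb {..<n} c b x) < e \<and> (\<forall>m\<ge>n. c m = 0)"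
proof -
  obtain M c where M: "finite M" "\<phi> (\<lambda>x. f x - lincomb M c b x) < e" using dense[OF assms] by blast
  obtain n where n: "M \<subseteq> {..<n}" using finite_nat_bounded[OF M(1)] by blast
  define c' where "c' m = (if m \<in> M then c m else 0)" for m
  have "lincomb {..<n} c' b = lincomb M c b"
  proof
    fix x
    show "lincomb {..<n} c' b x = lincomb M c b x"
      unfolding lincomb_def using n by (intro sum.mono_neutral_cong_right) (auto simp: c'_def)
  qed
  then show ?thesis using M n by (intro exI[of _ n] exI[of _ c']) (auto simp: c'_def)
qed

text \<open>Coefficients of approximating finite combinations form Cauchy sequences, which defines the expansion
  of a general element without extending the coordinate functionals explicitly.\<close>

lemma expansion_exists:
  assumes f: "f \<in> X"
  shows "\<exists>c. series_converges_to N b c f"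
proof -
  define \<epsilon> where "\<epsilon> i = 1 / real (Suc i)" for i
  have \<epsilon>: "0 < \<epsilon> i" for i by (simp add: \<epsilon>_def)
  have \<epsilon>_lim: "\<epsilon> \<longlonglongrightarrow> 0" unfolding \<epsilon>_def by (rule LIMSEQ_Suc[OF lim_1_over_n])
  have "\<exists>n c. \<phi> (\<lambda>x. f x - lincomb {..<n} c b x) < \<epsilon> i \<and> (\<forall>m\<ge>n. c m = 0)" for i
    by (rule dense_initial[OF f \<epsilon>])
  then obtain n \<gamma> where n: "\<And>i. \<phi> (\<lambda>x. f x - lincomb {..<n i} (\<gamma> i) b x) < \<epsilon> i" "\<And>i m. m \<ge> n i \<Longrightarrow> \<gamma> i m = 0"
    by metis
  have ext: "lincomb {..<k} (\<gamma> i) b = lincomb {..<n i} (\<gamma> i) b" if "k \<ge> n i" for k i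
  proof
    fix x
    show "lincomb {..<k} (\<gamma> i) b x = lincomb {..<n i} (\<gamma> i) b x"
      unfolding lincomb_def using that n(2) by (intro sum.mono_neutral_right) auto
  qed
  have gij: "\<phi> (lincomb {..<k} (\<lambda>m. \<gamma> i m - \<gamma> j m) b) \<le> C * (K * (\<epsilon> i + \<epsilon> j))" for k i j
  proof -
    define l where "l = max k (max (n i) (n j))"
    have eq: "lincomb {..<l} (\<lambda>m. \<gamma> i m - \<gamma> j m) b =
        (\<lambda>x. (f x - lincomb {..<n j} (\<gamma> j) b x) - (f x - lincomb {..<n i} (\<gamma> i) b x))"
      unfolding lincomb_diff[symmetric] using ext[of i l] ext[of j l] by (auto simp: l_def)
    have "\<phi> (lincomb {..<l} (\<lambda>m. \<gamma> i m - \<gamma> j m) b) \<le>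
        K * (\<phi> (\<lambda>x. f x - lincomb {..<n j} (\<gamma> j) b x) + \<phi> (\<lambda>x. f x - lincomb {..<n i} (\<gamma> i) b x))"
      unfolding eq by (intro quasi_diff diff_in f lincomb_in) auto
    also have "\<dots> \<le> K * (\<epsilon> i + \<epsilon> j)"
      using n(1)[of i] n(1)[of j] K by (intro mult_left_mono) auto
    finally have 1: "\<phi> (lincomb {..<l} (\<lambda>m. \<gamma> i m - \<gamma> j m) b) \<le> K * (\<epsilon> i + \<epsilon> j)" .
    have "{m \<in> {..<l}. m < k} = {..<k}" by (auto simp: l_def)
    then have "\<phi> (lincomb {..<k} (\<lambda>m. \<gamma> i m - \<gamma> j m) b) \<le> C * \<phi> (lincomb {..<l} (\<lambda>m. \<gamma> i m - \<gamma> j m) b)"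
      using bounded[of "{..<l}" k "\<lambda>m. \<gamma> i m - \<gamma> j m"] by simp
    also have "\<dots> \<le> C * (K * (\<epsilon> i + \<epsilon> j))" using 1 C by (intro mult_left_mono) auto
    finally show ?thesis .
  qed
  have "convergent (\<lambda>i. \<gamma> i m)" for m
  proof -
    define D where "D = 2 * K * C / \<phi> (b m) * (C * K)"
    have D: "D > 0" using K C b_pos[of m] by (simp add: D_def)
    have d: "\<bar>\<gamma> i m - \<gamma> j m\<bar> \<le> (D * (\<epsilon> i + \<epsilon> j)) powr (1 / q)" for i j
    proof -
      have "\<bar>\<gamma> i m - \<gamma> j m\<bar> powr q \<le> 2 * K * C / \<phi> (b m) * \<phi> (lincomb {..<Suc m} (\<lambda>m. \<gamma> i m - \<gamma> j m) b)"
        using coordinate_bound[of "{..<Suc m}" m "\<lambda>m. \<gamma> i m - \<gamma> j m"] by simp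
      also have "\<dots> \<le> 2 * K * C / \<phi> (b m) * (C * (K * (\<epsilon> i + \<epsilon> j)))"
        using K C b_pos[of m] by (intro mult_left_mono gij) auto
      finally have "\<bar>\<gamma> i m - \<gamma> j m\<bar> powr q \<le> D * (\<epsilon> i + \<epsilon> j)" by (simp add: D_def mult_ac)
      then have "(\<bar>\<gamma> i m - \<gamma> j m\<bar> powr q) powr (1 / q) \<le> (D * (\<epsilon> i + \<epsilon> j)) powr (1 / q)"
        using q by (intro powr_mono2) auto
      then show ?thesis using q by (simp add: powr_powr)
    qed
    have "Cauchy (\<lambda>i. \<gamma> i m)"
    proof (rule metric_CauchyI)
      fix e :: real assume e: "0 < e"
      have "\<forall>\<^sub>F i in sequentially. \<epsilon> i < (e powr q) / (4 * D)"
        using \<epsilon>_lim by (rule order_tendstoD(2)) (use e D in simp)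
      then obtain I where I: "\<And>i. i \<ge> I \<Longrightarrow> \<epsilon> i < (e powr q) / (4 * D)" by (auto simp: eventually_sequentially)
      show "\<exists>I. \<forall>i\<ge>I. \<forall>j\<ge>I. dist (\<gamma> i m) (\<gamma> j m) < e"
      proof (intro exI allI impI)
        fix i j assume "i \<ge> I" "j \<ge> I"
        then have "\<epsilon> i + \<epsilon> j \<le> (e powr q) / (4 * D) + (e powr q) / (4 * D)" using I by (intro add_mono less_imp_le) auto
        then have "D * (\<epsilon> i + \<epsilon> j) \<le> D * ((e powr q) / (4 * D) + (e powr q) / (4 * D))"
          using D by (intro mult_left_mono) auto
        also have "\<dots> = (e powr q) / 2" using D by (simp add: field_simps)
        also have "\<dots> < e powr q" using e by simp
        finally have "(D * (\<epsilon> i + \<epsilon> j)) powr (1 / q) < (e powr q) powr (1 / q)"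
          using q D \<epsilon>[of i] \<epsilon>[of j] by (intro powr_less_mono2) (auto intro!: mult_nonneg_nonneg)
        then show "dist (\<gamma> i m) (\<gamma> j m) < e" using d[of i j] q e by (simp add: dist_real_def powr_powr)
      qed
    qed
    then show ?thesis by (simp add: Cauchy_convergent_iff)
  qed
  then obtain c where c: "\<And>m. (\<lambda>i. \<gamma> i m) \<longlonglongrightarrow> c m" unfolding convergent_def by metis
  \<comment> \<open>The bound does not depend on k: for each k an index j is taken so large that the
    finite combination with coefficients \<open>\<gamma> j - c\<close> is negligible.\<close>
  have key: "\<phi> (lincomb {..<k} (\<lambda>m. \<gamma> i m - c m) b) \<le> K * (C * (K * (2 * \<epsilon> i)) + \<epsilon> i)" for k i
  proof -
    have "(\<lambda>j. \<gamma> j m - c m) \<longlonglongrightarrow> 0" for m using c[of m] by (simp add: LIM_zero_iff)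
    then have "(\<lambda>j. \<phi> (lincomb {..<k} (\<lambda>m. \<gamma> j m - c m) b)) \<longlonglongrightarrow> 0" by (intro lincomb_tendsto_0) auto
    then have "\<forall>\<^sub>F j in sequentially. \<phi> (lincomb {..<k} (\<lambda>m. \<gamma> j m - c m) b) < \<epsilon> i" by (rule order_tendstoD(2)) (rule \<epsilon>)
    moreover have "\<forall>\<^sub>F j in sequentially. \<epsilon> j < \<epsilon> i" using \<epsilon>_lim by (rule order_tendstoD(2)) (rule \<epsilon>)
    ultimately have "\<forall>\<^sub>F j in sequentially. \<phi> (lincomb {..<k} (\<lambda>m. \<gamma> j m - c m) b) < \<epsilon> i \<and> \<epsilon> j < \<epsilon> i" by (rule eventually_conj)
    then obtain j where j: "\<phi> (lincomb {..<k} (\<lambda>m. \<gamma> j m - c m) b) < \<epsilon> i" "\<epsilon> j < \<epsilon> i"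
      by (auto simp: eventually_sequentially)
    have eq: "lincomb {..<k} (\<lambda>m. \<gamma> i m - c m) b = (\<lambda>x. lincomb {..<k} (\<lambda>m. \<gamma> i m - \<gamma> j m) b x + lincomb {..<k} (\<lambda>m. \<gamma> j m - c m) b x)"
      by (auto simp: lincomb_def sum.distrib[symmetric] algebra_simps)
    have "\<phi> (lincomb {..<k} (\<lambda>m. \<gamma> i m - c m) b) \<le>
        K * (\<phi> (lincomb {..<k} (\<lambda>m. \<gamma> i m - \<gamma> j m) b) + \<phi> (lincomb {..<k} (\<lambda>m. \<gamma> j m - c m) b))"
      unfolding eq by (intro quasi lincomb_in) auto
    also have "\<dots> \<le> K * (C * (K * (2 * \<epsilon> i)) + \<epsilon> i)"
    proof (intro mult_left_mono add_mono)
      have "C * (K * (\<epsilon> i + \<epsilon> j)) \<le> C * (K * (2 * \<epsilon> i))" using j(2) C K by (intro mult_left_mono) auto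
      then show "\<phi> (lincomb {..<k} (\<lambda>m. \<gamma> i m - \<gamma> j m) b) \<le> C * (K * (2 * \<epsilon> i))" using gij[of k i j] by linarith
    qed (use j K in auto)
    finally show ?thesis .
  qed
  define R where "R = K * (1 + K * (C * (K * 2) + 1))"
  have "(\<lambda>k. \<phi> (\<lambda>x. f x - lincomb {..<k} c b x)) \<longlonglongrightarrow> 0"
  proof (rule LIMSEQ_I)
    fix e :: real assume e: "0 < e"
    have "(\<lambda>i. R * \<epsilon> i) \<longlonglongrightarrow> R * 0" by (intro tendsto_mult_left \<epsilon>_lim)
    then have "\<forall>\<^sub>F i in sequentially. R * \<epsilon> i < e" using e by (intro order_tendstoD(2)) auto
    then obtain i where i: "R * \<epsilon> i < e" by (auto simp: eventually_sequentially)
    have "norm (\<phi> (\<lambda>x. f x - lincomb {..<k} c b x) - 0) < e" if k: "k \<ge> n i" for k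
    proof -
      have "(\<lambda>x. f x - lincomb {..<k} c b x) = (\<lambda>x. (f x - lincomb {..<n i} (\<gamma> i) b x) + lincomb {..<k} (\<lambda>m. \<gamma> i m - c m) b x)"
        unfolding lincomb_diff[symmetric] ext[OF k] by simp
      then have "\<phi> (\<lambda>x. f x - lincomb {..<k} c b x) \<le> K * (\<phi> (\<lambda>x. f x - lincomb {..<n i} (\<gamma> i) b x) + \<phi> (lincomb {..<k} (\<lambda>m. \<gamma> i m - c m) b))"
        by (simp only:) (intro quasi diff_in f lincomb_in; simp)
      also have "\<dots> \<le> K * (\<epsilon> i + K * (C * (K * (2 * \<epsilon> i)) + \<epsilon> i))"
        using n(1)[of i] key[of k i] K by (intro mult_left_mono add_mono) auto
      also have "\<dots> = R * \<epsilon> i" by (simp add: R_def algebra_simps)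
      finally show ?thesis using i nonneg[OF diff_in[OF f lincomb_in]] by simp
    qed
    then show "\<exists>no. \<forall>k\<ge>no. norm (\<phi> (\<lambda>x. f x - lincomb {..<k} c b x) - 0) < e" by blast
  qed
  then show ?thesis using series_iff[OF f] by blast
qed

text \<open>The index sets are arbitrary finite sets that eventually contain m. This allows
  expansions summed in different orders to be compared, beyond the uniqueness required of a
  basis.\<close>

lemma coefficient_unique:
  assumes f: "f \<in> X"
    and c: "\<And>j. finite (M' j)" "(\<lambda>j. \<phi> (\<lambda>x. f x - lincomb (M' j) c b x)) \<longlonglongrightarrow> 0" "\<forall>\<^sub>F j in sequentially. m \<in> M' j"
    and d: "\<And>j. finite (M j)" "(\<lambda>j. \<phi> (\<lambda>x. f x - lincomb (M j) d b x)) \<longlonglongrightarrow> 0" "\<forall>\<^sub>F j in sequentially. m \<in> M j"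
  shows "c m = d m"
proof -
  let ?D = "2 * K * C / \<phi> (b m)"
  have D: "0 < ?D" using K C b_pos[of m] by simp
  have lim: "(\<lambda>j. ?D * (K * (\<phi> (\<lambda>x. f x - lincomb (M j) d b x) + \<phi> (\<lambda>x. f x - lincomb (M' j) c b x)))) \<longlonglongrightarrow> ?D * (K * (0 + 0))"
    using c(2) d(2) by (intro tendsto_mult tendsto_const tendsto_add)
  have ev: "\<forall>\<^sub>F j in sequentially. \<bar>c m - d m\<bar> powr q \<le> ?D * (K * (\<phi> (\<lambda>x. f x - lincomb (M j) d b x) + \<phi> (\<lambda>x. f x - lincomb (M' j) c b x)))"
    using c(3) d(3)
  proof eventually_elim
    case (elim j)
    define U where "U = M j \<union> M' j"
    define e where "e i = (if i \<in> M' j then c i else 0) - (if i \<in> M j then d i else 0)" for i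
    have U: "finite U" "m \<in> U" using c(1) d(1) elim by (auto simp: U_def)
    have l1: "lincomb U (\<lambda>i. if i \<in> M' j then c i else 0) b x = lincomb (M' j) c b x" for x
      unfolding lincomb_def using U by (intro sum.mono_neutral_cong_right) (auto simp: U_def)
    have l2: "lincomb U (\<lambda>i. if i \<in> M j then d i else 0) b x = lincomb (M j) d b x" for x
      unfolding lincomb_def using U by (intro sum.mono_neutral_cong_right) (auto simp: U_def)
    have eq: "lincomb U e b = (\<lambda>x. (f x - lincomb (M j) d b x) - (f x - lincomb (M' j) c b x))"
      unfolding e_def[abs_def] lincomb_diff[symmetric] by (simp add: l1 l2)
    have "\<bar>c m - d m\<bar> powr q = \<bar>e m\<bar> powr q" using elim by (simp add: e_def)
    also have "\<dots> \<le> ?D * \<phi> (lincomb U e b)" by (rule coordinate_bound[OF U])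
    also have "\<dots> \<le> ?D * (K * (\<phi> (\<lambda>x. f x - lincomb (M j) d b x) + \<phi> (\<lambda>x. f x - lincomb (M' j) c b x)))"
      unfolding eq using D c(1) d(1) by (intro mult_left_mono quasi_diff diff_in f lincomb_in) auto
    finally show ?case .
  qed
  have "\<bar>c m - d m\<bar> powr q \<le> ?D * (K * (0 + 0))"
    by (rule tendsto_lowerbound[OF lim ev]) simp
  then show ?thesis by simp
qed

theorem schauder: "schauder_basis X N b"
  unfolding schauder_basis_def
proof (intro conjI allI ballI)
  fix f assume f: "f \<in> X"
  obtain c where c: "series_converges_to N b c f" using expansion_exists[OF f] by blast
  have "c' = c" if c': "series_converges_to N b c' f" for c'
  proof
    fix m
    have ev: "\<forall>\<^sub>F j in sequentially. m \<in> {..<j}" using eventually_gt_at_top[of m] by eventually_elim simp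
    have lim: "(\<lambda>j. \<phi> (\<lambda>x. f x - lincomb {..<j} c b x)) \<longlonglongrightarrow> 0" "(\<lambda>j. \<phi> (\<lambda>x. f x - lincomb {..<j} c' b x)) \<longlonglongrightarrow> 0"
      using c c' series_iff[OF f] by blast+
    show "c' m = c m"
      by (rule coefficient_unique[OF f finite_lessThan lim(2) ev finite_lessThan lim(1) ev])
  qed
  with c show "\<exists>!c. series_converges_to N b c f" by blast
qed (rule b_in)

end

section \<open>Haar expansions in Besov spaces\<close>

lemma powr_add_le_nonneg:
  fixes x y r :: real
  assumes "0 < r" "0 \<le> x" "0 \<le> y"
  shows "(x + y) powr r \<le> 2 powr r * (x powr r + y powr r)"
  using powr_add_le[OF assms(1), of x y] assms by simp

lemma dyadic_step_cong:
  assumes "dyadic_step k u" "\<And>x. x \<in> half_cube \<Longrightarrow> u x = v x"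
  shows "dyadic_step k v" "Lp_pow p v = Lp_pow p u"
proof -
  show v: "dyadic_step k v" using assms unfolding dyadic_step_def by metis
  show "Lp_pow p v = Lp_pow p u"
    unfolding dyadic_step_Lp(2)[OF assms(1)] dyadic_step_Lp(2)[OF v]
    using assms(2) by (simp add: grid_point_in)
qed

lemma Lp_pow_pos:
  fixes u :: "real^'d \<Rightarrow> real"
  assumes u: "dyadic_step k u" and x: "x \<in> half_cube" "u x \<noteq> 0"
  shows "0 < Lp_pow p u"
proof -
  have "0 < (\<Sum>a\<in>grid k. \<bar>u (grid_point k a)\<bar> powr p)"
    using x dyadic_step_grid_point[OF u x(1)]
    by (intro sum_pos2[of _ "cell k x"]) (auto intro: cell_in)
  then show ?thesis unfolding dyadic_step_Lp(2)[OF u] by simp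
qed

section \<open>Iterated averages, applied from the finest level downwards\<close>

primrec iter_avg :: "nat \<Rightarrow> nat \<Rightarrow> (real^'d \<Rightarrow> real) \<Rightarrow> real^'d \<Rightarrow> real" where
  "iter_avg k 0 u = u"
| "iter_avg k (Suc n) u = iter_avg k n (avg (k + n) u)"

lemma dyadic_step_iter_avg: "dyadic_step (k + n) u \<Longrightarrow> dyadic_step k (iter_avg k n u)"
  by (induction n arbitrary: u) (auto intro: dyadic_step_avg)

lemma iter_avg_sum: "iter_avg k n (\<lambda>x. \<Sum>j\<in>J. u j x) = (\<lambda>x. \<Sum>j\<in>J. iter_avg k n (u j) x)"
  by (induction n arbitrary: u) (simp_all add: avg_sum[abs_def])

lemma iter_avg_diff: "iter_avg k n (\<lambda>x. u x - v x) = (\<lambda>x. iter_avg k n u x - iter_avg k n v x)"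
  by (induction n arbitrary: u v) (simp_all add: avg_diff[abs_def])

lemma iter_avg_cong:
  fixes u v :: "real^'d \<Rightarrow> real"
  shows "(\<And>x. x \<in> half_cube \<Longrightarrow> u x = v x) \<Longrightarrow> x \<in> half_cube \<Longrightarrow> iter_avg k n u x = iter_avg k n v x"
proof (induction n arbitrary: u v)
  case (Suc n)
  have "iter_avg k n (avg (k + n) u) x = iter_avg k n (avg (k + n) v) x"
  proof (rule Suc.IH)
    fix y :: "real^'d" assume "y \<in> half_cube"
    with Suc.prems(1) show "avg (k + n) u y = avg (k + n) v y" by (rule avg_cong)
  qed (rule Suc.prems(2))
  then show ?case by simp
qed simp

lemma iter_avg_id: "dyadic_step k u \<Longrightarrow> x \<in> half_cube \<Longrightarrow> iter_avg k n u x = u x"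
proof (induction n)
  case (Suc n)
  have "iter_avg k n (avg (k + n) u) x = iter_avg k n u x"
    using Suc.prems by (intro iter_avg_cong avg_step) (auto intro: dyadic_step_mono)
  then show ?case using Suc by simp
qed simp

text \<open>The averages taken above the level of u leave it unchanged, so only m of the n averages
  cost a factor. The bound thus does not see how fine the starting level is.\<close>

lemma Lp_pow_iter_avg_le:
  fixes u :: "real^'d \<Rightarrow> real"
  assumes p: "0 < p"
  shows "m \<le> n \<Longrightarrow> dyadic_step (k + m) u \<Longrightarrow> Lp_pow p (iter_avg k n u) \<le> avg_growth p TYPE('d) ^ m * Lp_pow p u"
proof (induction n arbitrary: u m)
  case (Suc n)
  let ?\<sigma> = "avg_growth p TYPE('d)"
  show ?case
  proof (cases "m = Suc n")
    case True
    have "Lp_pow p (iter_avg k n (avg (k + n) u)) \<le> ?\<sigma> ^ n * Lp_pow p (avg (k + n) u)"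
      by (intro Suc.IH dyadic_step_avg) simp
    also have "\<dots> \<le> ?\<sigma> ^ n * (?\<sigma> * Lp_pow p u)"
      using Suc.prems True avg_growth_ge_1[of p, where 'd = 'd] by (intro mult_left_mono Lp_pow_avg_le p) auto
    finally show ?thesis using True by (simp add: mult_ac)
  next
    case False
    have "avg (k + n) u x = u x" if "x \<in> half_cube" for x
      by (rule avg_step[OF dyadic_step_mono[OF Suc.prems(2)] that]) (use Suc.prems(1) False in simp)
    then have e: "dyadic_step (k + m) (avg (k + n) u)" "Lp_pow p (avg (k + n) u) = Lp_pow p u"
      using dyadic_step_cong[OF Suc.prems(2), of "avg (k + n) u"] by metis+
    have "Lp_pow p (iter_avg k n (avg (k + n) u)) \<le> ?\<sigma> ^ m * Lp_pow p (avg (k + n) u)"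
      using Suc.prems False by (intro Suc.IH e) auto
    then show ?thesis using e by simp
  qed
qed simp

lemma haar_level_nonempty: "haar_level k \<noteq> {}"
proof (cases k)
  case (Suc k')
  have "haar_tensor k' (\<lambda>_. 1) UNIV \<in> haar_level (Suc k')"
    unfolding haar_level_Suc mem_Collect_eq by (intro exI[of _ "\<lambda>_. 1"] exI[of _ UNIV]) simp
  then show ?thesis using Suc by blast
qed simp

context besov_params
begin

lemma step_diff_bound:
  fixes f :: "real^'d \<Rightarrow> real"
  assumes f: "f \<in> Lp_space p unit_cube" and u: "\<And>k. dyadic_step k (u k)"
  shows "(\<rho> ^ Suc j * Lp_pow p (\<lambda>x. u (Suc j) x - u j x)) powr r \<le>
    (2 powr p * \<rho>) powr r * 2 powr r *
    ((\<rho> ^ j * Lp_pow p (\<lambda>x. f x - u j x)) powr r + (\<rho> ^ Suc j * Lp_pow p (\<lambda>x. f x - u (Suc j) x)) powr r)"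
proof -
  define a where "a k = \<rho> ^ k * Lp_pow p (\<lambda>x. f x - u k x)" for k
  have a: "0 \<le> a k" for k using \<rho> by (simp add: a_def)
  note uL = dyadic_step_Lp(1)[OF u, of _ p]
  have "Lp_pow p (\<lambda>x. u (Suc j) x - u j x) = Lp_pow p (\<lambda>x. (f x - u j x) - (f x - u (Suc j) x))" by simp
  also have "\<dots> \<le> 2 powr p * (Lp_pow p (\<lambda>x. f x - u j x) + Lp_pow p (\<lambda>x. f x - u (Suc j) x))"
    by (intro diff_in_Lp_space(2) diff_in_Lp_space(1) p f uL)
  finally have "\<rho> ^ Suc j * Lp_pow p (\<lambda>x. u (Suc j) x - u j x) \<le> \<rho> ^ Suc j * \<dots>"
    using \<rho> by (intro mult_left_mono) auto
  also have "\<dots> = 2 powr p * (\<rho> * a j + a (Suc j))" by (simp add: a_def algebra_simps)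
  also have "\<dots> \<le> 2 powr p * (\<rho> * a j + \<rho> * a (Suc j))"
    using \<rho> a[of "Suc j"] mult_right_mono[of 1 \<rho> "a (Suc j)"] by (intro mult_left_mono add_left_mono) auto
  finally have "\<rho> ^ Suc j * Lp_pow p (\<lambda>x. u (Suc j) x - u j x) \<le> (2 powr p * \<rho>) * (a j + a (Suc j))"
    by (simp add: algebra_simps)
  then have "(\<rho> ^ Suc j * Lp_pow p (\<lambda>x. u (Suc j) x - u j x)) powr r \<le> ((2 powr p * \<rho>) * (a j + a (Suc j))) powr r"
    using r \<rho> by (intro powr_mono2) auto
  also have "\<dots> = (2 powr p * \<rho>) powr r * (a j + a (Suc j)) powr r"
    using \<rho> a by (simp add: powr_mult)
  also have "\<dots> \<le> (2 powr p * \<rho>) powr r * (2 powr r * (a j powr r + a (Suc j) powr r))"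
    using r a by (intro mult_left_mono powr_add_le_nonneg) auto
  finally show ?thesis by (simp add: a_def mult.assoc)
qed

text \<open>The error \<open>f - u n\<close> is the sum of the later increments of the approximants,
  and the upper estimate bounds it by the tail of a convergent series.\<close>

lemma dyadic_step_dense_besov:
  fixes f :: "real^'d \<Rightarrow> real"
  assumes f: "f \<in> besov_space p q s" and e: "0 < e"
  shows "\<exists>n u. dyadic_step n u \<and> (\<lambda>x. f x - u x) \<in> besov_space p q s \<and> besov_pow p q s (\<lambda>x. f x - u x) < e"
proof -
  obtain C where C: "C > 0" "\<And>(f :: real^'d \<Rightarrow> real) v. f \<in> Lp_space p unit_cube \<Longrightarrow> (\<forall>j. dyadic_step j (v j)) \<Longrightarrow>
     summable (\<lambda>j. (\<rho> ^ j * Lp_pow p (v j)) powr r) \<Longrightarrow>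
     (\<lambda>n. Lp_pow p (\<lambda>x. f x - (\<Sum>j<n. v j x))) \<longlonglongrightarrow> 0 \<Longrightarrow>
     f \<in> besov_space p q s \<and> besov_pow p q s f \<le> C * (\<Sum>j. (\<rho> ^ j * Lp_pow p (v j)) powr r)"
    using besov_series_upper by blast
  obtain u where u: "\<And>k. dyadic_step k (u k)" and sm: "summable (\<lambda>k. (\<rho> ^ k * Lp_pow p (\<lambda>x. f x - u k x)) powr r)"
    using besov_approx_lower f by blast
  note fL = Lp_of_besov[OF f] and uL = dyadic_step_Lp(1)[OF u, of _ p]
  define t where "t k = (\<rho> ^ k * Lp_pow p (\<lambda>x. f x - u k x)) powr r" for k
  have t: "summable t" "\<And>k. 0 \<le> t k" using sm by (auto simp: t_def[abs_def])
  define b where "b j = (\<rho> ^ Suc j * Lp_pow p (\<lambda>x. u (Suc j) x - u j x)) powr r" for j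
  have b0: "0 \<le> b j" for j by (simp add: b_def)
  have sb: "summable b"
  proof (rule summable_comparison_test'[of _ 0])
    show "summable (\<lambda>j. (2 powr p * \<rho>) powr r * 2 powr r * (t j + t (Suc j)))"
      using t by (intro summable_mult summable_add) (auto simp: summable_Suc_iff)
    show "norm (b j) \<le> (2 powr p * \<rho>) powr r * 2 powr r * (t j + t (Suc j))" for j
      using step_diff_bound[OF fL u, of j] b0[of j] by (simp add: b_def t_def)
  qed
  have lim: "(\<lambda>k. Lp_pow p (\<lambda>x. f x - u k x)) \<longlonglongrightarrow> 0"
  proof (rule tendsto_sandwich[OF _ _ tendsto_const])
    have "(\<lambda>k. t k powr (1 / r)) \<longlonglongrightarrow> 0"
      using summable_LIMSEQ_zero[OF t(1)] t(2) r by (intro tendsto_zero_powrI[where b = "1 / r"]) auto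
    then show "(\<lambda>k. \<rho> ^ k * Lp_pow p (\<lambda>x. f x - u k x)) \<longlonglongrightarrow> 0"
      using r \<rho> by (simp add: t_def powr_powr)
    show "\<forall>\<^sub>F k in sequentially. Lp_pow p (\<lambda>x. f x - u k x) \<le> \<rho> ^ k * Lp_pow p (\<lambda>x. f x - u k x)"
    proof (intro always_eventually allI)
      fix k
      have "1 * Lp_pow p (\<lambda>x. f x - u k x) \<le> \<rho> ^ k * Lp_pow p (\<lambda>x. f x - u k x)"
        using \<rho> by (intro mult_right_mono one_le_power) auto
      then show "Lp_pow p (\<lambda>x. f x - u k x) \<le> \<rho> ^ k * Lp_pow p (\<lambda>x. f x - u k x)" by simp
    qed
  qed auto
  obtain n where n: "norm (\<Sum>i. b (i + n)) < e / C"
    using suminf_exist_split[OF _ sb, of "e / C"] e C by auto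
  \<comment> \<open>Increments of index at most n are dropped, so that the series telescopes to the
    error at level n.\<close>
  define v where "v i = (if i \<le> n then (\<lambda>_. 0) else (\<lambda>x. u i x - u (i - 1) x))" for i
  have v: "dyadic_step i (v i)" for i
    unfolding v_def by (auto intro!: dyadic_step_const dyadic_step_diff u dyadic_step_mono[OF u])
  have vt: "(\<rho> ^ (i + Suc n) * Lp_pow p (v (i + Suc n))) powr r = b (i + n)" for i
    by (simp add: v_def b_def)
  have sv: "summable (\<lambda>i. (\<rho> ^ i * Lp_pow p (v i)) powr r)"
  proof (rule summable_iff_shift[THEN iffD1])
    show "summable (\<lambda>i. (\<rho> ^ (i + Suc n) * Lp_pow p (v (i + Suc n))) powr r)"
      unfolding vt using sb by (simp add: summable_iff_shift)
  qed
  have z: "Lp_pow p (\<lambda>_ :: real^'d. 0) = 0" by (simp add: Lp_pow_def)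
  have "(\<Sum>i. (\<rho> ^ i * Lp_pow p (v i)) powr r) = (\<Sum>i. b (i + n)) + (\<Sum>i<Suc n. (\<rho> ^ i * Lp_pow p (v i)) powr r)"
    unfolding vt[symmetric] by (rule suminf_split_initial_segment[OF sv])
  also have "(\<Sum>i<Suc n. (\<rho> ^ i * Lp_pow p (v i)) powr r) = 0"
    by (intro sum.neutral) (auto simp: v_def z)
  finally have sum: "(\<Sum>i. (\<rho> ^ i * Lp_pow p (v i)) powr r) < e / C" using n by simp
  have tel: "(\<Sum>i<n + Suc m. v i x) = u (n + m) x - u n x" for m x
    by (induction m) (auto simp: v_def)
  have "(\<lambda>m. Lp_pow p (\<lambda>x. (f x - u n x) - (\<Sum>i<m. v i x))) \<longlonglongrightarrow> 0"
  proof (rule LIMSEQ_offset[of _ "Suc n"])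
    have "(\<lambda>m. Lp_pow p (\<lambda>x. f x - u (m + n) x)) \<longlonglongrightarrow> 0" by (rule LIMSEQ_ignore_initial_segment[OF lim])
    moreover have "(\<lambda>x. (f x - u n x) - (\<Sum>i<m + Suc n. v i x)) = (\<lambda>x. f x - u (m + n) x)" for m
      using tel[of _ m] by (simp add: add.commute)
    ultimately show "(\<lambda>m. Lp_pow p (\<lambda>x. (f x - u n x) - (\<Sum>i<m + Suc n. v i x))) \<longlonglongrightarrow> 0" by simp
  qed
  then have "(\<lambda>x. f x - u n x) \<in> besov_space p q s \<and>
      besov_pow p q s (\<lambda>x. f x - u n x) \<le> C * (\<Sum>j. (\<rho> ^ j * Lp_pow p (v j)) powr r)"
    using v sv by (intro C(2) diff_in_Lp_space(1) p fL uL) auto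
  moreover have "C * (\<Sum>j. (\<rho> ^ j * Lp_pow p (v j)) powr r) < e" using sum C by (simp add: field_simps)
  ultimately show ?thesis using u by (intro exI[of _ n] exI[of _ "u n"]) auto
qed

lemma besov_in_add:
  fixes f g :: "real^'d \<Rightarrow> real"
  shows "f \<in> besov_space p q s \<Longrightarrow> g \<in> besov_space p q s \<Longrightarrow> (\<lambda>x. f x + g x) \<in> besov_space p q s"
  using besov_pow_add[OF p q s, where 'd = 'd] by blast

lemma besov_norm_tendsto_iff:
  fixes F :: "nat \<Rightarrow> real^'d \<Rightarrow> real"
  assumes F: "\<And>n. F n \<in> besov_space p q s"
  shows "(\<lambda>n. besov_norm p q s (F n)) \<longlonglongrightarrow> 0 \<longleftrightarrow> (\<lambda>n. besov_pow p q s (F n)) \<longlonglongrightarrow> 0"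
proof
  obtain C where C: "C > 0" "\<And>f :: real^'d \<Rightarrow> real. f \<in> besov_space p q s \<Longrightarrow>
     besov_norm p q s f powr q \<le> C * besov_pow p q s f \<and> besov_pow p q s f \<le> C * besov_norm p q s f powr q"
    using besov_norm_equiv[OF p q s, where 'd = 'd] by blast
  have N0: "0 \<le> besov_norm p q s (F n)" for n by (simp add: besov_norm_def)
  {
    assume "(\<lambda>n. besov_norm p q s (F n)) \<longlonglongrightarrow> 0"
    then have "(\<lambda>n. besov_norm p q s (F n) powr q) \<longlonglongrightarrow> 0"
      using q N0 by (intro tendsto_zero_powrI[where b = q]) auto
    then have "(\<lambda>n. C * besov_norm p q s (F n) powr q) \<longlonglongrightarrow> C * 0" by (rule tendsto_mult_left)
    then have lim: "(\<lambda>n. C * besov_norm p q s (F n) powr q) \<longlonglongrightarrow> 0" by simp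
    show "(\<lambda>n. besov_pow p q s (F n)) \<longlonglongrightarrow> 0"
      using C(2)[OF F] besov_pow_nonneg[OF p q s F]
      by (intro Lim_null_comparison[OF _ lim] always_eventually) auto
  next
    assume "(\<lambda>n. besov_pow p q s (F n)) \<longlonglongrightarrow> 0"
    then have "(\<lambda>n. C * besov_pow p q s (F n)) \<longlonglongrightarrow> C * 0" by (rule tendsto_mult_left)
    then have lim: "(\<lambda>n. C * besov_pow p q s (F n)) \<longlonglongrightarrow> 0" by simp
    have "(\<lambda>n. besov_norm p q s (F n) powr q) \<longlonglongrightarrow> 0"
      using C(2)[OF F]
      by (intro Lim_null_comparison[OF _ lim] always_eventually) auto
    then have "(\<lambda>n. (besov_norm p q s (F n) powr q) powr (1 / q)) \<longlonglongrightarrow> 0"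
      by (rule tendsto_zero_powrI[OF _ tendsto_const]) (use q in auto)
    then show "(\<lambda>n. besov_norm p q s (F n)) \<longlonglongrightarrow> 0" using q N0 by (simp add: powr_powr)
  }
qed

end

locale haar_enum = besov_params p q s for p q s :: real +
  fixes h :: "nat \<Rightarrow> real^'d \<Rightarrow> real"
  assumes enum: "level_ordered_enumeration h"
begin

definition \<sigma> :: real where "\<sigma> = avg_growth p TYPE('d)"

lemma \<sigma>: "1 \<le> \<sigma>"
  by (simp add: \<sigma>_def avg_growth_ge_1)

section \<open>Levels of the enumeration\<close>

definition lev :: "nat \<Rightarrow> nat" where "lev m = (THE k. h m \<in> haar_level k)"

lemma inj_h: "inj h"
  using enum by (auto simp: level_ordered_enumeration_def bij_betw_def)

lemma lev_eq: "h m \<in> haar_level k \<Longrightarrow> lev m = k"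
  unfolding lev_def using haar_level_disjoint by blast

lemma h_level: "h m \<in> haar_level (lev m)"
proof -
  have "h m \<in> haar_system" using enum unfolding level_ordered_enumeration_def by (metis bij_betwE UNIV_I)
  then obtain k where "h m \<in> haar_level k" unfolding haar_system_def by blast
  then show ?thesis using lev_eq by blast
qed

lemma ex_h:
  assumes "f \<in> haar_level k" shows "\<exists>m. h m = f \<and> lev m = k"
proof -
  have "f \<in> range h" using enum assms unfolding level_ordered_enumeration_def bij_betw_def haar_system_def by blast
  then show ?thesis using lev_eq assms by blast
qed

lemma finite_lev: "finite {m. lev m = k}"
proof -
  have "{m. lev m = k} \<subseteq> h -` haar_level k" using h_level by auto
  then show ?thesis using finite_vimageI[OF finite_haar_level inj_h] finite_subset by blast
qed

lemma finite_lev_le: "finite {m. lev m \<le> k}"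
proof -
  have "{m. lev m \<le> k} = (\<Union>j\<le>k. {m. lev m = j})" by auto
  then show ?thesis using finite_lev by simp
qed

lemma enum_less: "h m \<in> haar_level k \<Longrightarrow> h n \<in> haar_level (Suc k) \<Longrightarrow> m < n"
  using enum unfolding level_ordered_enumeration_def by blast

lemma lev_Suc_less: "lev n = Suc (lev m) \<Longrightarrow> m < n"
  using enum_less[OF h_level[of m]] h_level[of n] by metis

text \<open>The ordering is given for consecutive levels only; it extends by passing through the
  intermediate levels, all of which are nonempty.\<close>

lemma lev_less_imp: "lev m < lev n \<Longrightarrow> m < n"
proof -
  have "lev n = lev m + Suc e \<Longrightarrow> m < n" for e n
  proof (induction e arbitrary: n)
    case 0
    then show ?case by (intro lev_Suc_less) simp
  next
    case (Suc e)
    obtain n' where n': "lev n' = lev m + Suc e" using ex_h haar_level_nonempty by (metis all_not_in_conv)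
    have "n' < n" using n' Suc.prems by (intro lev_Suc_less) simp
    then show ?case using Suc.IH[OF n'] by simp
  qed
  then show "lev m < lev n \<Longrightarrow> m < n" by (metis add_Suc_right less_iff_Suc_add)
qed

section \<open>Finite combinations truncated by level\<close>

definition low :: "nat set \<Rightarrow> nat \<Rightarrow> nat set" where "low M k = {m \<in> M. lev m \<le> k}"

lemma lincomb_step: "(\<And>m. m \<in> M \<Longrightarrow> lev m \<le> k) \<Longrightarrow> dyadic_step k (lincomb M c h)"
  unfolding lincomb_def[abs_def]
  by (intro dyadic_step_sum dyadic_step_cmult) (auto intro: dyadic_step_mono[OF haar_level_dyadic_step[OF h_level]])

lemma lincomb_low_step: "dyadic_step k (lincomb (low M k) c h)"
  by (rule lincomb_step) (simp add: low_def)

lemma lincomb_low_Suc: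
  assumes "finite M"
  shows "lincomb (low M (Suc k)) c h x = lincomb (low M k) c h x + lincomb {m \<in> M. lev m = Suc k} c h x"
proof -
  have "low M (Suc k) = low M k \<union> {m \<in> M. lev m = Suc k}" by (auto simp: low_def)
  then show ?thesis using assms unfolding lincomb_def by (subst sum.union_disjoint[symmetric]) (auto simp: low_def)
qed

text \<open>The top level has mean zero over each cell of level k and the rest is constant there, so
  averaging is truncation. This brings partial sums within reach of the growth bound for
  averages.\<close>

lemma avg_lincomb_low:
  assumes "finite M" "x \<in> half_cube"
  shows "avg k (lincomb (low M (Suc k)) c h) x = lincomb (low M k) c h x"
proof -
  have "avg k (lincomb {m \<in> M. lev m = Suc k} c h) x = (\<Sum>m\<in>{m \<in> M. lev m = Suc k}. c m * avg k (h m) x)"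
    unfolding lincomb_def[abs_def] avg_sum avg_cmult ..
  also have "\<dots> = 0"
    using h_level by (intro sum.neutral) (metis (mono_tags, lifting) avg_haar_level mem_Collect_eq mult_zero_right)
  finally show ?thesis
    using avg_step[OF lincomb_low_step assms(2)]
    unfolding lincomb_low_Suc[OF assms(1), abs_def] avg_add by simp
qed

lemma iter_avg_lincomb_low:
  assumes "finite M" "x \<in> half_cube"
  shows "iter_avg k n (lincomb (low M (k + n)) c h) x = lincomb (low M k) c h x"
proof (induction n)
  case (Suc n)
  have "iter_avg k n (avg (k + n) (lincomb (low M (k + Suc n)) c h)) x = iter_avg k n (lincomb (low M (k + n)) c h) x"
    using avg_lincomb_low[OF assms(1), of _ "k + n"] assms(2) by (intro iter_avg_cong) auto
  then show ?case using Suc by simp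
qed simp

lemma lincomb_besov: "finite M \<Longrightarrow> lincomb M c h \<in> besov_space p q s"
proof -
  assume "finite M"
  then have "finite (lev ` M)" by simp
  then obtain J where "\<And>m. m \<in> M \<Longrightarrow> lev m \<le> J" by (metis finite_nat_set_iff_bounded_le imageI)
  then have "dyadic_step J (lincomb M c h)" by (rule lincomb_step)
  then show ?thesis using besov_dyadic_step[where 'd = 'd] by blast
qed

lemma lincomb_fibers:
  assumes M: "finite M" "\<And>m. m \<in> M \<Longrightarrow> lev m < n"
  shows "(\<Sum>j<n. lincomb {m \<in> M. lev m = j} c h x) = lincomb M c h x"
  unfolding lincomb_def using M by (intro sum.group) auto

text \<open>Supplies all later estimates with near-best approximants whose weighted increments are
  controlled by the norm and which coincide with the combination from some level on, so that
  telescoping sums are finite.\<close>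

lemma haar_approximants:
  "\<exists>C\<ge>1. \<forall>M c. finite M \<longrightarrow> (\<exists>u J. (\<forall>k. dyadic_step k (u k)) \<and> (\<forall>k\<ge>J. u k = lincomb M c h \<and> low M k = M) \<and>
     summable (\<lambda>j. (\<rho> ^ Suc j * Lp_pow p (\<lambda>x. u (Suc j) x - u j x)) powr r) \<and>
     (\<Sum>j. (\<rho> ^ Suc j * Lp_pow p (\<lambda>x. u (Suc j) x - u j x)) powr r) \<le> C * besov_pow p q s (lincomb M c h) \<and>
     Lp_pow p (u 0) powr r \<le> C * besov_pow p q s (lincomb M c h))"
proof -
  obtain C0 where C0: "C0 > 0" "\<forall>f \<in> besov_space p q s :: (real^'d \<Rightarrow> real) set. \<exists>u. (\<forall>k. dyadic_step k (u k)) \<and>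
     summable (\<lambda>k. (\<rho> ^ k * Lp_pow p (\<lambda>x. f x - u k x)) powr r) \<and>
     (\<Sum>k. (\<rho> ^ k * Lp_pow p (\<lambda>x. f x - u k x)) powr r) \<le> C0 * besov_pow p q s f"
    using besov_approx_lower[where 'd = 'd] by (elim exE conjE) (rule that)
  define Q where "Q = (2 powr p * \<rho>) powr r * 2 powr r"
  have Q: "Q \<ge> 0" by (simp add: Q_def)
  define Q' where "Q' = (2 powr p) powr r * 2 powr r"
  have Q': "Q' \<ge> 0" by (simp add: Q'_def)
  define C where "C = 1 + Q * (2 * C0) + Q' * (1 + C0)"
  have C: "C \<ge> 1" "Q * (2 * C0) \<le> C" "Q' * (1 + C0) \<le> C" using Q Q' C0 by (auto simp: C_def)
  show ?thesis
  proof (intro exI[of _ C] conjI C(1) allI impI)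
    fix M :: "nat set" and c assume M: "finite M"
    define g where "g = lincomb M c h"
    define N where "N = besov_pow p q s g"
    have gB: "g \<in> besov_space p q s" unfolding g_def by (rule lincomb_besov[OF M])
    have N: "0 \<le> N" unfolding N_def by (rule besov_pow_nonneg[OF p q s gB])
    note gL = Lp_of_besov[OF gB]
    obtain v where v: "\<And>k. dyadic_step k (v k)" "summable (\<lambda>k. (\<rho> ^ k * Lp_pow p (\<lambda>x. g x - v k x)) powr r)"
      "(\<Sum>k. (\<rho> ^ k * Lp_pow p (\<lambda>x. g x - v k x)) powr r) \<le> C0 * N"
      using bspec[OF C0(2) gB, folded N_def] by (elim exE conjE) (rule that, blast+)
    obtain J where J: "\<And>m. m \<in> M \<Longrightarrow> lev m \<le> J" using M by (metis finite_imageI finite_nat_set_iff_bounded_le imageI)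
    \<comment> \<open>Replacing the approximants by g itself from level J on only decreases the
      errors.\<close>
    define u where "u k = (if k < J then v k else g)" for k
    have u: "dyadic_step k (u k)" for k
    proof (cases "k < J")
      case False
      then have "lev m \<le> k" if "m \<in> M" for m using J[OF that] by simp
      then have "dyadic_step k g" unfolding g_def by (rule lincomb_step)
      then show ?thesis using False by (simp add: u_def)
    qed (simp add: u_def v(1))
    have uJ: "u k = g" "low M k = M" if "k \<ge> J" for k
      using that J by (force simp: u_def low_def)+
    note uL = dyadic_step_Lp(1)[OF u, of _ p]
    define t where "t k = (\<rho> ^ k * Lp_pow p (\<lambda>x. g x - u k x)) powr r" for k
    have z: "Lp_pow p (\<lambda>_ :: real^'d. 0) = 0" by (simp add: Lp_pow_def)
    have t0: "0 \<le> t k" for k by (simp add: t_def)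
    have tv: "t k \<le> (\<rho> ^ k * Lp_pow p (\<lambda>x. g x - v k x)) powr r" for k
      using r by (simp add: t_def u_def z)
    have st: "summable t" by (rule summable_comparison_test'[OF v(2), of 0]) (use tv t0 in auto)
    have "(\<Sum>k. t k) \<le> (\<Sum>k. (\<rho> ^ k * Lp_pow p (\<lambda>x. g x - v k x)) powr r)" by (intro suminf_le tv st v)
    then have sumt: "(\<Sum>k. t k) \<le> C0 * N" using v(3) by simp
    define b where "b j = (\<rho> ^ Suc j * Lp_pow p (\<lambda>x. u (Suc j) x - u j x)) powr r" for j
    have b: "b j \<le> Q * (t j + t (Suc j))" for j
      using step_diff_bound[OF gL u, of j] by (simp add: b_def t_def Q_def)
    have b0: "0 \<le> b j" for j by (simp add: b_def)
    have stS: "summable (\<lambda>j. t (Suc j))" using st by (simp add: summable_Suc_iff)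
    have sQ: "summable (\<lambda>j. Q * (t j + t (Suc j)))" by (intro summable_mult summable_add st stS)
    have sb: "summable b" by (rule summable_comparison_test'[OF sQ, of 0]) (use b b0 in auto)
    have t1: "(\<Sum>j. t (Suc j)) \<le> (\<Sum>k. t k)" using suminf_split_head[OF st] t0[of 0] by simp
    have "(\<Sum>j. b j) \<le> (\<Sum>j. Q * (t j + t (Suc j)))" by (intro suminf_le b sb sQ)
    also have "\<dots> = Q * ((\<Sum>j. t j) + (\<Sum>j. t (Suc j)))"
      using st stS by (simp add: suminf_mult summable_add suminf_add)
    also have "\<dots> \<le> Q * (C0 * N + C0 * N)" using t1 sumt Q by (intro mult_left_mono) auto
    also have "\<dots> = Q * (2 * C0) * N" by simp
    also have "\<dots> \<le> C * N" by (intro mult_right_mono C N)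
    finally have sumb: "(\<Sum>j. b j) \<le> C * N" .
    have "Lp_pow p (u 0) = Lp_pow p (\<lambda>x. g x - (g x - u 0 x))" by simp
    also have "\<dots> \<le> 2 powr p * (Lp_pow p g + Lp_pow p (\<lambda>x. g x - u 0 x))"
      by (intro diff_in_Lp_space(2) diff_in_Lp_space(1) p gL uL)
    finally have "Lp_pow p (u 0) powr r \<le> (2 powr p * (Lp_pow p g + Lp_pow p (\<lambda>x. g x - u 0 x))) powr r"
      using r by (intro powr_mono2) auto
    also have "\<dots> = (2 powr p) powr r * (Lp_pow p g + Lp_pow p (\<lambda>x. g x - u 0 x)) powr r"
      by (simp add: powr_mult)
    also have "\<dots> \<le> (2 powr p) powr r * (2 powr r * (Lp_pow p g powr r + Lp_pow p (\<lambda>x. g x - u 0 x) powr r))"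
      using r by (intro mult_left_mono powr_add_le_nonneg) auto
    also have "\<dots> = Q' * (Lp_pow p g powr r + t 0)" by (simp add: Q'_def t_def)
    also have "\<dots> \<le> Q' * (N + C0 * N)"
    proof (intro mult_left_mono add_mono Q')
      show "Lp_pow p g powr r \<le> N" unfolding N_def by (rule Lp_pow_le_besov[OF gB])
      have "t 0 \<le> (\<Sum>k. t k)" using sum_le_suminf[OF st, of "{0}"] t0 by simp
      then show "t 0 \<le> C0 * N" using sumt by simp
    qed
    also have "\<dots> = Q' * (1 + C0) * N" by (simp add: algebra_simps)
    also have "\<dots> \<le> C * N" by (intro mult_right_mono C N)
    finally have "Lp_pow p (u 0) powr r \<le> C * N" .
    then show "\<exists>u J. (\<forall>k. dyadic_step k (u k)) \<and> (\<forall>k\<ge>J. u k = lincomb M c h \<and> low M k = M) \<and>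
     summable (\<lambda>j. (\<rho> ^ Suc j * Lp_pow p (\<lambda>x. u (Suc j) x - u j x)) powr r) \<and>
     (\<Sum>j. (\<rho> ^ Suc j * Lp_pow p (\<lambda>x. u (Suc j) x - u j x)) powr r) \<le> C * besov_pow p q s (lincomb M c h) \<and>
     Lp_pow p (u 0) powr r \<le> C * besov_pow p q s (lincomb M c h)"
      using u uJ sb sumb unfolding g_def[symmetric] N_def[symmetric] b_def[abs_def]
      by (intro exI[of _ u] exI[of _ J]) auto
  qed
qed

text \<open>Averaging down to level k turns the combination into its truncation and fixes
  \<open>u k\<close>; hence the truncation error is the sum of the averaged later
  increments.\<close>

lemma trunc_identity:
  assumes M: "finite M" and u: "\<And>k. dyadic_step k (u k)" and J: "u J = lincomb M c h" "low M J = M" "k \<le> J"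
    and x: "x \<in> half_cube"
  shows "lincomb (low M k) c h x - u k x = (\<Sum>j\<in>{k..<J}. iter_avg k (J - k) (\<lambda>x. u (Suc j) x - u j x) x)"
proof -
  have "(\<lambda>x. lincomb M c h x - u k x) = (\<lambda>x. \<Sum>j\<in>{k..<J}. u (Suc j) x - u j x)"
  proof
    fix x show "lincomb M c h x - u k x = (\<Sum>j\<in>{k..<J}. u (Suc j) x - u j x)"
      using sum_Suc_diff'[OF J(3), of "\<lambda>j. u j x"] J(1) by simp
  qed
  then have "iter_avg k (J - k) (\<lambda>x. lincomb M c h x - u k x) x = (\<Sum>j\<in>{k..<J}. iter_avg k (J - k) (\<lambda>x. u (Suc j) x - u j x) x)"
    by (simp add: iter_avg_sum)
  moreover have "iter_avg k (J - k) (lincomb M c h) x = lincomb (low M k) c h x"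
    using iter_avg_lincomb_low[OF M x, of k "J - k" c] J by simp
  ultimately show ?thesis using iter_avg_id[OF u x] by (simp add: iter_avg_diff)
qed

lemma trunc_term_bound:
  fixes u :: "nat \<Rightarrow> real^'d \<Rightarrow> real"
  assumes u: "\<And>k. dyadic_step k (u k)" and j: "j \<in> {k..<J}"
  shows "Lp_pow p (iter_avg k (J - k) (\<lambda>x. u (Suc j) x - u j x)) \<le> \<sigma> ^ (Suc j - k) * Lp_pow p (\<lambda>x. u (Suc j) x - u j x)"
    "dyadic_step k (iter_avg k (J - k) (\<lambda>x. u (Suc j) x - u j x))"
proof -
  have w: "dyadic_step (Suc j) (\<lambda>x. u (Suc j) x - u j x)"
    by (intro dyadic_step_diff u dyadic_step_mono[OF u]) simp
  show "Lp_pow p (iter_avg k (J - k) (\<lambda>x. u (Suc j) x - u j x)) \<le> \<sigma> ^ (Suc j - k) * Lp_pow p (\<lambda>x. u (Suc j) x - u j x)"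
    unfolding \<sigma>_def using j w by (intro Lp_pow_iter_avg_le p) auto
  show "dyadic_step k (iter_avg k (J - k) (\<lambda>x. u (Suc j) x - u j x))"
    using j by (intro dyadic_step_iter_avg dyadic_step_mono[OF w]) auto
qed

text \<open>The part of level k + 1 is a difference of consecutive truncations, hence of two
  truncation errors plus one increment of the approximants; \<open>haar_level_subsum\<close> passes
  to an arbitrary subset of the level.\<close>

lemma level_diff_bound:
  "\<exists>C>0. \<forall>M M' c (u :: nat \<Rightarrow> real^'d \<Rightarrow> real) k. finite M \<longrightarrow> (\<forall>k. dyadic_step k (u k)) \<longrightarrow> M' \<subseteq> {m \<in> M. lev m = Suc k} \<longrightarrow>
    (\<rho> ^ Suc k * Lp_pow p (lincomb M' c h)) powr r \<le>
     C * ((\<rho> ^ k * Lp_pow p (\<lambda>x. lincomb (low M k) c h x - u k x)) powr r +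
          (\<rho> ^ Suc k * Lp_pow p (\<lambda>x. lincomb (low M (Suc k)) c h x - u (Suc k) x)) powr r +
          (\<rho> ^ Suc k * Lp_pow p (\<lambda>x. u (Suc k) x - u k x)) powr r)"
proof -
  define D where "D = (2 ^ CARD('d)) powr p * \<sigma> * (2 powr p * 2 powr p) * \<rho>"
  have D: "D > 0" using \<sigma> \<rho> by (simp add: D_def)
  define C where "C = D powr r * (2 powr r * 2 powr r)"
  have C: "C > 0" using D by (simp add: C_def)
  show ?thesis
  proof (intro exI[of _ C] conjI C allI impI)
    fix M M' :: "nat set" and c and u :: "nat \<Rightarrow> real^'d \<Rightarrow> real" and k
    assume M: "finite M" and u: "\<forall>k. dyadic_step k (u k)" and sub: "M' \<subseteq> {m \<in> M. lev m = Suc k}"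
    let ?L = "{m \<in> M. lev m = Suc k}"
    define a where "a k = Lp_pow p (\<lambda>x. lincomb (low M k) c h x - u k x)" for k
    define w where "w = Lp_pow p (\<lambda>x. u (Suc k) x - u k x)"
    have a0: "0 \<le> a k" for k by (simp add: a_def)
    have w0: "0 \<le> w" by (simp add: w_def)
    have eL: "(\<lambda>x. lincomb (low M k) c h x - u k x) \<in> Lp_space p unit_cube" for k
      using u by (intro dyadic_step_Lp(1)[of k] dyadic_step_diff lincomb_low_step) auto
    have wL: "(\<lambda>x. u (Suc k) x - u k x) \<in> Lp_space p unit_cube"
      using u by (intro diff_in_Lp_space(1) p dyadic_step_Lp(1)) auto
    have "Lp_pow p (lincomb M' c h) \<le> (2 ^ CARD('d)) powr p * avg_growth p TYPE('d) * Lp_pow p (lincomb ?L c h)"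
      unfolding lincomb_def[abs_def]
    proof (rule haar_level_subsum[OF p _ inj_on_subset[OF inj_h subset_UNIV] _ sub])
      show "finite ?L" using M by simp
      show "h m \<in> haar_level (Suc k)" if "m \<in> ?L" for m using h_level[of m] that by (simp del: haar_level.simps)
    qed
    also have "lincomb ?L c h = (\<lambda>x. ((lincomb (low M (Suc k)) c h x - u (Suc k) x) - (lincomb (low M k) c h x - u k x)) + (u (Suc k) x - u k x))"
      using lincomb_low_Suc[OF M, of k c] by auto
    also have "Lp_pow p \<dots> \<le> 2 powr p * (Lp_pow p (\<lambda>x. (lincomb (low M (Suc k)) c h x - u (Suc k) x) - (lincomb (low M k) c h x - u k x)) + w)"
      unfolding w_def by (intro add_in_Lp_space(2) p diff_in_Lp_space(1) eL wL)
    also have "\<dots> \<le> 2 powr p * (2 powr p * (a (Suc k) + a k) + w)"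
      unfolding a_def by (intro mult_left_mono add_right_mono diff_in_Lp_space(2) p eL) auto
    also have "\<dots> \<le> 2 powr p * (2 powr p * (a (Suc k) + a k) + 2 powr p * w)"
      using w0 p mult_right_mono[of 1 "2 powr p" w] by (intro mult_left_mono add_left_mono) (auto simp: ge_one_powr_ge_zero)
    also have "\<dots> = (2 powr p * 2 powr p) * (a k + a (Suc k) + w)" by (simp add: algebra_simps)
    finally have "Lp_pow p (lincomb M' c h) \<le> (2 ^ CARD('d)) powr p * \<sigma> * ((2 powr p * 2 powr p) * (a k + a (Suc k) + w))"
      using \<sigma> by (simp add: \<sigma>_def mult_left_mono)
    then have "\<rho> ^ Suc k * Lp_pow p (lincomb M' c h) \<le> \<rho> ^ Suc k * ((2 ^ CARD('d)) powr p * \<sigma> * ((2 powr p * 2 powr p) * (a k + a (Suc k) + w)))"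
      using \<rho> by (intro mult_left_mono) auto
    also have "\<dots> = (2 ^ CARD('d)) powr p * \<sigma> * (2 powr p * 2 powr p) * (\<rho> * (\<rho> ^ k * a k) + 1 * (\<rho> ^ Suc k * a (Suc k)) + 1 * (\<rho> ^ Suc k * w))"
      by (simp add: algebra_simps)
    also have "\<dots> \<le> (2 ^ CARD('d)) powr p * \<sigma> * (2 powr p * 2 powr p) * (\<rho> * (\<rho> ^ k * a k) + \<rho> * (\<rho> ^ Suc k * a (Suc k)) + \<rho> * (\<rho> ^ Suc k * w))"
      using \<rho> \<sigma> a0 w0 by (intro mult_left_mono add_mono mult_right_mono mult_nonneg_nonneg) auto
    also have "\<dots> = D * (\<rho> ^ k * a k + \<rho> ^ Suc k * a (Suc k) + \<rho> ^ Suc k * w)"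
      by (simp add: D_def algebra_simps)
    finally have "(\<rho> ^ Suc k * Lp_pow p (lincomb M' c h)) powr r \<le> (D * (\<rho> ^ k * a k + \<rho> ^ Suc k * a (Suc k) + \<rho> ^ Suc k * w)) powr r"
      using r \<rho> by (intro powr_mono2) auto
    also have "\<dots> = D powr r * (\<rho> ^ k * a k + \<rho> ^ Suc k * a (Suc k) + \<rho> ^ Suc k * w) powr r"
      using D \<rho> a0 w0 by (simp add: powr_mult)
    also have "\<dots> \<le> D powr r * (2 powr r * ((\<rho> ^ k * a k + \<rho> ^ Suc k * a (Suc k)) powr r + (\<rho> ^ Suc k * w) powr r))"
      using r \<rho> a0 w0 by (intro mult_left_mono powr_add_le_nonneg) auto
    also have "\<dots> \<le> D powr r * (2 powr r * (2 powr r * ((\<rho> ^ k * a k) powr r + (\<rho> ^ Suc k * a (Suc k)) powr r) + 2 powr r * (\<rho> ^ Suc k * w) powr r))"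
    proof (intro mult_left_mono add_mono)
      show "(\<rho> ^ k * a k + \<rho> ^ Suc k * a (Suc k)) powr r \<le> 2 powr r * ((\<rho> ^ k * a k) powr r + (\<rho> ^ Suc k * a (Suc k)) powr r)"
        using r \<rho> a0 by (intro powr_add_le_nonneg) auto
      have "1 \<le> (2::real) powr r" using r by (simp add: ge_one_powr_ge_zero)
      then show "(\<rho> ^ Suc k * w) powr r \<le> 2 powr r * (\<rho> ^ Suc k * w) powr r"
        using mult_right_mono[of 1 "2 powr r" "(\<rho> ^ Suc k * w) powr r"] by simp
    qed auto
    also have "\<dots> = C * ((\<rho> ^ k * a k) powr r + (\<rho> ^ Suc k * a (Suc k)) powr r + (\<rho> ^ Suc k * w) powr r)"
      by (simp add: C_def algebra_simps)
    finally show "(\<rho> ^ Suc k * Lp_pow p (lincomb M' c h)) powr r \<le>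
     C * ((\<rho> ^ k * Lp_pow p (\<lambda>x. lincomb (low M k) c h x - u k x)) powr r +
          (\<rho> ^ Suc k * Lp_pow p (\<lambda>x. lincomb (low M (Suc k)) c h x - u (Suc k) x)) powr r +
          (\<rho> ^ Suc k * Lp_pow p (\<lambda>x. u (Suc k) x - u k x)) powr r)"
      by (simp add: a_def w_def)
  qed
qed

lemma lev_zero_unique: "lev m = 0 \<Longrightarrow> lev n = 0 \<Longrightarrow> m = n"
  using h_level[of m] h_level[of n] by (intro injD[OF inj_h]) simp

text \<open>Level 0 consists of one function, so a subset keeps either all of it or nothing.\<close>

lemma level_zero_le:
  assumes "finite M" "M' \<subseteq> M"
  shows "Lp_pow p (lincomb {m \<in> M'. lev m = 0} c h) \<le> Lp_pow p (lincomb (low M 0) c h)"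
proof (cases "{m \<in> M'. lev m = 0} = {}")
  case True
  have "Lp_pow p (lincomb {} c h) = 0" by (simp add: lincomb_def[abs_def] Lp_pow_def)
  then show ?thesis unfolding True by simp
next
  case False
  then have "{m \<in> M'. lev m = 0} = low M 0" using assms lev_zero_unique by (auto simp: low_def)
  then show ?thesis by simp
qed

text \<open>The weighted truncation error at level k is bounded by the increments b_j, j \<ge> k,
  with ratio \<sigma>/\<rho> per level. Since this is below 1, Hardy makes the errors summable; the
  level parts of any subset are then summable too, and \<open>besov_series_upper\<close> reassembles
  them.\<close>

theorem subsum_bound_unconditional:
  assumes \<sigma>\<rho>: "\<sigma> < \<rho>"
  shows "\<exists>C\<ge>1. \<forall>M M' c. finite M \<longrightarrow> M' \<subseteq> M \<longrightarrow> besov_pow p q s (lincomb M' c h) \<le> C * besov_pow p q s (lincomb M c h)"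
proof -
  obtain C1 where C1: "C1 \<ge> 1" "\<And>M c. finite M \<Longrightarrow> \<exists>u J. (\<forall>k. dyadic_step k (u k)) \<and> (\<forall>k\<ge>J. u k = lincomb M c h \<and> low M k = M) \<and>
     summable (\<lambda>j. (\<rho> ^ Suc j * Lp_pow p (\<lambda>x. u (Suc j) x - u j x)) powr r) \<and>
     (\<Sum>j. (\<rho> ^ Suc j * Lp_pow p (\<lambda>x. u (Suc j) x - u j x)) powr r) \<le> C1 * besov_pow p q s (lincomb M c h) \<and>
     Lp_pow p (u 0) powr r \<le> C1 * besov_pow p q s (lincomb M c h)"
    using haar_approximants by (elim exE conjE) (rule that, assumption, blast)
  obtain C2 where C2: "C2 > 0" "\<And>M M' c (u :: nat \<Rightarrow> real^'d \<Rightarrow> real) k. finite M \<Longrightarrow> (\<forall>k. dyadic_step k (u k)) \<Longrightarrow> M' \<subseteq> {m \<in> M. lev m = Suc k} \<Longrightarrow>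
    (\<rho> ^ Suc k * Lp_pow p (lincomb M' c h)) powr r \<le>
     C2 * ((\<rho> ^ k * Lp_pow p (\<lambda>x. lincomb (low M k) c h x - u k x)) powr r +
          (\<rho> ^ Suc k * Lp_pow p (\<lambda>x. lincomb (low M (Suc k)) c h x - u (Suc k) x)) powr r +
          (\<rho> ^ Suc k * Lp_pow p (\<lambda>x. u (Suc k) x - u k x)) powr r)"
    using level_diff_bound by (elim exE conjE) (rule that, assumption, blast)
  obtain C3 where C3: "C3 > 0" "\<And>(f :: real^'d \<Rightarrow> real) v. f \<in> Lp_space p unit_cube \<Longrightarrow> (\<forall>j. dyadic_step j (v j)) \<Longrightarrow>
     summable (\<lambda>j. (\<rho> ^ j * Lp_pow p (v j)) powr r) \<Longrightarrow>
     (\<lambda>n. Lp_pow p (\<lambda>x. f x - (\<Sum>j<n. v j x))) \<longlonglongrightarrow> 0 \<Longrightarrow>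
     f \<in> besov_space p q s \<and> besov_pow p q s f \<le> C3 * (\<Sum>j. (\<rho> ^ j * Lp_pow p (v j)) powr r)"
    using besov_series_upper by blast
  \<comment> \<open>Halfway between 1 and \<rho>/\<sigma>, so that the loss in the quasi-triangle
    inequality still leaves \<theta> = \<tau> \<sigma> / \<rho> below 1.\<close>
  define \<tau> where "\<tau> = (1 + \<rho> / \<sigma>) / 2"
  have \<tau>: "1 < \<tau>" "\<tau> * \<sigma> < \<rho>" using \<sigma>\<rho> \<sigma> by (auto simp: \<tau>_def field_simps)
  define \<theta> where "\<theta> = \<tau> * \<sigma> / \<rho>"
  have \<theta>: "0 \<le> \<theta>" "\<theta> < 1" using \<tau> \<sigma> \<rho> by (auto simp: \<theta>_def)
  obtain K where K: "K > 0" "\<And>J k (a :: nat \<Rightarrow> real). finite J \<Longrightarrow>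
    \<bar>\<Sum>j\<in>J. a j\<bar> powr p \<le> K * (\<Sum>j\<in>J. \<tau> ^ ndist j k * \<bar>a j\<bar> powr p)"
    using weighted_power_sum[OF p \<tau>(1)] by blast
  obtain H where H: "H > 0" "\<And>b x :: nat \<Rightarrow> real. (\<forall>j. 0 \<le> b j) \<Longrightarrow> summable (\<lambda>j. b j powr r) \<Longrightarrow> (\<forall>k. 0 \<le> x k) \<Longrightarrow>
     (\<forall>k. \<forall>e>0. \<exists>J. finite J \<and> x k \<le> (\<Sum>j\<in>J. \<theta> ^ ndist j k * b j) + e) \<Longrightarrow>
     summable (\<lambda>k. x k powr r) \<and> (\<Sum>k. x k powr r) \<le> H * (\<Sum>j. b j powr r)"
    using discrete_hardy[OF r \<theta>] by blast
  define A where "A = K * \<sigma> / \<rho>"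
  have A: "A > 0" using K \<sigma> \<rho> by (simp add: A_def)
  define Y where "Y = A powr r * (H * C1)"
  have Y: "Y \<ge> 0" using H C1 by (simp add: Y_def)
  define Q where "Q = (2 powr p) powr r * 2 powr r"
  have Q: "Q \<ge> 0" by (simp add: Q_def)
  define C where "C = 1 + C3 * (Q * (Y + C1) + C2 * (Y + Y + C1))"
  have C: "C \<ge> 1" using C1 C2 C3 Q Y by (simp add: C_def)
  show ?thesis
  proof (intro exI[of _ C] conjI C allI impI)
    fix M M' :: "nat set" and c
    assume M: "finite M" and sub: "M' \<subseteq> M"
    define N where "N = besov_pow p q s (lincomb M c h)"
    have N: "0 \<le> N" unfolding N_def by (intro besov_pow_nonneg p q s lincomb_besov M)
    obtain u J where u: "\<And>k. dyadic_step k (u k)" and uJ: "\<And>k. k \<ge> J \<Longrightarrow> u k = lincomb M c h" "\<And>k. k \<ge> J \<Longrightarrow> low M k = M"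
      and sb: "summable (\<lambda>j. (\<rho> ^ Suc j * Lp_pow p (\<lambda>x. u (Suc j) x - u j x)) powr r)"
      and sumb: "(\<Sum>j. (\<rho> ^ Suc j * Lp_pow p (\<lambda>x. u (Suc j) x - u j x)) powr r) \<le> C1 * N"
      and u0: "Lp_pow p (u 0) powr r \<le> C1 * N"
      using C1(2)[OF M, of c] unfolding N_def by blast
    define b where "b j = \<rho> ^ Suc j * Lp_pow p (\<lambda>x. u (Suc j) x - u j x)" for j
    have b0: "0 \<le> b j" for j using \<rho> by (simp add: b_def)
    define a where "a k = Lp_pow p (\<lambda>x. lincomb (low M k) c h x - u k x)" for k
    have a0: "0 \<le> a k" for k by (simp add: a_def)
    have ak: "\<rho> ^ k * a k \<le> A * (\<Sum>j\<in>{k..<J}. \<theta> ^ ndist j k * b j)" for k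
    proof (cases "k \<le> J")
      case False
      then have "a k = 0" using uJ[of k] by (simp add: a_def Lp_pow_def)
      then show ?thesis using A \<theta> b0 by (simp add: sum_nonneg)
    next
      case True
      define w where "w j = iter_avg k (J - k) (\<lambda>x. u (Suc j) x - u j x)" for j
      have w: "dyadic_step k (w j)" "Lp_pow p (w j) \<le> \<sigma> ^ (Suc j - k) * Lp_pow p (\<lambda>x. u (Suc j) x - u j x)" if "j \<in> {k..<J}" for j
        unfolding w_def using trunc_term_bound[OF u that] by auto
      have eq: "lincomb (low M k) c h x - u k x = (\<Sum>j\<in>{k..<J}. w j x)" if "x \<in> half_cube" for x
        unfolding w_def using uJ True by (intro trunc_identity M u that) auto
      have "dyadic_step k (\<lambda>x. lincomb (low M k) c h x - u k x)" by (intro dyadic_step_diff lincomb_low_step u)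
      then have "a k = Lp_pow p (\<lambda>x. \<Sum>j\<in>{k..<J}. w j x)"
        unfolding a_def by (rule dyadic_step_cong(2)[symmetric]) (rule eq)
      also have "\<dots> \<le> (\<Sum>j\<in>{k..<J}. (K * \<tau> ^ ndist j k) * Lp_pow p (w j))"
      proof (rule sum_in_Lp_space(2)[OF p])
        show "w j \<in> Lp_space p unit_cube" if "j \<in> {k..<J}" for j using dyadic_step_Lp(1)[OF w(1)[OF that]] .
        show "\<bar>\<Sum>j\<in>{k..<J}. a j\<bar> powr p \<le> (\<Sum>j\<in>{k..<J}. K * \<tau> ^ ndist j k * \<bar>a j\<bar> powr p)" for a :: "nat \<Rightarrow> real"
          using K(2)[of "{k..<J}" a k] by (simp add: sum_distrib_left mult.assoc)
      qed simp
      finally have "\<rho> ^ k * a k \<le> \<rho> ^ k * (\<Sum>j\<in>{k..<J}. (K * \<tau> ^ ndist j k) * Lp_pow p (w j))"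
        using \<rho> by (intro mult_left_mono) auto
      also have "\<dots> = (\<Sum>j\<in>{k..<J}. \<rho> ^ k * ((K * \<tau> ^ ndist j k) * Lp_pow p (w j)))" by (simp add: sum_distrib_left)
      also have "\<dots> \<le> (\<Sum>j\<in>{k..<J}. A * (\<theta> ^ ndist j k * b j))"
      proof (rule sum_mono)
        fix j assume j: "j \<in> {k..<J}"
        define i where "i = j - k"
        have i: "j = k + i" "ndist j k = i" "Suc j - k = Suc i" using j by (auto simp: i_def ndist_def)
        define W where "W = Lp_pow p (\<lambda>x. u (Suc j) x - u j x)"
        have "\<rho> ^ k * ((K * \<tau> ^ ndist j k) * Lp_pow p (w j)) \<le> \<rho> ^ k * ((K * \<tau> ^ i) * (\<sigma> ^ Suc i * W))"
          unfolding i(2) W_def using w(2)[OF j] K \<tau> \<rho> unfolding i(3) by (intro mult_left_mono) auto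
        also have "\<dots> = A * (\<theta> ^ i * (\<rho> ^ Suc j * W))"
          unfolding i(1) A_def \<theta>_def using \<rho> by (simp add: power_add power_divide power_mult_distrib)
        finally show "\<rho> ^ k * ((K * \<tau> ^ ndist j k) * Lp_pow p (w j)) \<le> A * (\<theta> ^ ndist j k * b j)"
          by (simp add: i(2) b_def W_def)
      qed
      finally show ?thesis by (simp add: sum_distrib_left)
    qed
    define x where "x k = \<rho> ^ k * a k / A" for k
    have x: "summable (\<lambda>k. x k powr r) \<and> (\<Sum>k. x k powr r) \<le> H * (\<Sum>j. b j powr r)"
    proof (rule H(2))
      show "\<forall>k. \<forall>e>0. \<exists>J. finite J \<and> x k \<le> (\<Sum>j\<in>J. \<theta> ^ ndist j k * b j) + e"
      proof (intro allI impI)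
        fix k and e :: real assume "0 < e"
        have "x k \<le> (\<Sum>j\<in>{k..<J}. \<theta> ^ ndist j k * b j)" using ak[of k] A by (simp add: x_def field_simps)
        then show "\<exists>J. finite J \<and> x k \<le> (\<Sum>j\<in>J. \<theta> ^ ndist j k * b j) + e"
          using \<open>0 < e\<close> by (intro exI[of _ "{k..<J}"]) auto
      qed
      show "\<forall>j. 0 \<le> b j" using b0 by blast
      show "summable (\<lambda>j. b j powr r)" using sb by (simp add: b_def)
      show "\<forall>k. 0 \<le> x k" using a0 \<rho> A by (simp add: x_def)
    qed
    define y where "y k = (\<rho> ^ k * a k) powr r" for k
    have yx: "y k = A powr r * x k powr r" for k using A a0 \<rho> by (simp add: y_def x_def powr_divide)
    have sy: "summable y" unfolding yx[abs_def] using x by (intro summable_mult) auto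
    have "suminf y = A powr r * (\<Sum>k. x k powr r)" unfolding yx[abs_def] using x by (intro suminf_mult) auto
    also have "\<dots> \<le> A powr r * (H * (C1 * N))"
      using x sumb H by (intro mult_left_mono order_trans[OF conjunct2[OF x]]) (auto simp: b_def)
    finally have sumy: "suminf y \<le> Y * N" by (simp add: Y_def mult_ac)
    have y0: "0 \<le> y k" for k by (simp add: y_def)
    define f where "f = lincomb M' c h"
    \<comment> \<open>Grouping the subset by levels writes it as a series of step functions, one per
      level.\<close>
    define v where "v k = lincomb {m \<in> M'. lev m = k} c h" for k
    have v: "dyadic_step k (v k)" for k unfolding v_def by (rule lincomb_step) simp
    have finM': "finite M'" using M sub finite_subset by blast
    define z where "z k = (\<rho> ^ k * Lp_pow p (v k)) powr r" for k
    have z0: "0 \<le> z k" for k by (simp add: z_def)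
    have zS: "z (Suc k) \<le> C2 * (y k + y (Suc k) + b k powr r)" for k
      unfolding z_def v_def y_def a_def b_def using sub u by (intro C2(2)[OF M]) auto
    have z00: "z 0 \<le> Q * ((Y + C1) * N)"
    proof -
      have "Lp_pow p (v 0) \<le> Lp_pow p (lincomb (low M 0) c h)" unfolding v_def by (rule level_zero_le[OF M sub])
      also have "\<dots> = Lp_pow p (\<lambda>x. (lincomb (low M 0) c h x - u 0 x) + u 0 x)" by simp
      also have "\<dots> \<le> 2 powr p * (a 0 + Lp_pow p (u 0))"
        unfolding a_def by (intro add_in_Lp_space(2) p dyadic_step_Lp(1)[of 0] dyadic_step_diff lincomb_low_step u)
      finally have "z 0 \<le> (2 powr p * (a 0 + Lp_pow p (u 0))) powr r"
        unfolding z_def using r by (simp add: powr_mono2)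
      also have "\<dots> = (2 powr p) powr r * (a 0 + Lp_pow p (u 0)) powr r" using a0 by (simp add: powr_mult)
      also have "\<dots> \<le> (2 powr p) powr r * (2 powr r * (a 0 powr r + Lp_pow p (u 0) powr r))"
        using r a0 by (intro mult_left_mono powr_add_le_nonneg) auto
      also have "\<dots> = Q * (y 0 + Lp_pow p (u 0) powr r)" by (simp add: Q_def y_def)
      also have "\<dots> \<le> Q * (Y * N + C1 * N)"
        using u0 sumy sum_le_suminf[OF sy, of "{0}"] y0 Q by (intro mult_left_mono add_mono) auto
      finally show ?thesis by (simp add: algebra_simps)
    qed
    have syS: "summable (\<lambda>k. y (Suc k))" using sy by (simp add: summable_Suc_iff)
    have sb': "summable (\<lambda>j. b j powr r)" using sb by (simp add: b_def)
    have sC: "summable (\<lambda>k. C2 * (y k + y (Suc k) + b k powr r))" by (intro summable_mult summable_add sy syS sb')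
    have szS: "summable (\<lambda>k. z (Suc k))" by (rule summable_comparison_test'[OF sC, of 0]) (use zS z0 in auto)
    then have sz: "summable z" by (simp add: summable_Suc_iff)
    have yS: "(\<Sum>k. y (Suc k)) \<le> Y * N" using suminf_split_head[OF sy] y0[of 0] sumy by simp
    have "(\<Sum>k. z (Suc k)) \<le> (\<Sum>k. C2 * (y k + y (Suc k) + b k powr r))" by (intro suminf_le zS szS sC)
    also have "\<dots> = C2 * (suminf y + (\<Sum>k. y (Suc k)) + (\<Sum>k. b k powr r))"
      using sy syS sb' by (simp add: suminf_mult summable_add suminf_add[symmetric])
    also have "\<dots> \<le> C2 * (Y * N + Y * N + C1 * N)"
      using sumy yS sumb C2 by (intro mult_left_mono add_mono) (auto simp: b_def)
    finally have "suminf z \<le> Q * ((Y + C1) * N) + C2 * (Y * N + Y * N + C1 * N)"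
      using suminf_split_head[OF sz] z00 by simp
    also have "\<dots> = (Q * (Y + C1) + C2 * (Y + Y + C1)) * N" by (simp add: algebra_simps)
    finally have sumz: "suminf z \<le> (Q * (Y + C1) + C2 * (Y + Y + C1)) * N" .
    have lim: "(\<lambda>n. Lp_pow p (\<lambda>x. f x - (\<Sum>j<n. v j x))) \<longlonglongrightarrow> 0"
    proof (rule tendsto_eventually)
      have "Lp_pow p (\<lambda>x. f x - (\<Sum>j<n. v j x)) = 0" if n: "n > J" for n
      proof -
        have "lev m < n" if "m \<in> M'" for m
        proof -
          have "m \<in> low M J" using that sub uJ(2)[of J] by auto
          then show ?thesis using n by (simp add: low_def)
        qed
        then have "(\<Sum>j<n. v j x) = f x" for x unfolding v_def f_def by (intro lincomb_fibers finM')
        then show ?thesis by (simp add: Lp_pow_def)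
      qed
      then show "\<forall>\<^sub>F n in sequentially. Lp_pow p (\<lambda>x. f x - (\<Sum>j<n. v j x)) = 0"
        by (auto simp: eventually_sequentially intro!: exI[of _ "Suc J"])
    qed
    have "besov_pow p q s f \<le> C3 * suminf z"
      using C3(2)[of f v] Lp_of_besov[OF lincomb_besov[OF finM']] v sz lim by (auto simp: f_def z_def[abs_def])
    also have "\<dots> \<le> C3 * ((Q * (Y + C1) + C2 * (Y + Y + C1)) * N)" using sumz C3 by (intro mult_left_mono) auto
    also have "\<dots> \<le> C * N" using N by (simp add: C_def algebra_simps)
    finally show "besov_pow p q s (lincomb M' c h) \<le> C * besov_pow p q s (lincomb M c h)"
      by (simp add: f_def N_def)
  qed
qed

text \<open>In the limiting case the truncation errors are only bounded, not summable, but a level-ordered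
  partial sum meets a single truncation and one incomplete level.\<close>

theorem subsum_bound_initial:
  assumes \<sigma>\<rho>: "\<sigma> = \<rho>" and p1: "p \<le> 1" and qp: "q \<le> p"
  shows "\<exists>C\<ge>1. \<forall>M c n. finite M \<longrightarrow> besov_pow p q s (lincomb {m \<in> M. m < n} c h) \<le> C * besov_pow p q s (lincomb M c h)"
proof -
  have r1: "r \<le> 1" using p qp by (simp add: r_def)
  obtain C1 where C1: "C1 \<ge> 1" "\<And>M c. finite M \<Longrightarrow> \<exists>u J. (\<forall>k. dyadic_step k (u k)) \<and> (\<forall>k\<ge>J. u k = lincomb M c h \<and> low M k = M) \<and>
     summable (\<lambda>j. (\<rho> ^ Suc j * Lp_pow p (\<lambda>x. u (Suc j) x - u j x)) powr r) \<and>
     (\<Sum>j. (\<rho> ^ Suc j * Lp_pow p (\<lambda>x. u (Suc j) x - u j x)) powr r) \<le> C1 * besov_pow p q s (lincomb M c h) \<and>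
     Lp_pow p (u 0) powr r \<le> C1 * besov_pow p q s (lincomb M c h)"
    using haar_approximants by (elim exE conjE) (rule that, assumption, blast)
  obtain C2 where C2: "C2 > 0" "\<And>M M' c (u :: nat \<Rightarrow> real^'d \<Rightarrow> real) k. finite M \<Longrightarrow> (\<forall>k. dyadic_step k (u k)) \<Longrightarrow> M' \<subseteq> {m \<in> M. lev m = Suc k} \<Longrightarrow>
    (\<rho> ^ Suc k * Lp_pow p (lincomb M' c h)) powr r \<le>
     C2 * ((\<rho> ^ k * Lp_pow p (\<lambda>x. lincomb (low M k) c h x - u k x)) powr r +
          (\<rho> ^ Suc k * Lp_pow p (\<lambda>x. lincomb (low M (Suc k)) c h x - u (Suc k) x)) powr r +
          (\<rho> ^ Suc k * Lp_pow p (\<lambda>x. u (Suc k) x - u k x)) powr r)"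
    using level_diff_bound by (elim exE conjE) (rule that, assumption, blast)
  obtain C3 where C3: "C3 > 0" "\<And>(f :: real^'d \<Rightarrow> real) v. f \<in> Lp_space p unit_cube \<Longrightarrow> (\<forall>j. dyadic_step j (v j)) \<Longrightarrow>
     summable (\<lambda>j. (\<rho> ^ j * Lp_pow p (v j)) powr r) \<Longrightarrow>
     (\<lambda>n. Lp_pow p (\<lambda>x. f x - (\<Sum>j<n. v j x))) \<longlonglongrightarrow> 0 \<Longrightarrow>
     f \<in> besov_space p q s \<and> besov_pow p q s f \<le> C3 * (\<Sum>j. (\<rho> ^ j * Lp_pow p (v j)) powr r)"
    using besov_series_upper by blast
  obtain C4 where C4: "C4 > 0" "\<And>k (u :: real^'d \<Rightarrow> real). dyadic_step k u \<Longrightarrow>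
     u \<in> besov_space p q s \<and> besov_pow p q s u \<le> C4 * (\<rho> ^ k * Lp_pow p u) powr r"
    using besov_dyadic_step by blast
  obtain K where K: "K \<ge> 1" "\<And>f g :: real^'d \<Rightarrow> real. f \<in> besov_space p q s \<Longrightarrow> g \<in> besov_space p q s \<Longrightarrow>
     (\<lambda>x. f x + g x) \<in> besov_space p q s \<and> besov_pow p q s (\<lambda>x. f x + g x) \<le> K * (besov_pow p q s f + besov_pow p q s g)"
    using besov_pow_add[OF p q s, where 'd = 'd] by blast
  define E where "E = K * (K * (C4 * C1 + C3 * (2 * C1)) + C4 * (C2 * (3 * C1)))"
  have E: "E \<ge> 0" using K C1 C2 C3 C4 by (simp add: E_def)
  define C where "C = 1 + E"
  have C: "C \<ge> 1" using E by (simp add: C_def)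
  show ?thesis
  proof (intro exI[of _ C] conjI C allI impI)
    fix M :: "nat set" and c n
    assume M: "finite M"
    define N where "N = besov_pow p q s (lincomb M c h)"
    have N: "0 \<le> N" unfolding N_def by (intro besov_pow_nonneg p q s lincomb_besov M)
    obtain u J where u: "\<And>k. dyadic_step k (u k)" and uJ: "\<And>k. k \<ge> J \<Longrightarrow> u k = lincomb M c h" "\<And>k. k \<ge> J \<Longrightarrow> low M k = M"
      and sb: "summable (\<lambda>j. (\<rho> ^ Suc j * Lp_pow p (\<lambda>x. u (Suc j) x - u j x)) powr r)"
      and sumb: "(\<Sum>j. (\<rho> ^ Suc j * Lp_pow p (\<lambda>x. u (Suc j) x - u j x)) powr r) \<le> C1 * N"
      and u0: "Lp_pow p (u 0) powr r \<le> C1 * N"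
      using C1(2)[OF M, of c] unfolding N_def by blast
    note uL = dyadic_step_Lp(1)[OF u, of _ p]
    define b where "b j = \<rho> ^ Suc j * Lp_pow p (\<lambda>x. u (Suc j) x - u j x)" for j
    have b0: "0 \<le> b j" for j using \<rho> by (simp add: b_def)
    have sb': "summable (\<lambda>j. b j powr r)" and sumb': "(\<Sum>j. b j powr r) \<le> C1 * N" using sb sumb by (simp_all add: b_def)
    define a where "a k = Lp_pow p (\<lambda>x. lincomb (low M k) c h x - u k x)" for k
    have a0: "0 \<le> a k" for k by (simp add: a_def)
    \<comment> \<open>Here the loss \<sigma> per average is exactly cancelled by the weight \<rho>
      per level, so the increments enter undamped.\<close>
    have ak: "\<rho> ^ k * a k \<le> (\<Sum>j\<in>{k..<J}. b j)" for k
    proof (cases "k \<le> J")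
      case False
      then have "a k = 0" using uJ[of k] by (simp add: a_def Lp_pow_def)
      then show ?thesis using b0 by (simp add: sum_nonneg)
    next
      case True
      define w where "w j = iter_avg k (J - k) (\<lambda>x. u (Suc j) x - u j x)" for j
      have w: "dyadic_step k (w j)" "Lp_pow p (w j) \<le> \<sigma> ^ (Suc j - k) * Lp_pow p (\<lambda>x. u (Suc j) x - u j x)" if "j \<in> {k..<J}" for j
        unfolding w_def using trunc_term_bound[OF u that] by auto
      have eq: "lincomb (low M k) c h x - u k x = (\<Sum>j\<in>{k..<J}. w j x)" if "x \<in> half_cube" for x
        unfolding w_def using uJ True by (intro trunc_identity M u that) auto
      have "dyadic_step k (\<lambda>x. lincomb (low M k) c h x - u k x)" by (intro dyadic_step_diff lincomb_low_step u)
      then have "a k = Lp_pow p (\<lambda>x. \<Sum>j\<in>{k..<J}. w j x)"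
        unfolding a_def by (rule dyadic_step_cong(2)[symmetric]) (rule eq)
      also have "\<dots> \<le> (\<Sum>j\<in>{k..<J}. 1 * Lp_pow p (w j))"
      proof (rule sum_in_Lp_space(2)[OF p])
        show "w j \<in> Lp_space p unit_cube" if "j \<in> {k..<J}" for j using dyadic_step_Lp(1)[OF w(1)[OF that]] .
        show "\<bar>\<Sum>j\<in>{k..<J}. a j\<bar> powr p \<le> (\<Sum>j\<in>{k..<J}. 1 * \<bar>a j\<bar> powr p)" for a :: "nat \<Rightarrow> real"
          using powr_sum_le[OF p p1, of "{k..<J}" a] by simp
      qed simp
      finally have "\<rho> ^ k * a k \<le> \<rho> ^ k * (\<Sum>j\<in>{k..<J}. 1 * Lp_pow p (w j))"
        using \<rho> by (intro mult_left_mono) auto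
      also have "\<dots> = (\<Sum>j\<in>{k..<J}. \<rho> ^ k * Lp_pow p (w j))" by (simp add: sum_distrib_left)
      also have "\<dots> \<le> (\<Sum>j\<in>{k..<J}. b j)"
      proof (rule sum_mono)
        fix j assume j: "j \<in> {k..<J}"
        have "\<rho> ^ k * Lp_pow p (w j) \<le> \<rho> ^ k * (\<sigma> ^ (Suc j - k) * Lp_pow p (\<lambda>x. u (Suc j) x - u j x))"
          using w(2)[OF j] \<rho> by (intro mult_left_mono) auto
        also have "\<dots> = \<rho> ^ (k + (Suc j - k)) * Lp_pow p (\<lambda>x. u (Suc j) x - u j x)"
          unfolding \<sigma>\<rho> by (simp add: power_add)
        also have "k + (Suc j - k) = Suc j" using j by simp
        finally show "\<rho> ^ k * Lp_pow p (w j) \<le> b j" by (simp add: b_def)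
      qed
      finally show ?thesis .
    qed
    define y where "y k = (\<rho> ^ k * a k) powr r" for k
    \<comment> \<open>This is where q \<le> p is used: subadditivity of t^r lets the l_r sum of the
      increments dominate their plain sum.\<close>
    have sum_b_powr: "(\<Sum>j\<in>F. b j) powr r \<le> C1 * N" if "finite F" for F
    proof -
      have "(\<Sum>j\<in>F. b j) powr r = \<bar>\<Sum>j\<in>F. b j\<bar> powr r" using b0 by (simp add: sum_nonneg)
      also have "\<dots> \<le> (\<Sum>j\<in>F. \<bar>b j\<bar> powr r)" by (rule powr_sum_le[OF r r1 that])
      also have "\<dots> = (\<Sum>j\<in>F. b j powr r)" using b0 by simp
      also have "\<dots> \<le> (\<Sum>j. b j powr r)" by (intro sum_le_suminf sb' that) auto
      finally show ?thesis using sumb' by simp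
    qed
    have y: "y k \<le> C1 * N" for k
    proof -
      have "y k \<le> (\<Sum>j\<in>{k..<J}. b j) powr r" unfolding y_def using r ak a0 \<rho> by (intro powr_mono2) auto
      then show ?thesis using sum_b_powr[of "{k..<J}"] by simp
    qed
    have bk: "b k powr r \<le> C1 * N" for k using sum_b_powr[of "{k}"] by simp
    show "besov_pow p q s (lincomb {m \<in> M. m < n} c h) \<le> C * besov_pow p q s (lincomb M c h)"
    proof (cases "lev n")
      \<comment> \<open>The single function of level 0 comes first in the enumeration, so the
        initial segment is empty.\<close>
      case 0
      have e: "{m \<in> M. m < n} = {}"
      proof (rule ccontr)
        assume "{m \<in> M. m < n} \<noteq> {}"
        then obtain m where m: "m < n" by auto
        then show False using lev_less_imp[of n m] lev_zero_unique[OF _ 0, of m] 0 by (cases "lev m") auto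
      qed
      have "besov_pow p q s (lincomb {} c h) \<le> C4 * (\<rho> ^ 0 * Lp_pow p (lincomb {} c h)) powr r"
        using C4(2)[of 0 "lincomb {} c h"] lincomb_step[of "{}" 0 c] by simp
      also have "\<dots> = 0" using r by (simp add: lincomb_def[abs_def] Lp_pow_def)
      also have "0 \<le> C * N" using N C by simp
      finally show ?thesis unfolding e N_def .
    next
      case (Suc k)
      define M' where "M' = {m \<in> M. m < n \<and> lev m = Suc k}"
      have split: "{m \<in> M. m < n} = low M k \<union> M'"
      proof (intro subset_antisym subsetI)
        fix m assume m: "m \<in> {m \<in> M. m < n}"
        then have "\<not> n < m" by simp
        then have "lev m \<le> Suc k" using lev_less_imp[of n m] Suc by linarith
        then have "lev m \<le> k \<or> lev m = Suc k" by linarith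
        then show "m \<in> low M k \<union> M'" using m unfolding low_def M'_def by blast
      next
        fix m assume "m \<in> low M k \<union> M'"
        then have m: "m \<in> M" "lev m \<le> k \<or> m < n" unfolding low_def M'_def by blast+
        then have "m < n" using lev_less_imp[of m n] Suc by linarith
        with m show "m \<in> {m \<in> M. m < n}" by blast
      qed
      \<comment> \<open>Truncation error, approximant and incomplete level: the error is a single
        step function, to which Bernstein applies, and only the approximant needs a whole
        series.\<close>
      have eq: "lincomb {m \<in> M. m < n} c h = (\<lambda>x. ((lincomb (low M k) c h x - u k x) + u k x) + lincomb M' c h x)"
      proof
        fix x
        show "lincomb {m \<in> M. m < n} c h x = ((lincomb (low M k) c h x - u k x) + u k x) + lincomb M' c h x"
          unfolding split lincomb_def using M by (subst sum.union_disjoint) (auto simp: low_def M'_def)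
      qed
      have s1: "dyadic_step k (\<lambda>x. lincomb (low M k) c h x - u k x)" by (intro dyadic_step_diff lincomb_low_step u)
      have s3: "dyadic_step (Suc k) (lincomb M' c h)" by (rule lincomb_step) (simp add: M'_def)
      have n1: "besov_pow p q s (\<lambda>x. lincomb (low M k) c h x - u k x) \<le> C4 * (C1 * N)"
        using C4(2)[OF s1] mult_left_mono[OF y[of k], of C4] C4(1) unfolding y_def a_def by linarith
      have n3: "besov_pow p q s (lincomb M' c h) \<le> C4 * (C2 * (3 * (C1 * N)))"
      proof -
        have "(\<rho> ^ Suc k * Lp_pow p (lincomb M' c h)) powr r \<le> C2 * (y k + y (Suc k) + b k powr r)"
          unfolding y_def a_def b_def using u by (intro C2(2)[OF M]) (auto simp: M'_def)
        also have "\<dots> \<le> C2 * (3 * (C1 * N))"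
          using y[of k] y[of "Suc k"] bk[of k] C2 by (intro mult_left_mono) auto
        finally show ?thesis using C4(2)[OF s3] C4(1) by (meson less_imp_le mult_left_mono order_trans)
      qed
      \<comment> \<open>The approximant is the sum of its increments up to level k, so the series
        bound applies with the increments beyond k set to 0.\<close>
      have n2: "besov_pow p q s (u k) \<le> C3 * (2 * C1 * N)"
      proof -
        define v where "v i = (if i = 0 then u 0 else if i \<le> k then (\<lambda>x. u i x - u (i - 1) x) else (\<lambda>_. 0))" for i
        have v: "dyadic_step i (v i)" for i
          unfolding v_def by (auto intro!: dyadic_step_const dyadic_step_diff u dyadic_step_mono[OF u])
        define z where "z i = (\<rho> ^ i * Lp_pow p (v i)) powr r" for i
        have zz: "Lp_pow p (\<lambda>_ :: real^'d. 0) = 0" by (simp add: Lp_pow_def)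
        have zi: "z i = 0" if "i \<notin> {..k}" for i using that r by (simp add: z_def v_def zz)
        have sz: "summable z" by (rule summable_finite[of "{..k}"]) (use zi in auto)
        have "suminf z = (\<Sum>i\<le>k. z i)" by (rule suminf_finite) (use zi in auto)
        also have "\<dots> = z 0 + (\<Sum>j<k. z (Suc j))" by (simp add: sum.atMost_shift)
        also have "\<dots> = Lp_pow p (u 0) powr r + (\<Sum>j<k. b j powr r)"
          by (intro arg_cong2[where f = "(+)"] sum.cong) (auto simp: z_def v_def b_def)
        also have "\<dots> \<le> C1 * N + C1 * N"
          using u0 sum_le_suminf[OF sb', of "{..<k}"] sumb' by (intro add_mono) auto
        finally have z: "suminf z \<le> 2 * C1 * N" by simp
        have tel: "(\<Sum>i<Suc m. v i x) = u (min m k) x" for m x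
        proof (induction m)
          case (Suc m)
          have "(\<Sum>i<Suc (Suc m). v i x) = u (min m k) x + v (Suc m) x" unfolding Suc.IH[symmetric] by simp
          also have "\<dots> = u (min (Suc m) k) x"
            by (cases "Suc m \<le> k") (simp_all add: v_def min_absorb1 min_absorb2)
          finally show ?case .
        qed (simp add: v_def)
        have "(\<lambda>m. Lp_pow p (\<lambda>x. u k x - (\<Sum>i<m. v i x))) \<longlonglongrightarrow> 0"
        proof (rule tendsto_eventually)
          have "Lp_pow p (\<lambda>x. u k x - (\<Sum>i<m. v i x)) = 0" if mk: "m > k" for m
          proof -
            obtain m' where "m = Suc m'" "k \<le> m'" using mk by (cases m) auto
            then have "(\<lambda>x. u k x - (\<Sum>i<m. v i x)) = (\<lambda>_. 0)" using tel[where m = m'] by (simp add: min_absorb2)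
            then show ?thesis using zz by simp
          qed
          then show "\<forall>\<^sub>F m in sequentially. Lp_pow p (\<lambda>x. u k x - (\<Sum>i<m. v i x)) = 0"
            by (auto simp: eventually_sequentially intro!: exI[of _ "Suc k"])
        qed
        then have "besov_pow p q s (u k) \<le> C3 * suminf z"
          using C3(2)[OF uL, of v] v sz by (auto simp: z_def[abs_def])
        also have "\<dots> \<le> C3 * (2 * C1 * N)" using z C3 by (intro mult_left_mono) auto
        finally show ?thesis .
      qed
      have B: "(\<lambda>x. lincomb (low M k) c h x - u k x) \<in> besov_space p q s" "u k \<in> besov_space p q s"
        "lincomb M' c h \<in> besov_space p q s"
        using C4(2)[OF s1] C4(2)[OF u] C4(2)[OF s3] by auto
      have "besov_pow p q s (lincomb {m \<in> M. m < n} c h) \<le>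
         K * (besov_pow p q s (\<lambda>x. (lincomb (low M k) c h x - u k x) + u k x) + besov_pow p q s (lincomb M' c h))"
        unfolding eq using K(2)[OF conjunct1[OF K(2)[OF B(1,2)]] B(3)] by blast
      also have "\<dots> \<le> K * (K * (C4 * (C1 * N) + C3 * (2 * C1 * N)) + C4 * (C2 * (3 * (C1 * N))))"
      proof (intro mult_left_mono add_mono n3)
        have "besov_pow p q s (\<lambda>x. (lincomb (low M k) c h x - u k x) + u k x) \<le>
            K * (besov_pow p q s (\<lambda>x. lincomb (low M k) c h x - u k x) + besov_pow p q s (u k))"
          using K(2)[OF B(1,2)] by blast
        also have "\<dots> \<le> K * (C4 * (C1 * N) + C3 * (2 * C1 * N))"
          using n1 n2 K by (intro mult_left_mono add_mono) auto
        finally show "besov_pow p q s (\<lambda>x. (lincomb (low M k) c h x - u k x) + u k x) \<le> K * (C4 * (C1 * N) + C3 * (2 * C1 * N))" .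
      qed (use K in auto)
      also have "\<dots> = E * N" by (simp add: E_def algebra_simps)
      also have "\<dots> \<le> C * N" using N by (simp add: C_def algebra_simps)
      finally show ?thesis by (simp add: N_def)
    qed
  qed
qed

end

section \<open>The basis property\<close>

lemma lincomb_comp:
  assumes "bij \<pi>"
  shows "lincomb M c (h \<circ> \<pi>) = lincomb (\<pi> ` M) (c \<circ> inv \<pi>) h"
proof
  fix x
  have "inj_on \<pi> M" using assms by (meson bij_is_inj inj_on_subset subset_UNIV)
  then show "lincomb M c (h \<circ> \<pi>) x = lincomb (\<pi> ` M) (c \<circ> inv \<pi>) h x"
    unfolding lincomb_def using assms by (subst sum.reindex) (auto simp: bij_is_inj inv_f_f)
qed

context haar_enum
begin

lemma \<sigma>_less_iff:
  assumes "p < 1"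
  shows "\<sigma> < \<rho> \<longleftrightarrow> real CARD('d) * (1 / p - 1) < s" "\<sigma> = \<rho> \<longleftrightarrow> s = real CARD('d) * (1 / p - 1)"
proof -
  have \<sigma>: "\<sigma> = 2 powr (real CARD('d) * (1 - p))" using assms by (simp add: \<sigma>_def avg_growth_def)
  have e: "real CARD('d) * (1 - p) = (real CARD('d) * (1 / p - 1)) * p" using p by (simp add: field_simps)
  show "\<sigma> < \<rho> \<longleftrightarrow> real CARD('d) * (1 / p - 1) < s" "\<sigma> = \<rho> \<longleftrightarrow> s = real CARD('d) * (1 / p - 1)"
    unfolding \<sigma> \<rho>_def e using p by (auto simp: powr_inj)
qed

lemma \<sigma>_less_of_ge_1: "1 \<le> p \<Longrightarrow> \<sigma> < \<rho>"
  using \<rho> by (simp add: \<sigma>_def avg_growth_def)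

lemma lincomb_haar_levels:
  "lincomb {m. lev m \<le> n} (\<lambda>m. F (h m)) h x = (\<Sum>f\<in>(\<Union>j\<le>n. haar_level j). F f * f x)"
proof -
  have "h ` {m. lev m \<le> n} = (\<Union>j\<le>n. haar_level j)"
  proof (intro subset_antisym subsetI)
    fix g :: "real^'d \<Rightarrow> real" assume "g \<in> h ` {m. lev m \<le> n}"
    then show "g \<in> (\<Union>j\<le>n. haar_level j)" using h_level by blast
  next
    fix g :: "real^'d \<Rightarrow> real" assume "g \<in> (\<Union>j\<le>n. haar_level j)"
    then show "g \<in> h ` {m. lev m \<le> n}" using ex_h by blast
  qed
  then show ?thesis
    unfolding lincomb_def using sum.reindex[OF inj_on_subset[OF inj_h subset_UNIV], where A = "{m. lev m \<le> n}" and g = "\<lambda>f. F f * f x"]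
    by (simp add: o_def)
qed

lemma lincomb_dense:
  assumes f: "f \<in> besov_space p q s" and e: "0 < e"
  shows "\<exists>M c. finite M \<and> besov_pow p q s (\<lambda>x. f x - lincomb M c h x) < e"
proof -
  obtain K where K: "K \<ge> 1" "\<And>f g :: real^'d \<Rightarrow> real. f \<in> besov_space p q s \<Longrightarrow> g \<in> besov_space p q s \<Longrightarrow>
     (\<lambda>x. f x + g x) \<in> besov_space p q s \<and> besov_pow p q s (\<lambda>x. f x + g x) \<le> K * (besov_pow p q s f + besov_pow p q s g)"
    using besov_pow_add[OF p q s, where 'd = 'd] by blast
  obtain C4 where C4: "C4 > 0" "\<And>k (u :: real^'d \<Rightarrow> real). dyadic_step k u \<Longrightarrow>
     u \<in> besov_space p q s \<and> besov_pow p q s u \<le> C4 * (\<rho> ^ k * Lp_pow p u) powr r"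
    using besov_dyadic_step by blast
  obtain n u where u: "dyadic_step n u" "(\<lambda>x. f x - u x) \<in> besov_space p q s" "besov_pow p q s (\<lambda>x. f x - u x) < e / K"
    using dyadic_step_dense_besov[OF f, of "e / K"] e K by auto
  let ?L = "\<Union>j\<le>n. haar_level j"
  obtain F where F: "\<And>x. x \<in> half_cube \<Longrightarrow> u x = (\<Sum>f\<in>?L. F f * f x)"
    using haar_span_dyadic_step[OF u(1)] unfolding haar_span_def by blast
  define M where "M = {m. lev m \<le> n}"
  define c where "c m = F (h m)" for m
  have l: "lincomb M c h x = (\<Sum>f\<in>?L. F f * f x)" for x
    unfolding M_def c_def by (rule lincomb_haar_levels)
  \<comment> \<open>Step function and Haar combination agree on \<open>half_cube\<close>, so w has
    zero norm although it may be nonzero on the upper faces.\<close>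
  define w where "w x = u x - lincomb M c h x" for x
  have w: "dyadic_step n w" unfolding w_def by (intro dyadic_step_diff u lincomb_step) (simp add: M_def)
  have "Lp_pow p w = Lp_pow p (\<lambda>_ :: real^'d. 0)"
    by (rule dyadic_step_cong(2)) (auto simp: dyadic_step_const w_def l F)
  then have w0: "besov_pow p q s w \<le> 0" using C4(2)[OF w] r by (simp add: Lp_pow_def)
  have "(\<lambda>x. f x - lincomb M c h x) = (\<lambda>x. (f x - u x) + w x)" by (simp add: w_def)
  then have "besov_pow p q s (\<lambda>x. f x - lincomb M c h x) \<le> K * (besov_pow p q s (\<lambda>x. f x - u x) + besov_pow p q s w)"
    using K(2)[OF u(2)] C4(2)[OF w] by simp
  also have "\<dots> \<le> K * besov_pow p q s (\<lambda>x. f x - u x)" using K w0 by (intro mult_left_mono) auto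
  also have "\<dots> < e" using u(3) K by (simp add: field_simps)
  finally show ?thesis using finite_lev_le by (intro exI[of _ M] exI[of _ c]) (auto simp: M_def)
qed

text \<open>Stating the bound for images under \<pi> moves the rearrangement from the system into
  the index sets: arbitrary subsets give unconditionality, initial segments the natural
  order.\<close>

lemma quasi_norm_basis_rearranged:
  assumes \<pi>: "bij \<pi>" and C: "1 \<le> C"
    and bounded: "\<And>M c n. finite M \<Longrightarrow> besov_pow p q s (lincomb (\<pi> ` {m \<in> M. m < n}) c h) \<le> C * besov_pow p q s (lincomb (\<pi> ` M) c h)"
  shows "\<exists>K. quasi_norm_basis (besov_space p q s) (besov_pow p q s) (besov_norm p q s) (h \<circ> \<pi>) q K C"
proof -
  obtain K where K: "K \<ge> 1" "\<And>f g :: real^'d \<Rightarrow> real. f \<in> besov_space p q s \<Longrightarrow> g \<in> besov_space p q s \<Longrightarrow>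
     (\<lambda>x. f x + g x) \<in> besov_space p q s \<and> besov_pow p q s (\<lambda>x. f x + g x) \<le> K * (besov_pow p q s f + besov_pow p q s g)"
    using besov_pow_add[OF p q s, where 'd = 'd] by blast
  have h_in: "h m \<in> besov_space p q s" for m
  proof -
    have "lincomb {m} (\<lambda>_. 1) h = h m" by (auto simp: lincomb_def)
    then show ?thesis using lincomb_besov[of "{m}" "\<lambda>_. 1"] by simp
  qed
  show ?thesis
  proof (intro exI[of _ K], unfold_locales)
    show "0 < besov_pow p q s ((h \<circ> \<pi>) m)" for m
    proof -
      obtain x where "x \<in> half_cube" "h (\<pi> m) x \<noteq> 0" using haar_level_nonzero[OF h_level] by blast
      then have "0 < Lp_pow p (h (\<pi> m))" by (rule Lp_pow_pos[OF haar_level_dyadic_step[OF h_level]])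
      then have "0 < Lp_pow p (h (\<pi> m)) powr r" by simp
      also have "\<dots> \<le> besov_pow p q s (h (\<pi> m))" by (rule Lp_pow_le_besov[OF h_in])
      finally show ?thesis by simp
    qed
    show "(\<lambda>n. besov_norm p q s (F n)) \<longlonglongrightarrow> 0 \<longleftrightarrow> (\<lambda>n. besov_pow p q s (F n)) \<longlonglongrightarrow> 0"
      if "\<And>n. F n \<in> besov_space p q s" for F :: "nat \<Rightarrow> real^'d \<Rightarrow> real"
      by (rule besov_norm_tendsto_iff[OF that])
    show "\<exists>M c. finite M \<and> besov_pow p q s (\<lambda>x. f x - lincomb M c (h \<circ> \<pi>) x) < e"
      if f: "f \<in> besov_space p q s" and e: "0 < e" for f e
    proof -
      obtain M c where M: "finite M" "besov_pow p q s (\<lambda>x. f x - lincomb M c h x) < e"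
        using lincomb_dense[OF f e] by blast
      have "\<pi> ` (inv \<pi> ` M) = M" using \<pi> by (simp add: image_comp bij_is_surj surj_iff[THEN iffD1])
      moreover have "(c \<circ> \<pi>) \<circ> inv \<pi> = c" using \<pi> by (simp add: o_assoc[symmetric] bij_is_surj surj_iff[THEN iffD1])
      ultimately have "lincomb (inv \<pi> ` M) (c \<circ> \<pi>) (h \<circ> \<pi>) = lincomb M c h" using lincomb_comp[OF \<pi>] by metis
      then show ?thesis using M by (intro exI[of _ "inv \<pi> ` M"] exI[of _ "c \<circ> \<pi>"]) auto
    qed
    show "besov_pow p q s (lincomb {m \<in> M. m < n} c (h \<circ> \<pi>)) \<le> C * besov_pow p q s (lincomb M c (h \<circ> \<pi>))"
      if "finite M" for M c n
      unfolding lincomb_comp[OF \<pi>] by (rule bounded[OF that])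
  qed (use q C K h_in besov_pow_nonneg[OF p q s] besov_pow_scale[OF p q s] in \<open>simp_all add: o_def\<close>)
qed

theorem unconditional_basis:
  assumes "\<sigma> < \<rho>"
  shows "unconditional_schauder_basis (besov_space p q s) (besov_norm p q s) h"
  unfolding unconditional_schauder_basis_def
proof (intro allI impI)
  fix \<pi> :: "nat \<Rightarrow> nat" assume \<pi>: "bij \<pi>"
  obtain C where C: "C \<ge> 1" "\<And>M M' c. finite M \<Longrightarrow> M' \<subseteq> M \<Longrightarrow> besov_pow p q s (lincomb M' c h) \<le> C * besov_pow p q s (lincomb M c h)"
    using subsum_bound_unconditional[OF assms] by blast
  have "\<exists>K. quasi_norm_basis (besov_space p q s) (besov_pow p q s) (besov_norm p q s) (h \<circ> \<pi>) q K C"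
    by (intro quasi_norm_basis_rearranged \<pi> C) auto
  then show "schauder_basis (besov_space p q s) (besov_norm p q s) (h \<circ> \<pi>)"
    using quasi_norm_basis.schauder by blast
qed

lemma limiting_quasi_norm_basis:
  assumes "\<sigma> = \<rho>" "p \<le> 1" "q \<le> p"
  shows "\<exists>K C. quasi_norm_basis (besov_space p q s) (besov_pow p q s) (besov_norm p q s) h q K C"
proof -
  obtain C where C: "C \<ge> 1" "\<And>M c n. finite M \<Longrightarrow> besov_pow p q s (lincomb {m \<in> M. m < n} c h) \<le> C * besov_pow p q s (lincomb M c h)"
    using subsum_bound_initial[OF assms] by blast
  have "\<exists>K. quasi_norm_basis (besov_space p q s) (besov_pow p q s) (besov_norm p q s) (h \<circ> id) q K C"
    using C by (intro quasi_norm_basis_rearranged) auto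
  then show ?thesis by auto
qed

theorem limiting_basis:
  assumes "\<sigma> = \<rho>" "p \<le> 1" "q \<le> p"
  shows "schauder_basis (besov_space p q s) (besov_norm p q s) h"
  using limiting_quasi_norm_basis[OF assms] quasi_norm_basis.schauder by blast

end

section \<open>Approximate point masses\<close>

definition bump :: "nat \<Rightarrow> real^'d \<Rightarrow> real^'d \<Rightarrow> real" where
  "bump k x y = (2 ^ k) ^ CARD('d) * of_bool (cell k y = cell k x)"

lemma dyadic_step_bump: "dyadic_step k (bump k x)"
  unfolding bump_def by (rule dyadic_step_cell)

text \<open>The height is the reciprocal of the cell volume, so the mean over the cube stays 1 and
  averaging merely spreads the mass over the parent cell.\<close>

lemma avg_bump: "avg k (bump (Suc k) x) y = bump k x (y :: real^'d)"
proof -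
  have inj: "child k y S = child k y S' \<longleftrightarrow> S = S'" for S S' by (auto simp: child_def fun_eq_iff)
  have "child k y S = cell (Suc k) x \<longleftrightarrow> cell k y = cell k x \<and> S = {i. odd (cell (Suc k) x i)}" for S
  proof
    assume e: "child k y S = cell (Suc k) x"
    have "cell k y = cell k x"
    proof
      fix i
      have "cell k x i = cell (Suc k) x i div 2" using cell_div[of k "Suc k" x i] by simp
      also have "\<dots> = cell k y i" unfolding e[symmetric] by (simp add: child_def)
      finally show "cell k y i = cell k x i" by simp
    qed
    moreover have "S = {i. odd (cell (Suc k) x i)}" unfolding e[symmetric] by (auto simp: child_def)
    ultimately show "cell k y = cell k x \<and> S = {i. odd (cell (Suc k) x i)}" by blast
  next
    assume "cell k y = cell k x \<and> S = {i. odd (cell (Suc k) x i)}"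
    then show "child k y S = cell (Suc k) x" using cell_Suc_eq_child[of k x] by (simp add: child_def[abs_def])
  qed
  then have "avg k (bump (Suc k) x) y = (\<Sum>S\<in>UNIV. if S = {i. odd (cell (Suc k) x i)} then (2 ^ Suc k) ^ CARD('d) * of_bool (cell k y = cell k x) else 0) / 2 ^ CARD('d)"
    unfolding avg_def bump_def by (intro arg_cong2[where f = "(/)"] sum.cong refl) auto
  also have "\<dots> = bump k x y" by (simp add: bump_def power_mult_distrib)
  finally show ?thesis .
qed

lemma iter_avg_bump: "iter_avg k n (bump (k + n) x) = bump k x"
  by (induction n) (simp_all add: avg_bump[abs_def])

text \<open>Height to the power p times volume. The decay rate equals the growth rate of averaging,
  so bumps attain equality in that bound.\<close>

lemma bump_normalisation:
  assumes p: "0 < p" "p < 1"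
  shows "((2 ^ k) ^ CARD('d)) powr p / (2 ^ k) ^ CARD('d) = 1 / avg_growth p TYPE('d::finite) ^ k"
proof -
  have "((2 ^ k) ^ CARD('d)) powr p / (2 ^ k) ^ CARD('d) = 1 / ((2 ^ k) ^ CARD('d)) powr (1 - p)"
    by (simp add: powr_diff)
  also have "((2 ^ k) ^ CARD('d)) powr (1 - p) = avg_growth p TYPE('d) ^ k"
    using p by (simp add: avg_growth_def powr_power powr_realpow[symmetric] powr_powr mult_ac)
  finally show ?thesis .
qed

lemma Lp_pow_bump:
  fixes x :: "real^'d"
  assumes p: "0 < p" "p < 1" and x: "x \<in> half_cube"
  shows "Lp_pow p (bump k x) = 1 / avg_growth p TYPE('d) ^ k"
proof -
  have "Lp_pow p (bump k x) = (\<Sum>a\<in>grid k. if a = cell k x then ((2 ^ k) ^ CARD('d)) powr p else 0) / (2 ^ k) ^ CARD('d)"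
    unfolding dyadic_step_Lp(2)[OF dyadic_step_bump] bump_def
    by (intro arg_cong2[where f = "(/)"] sum.cong refl) auto
  also have "\<dots> = ((2 ^ k) ^ CARD('d)) powr p / (2 ^ k) ^ CARD('d)" using cell_in[OF x] by simp
  finally show ?thesis using bump_normalisation[OF p, of k, where 'd = 'd] by simp
qed

context haar_enum
begin

text \<open>The coefficients of the Haar expansion of the point mass at the origin.\<close>

lemma delta_coefficients:
  "\<exists>\<gamma>. (\<forall>m. lev m = 0 \<longrightarrow> \<gamma> m = 1) \<and>
    (\<forall>k. \<forall>x\<in>half_cube. lincomb {m. lev m = Suc k} \<gamma> h x = bump (Suc k) 0 x - bump k 0 x)"
proof -
  have "\<exists>c. \<forall>x\<in>half_cube. lincomb {m. lev m = Suc k} c h x = bump (Suc k) 0 x - bump k 0 x" for k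
  proof -
    define D where "D x = bump (Suc k) 0 x - bump k 0 x" for x :: "real^'d"
    have D: "dyadic_step (Suc k) D"
      unfolding D_def by (intro dyadic_step_diff dyadic_step_bump dyadic_step_mono[OF dyadic_step_bump]) simp
    have avgD: "avg k D x = 0" if "x \<in> half_cube" for x
      unfolding D_def avg_diff avg_bump using avg_step[OF dyadic_step_bump that] by simp
    let ?L = "\<Union>j\<le>Suc k. haar_level j"
    obtain F where F: "\<And>x. x \<in> half_cube \<Longrightarrow> D x = (\<Sum>f\<in>?L. F f * f x)"
      using haar_span_dyadic_step[OF D] unfolding haar_span_def by blast
    define M where "M = {m. lev m \<le> Suc k}"
    have finM: "finite M" unfolding M_def by (rule finite_lev_le)
    have l: "lincomb M (\<lambda>m. F (h m)) h x = (\<Sum>f\<in>?L. F f * f x)" for x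
      unfolding M_def by (rule lincomb_haar_levels)
    have lowM: "low M (Suc k) = M" "{m \<in> M. lev m = Suc k} = {m. lev m = Suc k}" by (auto simp: low_def M_def)
    have "lincomb {m. lev m = Suc k} (\<lambda>m. F (h m)) h x = D x" if x: "x \<in> half_cube" for x
    proof -
      \<comment> \<open>The increment has mean zero over the cells of level k; since averaging is
        truncation, its Haar expansion has no part below level k + 1.\<close>
      have "lincomb (low M k) (\<lambda>m. F (h m)) h x = avg k (lincomb M (\<lambda>m. F (h m)) h) x"
        using avg_lincomb_low[OF finM x, of k] lowM by simp
      also have "\<dots> = avg k D x" by (rule avg_cong[OF _ x]) (simp add: l F)
      finally have "lincomb (low M k) (\<lambda>m. F (h m)) h x = 0" using avgD[OF x] by simp
      then show ?thesis
        using lincomb_low_Suc[OF finM, of k "\<lambda>m. F (h m)" x] F[OF x] l[of x] lowM by simp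
    qed
    then show ?thesis unfolding D_def by blast
  qed
  then obtain c where c: "\<And>k x. x \<in> half_cube \<Longrightarrow> lincomb {m. lev m = Suc k} (c k) h x = bump (Suc k) 0 x - bump k 0 x"
    by metis
  define \<gamma> where "\<gamma> m = (if lev m = 0 then 1 else c (lev m - 1) m)" for m
  have "lincomb {m. lev m = Suc k} \<gamma> h = lincomb {m. lev m = Suc k} (c k) h" for k
    unfolding lincomb_def by (intro ext sum.cong) (auto simp: \<gamma>_def)
  then show ?thesis using c by (intro exI[of _ \<gamma>]) (auto simp: \<gamma>_def)
qed

lemma low_UNIV: "low UNIV k = {m. lev m \<le> k}"
  by (simp add: low_def)

lemma lincomb_low_UNIV_Suc:
  "lincomb (low UNIV (Suc k)) c h x = lincomb (low UNIV k) c h x + lincomb {m. lev m = Suc k} c h x"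
proof -
  have "low UNIV (Suc k) = low UNIV k \<union> {m. lev m = Suc k}" by (auto simp: low_def)
  then show ?thesis
    unfolding lincomb_def using finite_lev_le finite_lev
    by (simp only:) (subst sum.union_disjoint, auto simp: low_def)
qed

lemma lincomb_level_zero:
  assumes "\<And>m. lev m = 0 \<Longrightarrow> c m = a" "x \<in> half_cube"
  shows "lincomb (low UNIV 0) c h x = a * bump 0 0 x"
proof -
  obtain m0 where m0: "lev m0 = 0" using ex_h haar_level_nonempty by (metis all_not_in_conv)
  have "low UNIV 0 = {m0}" using m0 lev_zero_unique by (auto simp: low_def)
  moreover have "h m0 = indicator unit_cube" using h_level[of m0] m0 by simp
  moreover have "x \<in> unit_cube" using assms(2) half_cube_sub by blast
  moreover have "cell 0 x = cell 0 (0 :: real^'d)"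
  proof
    fix i
    have "0 \<le> x $ i" "x $ i < 1" using assms(2) by (auto simp: half_cube_def)
    then have "\<lfloor>x $ i\<rfloor> = 0" by linarith
    then show "cell 0 x i = cell 0 (0 :: real^'d) i" by (simp add: cell_def)
  qed
  ultimately show ?thesis using assms(1)[OF m0] by (simp add: lincomb_def bump_def)
qed

lemma initial_split:
  assumes "lev n = Suc k"
  shows "{..<n} = low UNIV k \<union> {m. m < n \<and> lev m = Suc k}" "low UNIV k \<inter> {m. m < n \<and> lev m = Suc k} = {}"
proof -
  have "lev m \<le> Suc k" if "m < n" for m using lev_less_imp[of n m] that assms by linarith
  moreover have "m < n" if "lev m \<le> k" for m using lev_less_imp[of m n] that assms by linarith
  ultimately show "{..<n} = low UNIV k \<union> {m. m < n \<and> lev m = Suc k}" "low UNIV k \<inter> {m. m < n \<and> lev m = Suc k} = {}"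
    by (force simp: low_def le_Suc_eq)+
qed

lemma lev_tendsto: "filterlim lev at_top sequentially"
  unfolding filterlim_at_top
proof
  fix k
  have "{n. \<not> k \<le> lev n} \<subseteq> {m. lev m \<le> k}" by auto
  then have "finite {n. \<not> k \<le> lev n}" using finite_lev_le finite_subset by blast
  then have "\<forall>\<^sub>F n in cofinite. k \<le> lev n" by (simp add: eventually_cofinite)
  then show "\<forall>\<^sub>F n in sequentially. k \<le> lev n" by (simp add: cofinite_eq_sequentially)
qed

lemma zero_in_half: "(0 :: real^'d) \<in> half_cube"
  by (simp add: half_cube_def)

text \<open>Below the limiting smoothness the expansion of the point mass converges to zero.\<close>

theorem not_basis_below:
  assumes p1: "p < 1" and \<sigma>\<rho>: "\<rho> < \<sigma>"
  shows "\<not> schauder_basis (besov_space p q s) (besov_norm p q s) h"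
proof
  assume "schauder_basis (besov_space p q s) (besov_norm p q s) h"
  moreover have z_in: "(\<lambda>_ :: real^'d. 0) \<in> besov_space p q s"
    using lincomb_besov[of "{}" "\<lambda>_. 0"] by (simp add: lincomb_def[abs_def])
  ultimately have ex1: "\<exists>!c. series_converges_to (besov_norm p q s) h c (\<lambda>_. 0)"
    unfolding schauder_basis_def by blast
  obtain \<gamma> where \<gamma>: "\<And>m. lev m = 0 \<Longrightarrow> \<gamma> m = 1"
    "\<And>k x. x \<in> half_cube \<Longrightarrow> lincomb {m. lev m = Suc k} \<gamma> h x = bump (Suc k) 0 x - bump k 0 x"
    using delta_coefficients by blast
  have F: "lincomb (low UNIV k) \<gamma> h x = bump k 0 x" if x: "x \<in> half_cube" for k x
  proof (induction k)
    case 0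
    then show ?case using lincomb_level_zero[of \<gamma> 1, OF \<gamma>(1) x] by simp
  next
    case (Suc k)
    then show ?case unfolding lincomb_low_UNIV_Suc using \<gamma>(2)[OF x] by simp
  qed
  obtain K where K: "K \<ge> 1" "\<And>f g :: real^'d \<Rightarrow> real. f \<in> besov_space p q s \<Longrightarrow> g \<in> besov_space p q s \<Longrightarrow>
     (\<lambda>x. f x + g x) \<in> besov_space p q s \<and> besov_pow p q s (\<lambda>x. f x + g x) \<le> K * (besov_pow p q s f + besov_pow p q s g)"
    using besov_pow_add[OF p q s, where 'd = 'd] by blast
  obtain C4 where C4: "C4 > 0" "\<And>k (u :: real^'d \<Rightarrow> real). dyadic_step k u \<Longrightarrow>
     u \<in> besov_space p q s \<and> besov_pow p q s u \<le> C4 * (\<rho> ^ k * Lp_pow p u) powr r"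
    using besov_dyadic_step by blast
  have Ab: "Lp_pow p (bump k (0 :: real^'d)) = 1 / \<sigma> ^ k" for k
    unfolding \<sigma>_def by (rule Lp_pow_bump[OF p p1 zero_in_half])
  define Q where "Q = (2 ^ CARD('d)) powr p * \<sigma> * (2 powr p * 2)"
  have Q: "Q > 0" using \<sigma> by (simp add: Q_def)
  define E where "E k = K * (C4 * ((\<rho> / \<sigma>) ^ k) powr r + C4 * (\<rho> * Q * (\<rho> / \<sigma>) ^ k) powr r)" for k
  \<comment> \<open>Complete levels sum to a bump, of weighted size (\<rho>/\<sigma>)^k; the
    incomplete level k + 1 is bounded by the corresponding complete one, a difference of two
    bumps.\<close>
  have bound: "besov_pow p q s (lincomb {..<n} \<gamma> h) \<le> E k" if n: "lev n = Suc k" for n k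
  proof -
    let ?M = "{m. m < n \<and> lev m = Suc k}"
    have s1: "dyadic_step k (lincomb (low UNIV k) \<gamma> h)" by (rule lincomb_low_step)
    have s2: "dyadic_step (Suc k) (lincomb ?M \<gamma> h)" by (rule lincomb_step) simp
    have "lincomb {..<n} \<gamma> h = (\<lambda>x. lincomb (low UNIV k) \<gamma> h x + lincomb ?M \<gamma> h x)"
      unfolding lincomb_def initial_split(1)[OF n] using initial_split(2)[OF n] finite_lev_le
      by (intro ext sum.union_disjoint) (auto simp: low_UNIV)
    then have "besov_pow p q s (lincomb {..<n} \<gamma> h) \<le> K * (besov_pow p q s (lincomb (low UNIV k) \<gamma> h) + besov_pow p q s (lincomb ?M \<gamma> h))"
      using K(2) C4(2)[OF s1] C4(2)[OF s2] by simp
    also have "\<dots> \<le> E k"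
      unfolding E_def
    proof (intro mult_left_mono add_mono)
      have "Lp_pow p (lincomb (low UNIV k) \<gamma> h) = 1 / \<sigma> ^ k"
        unfolding Ab[symmetric] by (rule dyadic_step_cong(2)[OF dyadic_step_bump]) (simp add: F)
      then show "besov_pow p q s (lincomb (low UNIV k) \<gamma> h) \<le> C4 * ((\<rho> / \<sigma>) ^ k) powr r"
        using C4(2)[OF s1] by (simp add: power_divide)
      have "Lp_pow p (lincomb ?M \<gamma> h) \<le> (2 ^ CARD('d)) powr p * avg_growth p TYPE('d) * Lp_pow p (lincomb {m. lev m = Suc k} \<gamma> h)"
        unfolding lincomb_def[abs_def]
      proof (rule haar_level_subsum[OF p finite_lev inj_on_subset[OF inj_h subset_UNIV]])
        show "h m \<in> haar_level (Suc k)" if "m \<in> {m. lev m = Suc k}" for m using h_level[of m] that by (simp del: haar_level.simps)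
      qed auto
      also have "Lp_pow p (lincomb {m. lev m = Suc k} \<gamma> h) = Lp_pow p (\<lambda>x :: real^'d. bump (Suc k) 0 x - bump k 0 x)"
      proof (rule dyadic_step_cong(2)[where k = "Suc k"])
        show "dyadic_step (Suc k) (\<lambda>x :: real^'d. bump (Suc k) 0 x - bump k 0 x)"
          by (intro dyadic_step_diff dyadic_step_bump dyadic_step_mono[OF dyadic_step_bump]) simp
      qed (simp add: \<gamma>(2))
      also have "\<dots> \<le> 2 powr p * (1 / \<sigma> ^ Suc k + 1 / \<sigma> ^ k)"
        unfolding Ab[symmetric] by (intro diff_in_Lp_space(2) p dyadic_step_Lp(1)[OF dyadic_step_bump])
      also have "\<dots> \<le> 2 powr p * (1 / \<sigma> ^ k + 1 / \<sigma> ^ k)"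
        using \<sigma> by (intro mult_left_mono add_right_mono divide_left_mono power_increasing) auto
      finally have "Lp_pow p (lincomb ?M \<gamma> h) \<le> (2 ^ CARD('d)) powr p * \<sigma> * (2 powr p * (1 / \<sigma> ^ k + 1 / \<sigma> ^ k))"
        using \<sigma> by (simp add: \<sigma>_def mult_left_mono)
      also have "\<dots> = Q / \<sigma> ^ k" by (simp add: Q_def)
      finally have "\<rho> ^ Suc k * Lp_pow p (lincomb ?M \<gamma> h) \<le> \<rho> ^ Suc k * (Q / \<sigma> ^ k)"
        using \<rho> by (intro mult_left_mono) auto
      also have "\<dots> = \<rho> * Q * (\<rho> / \<sigma>) ^ k" by (simp add: power_divide)
      finally have "(\<rho> ^ Suc k * Lp_pow p (lincomb ?M \<gamma> h)) powr r \<le> (\<rho> * Q * (\<rho> / \<sigma>) ^ k) powr r"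
        using \<rho> r by (intro powr_mono2) auto
      then show "besov_pow p q s (lincomb ?M \<gamma> h) \<le> C4 * (\<rho> * Q * (\<rho> / \<sigma>) ^ k) powr r"
        using C4(2)[OF s2] C4(1) by (meson less_imp_le mult_left_mono order_trans)
    qed (use K in auto)
    finally show ?thesis .
  qed
  have Elim: "E \<longlonglongrightarrow> 0"
  proof -
    have g: "(\<lambda>k. (\<rho> / \<sigma>) ^ k) \<longlonglongrightarrow> 0" using \<rho> \<sigma> \<sigma>\<rho> by (intro LIMSEQ_power_zero) auto
    then have g': "(\<lambda>k. \<rho> * Q * (\<rho> / \<sigma>) ^ k) \<longlonglongrightarrow> 0" by (rule tendsto_mult_right_zero)
    have "(\<lambda>k. ((\<rho> / \<sigma>) ^ k) powr r) \<longlonglongrightarrow> 0" "(\<lambda>k. (\<rho> * Q * (\<rho> / \<sigma>) ^ k) powr r) \<longlonglongrightarrow> 0"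
      using \<rho> \<sigma> Q r by (auto intro!: tendsto_zero_powrI[OF g tendsto_const] tendsto_zero_powrI[OF g' tendsto_const])
    then have "E \<longlonglongrightarrow> K * (C4 * 0 + C4 * 0)"
      unfolding E_def by (intro tendsto_mult tendsto_add tendsto_const)
    then show ?thesis by simp
  qed
  have levm: "filterlim (\<lambda>n. lev n - 1) at_top sequentially"
    using filterlim_compose[OF filterlim_minus_const_nat_at_top[of 1] lev_tendsto] by simp
  have lim: "(\<lambda>n. besov_pow p q s (lincomb {..<n} \<gamma> h)) \<longlonglongrightarrow> 0"
  proof (rule tendsto_sandwich[OF _ _ tendsto_const])
    show "(\<lambda>n. E (lev n - 1)) \<longlonglongrightarrow> 0" by (rule filterlim_compose[OF Elim levm])
    show "\<forall>\<^sub>F n in sequentially. 0 \<le> besov_pow p q s (lincomb {..<n} \<gamma> h)"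
      by (intro always_eventually allI besov_pow_nonneg p q s lincomb_besov) simp
    have "\<forall>\<^sub>F n in sequentially. 1 \<le> lev n" using lev_tendsto unfolding filterlim_at_top by blast
    then show "\<forall>\<^sub>F n in sequentially. besov_pow p q s (lincomb {..<n} \<gamma> h) \<le> E (lev n - 1)"
      by eventually_elim (rule bound, simp)
  qed
  have neg: "besov_pow p q s (\<lambda>x. 0 - lincomb {..<n} \<gamma> h x) \<le> besov_pow p q s (lincomb {..<n} \<gamma> h)" for n
    using besov_pow_scale(2)[OF p q s lincomb_besov[of "{..<n}" \<gamma>], of "- 1"] by simp
  have in_B: "(\<lambda>x. 0 - lincomb {..<n} \<gamma> h x) \<in> besov_space p q s" for n
    using besov_pow_scale(1)[OF p q s lincomb_besov[of "{..<n}" \<gamma>], of "- 1"] by simp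
  have "(\<lambda>n. besov_pow p q s (\<lambda>x. 0 - lincomb {..<n} \<gamma> h x)) \<longlonglongrightarrow> 0"
    by (rule tendsto_sandwich[OF _ _ tendsto_const lim])
      (intro always_eventually allI neg besov_pow_nonneg[OF p q s in_B])+
  then have "(\<lambda>n. besov_norm p q s (\<lambda>x. 0 - lincomb {..<n} \<gamma> h x)) \<longlonglongrightarrow> 0"
    by (rule besov_norm_tendsto_iff[THEN iffD2, rotated]) (rule in_B)
  then have 1: "series_converges_to (besov_norm p q s) h \<gamma> (\<lambda>_. 0)"
    unfolding series_converges_to_def lincomb_def .
  have zL: "besov_pow p q s (\<lambda>_ :: real^'d. 0) \<le> 0"
    using besov_pow_scale(2)[OF p q s z_in, of 0] q by simp
  have "(\<lambda>n. besov_pow p q s (\<lambda>_ :: real^'d. 0)) \<longlonglongrightarrow> 0"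
    using zL besov_pow_nonneg[OF p q s z_in] by simp
  then have "(\<lambda>n :: nat. besov_norm p q s (\<lambda>_ :: real^'d. 0)) \<longlonglongrightarrow> 0"
    using besov_norm_tendsto_iff[of "\<lambda>_ _. 0"] z_in by blast
  then have 2: "series_converges_to (besov_norm p q s) h (\<lambda>_. 0) (\<lambda>_. 0)"
    unfolding series_converges_to_def by simp
  obtain m0 where m0: "lev m0 = 0" using ex_h haar_level_nonempty by (metis all_not_in_conv)
  \<comment> \<open>The zero function has both the trivial expansion and the one just found, whose
    coefficient at level 0 is 1.\<close>
  have "\<gamma> = (\<lambda>_. 0)" using ex1 1 2 by blast
  then show False using \<gamma>(1)[OF m0] by (auto simp: fun_eq_iff)
qed

end

section \<open>Series of normalised cell indicators\<close>

lemma AE_cube_half_nonzero: "AE x in lebesgue_on (unit_cube :: (real^'d) set). x \<in> half_cube \<and> x \<noteq> 0"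
proof -
  have "AE x in lebesgue. x \<notin> {0 :: real^'d}"
    by (intro AE_not_in) (simp add: negligible_iff_null_sets[symmetric])
  then have "AE x in lebesgue_on (unit_cube :: (real^'d) set). x \<noteq> 0"
    by (subst AE_restrict_space_iff) auto
  then show ?thesis using AE_cube_half by eventually_elim auto
qed

lemma Lp_pow_mono_AE:
  fixes f g :: "real^'d \<Rightarrow> real"
  assumes "0 < p" "f \<in> Lp_space p unit_cube" "g \<in> Lp_space p unit_cube" "\<And>x. x \<in> half_cube \<Longrightarrow> \<bar>f x\<bar> \<le> \<bar>g x\<bar>"
  shows "Lp_pow p f \<le> Lp_pow p g"
  unfolding Lp_pow_def using Lp_spaceD(2)[OF assms(2)] Lp_spaceD(2)[OF assms(3)]
proof (rule integral_mono_AE)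
  show "AE x in lebesgue_on unit_cube. \<bar>f x\<bar> powr p \<le> \<bar>g x\<bar> powr p"
    using AE_cube_half by eventually_elim (use assms in \<open>auto intro!: powr_mono2\<close>)
qed

text \<open>At almost every point only finitely many terms are nonzero, so the tail obeys the
  subadditivity of t^p and its L_p part is bounded by the tail of the summable series. The point 0
  is exempted because bumps centred there never vanish at it.\<close>

lemma Lp_series:
  fixes v :: "nat \<Rightarrow> real^'d \<Rightarrow> real"
  assumes p: "0 < p" "p \<le> 1" and v: "\<And>j. v j \<in> Lp_space p unit_cube" and sm: "summable (\<lambda>j. Lp_pow p (v j))"
    and fin: "\<And>x. x \<in> half_cube \<Longrightarrow> x \<noteq> 0 \<Longrightarrow> \<exists>J. \<forall>j\<ge>J. v j x = 0"
  defines "f \<equiv> \<lambda>x. \<Sum>j. v j x"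
  shows "f \<in> Lp_space p unit_cube" "(\<lambda>n. Lp_pow p (\<lambda>x. f x - (\<Sum>j<n. v j x))) \<longlonglongrightarrow> 0"
proof -
  let ?M = "lebesgue_on (unit_cube :: (real^'d) set)"
  define R where "R n x = f x - (\<Sum>j<n. v j x)" for n x
  have mv: "v j \<in> borel_measurable ?M" for j by (rule Lp_spaceD(1)[OF v])
  have mf: "f \<in> borel_measurable ?M" unfolding f_def using mv by (intro borel_measurable_suminf)
  have mR: "R n \<in> borel_measurable ?M" for n
    unfolding R_def using mf mv by (intro borel_measurable_diff borel_measurable_sum) auto
  have mR': "(\<lambda>x. \<bar>R n x\<bar> powr p) \<in> borel_measurable ?M" for n using mR[of n] by measurable
  have key: "(\<integral>\<^sup>+x. ennreal (\<bar>R n x\<bar> powr p) \<partial>?M) \<le> ennreal (\<Sum>j. Lp_pow p (v (j + n)))" for n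
  proof -
    have smn: "summable (\<lambda>j. Lp_pow p (v (j + n)))" using sm summable_iff_shift[of "\<lambda>j. Lp_pow p (v j)" n] by simp
    have "AE x in ?M. ennreal (\<bar>R n x\<bar> powr p) \<le> (\<Sum>j. ennreal (\<bar>v (j + n) x\<bar> powr p))"
      using AE_cube_half_nonzero
    proof eventually_elim
      case (elim x)
      then obtain J0 where J0: "\<And>j. j \<ge> J0 \<Longrightarrow> v j x = 0" using fin by blast
      define J where "J = max J0 n"
      have "f x = (\<Sum>j<J. v j x)" unfolding f_def using J0 by (intro suminf_finite) (auto simp: J_def)
      also have "\<dots> = (\<Sum>j<n. v j x) + (\<Sum>j\<in>{n..<J}. v j x)"
        by (subst sum.union_disjoint[symmetric]) (auto simp: J_def intro!: sum.cong)
      also have "(\<Sum>j\<in>{n..<J}. v j x) = (\<Sum>j<J - n. v (j + n) x)"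
        using sum.shift_bounds_nat_ivl[of "\<lambda>j. v j x" 0 n "J - n"] by (simp add: J_def lessThan_atLeast0)
      finally have "R n x = (\<Sum>j<J - n. v (j + n) x)" by (simp add: R_def)
      then have "\<bar>R n x\<bar> powr p \<le> (\<Sum>j<J - n. \<bar>v (j + n) x\<bar> powr p)" using powr_sum_le[OF p finite_lessThan, where a = "\<lambda>j. v (j + n) x"] by simp
      then have "ennreal (\<bar>R n x\<bar> powr p) \<le> ennreal (\<Sum>j<J - n. \<bar>v (j + n) x\<bar> powr p)" by (rule ennreal_leI)
      also have "\<dots> = (\<Sum>j<J - n. ennreal (\<bar>v (j + n) x\<bar> powr p))" by (simp add: sum_ennreal)
      also have "\<dots> \<le> (\<Sum>j. ennreal (\<bar>v (j + n) x\<bar> powr p))" by (intro sum_le_suminf) auto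
      finally show ?case .
    qed
    then have "(\<integral>\<^sup>+x. ennreal (\<bar>R n x\<bar> powr p) \<partial>?M) \<le> (\<integral>\<^sup>+x. (\<Sum>j. ennreal (\<bar>v (j + n) x\<bar> powr p)) \<partial>?M)"
      by (rule nn_integral_mono_AE)
    also have "\<dots> = (\<Sum>j. \<integral>\<^sup>+x. ennreal (\<bar>v (j + n) x\<bar> powr p) \<partial>?M)"
    proof (rule nn_integral_suminf)
      fix j show "(\<lambda>x. ennreal (\<bar>v (j + n) x\<bar> powr p)) \<in> borel_measurable ?M" using mv[of "j + n"] by measurable
    qed
    also have "\<dots> = (\<Sum>j. ennreal (Lp_pow p (v (j + n))))"
      unfolding Lp_pow_def using Lp_spaceD(2)[OF v] by (subst nn_integral_eq_integral) auto
    also have "\<dots> = ennreal (\<Sum>j. Lp_pow p (v (j + n)))" by (intro suminf_ennreal2 smn) auto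
    finally show ?thesis .
  qed
  have int: "integrable ?M (\<lambda>x. \<bar>R n x\<bar> powr p)" for n
    using key[of n] mR' by (intro integrableI_nonneg) (auto intro: le_less_trans)
  have "R 0 = f" by (simp add: R_def[abs_def])
  then show "f \<in> Lp_space p unit_cube" using int[of 0] mf by (simp add: Lp_space_def)
  have le: "Lp_pow p (R n) \<le> (\<Sum>j. Lp_pow p (v (j + n)))" for n
  proof -
    have "ennreal (Lp_pow p (R n)) \<le> ennreal (\<Sum>j. Lp_pow p (v (j + n)))"
      using key[of n] nn_integral_eq_integral[OF int[of n]] by (simp add: Lp_pow_def)
    moreover have "0 \<le> (\<Sum>j. Lp_pow p (v (j + n)))"
      using sm summable_iff_shift[of "\<lambda>j. Lp_pow p (v j)" n] by (intro suminf_nonneg) auto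
    ultimately show ?thesis by (simp add: ennreal_le_iff)
  qed
  have "(\<lambda>n. Lp_pow p (R n)) \<longlonglongrightarrow> 0"
  proof (rule LIMSEQ_I)
    fix e :: real assume "0 < e"
    then obtain N where N: "\<And>n. n \<ge> N \<Longrightarrow> norm (\<Sum>j. Lp_pow p (v (j + n))) < e"
      using suminf_exist_split[OF _ sm] by blast
    show "\<exists>N. \<forall>n\<ge>N. norm (Lp_pow p (R n) - 0) < e"
    proof (intro exI allI impI)
      fix n assume "n \<ge> N"
      show "norm (Lp_pow p (R n) - 0) < e" using le[of n] N[OF \<open>n \<ge> N\<close>] by simp
    qed
  qed
  then show "(\<lambda>n. Lp_pow p (\<lambda>x. f x - (\<Sum>j<n. v j x))) \<longlonglongrightarrow> 0" by (simp add: R_def[abs_def])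
qed

lemma iter_avg_add: "iter_avg k (a + b) u = iter_avg k a (iter_avg (k + a) b u)"
  by (induction b arbitrary: u) (simp_all add: add.assoc)

lemma iter_avg_cmult: "iter_avg k n (\<lambda>x. c * u x) = (\<lambda>x. c * iter_avg k n u x)"
  by (induction n arbitrary: u) (simp_all add: avg_cmult[abs_def])

lemma iter_avg_mult_step:
  assumes v: "dyadic_step k v" and x: "x \<in> half_cube"
  shows "iter_avg k n (\<lambda>x. v x * u x) x = v x * iter_avg k n u x"
proof (induction n arbitrary: u)
  case (Suc n)
  have "iter_avg k n (avg (k + n) (\<lambda>x. v x * u x)) x = iter_avg k n (\<lambda>x. v x * avg (k + n) u x) x"
    by (intro iter_avg_cong avg_mult_step dyadic_step_mono[OF v] x) auto
  then show ?case using Suc by simp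
qed simp

lemma iter_avg_bump_le:
  assumes "k \<le> j" "j \<le> n" "y \<in> half_cube"
  shows "iter_avg k (n - k) (bump j x) y = bump k x y"
proof -
  have "n - k = (j - k) + (n - j)" "k + (j - k) = j" using assms by auto
  then have "iter_avg k (n - k) (bump j x) y = iter_avg k (j - k) (iter_avg j (n - j) (bump j x)) y"
    using iter_avg_add[of k "j - k" "n - j" "bump j x"] by simp
  also have "\<dots> = iter_avg k (j - k) (bump j x) y"
    by (intro iter_avg_cong iter_avg_id dyadic_step_bump assms)
  also have "\<dots> = bump k x y" using iter_avg_bump[of k "j - k" x] assms by simp
  finally show ?thesis .
qed

context besov_params
begin

text \<open>The remainder after n terms is the sum of the same series with its first n terms
  deleted, so the upper estimate bounds it by a tail.\<close>

lemma besov_series_tail: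
  fixes f :: "real^'d \<Rightarrow> real"
  assumes f: "f \<in> Lp_space p unit_cube" and v: "\<And>j. dyadic_step j (v j)"
    and sm: "summable (\<lambda>j. (\<rho> ^ j * Lp_pow p (v j)) powr r)"
    and lim: "(\<lambda>n. Lp_pow p (\<lambda>x. f x - (\<Sum>j<n. v j x))) \<longlonglongrightarrow> 0"
  shows "f \<in> besov_space p q s" "(\<lambda>n. besov_pow p q s (\<lambda>x. f x - (\<Sum>j<n. v j x))) \<longlonglongrightarrow> 0"
proof -
  obtain C where C: "C > 0" "\<And>(f :: real^'d \<Rightarrow> real) v. f \<in> Lp_space p unit_cube \<Longrightarrow> (\<forall>j. dyadic_step j (v j)) \<Longrightarrow>
     summable (\<lambda>j. (\<rho> ^ j * Lp_pow p (v j)) powr r) \<Longrightarrow>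
     (\<lambda>n. Lp_pow p (\<lambda>x. f x - (\<Sum>j<n. v j x))) \<longlonglongrightarrow> 0 \<Longrightarrow>
     f \<in> besov_space p q s \<and> besov_pow p q s f \<le> C * (\<Sum>j. (\<rho> ^ j * Lp_pow p (v j)) powr r)"
    using besov_series_upper by blast
  show "f \<in> besov_space p q s" using C(2)[OF f _ sm lim] v by blast
  define t where "t j = (\<rho> ^ j * Lp_pow p (v j)) powr r" for j
  have st: "summable t" using sm by (simp add: t_def[abs_def])
  have z: "Lp_pow p (\<lambda>_ :: real^'d. 0) = 0" by (simp add: Lp_pow_def)
  have main: "(\<lambda>x. f x - (\<Sum>j<n. v j x)) \<in> besov_space p q s \<and> besov_pow p q s (\<lambda>x. f x - (\<Sum>j<n. v j x)) \<le> C * (\<Sum>j. t (j + n))" for n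
  proof -
    define v' where "v' j = (if j < n then (\<lambda>_. 0) else v j)" for j
    define t' where "t' j = (\<rho> ^ j * Lp_pow p (v' j)) powr r" for j
    have t': "t' (j + n) = t (j + n)" for j by (simp add: t'_def t_def v'_def)
    have st': "summable t'" using st summable_iff_shift[of t' n] summable_iff_shift[of t n] by (simp add: t')
    have "suminf t' = (\<Sum>j. t' (j + n)) + (\<Sum>j<n. t' j)" by (rule suminf_split_initial_segment[OF st'])
    also have "(\<Sum>j<n. t' j) = 0" by (intro sum.neutral) (simp add: t'_def v'_def z)
    finally have e: "suminf t' = (\<Sum>j. t (j + n))" by (simp add: t')
    have sumn: "dyadic_step n (\<lambda>x. \<Sum>j<n. v j x)" by (intro dyadic_step_sum dyadic_step_mono[OF v]) simp
    have eq: "(\<lambda>x. (f x - (\<Sum>j<n. v j x)) - (\<Sum>j<i + n. v' j x)) = (\<lambda>x. f x - (\<Sum>j<i + n. v j x))" for i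
    proof
      fix x
      have s1: "(\<Sum>j<i + n. v' j x) = (\<Sum>j\<in>{n..<i + n}. v j x)"
        unfolding v'_def by (intro sum.mono_neutral_cong_right) auto
      have s2: "(\<Sum>j<i + n. v j x) = (\<Sum>j<n. v j x) + (\<Sum>j\<in>{n..<i + n}. v j x)"
        using sum.atLeastLessThan_concat[of 0 n "i + n" "\<lambda>j. v j x"] by (simp add: lessThan_atLeast0)
      show "(f x - (\<Sum>j<n. v j x)) - (\<Sum>j<i + n. v' j x) = f x - (\<Sum>j<i + n. v j x)"
        unfolding s1 s2 by simp
    qed
    have "(\<lambda>i. Lp_pow p (\<lambda>x. (f x - (\<Sum>j<n. v j x)) - (\<Sum>j<i. v' j x))) \<longlonglongrightarrow> 0"
      by (rule LIMSEQ_offset[of _ n]) (simp only: eq, rule LIMSEQ_ignore_initial_segment[OF lim])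
    moreover have "(\<lambda>x. f x - (\<Sum>j<n. v j x)) \<in> Lp_space p unit_cube"
      by (intro diff_in_Lp_space(1) p f dyadic_step_Lp(1)[OF sumn])
    ultimately show ?thesis
      unfolding e[symmetric] t'_def[abs_def] using st' v
      by (intro C(2)) (auto simp: v'_def dyadic_step_const t'_def[abs_def])
  qed
  show "(\<lambda>n. besov_pow p q s (\<lambda>x. f x - (\<Sum>j<n. v j x))) \<longlonglongrightarrow> 0"
  proof (rule LIMSEQ_I)
    fix e :: real assume "0 < e"
    then obtain N where N: "\<And>n. n \<ge> N \<Longrightarrow> norm (\<Sum>j. t (j + n)) < e / C"
      using suminf_exist_split[OF _ st, of "e / C"] C(1) by auto
    show "\<exists>N. \<forall>n\<ge>N. norm (besov_pow p q s (\<lambda>x. f x - (\<Sum>j<n. v j x)) - 0) < e"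
    proof (intro exI allI impI)
      fix n assume n: "n \<ge> N"
      have "C * (\<Sum>j. t (j + n)) < C * (e / C)" using N[OF n] C(1) by (intro mult_strict_left_mono) auto
      then show "norm (besov_pow p q s (\<lambda>x. f x - (\<Sum>j<n. v j x)) - 0) < e"
        using main[of n] besov_pow_nonneg[OF p q s conjunct1[OF main[of n]]] C(1) by simp
    qed
  qed
qed

text \<open>A converse Bernstein inequality. A step function u of level k cannot approximate D well:
  since D has mean zero over the cells of level k, u is minus the average of D - u, and so D itself
  is controlled by D - u.\<close>

lemma mean_zero_lower:
  "\<exists>C>0. \<forall>k (D :: real^'d \<Rightarrow> real). dyadic_step (Suc k) D \<longrightarrow> (\<forall>x\<in>half_cube. avg k D x = 0) \<longrightarrow>
     (\<rho> ^ Suc k * Lp_pow p D) powr r \<le> C * besov_pow p q s D"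
proof -
  obtain C0 where C0: "C0 > 0" "\<forall>f \<in> besov_space p q s :: (real^'d \<Rightarrow> real) set. \<exists>u. (\<forall>k. dyadic_step k (u k)) \<and>
     summable (\<lambda>k. (\<rho> ^ k * Lp_pow p (\<lambda>x. f x - u k x)) powr r) \<and>
     (\<Sum>k. (\<rho> ^ k * Lp_pow p (\<lambda>x. f x - u k x)) powr r) \<le> C0 * besov_pow p q s f"
    using besov_approx_lower[where 'd = 'd] by (elim exE conjE) (rule that)
  define \<sigma> where "\<sigma> = avg_growth p TYPE('d)"
  have \<sigma>: "1 \<le> \<sigma>" by (simp add: \<sigma>_def avg_growth_ge_1)
  define Q where "Q = \<rho> * (2 powr p * (1 + \<sigma>))"
  have Q: "Q > 0" using \<sigma> \<rho> by (simp add: Q_def)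
  have "(\<rho> ^ Suc k * Lp_pow p D) powr r \<le> (Q powr r * C0) * besov_pow p q s D"
    if D: "dyadic_step (Suc k) D" and avg: "\<And>x. x \<in> half_cube \<Longrightarrow> avg k D x = 0" for k and D :: "real^'d \<Rightarrow> real"
  proof -
    have DB: "D \<in> besov_space p q s" using besov_dyadic_step D by blast
    obtain u where u: "\<And>k. dyadic_step k (u k)" "summable (\<lambda>k. (\<rho> ^ k * Lp_pow p (\<lambda>x. D x - u k x)) powr r)"
      "(\<Sum>k. (\<rho> ^ k * Lp_pow p (\<lambda>x. D x - u k x)) powr r) \<le> C0 * besov_pow p q s D"
      using bspec[OF C0(2) DB] by (elim exE conjE) (rule that, blast+)
    define w where "w x = D x - u k x" for x
    have w: "dyadic_step (Suc k) w" unfolding w_def by (intro dyadic_step_diff D dyadic_step_mono[OF u(1)]) simp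
    note L = dyadic_step_Lp(1)[OF D, of p] dyadic_step_Lp(1)[OF u(1), of k p] dyadic_step_Lp(1)[OF w, of p]
    have aw: "avg k w x = - u k x" if "x \<in> half_cube" for x
      unfolding w_def avg_diff using avg[OF that] avg_step[OF u(1) that] by simp
    have "Lp_pow p (u k) = Lp_pow p (avg k w)"
      unfolding dyadic_step_Lp(2)[OF u(1)] dyadic_step_Lp(2)[OF dyadic_step_avg] by (simp add: aw grid_point_in)
    also have "\<dots> \<le> \<sigma> * Lp_pow p w" unfolding \<sigma>_def by (rule Lp_pow_avg_le[OF p w])
    finally have uk: "Lp_pow p (u k) \<le> \<sigma> * Lp_pow p w" .
    have "Lp_pow p D = Lp_pow p (\<lambda>x. w x + u k x)" by (simp add: w_def)
    also have "\<dots> \<le> 2 powr p * (Lp_pow p w + Lp_pow p (u k))" by (intro add_in_Lp_space(2) p L)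
    also have "\<dots> \<le> 2 powr p * (Lp_pow p w + \<sigma> * Lp_pow p w)" using uk by (intro mult_left_mono) auto
    finally have "\<rho> ^ Suc k * Lp_pow p D \<le> \<rho> ^ Suc k * (2 powr p * (Lp_pow p w + \<sigma> * Lp_pow p w))"
      using \<rho> by (intro mult_left_mono) auto
    also have "\<dots> = Q * (\<rho> ^ k * Lp_pow p w)" by (simp add: Q_def algebra_simps)
    finally have "(\<rho> ^ Suc k * Lp_pow p D) powr r \<le> (Q * (\<rho> ^ k * Lp_pow p w)) powr r"
      using r \<rho> by (intro powr_mono2) auto
    also have "\<dots> = Q powr r * (\<rho> ^ k * Lp_pow p w) powr r" using Q \<rho> by (simp add: powr_mult)
    also have "\<dots> \<le> Q powr r * (C0 * besov_pow p q s D)"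
      using sum_le_suminf[OF u(2), of "{k}"] u(3) unfolding w_def[abs_def] by (intro mult_left_mono) auto
    finally show ?thesis by simp
  qed
  then show ?thesis using Q C0(1) by (intro exI[of _ "Q powr r * C0"]) auto
qed

end

context haar_enum
begin

text \<open>When \<sigma> = \<rho>, the weight and the size of a bump cancel and the norm of the
  series is controlled by the l_q size of the coefficients, wherever the bumps are placed.\<close>

lemma bump_series:
  fixes x :: "nat \<Rightarrow> real^'d"
  assumes p1: "p < 1" and \<sigma>\<rho>: "\<sigma> = \<rho>" and x: "\<And>j. x j \<in> half_cube" and \<beta>: "\<And>j. \<bar>\<beta> j\<bar> \<le> 1"
    and sm: "summable (\<lambda>j. \<bar>\<beta> j\<bar> powr q)"
    and fin: "\<And>y. y \<in> half_cube \<Longrightarrow> y \<noteq> 0 \<Longrightarrow> \<exists>J. \<forall>j\<ge>J. \<beta> j * bump j (x j) y = 0"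
  defines "f \<equiv> \<lambda>y. \<Sum>j. \<beta> j * bump j (x j) y"
  shows "f \<in> besov_space p q s" "(\<lambda>n. besov_pow p q s (\<lambda>y. f y - (\<Sum>j<n. \<beta> j * bump j (x j) y))) \<longlonglongrightarrow> 0"
proof -
  define v where "v j y = \<beta> j * bump j (x j) y" for j y
  have v: "dyadic_step j (v j)" for j unfolding v_def by (intro dyadic_step_cmult dyadic_step_bump)
  have A: "Lp_pow p (v j) = \<bar>\<beta> j\<bar> powr p / \<rho> ^ j" for j
    unfolding v_def using scale_in_Lp_space(2)[OF p dyadic_step_Lp(1)[OF dyadic_step_bump], of "\<beta> j" j "x j"]
      Lp_pow_bump[OF p p1 x, of j] by (simp add: \<sigma>_def[symmetric] \<sigma>\<rho>)
  have sA: "summable (\<lambda>j. Lp_pow p (v j))"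
  proof (rule summable_comparison_test'[of "\<lambda>j. (1 / \<rho>) ^ j" 0])
    show "summable (\<lambda>j. (1 / \<rho>) ^ j)" using \<rho> by (intro summable_geometric) auto
    fix j
    have "\<bar>\<beta> j\<bar> powr p \<le> 1 powr p" using \<beta> p by (intro powr_mono2) auto
    then show "norm (Lp_pow p (v j)) \<le> (1 / \<rho>) ^ j"
      unfolding A using \<rho> by (simp add: power_divide divide_right_mono)
  qed
  have vL: "v j \<in> Lp_space p unit_cube" for j by (rule dyadic_step_Lp(1)[OF v])
  have fin': "\<exists>J. \<forall>j\<ge>J. v j y = 0" if "y \<in> half_cube" "y \<noteq> 0" for y using fin[OF that] by (simp add: v_def)
  note S = Lp_series[OF p _ vL sA fin']
  have fe: "f = (\<lambda>y. \<Sum>j. v j y)" by (simp add: f_def v_def)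
  have "(\<rho> ^ j * Lp_pow p (v j)) powr r = \<bar>\<beta> j\<bar> powr q" for j
    unfolding A using \<rho> p by (simp add: powr_powr r_def)
  then have sb: "summable (\<lambda>j. (\<rho> ^ j * Lp_pow p (v j)) powr r)" using sm by simp
  have fL: "f \<in> Lp_space p unit_cube" and lim: "(\<lambda>n. Lp_pow p (\<lambda>x. f x - (\<Sum>j<n. v j x))) \<longlonglongrightarrow> 0"
    unfolding fe using S p1 by auto
  show "f \<in> besov_space p q s" "(\<lambda>n. besov_pow p q s (\<lambda>y. f y - (\<Sum>j<n. \<beta> j * bump j (x j) y))) \<longlonglongrightarrow> 0"
    using besov_series_tail[OF fL v sb lim] by (simp_all add: v_def)
qed

definition start :: "nat \<Rightarrow> nat" where "start k = (LEAST n. lev n = k)"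

lemma lev_start: "lev (start k) = k"
  unfolding start_def using ex_h haar_level_nonempty by (metis (mono_tags, lifting) LeastI all_not_in_conv)

lemma start_eq: "{..<start k} = {m. lev m < k}"
proof (intro subset_antisym subsetI)
  fix m assume "m \<in> {..<start k}"
  then have m: "m < start k" by simp
  then have "lev m \<noteq> k" unfolding start_def using not_less_Least by blast
  moreover have "\<not> k < lev m" using lev_less_imp[of "start k" m] lev_start[of k] m by auto
  ultimately show "m \<in> {m. lev m < k}" by simp
next
  fix m assume "m \<in> {m. lev m < k}"
  then show "m \<in> {..<start k}" using lev_less_imp[of m "start k"] lev_start[of k] by auto
qed

lemma start_strict_mono: "strict_mono start"
  unfolding strict_mono_Suc_iff using lev_less_imp lev_start by auto

lemma low_eq_start: "low UNIV k = {..<start (Suc k)}"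
  unfolding start_eq by (auto simp: low_def)

text \<open>Convergence in the space gives a rate in L_p: increments of the level sums have mean
  zero, so \<open>mean_zero_lower\<close> makes their weighted sizes tend to 0, and as \<rho> > 1
  the later increments sum geometrically to o(\<rho>^(-k)).\<close>

lemma level_sums_close:
  assumes f: "f \<in> besov_space p q s" and lim: "(\<lambda>k. besov_pow p q s (\<lambda>x. f x - lincomb (low UNIV k) c h x)) \<longlonglongrightarrow> 0"
    and p1: "p \<le> 1"
  shows "(\<lambda>k. \<rho> ^ k * Lp_pow p (\<lambda>x. f x - lincomb (low UNIV k) c h x)) \<longlonglongrightarrow> 0"
proof -
  define F where "F k = lincomb (low UNIV k) c h" for k
  obtain K where K: "K \<ge> 1" "\<And>f g :: real^'d \<Rightarrow> real. f \<in> besov_space p q s \<Longrightarrow> g \<in> besov_space p q s \<Longrightarrow>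
     (\<lambda>x. f x + g x) \<in> besov_space p q s \<and> besov_pow p q s (\<lambda>x. f x + g x) \<le> K * (besov_pow p q s f + besov_pow p q s g)"
    using besov_pow_add[OF p q s, where 'd = 'd] by blast
  obtain C where C: "C > 0" "\<And>k (D :: real^'d \<Rightarrow> real). dyadic_step (Suc k) D \<Longrightarrow> (\<forall>x\<in>half_cube. avg k D x = 0) \<Longrightarrow>
     (\<rho> ^ Suc k * Lp_pow p D) powr r \<le> C * besov_pow p q s D"
    using mean_zero_lower[where 'd = 'd] by blast
  have finL: "finite (low UNIV k)" for k unfolding low_UNIV by (rule finite_lev_le)
  have FB: "F k \<in> besov_space p q s" for k unfolding F_def by (rule lincomb_besov[OF finL])
  have Fst: "dyadic_step k (F k)" for k unfolding F_def by (rule lincomb_low_step)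
  have neg: "(\<lambda>x. - 1 * g x) \<in> besov_space p q s \<and> besov_pow p q s (\<lambda>x. - 1 * g x) \<le> besov_pow p q s g"
    if "g \<in> besov_space p q s" for g :: "real^'d \<Rightarrow> real"
    using besov_pow_scale[OF p q s that, of "- 1"] by simp
  have fF: "(\<lambda>x. f x - F k x) \<in> besov_space p q s" for k
    using K(2)[OF f conjunct1[OF neg[OF FB]], of k] by simp
  define \<delta> where "\<delta> k = besov_pow p q s (\<lambda>x. f x - F k x)" for k
  have \<delta>: "\<delta> \<longlonglongrightarrow> 0" "\<And>k. 0 \<le> \<delta> k"
    using lim besov_pow_nonneg[OF p q s fF] by (simp_all add: \<delta>_def[abs_def] F_def)
  define D where "D k x = F (Suc k) x - F k x" for k x
  have Dst: "dyadic_step (Suc k) (D k)" for k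
    unfolding D_def by (intro dyadic_step_diff Fst dyadic_step_mono[OF Fst]) simp
  define \<epsilon> where "\<epsilon> k = \<rho> ^ Suc k * Lp_pow p (D k)" for k
  have \<epsilon>0: "0 \<le> \<epsilon> k" for k using \<rho> by (simp add: \<epsilon>_def)
  have \<epsilon>r: "\<epsilon> k powr r \<le> C * (K * (\<delta> k + \<delta> (Suc k)))" for k
  proof -
    have "avg k (D k) x = 0" if x: "x \<in> half_cube" for x
    proof -
      have "low (low UNIV (Suc k)) (Suc k) = low UNIV (Suc k)" "low (low UNIV (Suc k)) k = low UNIV k" by (auto simp: low_def)
      then have "avg k (F (Suc k)) x = F k x" using avg_lincomb_low[OF finL x, of k "Suc k" c] by (simp add: F_def)
      then show ?thesis unfolding D_def avg_diff using avg_step[OF Fst x] by simp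
    qed
    then have "\<epsilon> k powr r \<le> C * besov_pow p q s (D k)" unfolding \<epsilon>_def using C(2)[OF Dst] by blast
    also have "D k = (\<lambda>x. (f x - F k x) + - 1 * (f x - F (Suc k) x))" by (auto simp: D_def)
    also have "besov_pow p q s \<dots> \<le> K * (\<delta> k + besov_pow p q s (\<lambda>x. - 1 * (f x - F (Suc k) x)))"
      unfolding \<delta>_def using K(2)[OF fF conjunct1[OF neg[OF fF]]] by blast
    also have "\<dots> \<le> K * (\<delta> k + \<delta> (Suc k))"
      unfolding \<delta>_def using K neg[OF fF] by (intro mult_left_mono add_left_mono) auto
    finally show ?thesis using C(1) by (simp add: mult_left_mono)
  qed
  have "(\<lambda>k. C * (K * (\<delta> k + \<delta> (Suc k)))) \<longlonglongrightarrow> C * (K * (0 + 0))"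
    by (intro tendsto_mult tendsto_add tendsto_const \<delta>(1) LIMSEQ_Suc[OF \<delta>(1)])
  then have "(\<lambda>k. C * (K * (\<delta> k + \<delta> (Suc k)))) \<longlonglongrightarrow> 0" by simp
  then have "(\<lambda>k. \<epsilon> k powr r) \<longlonglongrightarrow> 0"
    by (rule Lim_null_comparison[rotated]) (use \<epsilon>r in auto)
  then have "(\<lambda>k. (\<epsilon> k powr r) powr (1 / r)) \<longlonglongrightarrow> 0"
    by (rule tendsto_zero_powrI[OF _ tendsto_const]) (use r in auto)
  then have \<epsilon>: "\<epsilon> \<longlonglongrightarrow> 0" using r \<epsilon>0 by (simp add: powr_powr)
  define \<alpha> where "\<alpha> k = Lp_pow p (\<lambda>x. f x - F k x)" for k
  have \<alpha>: "\<alpha> \<longlonglongrightarrow> 0"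
  proof -
    have "(\<lambda>k. \<alpha> k powr r) \<longlonglongrightarrow> 0"
    proof (rule Lim_null_comparison[OF _ \<delta>(1)])
      show "\<forall>\<^sub>F k in sequentially. norm (\<alpha> k powr r) \<le> \<delta> k"
        unfolding \<alpha>_def \<delta>_def using Lp_pow_le_besov[OF fF] by auto
    qed
    then have "(\<lambda>k. (\<alpha> k powr r) powr (1 / r)) \<longlonglongrightarrow> 0"
      by (rule tendsto_zero_powrI[OF _ tendsto_const]) (use r in auto)
    moreover have "(\<alpha> k powr r) powr (1 / r) = \<alpha> k" for k using r by (simp add: powr_powr \<alpha>_def)
    ultimately show ?thesis by simp
  qed
  define Q where "Q = 2 powr p * (1 / (\<rho> - 1))"
  have Q: "Q > 0" using \<rho> by (simp add: Q_def)
  have "(\<lambda>k. \<rho> ^ k * \<alpha> k) \<longlonglongrightarrow> 0"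
  proof (rule LIMSEQ_I)
    fix e :: real assume e: "0 < e"
    define e' where "e' = e / (2 * Q)"
    have e': "e' > 0" using e Q by (simp add: e'_def)
    have "\<forall>\<^sub>F k in sequentially. \<epsilon> k < e'" using \<epsilon> e' by (rule order_tendstoD(2))
    then obtain k0 where k0': "\<forall>k\<ge>k0. \<epsilon> k < e'" unfolding eventually_sequentially by blast
    then have k0: "\<epsilon> k \<le> e'" if "k \<ge> k0" for k using that by (simp add: less_imp_le)
    have "\<rho> ^ k * \<alpha> k \<le> Q * e'" if k: "k \<ge> k0" for k
    proof -
      have Dk: "Lp_pow p (D j) \<le> e' * (1 / \<rho>) ^ Suc j" if "j \<ge> k" for j
        using k0[of j] that k \<rho> by (simp add: \<epsilon>_def field_simps power_divide)
      have FF: "\<rho> ^ k * Lp_pow p (\<lambda>x. F n x - F k x) \<le> e' * (1 / (\<rho> - 1))" if n: "n \<ge> k" for n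
      proof -
        have "(\<lambda>x. F n x - F k x) = (\<lambda>x. \<Sum>j\<in>{k..<n}. D j x)"
        proof
          fix x show "F n x - F k x = (\<Sum>j\<in>{k..<n}. D j x)"
            unfolding D_def using sum_Suc_diff'[OF n, of "\<lambda>j. F j x"] by simp
        qed
        then have "Lp_pow p (\<lambda>x. F n x - F k x) \<le> (\<Sum>j\<in>{k..<n}. 1 * Lp_pow p (D j))"
          using powr_sum_le[OF p p1, of "{k..<n}"]
          by (simp only:) (rule sum_in_Lp_space(2)[OF p dyadic_step_Lp(1)[OF Dst]], simp_all)
        also have "\<dots> \<le> (\<Sum>j\<in>{k..<n}. e' * (1 / \<rho>) ^ Suc j)" using Dk by (intro sum_mono) auto
        also have "\<dots> = (\<Sum>i<n - k. e' * (1 / \<rho>) ^ Suc (i + k))"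
          using sum.shift_bounds_nat_ivl[of "\<lambda>j. e' * (1 / \<rho>) ^ Suc j" 0 k "n - k"] n by (simp add: lessThan_atLeast0)
        also have "\<dots> = e' * (1 / \<rho>) ^ Suc k * (\<Sum>i<n - k. (1 / \<rho>) ^ i)"
          by (simp add: sum_distrib_left sum_divide_distrib power_add mult_ac)
        also have "\<dots> \<le> e' * (1 / \<rho>) ^ Suc k * (1 / (1 - 1 / \<rho>))"
        proof (rule mult_left_mono)
          have "(\<Sum>i<n - k. (1 / \<rho>) ^ i) \<le> (\<Sum>i. (1 / \<rho>) ^ i)"
            using \<rho> by (intro sum_le_suminf summable_geometric) auto
          then show "(\<Sum>i<n - k. (1 / \<rho>) ^ i) \<le> 1 / (1 - 1 / \<rho>)" using \<rho> by (simp add: suminf_geometric)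
        qed (use e' \<rho> in auto)
        finally have "\<rho> ^ k * Lp_pow p (\<lambda>x. F n x - F k x) \<le> \<rho> ^ k * (e' * (1 / \<rho>) ^ Suc k * (1 / (1 - 1 / \<rho>)))"
          using \<rho> by (intro mult_left_mono) auto
        also have "\<dots> = e' * (1 / (\<rho> - 1))" using \<rho> by (simp add: field_simps power_divide)
        finally show ?thesis .
      qed
      \<comment> \<open>The increments cover only the passage from level k to level n; the remaining
        error tends to 0 as n grows with k fixed.\<close>
      have bd: "\<rho> ^ k * \<alpha> k \<le> 2 powr p * (\<rho> ^ k * \<alpha> n + e' * (1 / (\<rho> - 1)))" if n: "n \<ge> k" for n
      proof -
        have "\<alpha> k = Lp_pow p (\<lambda>x. (f x - F n x) + (F n x - F k x))" by (simp add: \<alpha>_def)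
        also have "\<dots> \<le> 2 powr p * (\<alpha> n + Lp_pow p (\<lambda>x. F n x - F k x))"
          unfolding \<alpha>_def by (intro add_in_Lp_space(2) diff_in_Lp_space(1) p Lp_of_besov[OF f] Lp_of_besov[OF FB])
        finally have "\<rho> ^ k * \<alpha> k \<le> \<rho> ^ k * (2 powr p * (\<alpha> n + Lp_pow p (\<lambda>x. F n x - F k x)))"
          using \<rho> by (intro mult_left_mono) auto
        also have "\<dots> = 2 powr p * (\<rho> ^ k * \<alpha> n + \<rho> ^ k * Lp_pow p (\<lambda>x. F n x - F k x))" by (simp add: algebra_simps)
        also have "\<dots> \<le> 2 powr p * (\<rho> ^ k * \<alpha> n + e' * (1 / (\<rho> - 1)))" using FF[OF n] by (intro mult_left_mono) auto
        finally show ?thesis .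
      qed
      have "(\<lambda>n. 2 powr p * (\<rho> ^ k * \<alpha> n + e' * (1 / (\<rho> - 1)))) \<longlonglongrightarrow> 2 powr p * (\<rho> ^ k * 0 + e' * (1 / (\<rho> - 1)))"
        by (intro tendsto_mult tendsto_add tendsto_const \<alpha>)
      then have "\<rho> ^ k * \<alpha> k \<le> 2 powr p * (\<rho> ^ k * 0 + e' * (1 / (\<rho> - 1)))"
        by (rule LIMSEQ_le_const) (use bd in blast)
      then show ?thesis by (simp add: Q_def mult_ac)
    qed
    moreover have "Q * e' < e" using e Q by (simp add: e'_def)
    moreover have "0 \<le> \<rho> ^ k * \<alpha> k" for k using \<rho> by (simp add: \<alpha>_def)
    ultimately show "\<exists>k0. \<forall>k\<ge>k0. norm (\<rho> ^ k * \<alpha> k - 0) < e" by (intro exI[of _ k0]) force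
  qed
  then show ?thesis by (simp add: \<alpha>_def F_def)
qed

end

section \<open>Failure of the basis property in the limiting case\<close>

lemma cell_const:
  "cell k (\<chi> i. c) = (\<lambda>_. \<lfloor>2 ^ k * c\<rfloor>)"
  by (simp add: cell_def[abs_def])

text \<open>The points \<open>j / 4\<^sup>m\<close>, \<open>2\<^sup>m \<le> j < 2\<^sup>m\<^sup>+\<^sup>1\<close>, lie in distinct cells of level \<open>2 m\<close>, and the
  cells belonging to different \<open>m\<close> are disjoint.\<close>

definition octave :: "nat \<Rightarrow> nat" where "octave j = (LEAST m. j < 2 ^ Suc m)"

text \<open>For j = 1 the formula would give the vertex with all coordinates 1, outside
  \<open>half_cube\<close>; indices below 2 receive the coefficient 0 later.\<close>

definition octave_point :: "nat \<Rightarrow> real^'d" where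
  "octave_point j = (if j < 2 then 0 else (\<chi> i. real j / 4 ^ octave j))"

lemma octave_less: "j < 2 ^ Suc (octave j)"
  unfolding octave_def by (rule LeastI[of _ j]) (rule Suc_lessD[OF less_exp])

lemma octave_le: "1 \<le> j \<Longrightarrow> 2 ^ octave j \<le> j"
proof (cases "octave j")
  case (Suc m)
  then have "\<not> j < 2 ^ Suc m" unfolding octave_def using not_less_Least[of m "\<lambda>m. j < 2 ^ Suc m"] by simp
  then show ?thesis using Suc by simp
qed simp

lemma octave_eq: "2 ^ m \<le> j \<Longrightarrow> j < 2 ^ Suc m \<Longrightarrow> octave j = m"
  unfolding octave_def
proof (rule Least_equality)
  fix n assume "2 ^ m \<le> j" "j < 2 ^ Suc n"
  then have "(2::nat) ^ m < 2 ^ Suc n" by linarith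
  then have "m < Suc n" by (simp add: power_strict_increasing_iff[of "2::nat"] del: power_Suc)
  then show "m \<le> n" by simp
qed

lemma two_mult_le_power: "1 \<le> m \<Longrightarrow> 2 * m \<le> (2::nat) ^ m"
proof (induction m rule: nat_induct_at_least)
  case (Suc n)
  then show ?case by simp
qed simp

lemma three_mult_le_power: "4 \<le> m \<Longrightarrow> 3 * m \<le> (2::nat) ^ m"
proof (induction m rule: nat_induct_at_least)
  case (Suc n)
  then show ?case by simp
qed simp

lemma octave_ge_1: "2 \<le> j \<Longrightarrow> 1 \<le> octave j"
  using octave_less[of j] by (cases "octave j") auto

lemma cell_octave_point:
  assumes "2 \<le> j"
  shows "cell (2 * octave j) (octave_point j :: real^'d) = (\<lambda>_. int j)"
proof -
  have "(2::real) ^ (2 * octave j) = 4 ^ octave j" by (simp add: power_mult)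
  then show ?thesis using assms by (simp add: octave_point_def cell_const)
qed

lemma octave_point_in_half: "(octave_point j :: real^'d) \<in> half_cube"
proof (cases "j < 2")
  case False
  have "j < 2 ^ Suc (octave j)" by (rule octave_less)
  also have "\<dots> \<le> 2 ^ (2 * octave j)" using octave_ge_1[of j] False by (intro power_increasing) auto
  finally have "int j < 2 ^ (2 * octave j)" by (metis of_nat_less_iff of_nat_numeral of_nat_power)
  then show ?thesis
    using False unfolding half_cube_iff_cell[of _ "2 * octave j"] by (simp add: cell_octave_point grid_def)
qed (simp add: octave_point_def half_cube_def)

lemma cell_octave_eq_1:
  assumes "cell (2 * m) y = (\<lambda>_. int j)" "2 ^ m \<le> j" "j < 2 ^ Suc m"
  shows "cell m y i = 1"
proof -
  have "cell m y i = int j div 2 ^ m" using cell_div[of m "2 * m" y i] assms(1) by simp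
  also have "\<dots> = int (j div 2 ^ m)" by (simp add: zdiv_int)
  also have "j div 2 ^ m = 1" using assms(2,3) by (intro div_nat_eqI) auto
  finally show ?thesis by simp
qed

text \<open>All cells of octave m have index 1 at level m, and a point can have index 1 at one level
  only; this keeps different octaves apart.\<close>

lemma cell_eq_1_unique:
  assumes "cell m y i = 1" "cell n y i = 1" shows "m = n"
proof -
  have False if "m < n" "cell m y i = 1" "cell n y i = 1" for m n
  proof -
    have "cell m y i = 1 div 2 ^ (n - m)" using cell_div[of m n y i] that by simp
    moreover have "(1::int) < 2 ^ (n - m)" using that by (intro one_less_power) auto
    ultimately show False using that by simp
  qed
  then show ?thesis using assms by (metis linorder_neqE_nat)
qed

lemma bump_octave_nonzero:
  fixes y :: "real^'d"
  assumes "bump j (octave_point j) y \<noteq> 0" "2 \<le> j"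
  shows "cell (2 * octave j) y = (\<lambda>_. int j)" "cell (octave j) y i = 1"
proof -
  have "cell j y = cell j (octave_point j :: real^'d)" using assms(1) by (auto simp: bump_def)
  moreover have "2 * octave j \<le> j"
    using two_mult_le_power[OF octave_ge_1[OF assms(2)]] octave_le[of j] assms(2) by linarith
  ultimately show c: "cell (2 * octave j) y = (\<lambda>_. int j)"
    using cell_mono cell_octave_point[OF assms(2), where 'd = 'd] by metis
  show "cell (octave j) y i = 1"
    using octave_le[of j] octave_less[of j] assms(2) by (intro cell_octave_eq_1[OF c]) auto
qed

text \<open>A permutation that within each block S i \<le> m < S (i + 1) puts the members of P
  before the others. Both the state before a block and the state after its P-part are then initial
  segments.\<close>

lemma rearrangement:
  fixes S :: "nat \<Rightarrow> nat" and P :: "nat set"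
  assumes S: "strict_mono S" "S 0 = 0"
  shows "\<exists>\<pi> :: nat \<Rightarrow> nat. bij \<pi> \<and> (\<forall>i. \<exists>t. \<pi> ` {..<t} = {..<S i}) \<and> (\<forall>i. \<exists>t. \<pi> ` {..<t} = {..<S i} \<union> (P \<inter> {S i..<S (Suc i)}))"
proof -
  define blk where "blk m = (LEAST i. m < S (Suc i))" for m
  have blk: "S (blk m) \<le> m" "m < S (Suc (blk m))" for m
  proof -
    have "m < S (Suc m)" using strict_mono_imp_increasing[OF S(1), of "Suc m"] by simp
    then show "m < S (Suc (blk m))" unfolding blk_def by (rule LeastI)
    show "S (blk m) \<le> m"
    proof (cases "blk m")
      case (Suc i)
      then have "\<not> m < S (Suc i)" unfolding blk_def using not_less_Least[of i "\<lambda>i. m < S (Suc i)"] by simp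
      then show ?thesis using Suc by simp
    qed (simp add: S(2))
  qed
  \<comment> \<open>A sorting key: the block [S i, S (i+1)) is mapped into [2 S i, 2 S (i+1)),
    members of P into the first half and the others, moved by the block length, into the second
    half.\<close>
  define \<kappa> where "\<kappa> m = S (blk m) + m + (if m \<in> P then 0 else S (Suc (blk m)) - S (blk m))" for m
  have \<kappa>: "2 * S (blk m) \<le> \<kappa> m" "\<kappa> m < 2 * S (Suc (blk m))" for m
    using blk[of m] by (auto simp: \<kappa>_def)
  have blk_less: "blk m < i \<longleftrightarrow> m < S i" for m i
  proof
    assume "blk m < i"
    then have "S (Suc (blk m)) \<le> S i" using S(1) by (simp add: strict_mono_less_eq)
    then show "m < S i" using blk(2)[of m] by simp
  next
    assume "m < S i"
    then have "S (blk m) < S i" using blk(1)[of m] by simp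
    then show "blk m < i" using S(1) by (simp add: strict_mono_less)
  qed
  have \<kappa>_blk: "\<kappa> m < 2 * S i \<longleftrightarrow> m < S i" for m i
  proof
    assume "\<kappa> m < 2 * S i"
    then have "S (blk m) < S i" using \<kappa>(1)[of m] by simp
    then show "m < S i" using S(1) blk_less by (simp add: strict_mono_less)
  next
    assume "m < S i"
    then have "S (Suc (blk m)) \<le> S i" using S(1) blk_less[of m i] by (simp add: strict_mono_less_eq)
    then show "\<kappa> m < 2 * S i" using \<kappa>(2)[of m] by simp
  qed
  have inj: "inj \<kappa>"
  proof (rule injI)
    fix m n assume e: "\<kappa> m = \<kappa> n"
    have "blk m = blk n"
    proof (rule ccontr)
      assume "blk m \<noteq> blk n"
      then have "blk m < blk n \<or> blk n < blk m" by linarith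
      then have "S (Suc (blk m)) \<le> S (blk n) \<or> S (Suc (blk n)) \<le> S (blk m)"
        using S(1) by (simp add: strict_mono_less_eq Suc_le_eq)
      then show False using \<kappa>[of m] \<kappa>[of n] e by linarith
    qed
    then show "m = n" using e blk[of m] blk[of n] by (auto simp: \<kappa>_def split: if_splits)
  qed
  have infR: "infinite (range \<kappa>)" using inj by (simp add: range_inj_infinite)
  define e where "e = enumerate (range \<kappa>)"
  have e: "bij_betw e UNIV (range \<kappa>)" unfolding e_def by (rule bij_enumerate[OF infR])
  define \<pi> where "\<pi> = inv \<kappa> \<circ> e"
  have \<kappa>\<pi>: "\<kappa> (\<pi> n) = e n" for n
  proof -
    have "e n \<in> range \<kappa>" using e by (auto simp: bij_betw_def)
    then show ?thesis by (simp add: \<pi>_def f_inv_into_f)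
  qed
  have bij: "bij \<pi>"
  proof (rule bijI)
    show "inj \<pi>"
    proof (rule injI)
      fix m n assume "\<pi> m = \<pi> n"
      then have "e m = e n" using \<kappa>\<pi> by metis
      then show "m = n" using e by (auto simp: bij_betw_def dest: injD)
    qed
    show "surj \<pi>"
    proof (rule surjI[where f = "inv e \<circ> \<kappa>"])
      fix m
      have "\<kappa> m \<in> range e" using e by (auto simp: bij_betw_def)
      then have "\<kappa> (\<pi> (inv e (\<kappa> m))) = \<kappa> m" unfolding \<kappa>\<pi> by (simp add: f_inv_into_f)
      then show "\<pi> ((inv e \<circ> \<kappa>) m) = m" using inj by (simp add: inj_eq)
    qed
  qed
  \<comment> \<open>Since e lists the keys in increasing order, every set given by a bound on the
    key is an initial segment of the rearranged order.\<close>
  have thr: "\<exists>t. \<pi> ` {..<t} = {m. \<kappa> m < T}" for T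
  proof -
    define t where "t = (LEAST n. T \<le> e n)"
    have mono: "strict_mono e" unfolding e_def by (rule strict_mono_enumerate[OF infR])
    have ex: "T \<le> e T" using strict_mono_imp_increasing[OF mono] by simp
    have t: "n < t \<longleftrightarrow> e n < T" for n
    proof
      assume "n < t"
      then show "e n < T" unfolding t_def using not_less_Least[of n "\<lambda>n. T \<le> e n"] by simp
    next
      assume "e n < T"
      moreover have "T \<le> e t" unfolding t_def by (rule LeastI[of "\<lambda>n. T \<le> e n", OF ex])
      ultimately have "e n < e t" by simp
      then show "n < t" using mono by (simp add: strict_mono_less)
    qed
    have "\<pi> ` {..<t} = {m. \<kappa> m < T}"
    proof (intro subset_antisym subsetI)
      fix m assume "m \<in> \<pi> ` {..<t}"
      then show "m \<in> {m. \<kappa> m < T}" using t \<kappa>\<pi> by auto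
    next
      fix m assume "m \<in> {m. \<kappa> m < T}"
      moreover obtain n where n: "m = \<pi> n" using bij by (metis bij_is_surj surjD)
      ultimately show "m \<in> \<pi> ` {..<t}" using t[of n] \<kappa>\<pi>[of n] by auto
    qed
    then show ?thesis ..
  qed
  show ?thesis
  proof (intro exI[of _ \<pi>] conjI allI bij)
    fix i
    show "\<exists>t. \<pi> ` {..<t} = {..<S i}" using thr[of "2 * S i"] by (simp add: \<kappa>_blk lessThan_def)
    have "{m. \<kappa> m < S i + S (Suc i)} = {..<S i} \<union> (P \<inter> {S i..<S (Suc i)})"
    proof (intro subset_antisym subsetI)
      fix m assume "m \<in> {m. \<kappa> m < S i + S (Suc i)}"
      then have k: "\<kappa> m < S i + S (Suc i)" by simp
      have "S i < S (Suc i)" using S(1) by (simp add: strict_mono_less)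
      then have m: "m < S (Suc i)" using k \<kappa>_blk[of m "Suc i"] by simp
      show "m \<in> {..<S i} \<union> (P \<inter> {S i..<S (Suc i)})"
      proof (cases "m < S i")
        case False
        then have "blk m = i" using blk_less[of m i] blk_less[of m "Suc i"] m by simp
        then have "m \<in> P" using k False by (auto simp: \<kappa>_def split: if_splits)
        then show ?thesis using False m by simp
      qed simp
    next
      fix m assume m: "m \<in> {..<S i} \<union> (P \<inter> {S i..<S (Suc i)})"
      have "S i < S (Suc i)" using S(1) by (simp add: strict_mono_less)
      show "m \<in> {m. \<kappa> m < S i + S (Suc i)}"
      proof (cases "m < S i")
        case True
        then show ?thesis using \<kappa>_blk[of m i] \<open>S i < S (Suc i)\<close> by simp
      next
        case False
        then have "blk m = i" using blk_less[of m i] blk_less[of m "Suc i"] m by simp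
        then show ?thesis using m False by (simp add: \<kappa>_def)
      qed
    qed
    then show "\<exists>t. \<pi> ` {..<t} = {..<S i} \<union> (P \<inter> {S i..<S (Suc i)})" using thr[of "S i + S (Suc i)"] by simp
  qed
qed

context haar_enum
begin

text \<open>The coefficients j^(-1/p) are in l_q but not in l_p. A bump of level j in octave m is
  tiny in L_p, but averaged to level 2m its weighted p-th power is 1/j, and the octave contributes
  at least 1/2. Any expansion is forced to have these averages as level sums, contrary to
  \<open>level_sums_close\<close>.\<close>

theorem not_basis_limiting:
  assumes p1: "p < 1" and \<sigma>\<rho>: "\<sigma> = \<rho>" and qp: "p < q"
  shows "\<not> schauder_basis (besov_space p q s) (besov_norm p q s) h"
proof
  assume basis: "schauder_basis (besov_space p q s) (besov_norm p q s) h"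
  define \<beta> where "\<beta> j = (if j < 2 then 0 else real j powr (- 1 / p))" for j :: nat
  have \<beta>1: "\<bar>\<beta> j\<bar> \<le> 1" for j
  proof (cases "j < 2")
    case False
    then have "real j powr (- 1 / p) \<le> 1 powr (- 1 / p)" using p by (intro powr_mono2') auto
    then show ?thesis using False by (simp add: \<beta>_def)
  qed (simp add: \<beta>_def)
  have \<beta>p: "\<bar>\<beta> j\<bar> powr p = 1 / real j" if "2 \<le> j" for j
    using that p by (simp add: \<beta>_def powr_powr powr_minus_divide powr_divide)
  let ?x = "octave_point :: nat \<Rightarrow> real^'d"
  define v where "v j y = \<beta> j * bump j (?x j) y" for j y
  have v_nz: "2 \<le> j \<and> cell (2 * octave j) y = (\<lambda>_. int j) \<and> (\<forall>i. cell (octave j) y i = 1)" if "v j y \<noteq> 0" for j y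
  proof -
    have j: "2 \<le> j" and b: "bump j (?x j) y \<noteq> 0" using that by (auto simp: v_def \<beta>_def split: if_splits)
    show ?thesis using bump_octave_nonzero[OF b j] j by blast
  qed
  have sm: "summable (\<lambda>j. \<bar>\<beta> j\<bar> powr q)"
  proof (rule summable_comparison_test'[of "\<lambda>j. real j powr (- (q / p))" 0])
    show "summable (\<lambda>j. real j powr (- (q / p)))" using p qp by (simp add: summable_real_powr_iff)
    show "norm (\<bar>\<beta> j\<bar> powr q) \<le> real j powr (- (q / p))" for j by (simp add: \<beta>_def powr_powr)
  qed
  define f where "f y = (\<Sum>j. \<beta> j * bump j (?x j) y)" for y
  have fin: "\<exists>J. \<forall>j\<ge>J. \<beta> j * bump j (?x j) y = 0" for y
  proof (cases "\<exists>j. v j y \<noteq> 0")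
    case True
    then obtain j0 where j0: "v j0 y \<noteq> 0" by blast
    have "v j y = 0" if "j \<ge> 2 ^ Suc (octave j0)" for j
    proof (rule ccontr)
      assume "v j y \<noteq> 0"
      then have "octave j = octave j0" using cell_eq_1_unique v_nz[of j y] v_nz[OF j0] by blast
      then show False using octave_less[of j] that by simp
    qed
    then show ?thesis by (auto simp: v_def)
  qed (auto simp: v_def)
  have fB: "f \<in> besov_space p q s"
    unfolding f_def using fin by (intro bump_series(1)[OF p1 \<sigma>\<rho> octave_point_in_half \<beta>1 sm]) blast
  note fL = Lp_of_besov[OF fB]
  obtain c where c: "series_converges_to (besov_norm p q s) h c f"
    using basis fB unfolding schauder_basis_def by blast
  have nB: "(\<lambda>x. f x - lincomb {..<n} c h x) \<in> besov_space p q s" for n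
    using besov_in_add[OF fB besov_pow_scale(1)[OF p q s lincomb_besov[of "{..<n}" c], of "- 1"]] by simp
  have "(\<lambda>n. besov_norm p q s (\<lambda>x. f x - lincomb {..<n} c h x)) \<longlonglongrightarrow> 0"
    using c unfolding series_converges_to_def lincomb_def .
  then have "(\<lambda>n. besov_pow p q s (\<lambda>x. f x - lincomb {..<n} c h x)) \<longlonglongrightarrow> 0"
    by (rule besov_norm_tendsto_iff[THEN iffD1, rotated]) (rule nB)
  then have "((\<lambda>n. besov_pow p q s (\<lambda>x. f x - lincomb {..<n} c h x)) \<circ> (\<lambda>k. start (Suc k))) \<longlonglongrightarrow> 0"
    by (rule LIMSEQ_subseq_LIMSEQ) (use start_strict_mono in \<open>auto simp: strict_mono_def\<close>)
  then have "(\<lambda>k. besov_pow p q s (\<lambda>x. f x - lincomb (low UNIV k) c h x)) \<longlonglongrightarrow> 0"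
    unfolding low_eq_start by (simp add: o_def)
  then have close: "(\<lambda>k. \<rho> ^ k * Lp_pow p (\<lambda>x. f x - lincomb (low UNIV k) c h x)) \<longlonglongrightarrow> 0"
    using p1 by (intro level_sums_close[OF fB]) auto
  define F where "F k = lincomb (low UNIV k) c h" for k
  define \<alpha> where "\<alpha> k = Lp_pow p (\<lambda>x. f x - F k x)" for k
  have \<alpha>: "(\<lambda>k. \<rho> ^ k * \<alpha> k) \<longlonglongrightarrow> 0" using close by (simp add: \<alpha>_def F_def)
  have \<alpha>0: "0 \<le> \<alpha> k" for k by (simp add: \<alpha>_def)
  have Fst: "dyadic_step k (F k)" for k unfolding F_def by (rule lincomb_low_step)
  have finL: "finite (low UNIV k)" for k unfolding low_UNIV by (rule finite_lev_le)
  have Favg: "iter_avg k n (F (k + n)) y = F k y" if "y \<in> half_cube" for k n y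
  proof -
    have "low (low UNIV (k + n)) (k + n) = low UNIV (k + n)" "low (low UNIV (k + n)) k = low UNIV k" by (auto simp: low_def)
    then show ?thesis using iter_avg_lincomb_low[OF finL that, of k n "k + n" c] by (simp add: F_def)
  qed
  have Ab: "Lp_pow p (bump k x) = 1 / \<rho> ^ k" if "x \<in> half_cube" for k and x :: "real^'d"
    using Lp_pow_bump[OF p p1 that, of k] by (simp add: \<sigma>_def[symmetric] \<sigma>\<rho>)
  have main: "1 / 2 \<le> (2 powr p * 2 powr p) * (\<rho> ^ (2 * m) * \<alpha> (2 * m) + \<rho> ^ (2 * m) / \<rho> ^ (2 ^ m))" if m: "1 \<le> m" for m
  proof -
    define k where "k = 2 * m"
    define grp where "grp = {2 ^ m..<(2::nat) ^ Suc m}"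
    have two: "(2::nat) \<le> 2 ^ m" using m by (metis one_le_numeral power_increasing power_one_right)
    have grp: "2 \<le> j" "octave j = m" "k \<le> j" "cell k (?x j) = (\<lambda>_. int j)" if "j \<in> grp" for j
    proof -
      have j: "2 ^ m \<le> j" "j < 2 ^ Suc m" using that by (auto simp: grp_def)
      show j2: "2 \<le> j" using j two by linarith
      show o: "octave j = m" by (rule octave_eq[OF j])
      show "k \<le> j" using two_mult_le_power[OF m] j by (simp add: k_def)
      show "cell k (?x j) = (\<lambda>_. int j)" using cell_octave_point[OF j2, where 'd = 'd] by (simp add: o k_def)
    qed
    \<comment> \<open>A cutoff to the cells of octave m, constant on cells of level k = 2m and hence
      commuting with averages down to that level; it isolates the group from the other
      octaves.\<close>
    define e :: "real^'d \<Rightarrow> real" where "e y = of_bool (\<exists>j\<in>grp. cell k y = (\<lambda>_. int j))" for y :: "real^'d"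
    have est: "dyadic_step k e" unfolding e_def by (rule dyadic_step_cell)
    define V where "V y = (\<Sum>j\<in>grp. \<beta> j * bump j (?x j) y)" for y
    define Vk where "Vk y = (\<Sum>j\<in>grp. \<beta> j * bump k (?x j) y)" for y
    have Vst: "dyadic_step n V" if "2 ^ Suc m \<le> n" for n
      unfolding V_def using that by (intro dyadic_step_sum dyadic_step_cmult dyadic_step_mono[OF dyadic_step_bump]) (auto simp: grp_def)
    have Vkst: "dyadic_step k Vk" unfolding Vk_def by (intro dyadic_step_sum dyadic_step_cmult dyadic_step_bump)
    have fe: "e y * f y = V y" for y
    proof (cases "\<exists>j\<in>grp. cell k y = (\<lambda>_. int j)")
      case True
      then obtain j0 where j0: "j0 \<in> grp" "cell k y = (\<lambda>_. int j0)" by blast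
      have cm: "cell m y i = 1" for i
        using cell_octave_eq_1[of m y j0 i] j0 by (simp add: k_def grp_def)
      have "f y = (\<Sum>j\<in>grp. v j y)"
        unfolding f_def v_def[symmetric]
      proof (rule suminf_finite)
        fix j assume j: "j \<notin> grp"
        show "v j y = 0"
        proof (rule ccontr)
          assume "v j y \<noteq> 0"
          then have "octave j = m" "2 \<le> j" using cell_eq_1_unique cm v_nz[of j y] by blast+
          then show False using j octave_le[of j] octave_less[of j] by (auto simp: grp_def)
        qed
      qed (simp add: grp_def)
      then show ?thesis using True by (simp add: e_def V_def v_def)
    next
      case False
      have "v j y = 0" if "j \<in> grp" for j
        using v_nz[of j y] False grp(2)[OF that] that by (auto simp: k_def)
      then have "V y = 0" unfolding V_def v_def by (intro sum.neutral) blast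
      then show ?thesis using False by (simp add: e_def)
    qed
    have e01: "\<bar>e y\<bar> \<le> (1::real)" for y by (simp add: e_def)
    define G where "G y = e y * F k y - Vk y" for y
    have Gst: "dyadic_step k G" unfolding G_def by (intro dyadic_step_diff dyadic_step_mult est Fst Vkst)
    \<comment> \<open>G is the average of e (F n - f), and this for every large n; letting n grow
      shows that G vanishes in L_p, so the cut level sum is the averaged group.\<close>
    have GA: "Lp_pow p G \<le> \<rho> ^ n * \<alpha> n" if n: "n \<ge> 2 ^ Suc m" for n
    proof -
      have kn: "k \<le> n"
        using two_mult_le_power[OF m] n by (simp add: k_def)
      define z where "z y = e y * F n y - V y" for y
      have zst: "dyadic_step n z"
        unfolding z_def by (intro dyadic_step_diff dyadic_step_mult dyadic_step_mono[OF est kn] Fst Vst n)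
      have zA: "Lp_pow p z \<le> \<alpha> n"
        unfolding \<alpha>_def
      proof (rule Lp_pow_mono_AE[OF p dyadic_step_Lp(1)[OF zst]])
        show "(\<lambda>x. f x - F n x) \<in> Lp_space p unit_cube" by (intro diff_in_Lp_space(1) p fL dyadic_step_Lp(1)[OF Fst])
        fix y :: "real^'d"
        have "z y = e y * (F n y - f y)" unfolding z_def fe[symmetric] by (simp add: algebra_simps)
        then show "\<bar>z y\<bar> \<le> \<bar>f y - F n y\<bar>"
          using e01[of y] by (simp add: abs_mult mult_left_le_one_le abs_minus_commute)
      qed
      have Gz: "iter_avg k (n - k) z y = G y" if y: "y \<in> half_cube" for y
      proof -
        have "iter_avg k (n - k) (\<lambda>y. e y * F n y) y = e y * F k y"
          using iter_avg_mult_step[OF est y, of "n - k" "F n"] Favg[OF y, of k "n - k"] kn by simp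
        moreover have "iter_avg k (n - k) V y = Vk y"
          unfolding V_def Vk_def iter_avg_sum iter_avg_cmult
        proof (intro sum.cong refl arg_cong2[where f = "(*)"])
          fix j assume j: "j \<in> grp"
          show "iter_avg k (n - k) (bump j (?x j)) y = bump k (?x j) y"
            using grp(3)[OF j] j n by (intro iter_avg_bump_le y) (auto simp: grp_def)
        qed
        ultimately show ?thesis unfolding z_def[abs_def] iter_avg_diff G_def by simp
      qed
      have "dyadic_step (k + (n - k)) z" using zst kn by simp
      then have "Lp_pow p (iter_avg k (n - k) z) \<le> \<sigma> ^ (n - k) * Lp_pow p z" "dyadic_step k (iter_avg k (n - k) z)"
        unfolding \<sigma>_def by (auto intro: Lp_pow_iter_avg_le[OF p] dyadic_step_iter_avg)
      moreover have "Lp_pow p G = Lp_pow p (iter_avg k (n - k) z)"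
        by (rule dyadic_step_cong(2)) (use calculation Gz in auto)
      ultimately have "Lp_pow p G \<le> \<rho> ^ (n - k) * Lp_pow p z" by (simp add: \<sigma>\<rho>)
      also have "\<dots> \<le> \<rho> ^ n * \<alpha> n"
        using zA \<rho> by (intro mult_mono power_increasing) auto
      finally show ?thesis .
    qed
    have "Lp_pow p G \<le> 0" by (rule LIMSEQ_le_const[OF \<alpha>]) (use GA in blast)
    then have G0: "Lp_pow p G = 0" using Lp_pow_nonneg[of p G] by linarith
    have V2: "dyadic_step (2 ^ Suc m) V" by (rule Vst) simp
    define eF where "eF y = e y * F k y" for y
    have eFst: "dyadic_step k eF" unfolding eF_def by (intro dyadic_step_mult est Fst)
    note L = dyadic_step_Lp(1)[OF Gst, of p] dyadic_step_Lp(1)[OF eFst, of p] dyadic_step_Lp(1)[OF V2, of p]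
    have "Lp_pow p Vk = Lp_pow p (\<lambda>y. eF y - G y)" by (simp add: G_def eF_def)
    also have "\<dots> \<le> 2 powr p * (Lp_pow p eF + Lp_pow p G)" by (intro diff_in_Lp_space(2) p L)
    finally have Vk1: "Lp_pow p Vk \<le> 2 powr p * Lp_pow p eF" using G0 by simp
    have "Lp_pow p eF = Lp_pow p (\<lambda>y. (eF y - V y) + V y)" by simp
    also have "\<dots> \<le> 2 powr p * (Lp_pow p (\<lambda>y. eF y - V y) + Lp_pow p V)"
      by (intro add_in_Lp_space(2) diff_in_Lp_space(1) p L)
    also have "Lp_pow p (\<lambda>y. eF y - V y) \<le> \<alpha> k"
      unfolding \<alpha>_def
    proof (rule Lp_pow_mono_AE[OF p diff_in_Lp_space(1)[OF p L(2,3)]])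
      show "(\<lambda>x. f x - F k x) \<in> Lp_space p unit_cube" by (intro diff_in_Lp_space(1) p fL dyadic_step_Lp(1)[OF Fst])
      fix y :: "real^'d"
      have "eF y - V y = e y * (F k y - f y)" unfolding eF_def fe[symmetric] by (simp add: algebra_simps)
      then show "\<bar>eF y - V y\<bar> \<le> \<bar>f y - F k y\<bar>"
        using e01[of y] by (simp add: abs_mult mult_left_le_one_le abs_minus_commute)
    qed
    \<comment> \<open>Every bump of the group has level at least 2^m, far beyond 2m, so the group
      itself is negligible before averaging.\<close>
    also have "Lp_pow p V \<le> 1 / \<rho> ^ (2 ^ m)"
    proof -
      have "Lp_pow p V \<le> (\<Sum>j\<in>grp. 1 * Lp_pow p (\<lambda>y. \<beta> j * bump j (?x j) y))"
        unfolding V_def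
      proof (rule sum_in_Lp_space(2)[OF p])
        show "(\<lambda>y. \<beta> j * bump j (?x j) y) \<in> Lp_space p unit_cube" for j
          by (rule dyadic_step_Lp(1)) (rule dyadic_step_cmult[OF dyadic_step_bump])
        show "\<bar>\<Sum>j\<in>grp. a j\<bar> powr p \<le> (\<Sum>j\<in>grp. 1 * \<bar>a j\<bar> powr p)" for a :: "nat \<Rightarrow> real"
          using powr_sum_le[OF p, of grp a] p1 by (simp add: grp_def)
      qed (simp add: grp_def)
      also have "\<dots> \<le> (\<Sum>j\<in>grp. 1 / 2 ^ m * (1 / \<rho> ^ (2 ^ m)))"
      proof (rule sum_mono)
        fix j assume j: "j \<in> grp"
        have "Lp_pow p (\<lambda>y. \<beta> j * bump j (?x j) y) = (1 / real j) * (1 / \<rho> ^ j)"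
          using scale_in_Lp_space(2)[OF p dyadic_step_Lp(1)[OF dyadic_step_bump], of "\<beta> j" j "?x j"] \<beta>p[OF grp(1)[OF j]]
            Ab[OF octave_point_in_half, of j j] by simp
        also have "\<dots> \<le> 1 / 2 ^ m * (1 / \<rho> ^ (2 ^ m))"
        proof (intro mult_mono divide_left_mono power_increasing)
          have "real (2 ^ m) \<le> real j" using j by (simp only: of_nat_le_iff grp_def atLeastLessThan_iff)
          then show "2 ^ m \<le> real j" by simp
        qed (use \<rho> j grp(1)[OF j] in \<open>auto simp: grp_def\<close>)
        finally show "1 * Lp_pow p (\<lambda>y. \<beta> j * bump j (?x j) y) \<le> 1 / 2 ^ m * (1 / \<rho> ^ (2 ^ m))" by simp
      qed
      also have "\<dots> = 1 / \<rho> ^ (2 ^ m)" by (simp add: grp_def)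
      finally show ?thesis .
    qed
    finally have eF: "Lp_pow p eF \<le> 2 powr p * (\<alpha> k + 1 / \<rho> ^ (2 ^ m))" by simp
    \<comment> \<open>At level 2m the averaged bumps still sit in distinct cells, so their p-th
      powers add; 2^m terms of size at least 2^(-m-1) give 1/2.\<close>
    have low: "1 / 2 * (1 / \<rho> ^ k) \<le> Lp_pow p Vk"
    proof -
      define g where "g j = (\<lambda>_ :: 'd. int j)" for j
      have inj: "inj_on g grp" by (auto simp: inj_on_def g_def fun_eq_iff)
      have gk: "g j \<in> grid k" if "j \<in> grp" for j
      proof -
        have "cell k (?x j) \<in> grid k" by (rule cell_in[OF octave_point_in_half])
        then show ?thesis using grp(4)[OF that] by (simp add: g_def)
      qed
      have val: "Vk (grid_point k (g j)) = \<beta> j * (2 ^ k) ^ CARD('d)" if j: "j \<in> grp" for j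
      proof -
        have "Vk (grid_point k (g j)) = (\<Sum>i\<in>grp. if i = j then \<beta> j * (2 ^ k) ^ CARD('d) else 0)"
          unfolding Vk_def bump_def using grp(4)
          by (intro sum.cong refl) (auto simp: g_def fun_eq_iff)
        then show ?thesis using j by (simp add: grp_def)
      qed
      have one: "((2 ^ k) ^ CARD('d)) powr p / (2 ^ k) ^ CARD('d) = 1 / \<rho> ^ k"
        using bump_normalisation[OF p p1, of k, where 'd = 'd] by (simp add: \<sigma>_def[symmetric] \<sigma>\<rho>)
      have "1 / 2 \<le> (\<Sum>j\<in>grp. 1 / real j)"
      proof -
        have "(\<Sum>j\<in>grp. 1 / 2 ^ Suc m) \<le> (\<Sum>j\<in>grp. 1 / real j)"
        proof (intro sum_mono divide_left_mono)
          fix j assume j: "j \<in> grp"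
          then have "real j \<le> real (2 ^ Suc m)" by (simp only: of_nat_le_iff grp_def atLeastLessThan_iff less_imp_le)
          then show "real j \<le> 2 ^ Suc m" by simp
          show "0 < 2 ^ Suc m * real j" using grp(1)[OF j] by simp
        qed auto
        moreover have "(\<Sum>j\<in>grp. 1 / 2 ^ Suc m) = (1 / 2 :: real)" by (simp add: grp_def)
        ultimately show ?thesis by linarith
      qed
      then have "1 / 2 * (1 / \<rho> ^ k) \<le> (\<Sum>j\<in>grp. 1 / real j) * (1 / \<rho> ^ k)" using \<rho> by (intro mult_right_mono) auto
      also have "\<dots> = (\<Sum>j\<in>grp. \<bar>Vk (grid_point k (g j))\<bar> powr p) / (2 ^ k) ^ CARD('d)"
      proof -
        have "\<bar>Vk (grid_point k (g j))\<bar> powr p = (1 / real j) * ((2 ^ k) ^ CARD('d)) powr p" if "j \<in> grp" for j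
          unfolding val[OF that] using \<beta>p[OF grp(1)[OF that]] by (simp add: abs_mult powr_mult)
        then have "(\<Sum>j\<in>grp. \<bar>Vk (grid_point k (g j))\<bar> powr p) = (\<Sum>j\<in>grp. 1 / real j) * ((2 ^ k) ^ CARD('d)) powr p"
          by (simp add: sum_distrib_right)
        then show ?thesis unfolding one[symmetric] by simp
      qed
      also have "(\<Sum>j\<in>grp. \<bar>Vk (grid_point k (g j))\<bar> powr p) = (\<Sum>a\<in>g ` grp. \<bar>Vk (grid_point k a)\<bar> powr p)"
        using sum.reindex[OF inj, of "\<lambda>a. \<bar>Vk (grid_point k a)\<bar> powr p"] by (simp add: o_def)
      also have "\<dots> / (2 ^ k) ^ CARD('d) \<le> Lp_pow p Vk"
        unfolding dyadic_step_Lp(2)[OF Vkst] using gk by (intro divide_right_mono sum_mono2) auto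
      finally show ?thesis .
    qed
    have "1 / 2 = \<rho> ^ k * (1 / 2 * (1 / \<rho> ^ k))" using \<rho> by simp
    also have "\<dots> \<le> \<rho> ^ k * (2 powr p * (2 powr p * (\<alpha> k + 1 / \<rho> ^ (2 ^ m))))"
    proof (rule mult_left_mono)
      have "Lp_pow p Vk \<le> 2 powr p * (2 powr p * (\<alpha> k + 1 / \<rho> ^ (2 ^ m)))"
        by (rule order_trans[OF Vk1 mult_left_mono[OF eF]]) simp
      then show "1 / 2 * (1 / \<rho> ^ k) \<le> 2 powr p * (2 powr p * (\<alpha> k + 1 / \<rho> ^ (2 ^ m)))" using low by linarith
    qed (use \<rho> in simp)
    finally show ?thesis by (simp add: k_def algebra_simps)
  qed
  have "(\<lambda>m. \<rho> ^ (2 * m) * \<alpha> (2 * m)) \<longlonglongrightarrow> 0"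
    using LIMSEQ_subseq_LIMSEQ[OF \<alpha>, of "\<lambda>m. 2 * m"] by (simp add: o_def strict_mono_def)
  moreover have "(\<lambda>m. \<rho> ^ (2 * m) / \<rho> ^ (2 ^ m)) \<longlonglongrightarrow> 0"
  proof (rule Lim_null_comparison)
    show "(\<lambda>m. (1 / \<rho>) ^ m) \<longlonglongrightarrow> 0" using \<rho> by (intro LIMSEQ_power_zero) auto
    show "\<forall>\<^sub>F m in sequentially. norm (\<rho> ^ (2 * m) / \<rho> ^ (2 ^ m)) \<le> (1 / \<rho>) ^ m"
      using eventually_ge_at_top[of 4]
    proof eventually_elim
      case (elim m)
      have "\<rho> ^ (2 * m) * \<rho> ^ m = \<rho> ^ (3 * m)" by (simp flip: power_add)
      also have "\<dots> \<le> \<rho> ^ (2 ^ m)" using \<rho> three_mult_le_power[OF elim] by (intro power_increasing) auto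
      finally show ?case using \<rho> by (simp add: power_divide field_simps)
    qed
  qed
  ultimately have "(\<lambda>m. (2 powr p * 2 powr p) * (\<rho> ^ (2 * m) * \<alpha> (2 * m) + \<rho> ^ (2 * m) / \<rho> ^ (2 ^ m))) \<longlonglongrightarrow>
      (2 powr p * 2 powr p) * (0 + 0)"
    by (intro tendsto_mult tendsto_add tendsto_const)
  then have "1 / 2 \<le> (2 powr p * 2 powr p) * (0 + 0 :: real)"
    by (rule LIMSEQ_le_const) (use main in blast)
  then show False by simp
qed

end

section \<open>Loss of unconditionality in the limiting case\<close>

lemma bump_zero_vanishes:
  fixes y :: "real^'d"
  assumes "y \<in> half_cube" "y \<noteq> 0"
  shows "\<exists>J. \<forall>j\<ge>J. bump j 0 y = 0"
proof -
  obtain l where "y $ l \<noteq> 0" using assms(2) by (auto simp: vec_eq_iff)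
  moreover have "0 \<le> y $ l" using assms(1) by (auto simp: half_cube_def)
  ultimately have l: "0 < y $ l" by simp
  obtain J where J: "1 / y $ l < 2 ^ J" using real_arch_pow[of 2 "1 / y $ l"] by auto
  have "bump j 0 y = 0" if "j \<ge> J" for j
  proof -
    have "1 / y $ l < 2 ^ j" using J power_increasing[OF that, of "2::real"] by linarith
    then have "1 < 2 ^ j * y $ l" using l by (simp add: field_simps)
    then have "cell j y l \<noteq> 0" by (simp add: cell_def floor_eq_iff)
    moreover have "cell j (0 :: real^'d) l = 0" by (simp add: cell_def)
    ultimately have "cell j y \<noteq> cell j 0" by metis
    then show ?thesis by (simp add: bump_def)
  qed
  then show ?thesis by blast
qed

text \<open>The sequence k^(-1/q) just fails to be in l_q, while by the mean value theorem its
  decrements are of order k^(-1/q-1), whose q-th powers are summable.\<close>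

lemma powr_decrement_summable:
  assumes q: "0 < q"
  defines "\<beta> \<equiv> \<lambda>k. real (Suc k) powr (- 1 / q) - real (Suc (Suc k)) powr (- 1 / q)"
  shows "\<bar>\<beta> k\<bar> \<le> 1" "summable (\<lambda>k. \<bar>\<beta> k\<bar> powr q)"
proof -
  have b0: "0 \<le> \<beta> k" for k unfolding \<beta>_def using powr_mono2'[of "- 1 / q" "real (Suc k)" "real (Suc (Suc k))"] q by simp
  have "real (Suc k) powr (- 1 / q) \<le> 1 powr (- 1 / q)" using q by (intro powr_mono2') auto
  moreover have "0 \<le> real (Suc (Suc k)) powr (- 1 / q)" by simp
  ultimately show "\<bar>\<beta> k\<bar> \<le> 1" using b0[of k] unfolding \<beta>_def powr_one_eq_one by linarith
  show "summable (\<lambda>k. \<bar>\<beta> k\<bar> powr q)"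
  proof (rule summable_comparison_test'[of "\<lambda>k. (1 / q) powr q * real (Suc k) powr (- 1 - q)" 0])
    have "summable (\<lambda>k. real k powr (- 1 - q))" using q by (simp add: summable_real_powr_iff)
    then show "summable (\<lambda>k. (1 / q) powr q * real (Suc k) powr (- 1 - q))"
      by (intro summable_mult) (simp add: summable_Suc_iff[of "\<lambda>k. real k powr (- 1 - q)"] del: of_nat_Suc)
    fix k
    have "\<exists>z>real (Suc k). z < real (Suc (Suc k)) \<and>
        real (Suc (Suc k)) powr (- 1 / q) - real (Suc k) powr (- 1 / q) =
        (real (Suc (Suc k)) - real (Suc k)) * (- 1 / q * z powr (- 1 / q - 1))"
      by (rule MVT2) (auto intro!: derivative_eq_intros)
    then obtain z where z: "z > real (Suc k)" "\<beta> k = 1 / q * z powr (- 1 / q - 1)"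
      by (auto simp: \<beta>_def algebra_simps)
    have "\<beta> k \<le> 1 / q * real (Suc k) powr (- 1 / q - 1)"
      unfolding z(2) using z(1) q order_trans[of "- 1" 0 "1 / q"] by (intro mult_left_mono powr_mono2') auto
    then have "\<bar>\<beta> k\<bar> powr q \<le> (1 / q * real (Suc k) powr (- 1 / q - 1)) powr q"
      using b0[of k] q by (intro powr_mono2) auto
    also have "\<dots> = (1 / q) powr q * real (Suc k) powr ((- 1 / q - 1) * q)"
      using q by (simp only: powr_mult powr_powr)
    also have "(- 1 / q - 1) * q = - 1 - q" using q by (simp add: field_simps)
    finally show "norm (\<bar>\<beta> k\<bar> powr q) \<le> (1 / q) powr q * real (Suc k) powr (- 1 - q)" by simp
  qed
qed

lemma powr_diff_le:
  fixes x y :: real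
  assumes "0 < p" "p \<le> 1"
  shows "\<bar>x - y\<bar> powr p \<le> \<bar>x\<bar> powr p + \<bar>y\<bar> powr p"
proof -
  have "\<bar>x - y\<bar> powr p \<le> (\<bar>x\<bar> + \<bar>y\<bar>) powr p" using assms by (intro powr_mono2) auto
  also have "\<dots> \<le> \<bar>x\<bar> powr p + \<bar>y\<bar> powr p"
    using powr_sum_le[OF assms, of "UNIV :: bool set" "\<lambda>b. if b then \<bar>x\<bar> else \<bar>y\<bar>"] by (simp add: UNIV_bool add.commute)
  finally show ?thesis .
qed

text \<open>There are 6 * 4^n even numbers in the block, each contributing at least 1 / (16 *
  4^n).\<close>

lemma even_block:
  fixes n :: nat
  defines "J \<equiv> {j. even j \<and> 4 ^ Suc n \<le> j \<and> j < 4 ^ Suc (Suc n)}"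
  shows "finite J" "3 / 8 \<le> (\<Sum>j\<in>J. 1 / real (Suc j))"
proof -
  have J: "J = (\<lambda>l. 2 * l) ` {2 * 4 ^ n..<8 * 4 ^ n}"
    by (auto simp: J_def elim!: evenE)
  then show fin: "finite J" by simp
  have "card J = card {2 * 4 ^ n..<8 * (4::nat) ^ n}" unfolding J by (rule card_image) (simp add: inj_on_def)
  then have c: "card J = 6 * 4 ^ n" by simp
  have "(\<Sum>j\<in>J. 1 / (16 * 4 ^ n)) \<le> (\<Sum>j\<in>J. 1 / real (Suc j))"
  proof (intro sum_mono divide_left_mono)
    fix j assume "j \<in> J"
    then have "Suc j \<le> 16 * 4 ^ n" by (simp add: J_def)
    then have "real (Suc j) \<le> real (16 * 4 ^ n)" by (simp only: of_nat_le_iff)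
    then show "real (Suc j) \<le> 16 * 4 ^ n" by simp
  qed auto
  then show "3 / 8 \<le> (\<Sum>j\<in>J. 1 / real (Suc j))" by (simp add: c)
qed

context haar_enum
begin

text \<open>The cells (1,...,1) and (2,...,2) of level k + 1 share their cell of level k - 1, so u
  has equal values there, but only the former lies in the cell of level k at 0. The difference of g
  across them is therefore exactly that of the k-th bump.\<close>

lemma oscillation_lower:
  assumes p1: "p < 1" and \<sigma>\<rho>: "\<sigma> = \<rho>" and J: "finite J" "\<And>j. j \<in> J \<Longrightarrow> even j \<and> 0 < j" and kJ: "k \<in> J"
    and u: "dyadic_step (k - 1) u" and g: "g \<in> Lp_space p unit_cube"
    and gy: "\<And>y. y \<in> half_cube \<Longrightarrow> g y = (\<Sum>j\<in>J. a j * (bump j (0::real^'d) y - bump (j - 1) 0 y))"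
  shows "\<bar>a k\<bar> powr p / (\<rho> * 2 ^ CARD('d)) \<le> \<rho> ^ (k - 1) * Lp_pow p (\<lambda>x. g x - u x)"
proof -
  have k: "even k" "0 < k" using J kJ by auto
  define N where "N = Suc k"
  define e :: "real^'d \<Rightarrow> real" where "e y = of_bool (\<exists>b\<in>{1, 2}. cell N y = (\<lambda>_. b))" for y
  have est: "dyadic_step N e" unfolding e_def by (rule dyadic_step_cell)
  define T where "T y = (\<Sum>j\<in>{j \<in> J. j \<le> k}. a j * (bump j (0::real^'d) y - bump (j - 1) 0 y))" for y
  define w where "w y = e y * (T y - u y)" for y
  have wst: "dyadic_step N w"
    unfolding w_def T_def
    by (intro dyadic_step_mult est dyadic_step_diff dyadic_step_sum dyadic_step_cmult dyadic_step_mono[OF u] dyadic_step_mono[OF dyadic_step_bump])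
      (auto simp: N_def)
  have cell_low: "cell j y = (\<lambda>_. b div 2 ^ (N - j))" if "cell N y = (\<lambda>_. b)" "j \<le> N" for j b and y :: "real^'d"
    using cell_div[OF that(2), of y] that(1) by (simp add: fun_eq_iff)
  have cell0: "cell j (0 :: real^'d) = (\<lambda>_. 0)" for j by (simp add: cell_def[abs_def])
  have cut: "e y * g y = e y * T y" if y: "y \<in> half_cube" for y
  proof (cases "\<exists>b\<in>{1, 2}. cell N y = (\<lambda>_. b)")
    case True
    then obtain b where b: "b = 1 \<or> b = 2" "cell N y = (\<lambda>_. b)" by blast
    have nz: "bump j 0 y = 0" if "N \<le> j" for j
    proof -
      have "cell j y \<noteq> cell j 0"
      proof
        assume "cell j y = cell j 0"
        then have "cell N y = cell N 0" by (rule cell_mono[OF that])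
        then show False using b by (auto simp: cell0 fun_eq_iff)
      qed
      then show ?thesis by (simp add: bump_def)
    qed
    have "g y = T y"
      unfolding gy[OF y] T_def
    proof (rule sum.mono_neutral_right)
      show "\<forall>j\<in>J - {j \<in> J. j \<le> k}. a j * (bump j 0 y - bump (j - 1) 0 y) = 0"
      proof
        fix j assume j: "j \<in> J - {j \<in> J. j \<le> k}"
        then have "even j" "k < j" using J by auto
        \<comment> \<open>Evenness leaves a gap: even the subtracted bump of level j - 1 is of level
          at least k + 1 and vanishes on both probe cells.\<close>
        then have "Suc (Suc k) \<le> j" using k by (metis Suc_leI le_neq_implies_less even_Suc)
        then show "a j * (bump j 0 y - bump (j - 1) 0 y) = 0" using nz by (simp add: N_def)
      qed
    qed (use J in auto)
    then show ?thesis by simp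
  qed (simp add: e_def)
  define y where "y b = (grid_point N (\<lambda>_. b) :: real^'d)" for b :: int
  have "(2::int) ^ 1 < 2 ^ N" unfolding N_def using k by (intro power_strict_increasing) auto
  then have gr: "(\<lambda>_ :: 'd. 1) \<in> grid N" "(\<lambda>_ :: 'd. 2) \<in> grid N" by (auto simp: grid_def)
  have yh: "y 1 \<in> half_cube" "y 2 \<in> half_cube" unfolding y_def by (intro grid_point_in gr)+
  have cy: "cell N (y b) = (\<lambda>_. b)" for b by (simp add: y_def)
  have low: "cell j (y 1) = (\<lambda>_. 0)" "cell j (y 2) = (\<lambda>_. 0)" if "j < k" for j
  proof -
    have "(2::int) ^ 2 \<le> 2 ^ (N - j)" using that by (intro power_increasing) (auto simp: N_def)
    then show "cell j (y 1) = (\<lambda>_. 0)" "cell j (y 2) = (\<lambda>_. 0)"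
      using that by (simp_all add: cell_low[OF cy] N_def)
  qed
  have kk: "cell k (y 1) = (\<lambda>_. 0)" "cell k (y 2) = (\<lambda>_. 1)" by (simp_all add: cell_low[OF cy] N_def)
  have uy: "u (y 1) = u (y 2)" by (rule dyadic_stepD[OF u yh]) (use k in \<open>simp add: low\<close>)
  have "T (y 1) - T (y 2) = (\<Sum>j\<in>{j \<in> J. j \<le> k}. a j * ((bump j 0 (y 1) - bump j 0 (y 2)) - (bump (j - 1) 0 (y 1) - bump (j - 1) 0 (y 2))))"
    unfolding T_def by (simp add: sum_subtractf[symmetric] algebra_simps)
  also have "\<dots> = (\<Sum>j\<in>{j \<in> J. j \<le> k}. if j = k then a k * (2 ^ k) ^ CARD('d) else 0)"
  proof (intro sum.cong refl)
    fix j assume j: "j \<in> {j \<in> J. j \<le> k}"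
    have "j - 1 < k" using j J(2)[of j] by auto
    then have "bump (j - 1) 0 (y 1) - bump (j - 1) 0 (y 2) = 0"
      using low[of "j - 1"] by (simp add: bump_def cell0)
    moreover have "bump j 0 (y 1) - bump j 0 (y 2) = (if j = k then (2 ^ k) ^ CARD('d) else 0)"
      using j low[of j] kk by (auto simp: bump_def cell0 fun_eq_iff)
    ultimately show "a j * ((bump j 0 (y 1) - bump j 0 (y 2)) - (bump (j - 1) 0 (y 1) - bump (j - 1) 0 (y 2))) = (if j = k then a k * (2 ^ k) ^ CARD('d) else 0)"
      by simp
  qed
  also have "\<dots> = a k * (2 ^ k) ^ CARD('d)" using J kJ by simp
  finally have Ty: "T (y 1) - T (y 2) = a k * (2 ^ k) ^ CARD('d)" .
  have ey: "e (y 1) = 1" "e (y 2) = 1" by (auto simp: e_def cy)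
  have wy: "w (y 1) - w (y 2) = a k * (2 ^ k) ^ CARD('d)" using Ty by (simp add: w_def ey uy)
  have X: "((2 ^ k) ^ CARD('d)) powr p / (2 ^ k) ^ CARD('d) = 1 / \<rho> ^ k"
    using bump_normalisation[OF p p1, of k, where 'd = 'd] by (simp add: \<sigma>_def[symmetric] \<sigma>\<rho>)
  have "(\<bar>a k\<bar> powr p * ((2 ^ k) ^ CARD('d)) powr p) / (2 ^ N) ^ CARD('d)
      = \<bar>a k\<bar> powr p / 2 ^ CARD('d) * (((2 ^ k) ^ CARD('d)) powr p / (2 ^ k) ^ CARD('d))"
    by (simp add: N_def power_mult_distrib)
  moreover have "\<rho> ^ k = \<rho> * \<rho> ^ (k - 1)" using k by (simp add: power_eq_if)
  ultimately have "\<bar>a k\<bar> powr p / (\<rho> * 2 ^ CARD('d)) = \<rho> ^ (k - 1) * ((\<bar>a k\<bar> powr p * ((2 ^ k) ^ CARD('d)) powr p) / (2 ^ N) ^ CARD('d))"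
    unfolding X using \<rho> by simp
  also have "\<dots> \<le> \<rho> ^ (k - 1) * Lp_pow p w"
  proof (rule mult_left_mono)
    \<comment> \<open>Although w itself is unknown, its difference over the two cells is not, so one
      of its two values must be large.\<close>
    have "\<bar>a k\<bar> powr p * ((2 ^ k) ^ CARD('d)) powr p = \<bar>w (y 1) - w (y 2)\<bar> powr p"
      unfolding wy by (simp add: abs_mult powr_mult)
    also have "\<dots> \<le> \<bar>w (y 1)\<bar> powr p + \<bar>w (y 2)\<bar> powr p" using p p1 by (intro powr_diff_le) auto
    also have "\<dots> = (\<Sum>b\<in>{\<lambda>_. 1, \<lambda>_. 2}. \<bar>w (grid_point N b)\<bar> powr p)" by (simp add: y_def fun_eq_iff)
    also have "\<dots> \<le> (\<Sum>b\<in>grid N. \<bar>w (grid_point N b)\<bar> powr p)" using gr by (intro sum_mono2) auto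
    finally show "\<bar>a k\<bar> powr p * ((2 ^ k) ^ CARD('d)) powr p / (2 ^ N) ^ CARD('d) \<le> Lp_pow p w"
      unfolding dyadic_step_Lp(2)[OF wst] by (intro divide_right_mono) auto
  qed (use \<rho> in simp)
  also have "\<dots> \<le> \<rho> ^ (k - 1) * Lp_pow p (\<lambda>x. g x - u x)"
  proof (rule mult_left_mono)
    show "Lp_pow p w \<le> Lp_pow p (\<lambda>x. g x - u x)"
    proof (rule Lp_pow_mono_AE[OF p dyadic_step_Lp(1)[OF wst]])
      show "(\<lambda>x. g x - u x) \<in> Lp_space p unit_cube" by (intro diff_in_Lp_space(1) p g dyadic_step_Lp(1)[OF u])
      fix x :: "real^'d" assume "x \<in> half_cube"
      then have "w x = e x * (g x - u x)" using cut[of x] by (simp only: w_def right_diff_distrib)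
      then show "\<bar>w x\<bar> \<le> \<bar>g x - u x\<bar>" by (simp add: e_def)
    qed
  qed (use \<rho> in simp)
  finally show ?thesis .
qed

text \<open>The amplitudes a_k satisfy a_k^q = 1/(k+1). Summation by parts replaces them by their
  decrements, so the series converges in level order. Restricted to even levels nothing telescopes,
  and each block of levels from 4^i to 4^(i+1) keeps a norm bounded below.\<close>

theorem not_unconditional_limiting:
  assumes p1: "p < 1" and \<sigma>\<rho>: "\<sigma> = \<rho>" and qp: "q \<le> p"
  shows "\<not> unconditional_schauder_basis (besov_space p q s) (besov_norm p q s) h"
proof
  assume unc: "unconditional_schauder_basis (besov_space p q s) (besov_norm p q s) h"
  obtain K where K: "K \<ge> 1" "\<And>f g :: real^'d \<Rightarrow> real. f \<in> besov_space p q s \<Longrightarrow> g \<in> besov_space p q s \<Longrightarrow>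
     (\<lambda>x. f x + g x) \<in> besov_space p q s \<and> besov_pow p q s (\<lambda>x. f x + g x) \<le> K * (besov_pow p q s f + besov_pow p q s g)"
    using besov_pow_add[OF p q s, where 'd = 'd] by blast
  obtain C4 where C4: "C4 > 0" "\<And>k (u :: real^'d \<Rightarrow> real). dyadic_step k u \<Longrightarrow>
     u \<in> besov_space p q s \<and> besov_pow p q s u \<le> C4 * (\<rho> ^ k * Lp_pow p u) powr r"
    using besov_dyadic_step by blast
  obtain C0 where C0: "C0 > 0" "\<forall>f \<in> besov_space p q s :: (real^'d \<Rightarrow> real) set. \<exists>u. (\<forall>k. dyadic_step k (u k)) \<and>
     summable (\<lambda>k. (\<rho> ^ k * Lp_pow p (\<lambda>x. f x - u k x)) powr r) \<and>
     (\<Sum>k. (\<rho> ^ k * Lp_pow p (\<lambda>x. f x - u k x)) powr r) \<le> C0 * besov_pow p q s f"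
    using besov_approx_lower[where 'd = 'd] by (elim exE conjE) (rule that)
  obtain \<gamma> where \<gamma>: "\<And>m. lev m = 0 \<Longrightarrow> \<gamma> m = 1"
    "\<And>k x. x \<in> half_cube \<Longrightarrow> lincomb {m. lev m = Suc k} \<gamma> h x = bump (Suc k) 0 x - bump k 0 x"
    using delta_coefficients by blast
  define a where "a k = real (Suc k) powr (- 1 / q)" for k
  have a0: "0 \<le> a k" for k by (simp add: a_def)
  have aq: "a k powr q = 1 / real (Suc k)" for k
    using q by (simp add: a_def powr_powr powr_minus_divide powr_divide)
  have apr: "(a k powr p) powr r = 1 / real (Suc k)" for k
  proof -
    have "(a k powr p) powr r = a k powr q" using p by (simp add: powr_powr r_def)
    then show ?thesis by (simp add: aq)
  qed
  define \<beta> where "\<beta> k = a k - a (Suc k)" for k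
  have \<beta>: "\<bar>\<beta> k\<bar> \<le> 1" "summable (\<lambda>k. \<bar>\<beta> k\<bar> powr q)" for k
    using powr_decrement_summable[OF q] by (simp_all only: \<beta>_def a_def)
  define f where "f y = (\<Sum>j. \<beta> j * bump j (0 :: real^'d) y)" for y
  have fin: "\<exists>J. \<forall>j\<ge>J. \<beta> j * bump j 0 y = 0" if "y \<in> half_cube" "y \<noteq> 0" for y :: "real^'d"
    using bump_zero_vanishes[OF that] by auto
  note series = bump_series[OF p1 \<sigma>\<rho> zero_in_half \<beta> fin, folded f_def]
  note fB = series(1)
  define c where "c m = a (lev m) * \<gamma> m" for m
  have c_level: "lincomb {m. lev m = Suc k} c h x = a (Suc k) * (bump (Suc k) 0 x - bump k 0 x)" if "x \<in> half_cube" for k x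
    unfolding \<gamma>(2)[OF that, symmetric] lincomb_def c_def by (simp add: sum_distrib_left mult_ac)
  \<comment> \<open>Summation by parts: beside the series with decremented amplitudes only one bump
    with amplitude a k remains, and its norm tends to 0.\<close>
  have F: "lincomb (low UNIV k) c h x = a k * bump k 0 x + (\<Sum>i<k. \<beta> i * bump i 0 x)" if x: "x \<in> half_cube" for k x
  proof (induction k)
    case 0
    have "c m = a 0" if "lev m = 0" for m using that \<gamma>(1) by (simp add: c_def)
    then show ?case using lincomb_level_zero[OF _ x, of c "a 0"] by simp
  next
    case (Suc k)
    then show ?case unfolding lincomb_low_UNIV_Suc c_level[OF x] by (simp add: \<beta>_def algebra_simps)
  qed
  have finL: "finite (low UNIV k)" for k unfolding low_UNIV by (rule finite_lev_le)
  have nB: "(\<lambda>x. f x - lincomb M d h x) \<in> besov_space p q s" if "finite M" for M d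
    using besov_in_add[OF fB besov_pow_scale(1)[OF p q s lincomb_besov[OF that, of d], where a = "- 1"]] by simp
  have Ab: "Lp_pow p (bump k (0 :: real^'d)) = 1 / \<rho> ^ k" for k
    unfolding \<sigma>\<rho>[symmetric] \<sigma>_def by (rule Lp_pow_bump[OF p p1 zero_in_half])
  have lim_low: "(\<lambda>k. besov_pow p q s (\<lambda>x. f x - lincomb (low UNIV k) c h x)) \<longlonglongrightarrow> 0"
  proof -
    define w where "w k x = (\<Sum>i<k. \<beta> i * bump i 0 x) - lincomb (low UNIV k) c h x" for k x
    have st: "dyadic_step k (\<lambda>x :: real^'d. \<Sum>i<k. \<beta> i * bump i 0 x)" for k
      by (intro dyadic_step_sum dyadic_step_cmult dyadic_step_mono[OF dyadic_step_bump]) auto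
    have wst: "dyadic_step k (w k)" for k unfolding w_def by (intro dyadic_step_diff lincomb_low_step st)
    have w: "besov_pow p q s (w k) \<le> C4 * (1 / real (Suc k))" for k
    proof -
      have "Lp_pow p (w k) = Lp_pow p (\<lambda>x. - a k * bump k (0 :: real^'d) x)"
        by (rule dyadic_step_cong(2)[OF dyadic_step_cmult[OF dyadic_step_bump]]) (simp add: w_def F)
      also have "\<dots> = a k powr p * (1 / \<rho> ^ k)"
        using scale_in_Lp_space(2)[OF p dyadic_step_Lp(1)[OF dyadic_step_bump], of "- a k" k "0 :: real^'d"]
          Ab[of k] a0 by simp
      finally have "\<rho> ^ k * Lp_pow p (w k) = a k powr p" using \<rho> by simp
      then show ?thesis using C4(2)[OF wst[of k]] apr by simp
    qed
    define R where "R k x = f x - (\<Sum>i<k. \<beta> i * bump i 0 x)" for k x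
    have RB: "R k \<in> besov_space p q s" for k
      using besov_in_add[OF fB besov_pow_scale(1)[OF p q s conjunct1[OF C4(2)[OF st[of k]]], where a = "- 1"]]
      by (simp add: R_def[abs_def])
    have Rlim: "(\<lambda>k. besov_pow p q s (R k)) \<longlonglongrightarrow> 0" using series(2) by (simp add: R_def[abs_def])
    have le: "besov_pow p q s (\<lambda>x. f x - lincomb (low UNIV k) c h x) \<le> K * (besov_pow p q s (R k) + C4 * (1 / real (Suc k)))" for k
    proof -
      have "(\<lambda>x. f x - lincomb (low UNIV k) c h x) = (\<lambda>x. R k x + w k x)" by (simp add: R_def w_def)
      then have "besov_pow p q s (\<lambda>x. f x - lincomb (low UNIV k) c h x) \<le> K * (besov_pow p q s (R k) + besov_pow p q s (w k))"
        using K(2)[OF RB conjunct1[OF C4(2)[OF wst]], of k k] by simp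
      also have "\<dots> \<le> K * (besov_pow p q s (R k) + C4 * (1 / real (Suc k)))" using w K by (intro mult_left_mono add_left_mono) auto
      finally show ?thesis .
    qed
    have "(\<lambda>k. K * (besov_pow p q s (R k) + C4 * (1 / real (Suc k)))) \<longlonglongrightarrow> K * (0 + C4 * 0)"
      by (intro tendsto_mult tendsto_add tendsto_const Rlim LIMSEQ_inverse_real_of_nat[unfolded inverse_eq_divide])
    then have U: "(\<lambda>k. K * (besov_pow p q s (R k) + C4 * (1 / real (Suc k)))) \<longlonglongrightarrow> 0" by simp
    show ?thesis
      by (rule tendsto_sandwich[OF _ _ tendsto_const U]) (intro always_eventually allI le besov_pow_nonneg[OF p q s nB[OF finL]])+
  qed
  \<comment> \<open>Blocks of levels bounded by powers of 4, so that each carries a fixed share of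
    the harmonic series; the exception at i = 0 makes the first block start at index 0.\<close>
  define S where "S i = start (if i = 0 then 0 else 4 ^ i)" for i
  have S: "strict_mono S"
    unfolding strict_mono_Suc_iff S_def using start_strict_mono by (auto simp: strict_mono_less)
  have S0: "S 0 = 0"
  proof -
    have "{..<start 0} = {}" unfolding start_eq by simp
    then have "start 0 = 0" by (metis bot_nat_0.not_eq_extremum empty_iff lessThan_iff)
    then show ?thesis by (simp add: S_def)
  qed
  define P where "P = {m. even (lev m)}"
  obtain \<pi> :: "nat \<Rightarrow> nat" where \<pi>: "bij \<pi>" "\<And>i. \<exists>t. \<pi> ` {..<t} = {..<S i}"
    "\<And>i. \<exists>t. \<pi> ` {..<t} = {..<S i} \<union> (P \<inter> {S i..<S (Suc i)})"
    using rearrangement[OF S S0, of P] by blast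
  obtain t0 where t0: "\<And>i. \<pi> ` {..<t0 i} = {..<S i}" using \<pi>(2) by metis
  obtain t1 where t1: "\<And>i. \<pi> ` {..<t1 i} = {..<S i} \<union> (P \<inter> {S i..<S (Suc i)})" using \<pi>(3) by metis
  have inj\<pi>: "inj_on \<pi> A" for A using \<pi>(1) by (meson bij_is_inj inj_on_subset subset_UNIV)
  have t_ge: "i \<le> t" if "{..<S i} \<subseteq> \<pi> ` {..<t}" for i t
  proof -
    have "i \<le> S i" by (rule strict_mono_imp_increasing[OF S])
    also have "\<dots> \<le> card (\<pi> ` {..<t})" using card_mono[OF _ that] by simp
    also have "\<dots> = t" using card_image[OF inj\<pi>, of "{..<t}"] by simp
    finally show ?thesis .
  qed
  have t_lim: "filterlim t0 at_top sequentially" "filterlim t1 at_top sequentially"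
    by (auto intro!: filterlim_at_top_mono[OF filterlim_ident] always_eventually t_ge simp: t0 t1)
  have "schauder_basis (besov_space p q s) (besov_norm p q s) (h \<circ> \<pi>)"
    using unc \<pi>(1) unfolding unconditional_schauder_basis_def by blast
  then obtain c' where c': "series_converges_to (besov_norm p q s) (h \<circ> \<pi>) c' f"
    using fB unfolding schauder_basis_def by blast
  define d where "d = c' \<circ> inv \<pi>"
  have "(\<lambda>n. besov_norm p q s (\<lambda>x. f x - lincomb (\<pi> ` {..<n}) d h x)) \<longlonglongrightarrow> 0"
    using c' unfolding series_converges_to_def lincomb_def[symmetric] lincomb_comp[OF \<pi>(1)] d_def .
  then have d: "(\<lambda>n. besov_pow p q s (\<lambda>x. f x - lincomb (\<pi> ` {..<n}) d h x)) \<longlonglongrightarrow> 0"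
    by (rule besov_norm_tendsto_iff[THEN iffD1, rotated]) (rule nB, simp)
  obtain K' C' where qb: "quasi_norm_basis (besov_space p q s) (besov_pow p q s) (besov_norm p q s) h q K' C'"
    using limiting_quasi_norm_basis[OF \<sigma>\<rho> _ qp] p1 by auto
  \<comment> \<open>The expansion in the rearranged order could a priori have other coefficients;
    comparing it with the level sums identifies them.\<close>
  have dc: "d = c"
  proof
    fix m
    have "\<forall>\<^sub>F n in sequentially. m \<in> \<pi> ` {..<n}"
      using eventually_gt_at_top[of "inv \<pi> m"]
    proof eventually_elim
      case (elim n)
      have "\<pi> (inv \<pi> m) = m" using \<pi>(1) by (simp add: bij_is_surj surj_f_inv_f)
      then show ?case using elim by (metis imageI lessThan_iff)
    qed
    moreover have "\<forall>\<^sub>F n in sequentially. m \<in> low UNIV n"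
      using eventually_ge_at_top[of "lev m"] by eventually_elim (simp add: low_def)
    ultimately show "d m = c m"
      by (intro quasi_norm_basis.coefficient_unique[OF qb fB _ d _ _ lim_low]) (auto intro: finL)
  qed
  \<comment> \<open>The even levels of block i: the difference of two partial sums of the rearranged
    series, so its norm must tend to 0.\<close>
  define G where "G i = lincomb (P \<inter> {S i..<S (Suc i)}) c h" for i
  have GB: "G i \<in> besov_space p q s" for i unfolding G_def by (rule lincomb_besov) simp
  have Glim: "(\<lambda>i. besov_pow p q s (G i)) \<longlonglongrightarrow> 0"
  proof -
    define \<delta> where "\<delta> n = besov_pow p q s (\<lambda>x. f x - lincomb (\<pi> ` {..<n}) c h x)" for n
    have \<delta>: "\<delta> \<longlonglongrightarrow> 0" using d unfolding dc \<delta>_def[abs_def] .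
    have le: "besov_pow p q s (G i) \<le> K * (\<delta> (t0 i) + \<delta> (t1 i))" for i
    proof -
      let ?f0 = "\<lambda>x. f x - lincomb (\<pi> ` {..<t0 i}) c h x" and ?f1 = "\<lambda>x. f x - lincomb (\<pi> ` {..<t1 i}) c h x"
      have f0: "?f0 \<in> besov_space p q s" and f1: "?f1 \<in> besov_space p q s" by (rule nB, simp)+
      have "lincomb (\<pi> ` {..<t1 i}) c h x = lincomb (\<pi> ` {..<t0 i}) c h x + G i x" for x
        unfolding G_def lincomb_def t0 t1 by (rule sum.union_disjoint) auto
      then have "G i = (\<lambda>x. ?f0 x + (- 1) * ?f1 x)" by (simp add: fun_eq_iff)
      then have "besov_pow p q s (G i) \<le> K * (besov_pow p q s ?f0 + besov_pow p q s (\<lambda>x. (- 1) * ?f1 x))"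
        using K(2)[OF f0 besov_pow_scale(1)[OF p q s f1, of "- 1"]] by simp
      also have "\<dots> \<le> K * (\<delta> (t0 i) + \<delta> (t1 i))"
        using besov_pow_scale(2)[OF p q s f1, of "- 1"] K by (intro mult_left_mono add_mono) (auto simp: \<delta>_def)
      finally show ?thesis .
    qed
    have "(\<lambda>i. K * (\<delta> (t0 i) + \<delta> (t1 i))) \<longlonglongrightarrow> K * (0 + 0)"
      by (intro tendsto_mult tendsto_add tendsto_const filterlim_compose[OF \<delta>] t_lim)
    then have U: "(\<lambda>i. K * (\<delta> (t0 i) + \<delta> (t1 i))) \<longlonglongrightarrow> 0" by simp
    show ?thesis
      by (rule tendsto_sandwich[OF _ _ tendsto_const U]) (intro always_eventually allI le besov_pow_nonneg[OF p q s GB])+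
  qed
  define Q where "Q = (1 / (\<rho> * 2 ^ CARD('d))) powr r"
  have Q: "0 < Q" using \<rho> by (simp add: Q_def)
  \<comment> \<open>Each even level j of the block forces an approximation error of r-th power at
    least Q / (j + 1) at level j - 1; these levels are distinct, so the errors add up.\<close>
  have lower: "Q * (3 / 8) / C0 \<le> besov_pow p q s (G (Suc n))" for n
  proof -
    define J where "J = {j :: nat. even j \<and> 4 ^ Suc n \<le> j \<and> j < 4 ^ Suc (Suc n)}"
    note J = even_block[of n, folded J_def]
    have J_pos: "even j \<and> 0 < j" if "j \<in> J" for j
    proof -
      have "even j" "4 ^ Suc n \<le> j" using that by (simp_all add: J_def)
      moreover have "(0::nat) < 4 ^ Suc n" by simp
      ultimately show ?thesis by linarith
    qed
    have Gy: "G (Suc n) y = (\<Sum>j\<in>J. a j * (bump j 0 y - bump (j - 1) 0 y))" if y: "y \<in> half_cube" for y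
    proof -
      have mem: "m < start k \<longleftrightarrow> lev m < k" for m k using start_eq[of k] by auto
      have "P \<inter> {S (Suc n)..<S (Suc (Suc n))} = (\<Union>j\<in>J. {m. lev m = j})"
        by (auto simp: P_def J_def S_def mem not_less[symmetric] simp del: power_Suc)
      then have "G (Suc n) y = (\<Sum>m\<in>(\<Union>j\<in>J. {m. lev m = j}). c m * h m y)" by (simp add: G_def lincomb_def)
      also have "\<dots> = (\<Sum>j\<in>J. \<Sum>m\<in>{m. lev m = j}. c m * h m y)"
        using J finite_lev by (intro sum.UNION_disjoint) auto
      also have "\<dots> = (\<Sum>j\<in>J. a j * (bump j 0 y - bump (j - 1) 0 y))"
      proof (intro sum.cong refl)
        fix j assume "j \<in> J"
        then obtain k where "j = Suc k" using J_pos by (metis gr0_implies_Suc)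
        then show "(\<Sum>m\<in>{m. lev m = j}. c m * h m y) = a j * (bump j 0 y - bump (j - 1) 0 y)"
          using c_level[OF y, of k] by (simp add: lincomb_def)
      qed
      finally show ?thesis .
    qed
    obtain u where u: "\<And>k. dyadic_step k (u k)" "summable (\<lambda>k. (\<rho> ^ k * Lp_pow p (\<lambda>x. G (Suc n) x - u k x)) powr r)"
      "(\<Sum>k. (\<rho> ^ k * Lp_pow p (\<lambda>x. G (Suc n) x - u k x)) powr r) \<le> C0 * besov_pow p q s (G (Suc n))"
      using bspec[OF C0(2) GB[of "Suc n"]] by (elim exE conjE) (rule that, blast+)
    define \<tau> where "\<tau> k = (\<rho> ^ k * Lp_pow p (\<lambda>x. G (Suc n) x - u k x)) powr r" for k
    have "Q * (3 / 8) \<le> Q * (\<Sum>j\<in>J. 1 / real (Suc j))" using J(2) Q by (intro mult_left_mono) auto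
    also have "\<dots> = (\<Sum>j\<in>J. Q * (1 / real (Suc j)))" by (rule sum_distrib_left)
    also have "\<dots> \<le> (\<Sum>j\<in>J. \<tau> (j - 1))"
    proof (rule sum_mono)
      fix j assume j: "j \<in> J"
      have "\<bar>a j\<bar> powr p / (\<rho> * 2 ^ CARD('d)) \<le> \<rho> ^ (j - 1) * Lp_pow p (\<lambda>x. G (Suc n) x - u (j - 1) x)"
        by (rule oscillation_lower[OF p1 \<sigma>\<rho> J(1) J_pos j u(1) Lp_of_besov[OF GB] Gy])
      then have "(\<bar>a j\<bar> powr p / (\<rho> * 2 ^ CARD('d))) powr r \<le> \<tau> (j - 1)"
        unfolding \<tau>_def using r \<rho> by (intro powr_mono2) auto
      moreover have "(\<bar>a j\<bar> powr p / (\<rho> * 2 ^ CARD('d))) powr r = Q * (1 / real (Suc j))"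
      proof -
        have "\<bar>a j\<bar> powr p / (\<rho> * 2 ^ CARD('d)) = (1 / (\<rho> * 2 ^ CARD('d))) * a j powr p" using a0 by simp
        then show ?thesis unfolding Q_def apr[symmetric] using \<rho> by (simp only: powr_mult)
      qed
      ultimately show "Q * (1 / real (Suc j)) \<le> \<tau> (j - 1)" by simp
    qed
    also have "\<dots> = sum \<tau> ((\<lambda>j. j - 1) ` J)"
    proof (rule sum.reindex_cong[symmetric])
      show "inj_on (\<lambda>j. j - 1) J"
      proof (rule inj_onI)
        fix i j assume "i \<in> J" "j \<in> J" "i - 1 = j - 1"
        then show "i = j" using J_pos[of i] J_pos[of j] by linarith
      qed
    qed auto
    also have "\<dots> \<le> suminf \<tau>" using u(2) J(1) by (intro sum_le_suminf) (auto simp: \<tau>_def[abs_def])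
    also have "\<dots> \<le> C0 * besov_pow p q s (G (Suc n))" using u(3) by (simp add: \<tau>_def[abs_def])
    finally show ?thesis using C0(1) by (simp add: field_simps)
  qed
  have "Q * (3 / 8) / C0 \<le> 0"
    by (rule LIMSEQ_le_const[OF LIMSEQ_Suc[OF Glim]]) (use lower in blast)
  then show False using Q C0(1) by (simp add: field_simps)
qed

end

section \<open>The cases \<sigma> < \<rho>, \<sigma> = \<rho> and \<rho> < \<sigma> translated back
  to s\<close>

theorem theorem1:
  fixes p q s :: real and h :: "nat \<Rightarrow> real^'d \<Rightarrow> real"
  assumes "0 < p" and "0 < q" and "0 < s" and "s < 1 / p"
    and "level_ordered_enumeration h"
  shows
    "(1 \<le> p \<longrightarrow>
        unconditional_schauder_basis (besov_space p q s) (besov_norm p q s) h) \<and>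
     (p < 1 \<longrightarrow>
        (unconditional_schauder_basis (besov_space p q s) (besov_norm p q s) h \<longleftrightarrow>
           real CARD('d) * (1 / p - 1) < s \<and> s < 1 / p) \<and>
        (s = real CARD('d) * (1 / p - 1) \<and> q \<le> p \<longrightarrow>
           schauder_basis (besov_space p q s) (besov_norm p q s) h \<and>
           \<not> unconditional_schauder_basis (besov_space p q s) (besov_norm p q s) h) \<and>
        (\<not> (real CARD('d) * (1 / p - 1) < s \<and> s < 1 / p) \<and>
         \<not> (s = real CARD('d) * (1 / p - 1) \<and> q \<le> p) \<longrightarrow>
           \<not> schauder_basis (besov_space p q s) (besov_norm p q s) h))"
proof -
  interpret haar_enum p q s h using assms by unfold_locales
  let ?B = "schauder_basis (besov_space p q s) (besov_norm p q s) h"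
  let ?U = "unconditional_schauder_basis (besov_space p q s) (besov_norm p q s) h"
  have UB: "?B" if ?U
  proof -
    have "schauder_basis (besov_space p q s) (besov_norm p q s) (h \<circ> id)"
      using that bij_id unfolding unconditional_schauder_basis_def by blast
    then show ?thesis by simp
  qed
  have above: ?U if "\<sigma> < \<rho>" using that by (rule unconditional_basis)
  have at1: "?B" "\<not> ?U" if "p < 1" "\<sigma> = \<rho>" "q \<le> p"
    using limiting_basis[OF that(2) _ that(3)] not_unconditional_limiting[OF that] that(1) by simp_all
  have at2: "\<not> ?B" if "p < 1" "\<sigma> = \<rho>" "\<not> q \<le> p" using not_basis_limiting[OF that(1,2)] that(3) by simp
  have below: "\<not> ?B" if "p < 1" "\<rho> < \<sigma>" using not_basis_below[OF that] .
  show ?thesis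
  proof (intro conjI impI)
    show ?U if "1 \<le> p" using above \<sigma>_less_of_ge_1[OF that] .
  next
    assume p1: "p < 1"
    note iff = \<sigma>_less_iff[OF p1, symmetric]
    have U: "\<sigma> < \<rho>" if ?U
    proof (rule ccontr)
      assume n: "\<not> \<sigma> < \<rho>"
      have "\<not> \<rho> < \<sigma>" using below[OF p1] UB[OF that] by blast
      then have "\<sigma> = \<rho>" using n by simp
      then show False using at1(2)[OF p1] at2[OF p1] UB[OF that] that by blast
    qed
    show "?U \<longleftrightarrow> real CARD('d) * (1 / p - 1) < s \<and> s < 1 / p"
      unfolding iff using U above sp by blast
    show "?B" "\<not> ?U" if "s = real CARD('d) * (1 / p - 1) \<and> q \<le> p"
      using at1[OF p1] that unfolding iff by blast+
    show "\<not> ?B" if "\<not> (real CARD('d) * (1 / p - 1) < s \<and> s < 1 / p) \<and> \<not> (s = real CARD('d) * (1 / p - 1) \<and> q \<le> p)"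
    proof (cases "\<sigma> = \<rho>")
      case True
      then show ?thesis using at2[OF p1] that unfolding iff by blast
    next
      case False
      then have "\<rho> < \<sigma>" using that sp unfolding iff by linarith
      then show ?thesis by (rule below[OF p1])
    qed
  qed
qed

end
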